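(* Let $F'/F/\mathbb{F}_q$ be a tower of field extensions and let $K$ be a field containing $\mathbb{F}_q$. Assume that the number of roots of unity of $K$ is finite. The restriction of the functor of bold scalar extension $\boldsymbol{F'_K}\otimes_{\boldsymbol{F_K}}(-)$ to restricted $\boldsymbol{F_K}$-modules is: (a) $F'/F$-fully faithful, and (b) if $F'/F$ is a separable field extension, it is semisimple on objects.
   Context: $\mathbb{F}_q$ is a finite field with $q$ elements; $F/\mathbb{F}_q$ may be any field extension. $F_K:=\mathrm{Frac}(F\otimes_{\mathbb{F}_q}K)$ denotes the total ring of fractions, and $\sigma$ is the endomorphism of $F_K$ induced by $\mathrm{id}_F\otimes\sigma_q$, where $\sigma_q(c)=c^q$ on $K$; $\boldsymbol{F_K}=(F_K,\sigma)$. Similarly $F'_K:=\mathrm{Frac}(F'\otimes_{\mathbb{F}_q}K)$ and $\boldsymbol{F'_K}=(F'_K,\sigma)$. A bold ring $\boldsymbol{R}=(R,\sigma)$ is a unital commutative ring $R$ with a unital ring endomorphism $\sigma$. An $\boldsymbol{R}$-module is an $R$-module $M$ with a $\sigma$-linear (i.e. additive with $\tau(rm)=\sigma(r)\tau(m)$) map $\tau:M\to M$; homomorphisms are $R$-linear maps commuting with $\tau$; tensor products carry $\tau(m\otimes n)=\tau_M(m)\otimes\tau_N(n)$. For a homomorphism of bold rings $\boldsymbol{S}\to\boldsymbol{R}$ (a ring homomorphism commuting with $\sigma$), bold scalar extension sends $\boldsymbol{M}=(M,\tau)$ to $R\otimes_SM$ with $r\otimes m\mapsto\sigma(r)\otimes\tau(m)$.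 An $\boldsymbol{R}$-module $(M,\tau)$ is restricted if $M$ is a finitely generated projective $R$-module and the linearisation $\tau_{\mathrm{lin}}:R\otimes_{\sigma,R}M\to M$, $r\otimes m\mapsto r\tau(m)$, is bijective. Under the hypothesis on $K$, restricted $\boldsymbol{F_K}$-modules form an $F$-linear abelian category. An $F$-linear functor $V:\mathcal{C}\to\mathcal{D}$ from an $F$-linear category to an $F'$-linear category is $F'/F$-fully faithful if $F'\otimes_F\mathrm{Hom}_{\mathcal{C}}(X,Y)\to\mathrm{Hom}_{\mathcal{D}}(VX,VY)$ is bijective for all objects $X,Y$. An exact functor of abelian categories is semisimple on objects if it maps semisimple objects to semisimple objects. A field extension $F'/F$ is separable if $F'\otimes_FF''$ is reduced for every field extension $F''\supset F$. *)

theory Defs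
  imports "HOL-Algebra.Algebra"
begin

section \<open>Tensor products over a commutative ring\<close>

text \<open>
  Rings and modules are HOL-Algebra records. The tensor product of two \<open>S\<close>-modules is the
  quotient of the free abelian group on pairs by the bilinear (and \<open>S\<close>-balanced) relations;
  its elements are cosets. For groups that are only used additively the fields
  \<^const>\<open>monoid.mult\<close> and \<^const>\<open>one\<close> of the record are left undefined, since the locale
  \<^locale>\<open>module\<close> does not constrain them.
\<close>

type_synonym ('m, 'n) tensor = "(('m \<times> 'n) \<Rightarrow>\<^sub>0 int) set"

definition tensor_relations ::
  "('s, 'x) ring_scheme \<Rightarrow> ('s, 'm, 'y) module_scheme \<Rightarrow> ('s, 'n, 'z) module_scheme
    \<Rightarrow> (('m \<times> 'n) \<Rightarrow>\<^sub>0 int) set" where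
  "tensor_relations S M N =
     {frag_of (x \<oplus>\<^bsub>M\<^esub> x', y) - frag_of (x, y) - frag_of (x', y) | x x' y.
        x \<in> carrier M \<and> x' \<in> carrier M \<and> y \<in> carrier N}
   \<union> {frag_of (x, y \<oplus>\<^bsub>N\<^esub> y') - frag_of (x, y) - frag_of (x, y') | x y y'.
        x \<in> carrier M \<and> y \<in> carrier N \<and> y' \<in> carrier N}
   \<union> {frag_of (s \<odot>\<^bsub>M\<^esub> x, y) - frag_of (x, s \<odot>\<^bsub>N\<^esub> y) | s x y.
        s \<in> carrier S \<and> x \<in> carrier M \<and> y \<in> carrier N}"

definition tensor_kernel ::
  "('s, 'x) ring_scheme \<Rightarrow> ('s, 'm, 'y) module_scheme \<Rightarrow> ('s, 'n, 'z) module_scheme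
    \<Rightarrow> (('m \<times> 'n) \<Rightarrow>\<^sub>0 int) set" where
  "tensor_kernel S M N =
     generate (free_Abelian_group (carrier M \<times> carrier N)) (tensor_relations S M N)"

definition tensor_pure ::
  "('s, 'x) ring_scheme \<Rightarrow> ('s, 'm, 'y) module_scheme \<Rightarrow> ('s, 'n, 'z) module_scheme
    \<Rightarrow> 'm \<Rightarrow> 'n \<Rightarrow> ('m, 'n) tensor" where
  "tensor_pure S M N x y =
     tensor_kernel S M N #>\<^bsub>free_Abelian_group (carrier M \<times> carrier N)\<^esub> frag_of (x, y)"

definition tensor_group ::
  "('s, 'x) ring_scheme \<Rightarrow> ('s, 'm, 'y) module_scheme \<Rightarrow> ('s, 'n, 'z) module_scheme
    \<Rightarrow> ('m, 'n) tensor ring" where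
  "tensor_group S M N =
    (let Q = free_Abelian_group (carrier M \<times> carrier N) Mod tensor_kernel S M N in
     \<lparr>carrier = carrier Q, monoid.mult = undefined, one = undefined,
      ring.zero = \<one>\<^bsub>Q\<^esub>, ring.add = (\<otimes>\<^bsub>Q\<^esub>)\<rparr>)"

text \<open>
  The additive map out of a tensor product induced by a balanced map \<open>f\<close> on pairs: extend \<open>f\<close>
  additively to the free abelian group, and take the common value on the coset.
\<close>

definition free_lift :: "('p, 'x) ring_scheme \<Rightarrow> ('m \<times> 'n \<Rightarrow> 'p) \<Rightarrow> (('m \<times> 'n) \<Rightarrow>\<^sub>0 int) \<Rightarrow> 'p" where
  "free_lift P f u =
     (\<Oplus>\<^bsub>P\<^esub>k\<in>Poly_Mapping.keys u. add_pow P (Poly_Mapping.lookup u k) (f k))"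

definition tensor_lift :: "('p, 'x) ring_scheme \<Rightarrow> ('m \<times> 'n \<Rightarrow> 'p) \<Rightarrow> ('m, 'n) tensor \<Rightarrow> 'p" where
  "tensor_lift P f U = the_elem (free_lift P f ` U)"

definition restrict_scalars ::
  "('s \<Rightarrow> 'r) \<Rightarrow> ('r, 'x) ring_scheme \<Rightarrow> ('s, 'r) module" where
  "restrict_scalars \<phi> R =
     \<lparr>carrier = carrier R, monoid.mult = (\<otimes>\<^bsub>R\<^esub>), one = \<one>\<^bsub>R\<^esub>,
      ring.zero = \<zero>\<^bsub>R\<^esub>, ring.add = (\<oplus>\<^bsub>R\<^esub>),
      smult = (\<lambda>s r. \<phi> s \<otimes>\<^bsub>R\<^esub> r)\<rparr>"

definition tensor_algebra ::
  "('s, 'x) ring_scheme \<Rightarrow> ('s \<Rightarrow> 'a) \<Rightarrow> ('a, 'y) ring_scheme \<Rightarrow> ('s \<Rightarrow> 'b) \<Rightarrow> ('b, 'z) ring_scheme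
    \<Rightarrow> ('a, 'b) tensor ring" where
  "tensor_algebra S i A j B =
    (let A' = restrict_scalars i A; B' = restrict_scalars j B;
         T = tensor_group S A' B'; p = tensor_pure S A' B' in
     \<lparr>carrier = carrier T,
      monoid.mult = (\<lambda>U V. tensor_lift T (\<lambda>(a, b).
                tensor_lift T (\<lambda>(a', b'). p (a \<otimes>\<^bsub>A\<^esub> a') (b \<otimes>\<^bsub>B\<^esub> b')) V) U),
      one = p \<one>\<^bsub>A\<^esub> \<one>\<^bsub>B\<^esub>, ring.zero = \<zero>\<^bsub>T\<^esub>, ring.add = (\<oplus>\<^bsub>T\<^esub>)\<rparr>)"

definition algebra_pure ::
  "('s, 'x) ring_scheme \<Rightarrow> ('s \<Rightarrow> 'a) \<Rightarrow> ('a, 'y) ring_scheme \<Rightarrow> ('s \<Rightarrow> 'b) \<Rightarrow> ('b, 'z) ring_scheme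
    \<Rightarrow> 'a \<Rightarrow> 'b \<Rightarrow> ('a, 'b) tensor" where
  "algebra_pure S i A j B = tensor_pure S (restrict_scalars i A) (restrict_scalars j B)"

section \<open>Total rings of fractions\<close>

definition nonzerodivisors :: "('a, 'x) ring_scheme \<Rightarrow> 'a set" where
  "nonzerodivisors A =
     {s \<in> carrier A. \<forall>a \<in> carrier A. s \<otimes>\<^bsub>A\<^esub> a = \<zero>\<^bsub>A\<^esub> \<longrightarrow> a = \<zero>\<^bsub>A\<^esub>}"

definition fraction :: "('a, 'x) ring_scheme \<Rightarrow> 'a \<Rightarrow> 'a \<Rightarrow> ('a \<times> 'a) set" where
  "fraction A a s =
     {(b, t). b \<in> carrier A \<and> t \<in> nonzerodivisors A \<and> a \<otimes>\<^bsub>A\<^esub> t = b \<otimes>\<^bsub>A\<^esub> s}"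

definition total_fractions :: "('a, 'x) ring_scheme \<Rightarrow> ('a \<times> 'a) set ring" where
  "total_fractions A =
     \<lparr>carrier = {fraction A a s | a s. a \<in> carrier A \<and> s \<in> nonzerodivisors A},
      monoid.mult = (\<lambda>U V. \<Union>(a, s)\<in>U. \<Union>(b, t)\<in>V. fraction A (a \<otimes>\<^bsub>A\<^esub> b) (s \<otimes>\<^bsub>A\<^esub> t)),
      one = fraction A \<one>\<^bsub>A\<^esub> \<one>\<^bsub>A\<^esub>,
      ring.zero = fraction A \<zero>\<^bsub>A\<^esub> \<one>\<^bsub>A\<^esub>,
      ring.add = (\<lambda>U V. \<Union>(a, s)\<in>U. \<Union>(b, t)\<in>V.
               fraction A (a \<otimes>\<^bsub>A\<^esub> t \<oplus>\<^bsub>A\<^esub> b \<otimes>\<^bsub>A\<^esub> s) (s \<otimes>\<^bsub>A\<^esub> t))\<rparr>"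

text \<open>Meaningful when \<open>h\<close>, a ring homomorphism into \<open>B\<close>, preserves non-zero-divisors.\<close>

definition frac_map ::
  "('b, 'x) ring_scheme \<Rightarrow> ('a \<Rightarrow> 'b) \<Rightarrow> ('a \<times> 'a) set \<Rightarrow> ('b \<times> 'b) set" where
  "frac_map B h U = (\<Union>(a, s)\<in>U. fraction B (h a) (h s))"

section \<open>Bold rings and modules\<close>

record 'a bold_ring = "'a ring" +
  endo :: "'a \<Rightarrow> 'a"

record ('a, 'b) bold_module = "('a, 'b) module" +
  tau :: "'b \<Rightarrow> 'b"

locale bold_ring = cring R for R :: "('a, 'x) bold_ring_scheme" (structure) +
  assumes endo_hom: "endo R \<in> ring_hom R R"

locale bold_module = R?: bold_ring R + module R M
  for R :: "('a, 'x) bold_ring_scheme" (structure)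
    and M :: "('a, 'b, 'y) bold_module_scheme" (structure) +
  assumes tau_closed: "tau M \<in> carrier M \<rightarrow> carrier M"
    and tau_add: "\<lbrakk>x \<in> carrier M; y \<in> carrier M\<rbrakk> \<Longrightarrow> tau M (x \<oplus>\<^bsub>M\<^esub> y) = tau M x \<oplus>\<^bsub>M\<^esub> tau M y"
    and tau_smult: "\<lbrakk>r \<in> carrier R; x \<in> carrier M\<rbrakk> \<Longrightarrow>
      tau M (r \<odot>\<^bsub>M\<^esub> x) = endo R r \<odot>\<^bsub>M\<^esub> tau M x"

text \<open>Maps are extensional, so that sets of homomorphisms have the right equality.\<close>

definition linear_maps ::
  "('r, 'x) ring_scheme \<Rightarrow> ('r, 'm, 'y) module_scheme \<Rightarrow> ('r, 'n, 'z) module_scheme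
    \<Rightarrow> ('m \<Rightarrow> 'n) set" where
  "linear_maps R M N =
     {h \<in> carrier M \<rightarrow>\<^sub>E carrier N.
        (\<forall>x\<in>carrier M. \<forall>y\<in>carrier M. h (x \<oplus>\<^bsub>M\<^esub> y) = h x \<oplus>\<^bsub>N\<^esub> h y) \<and>
        (\<forall>r\<in>carrier R. \<forall>x\<in>carrier M. h (r \<odot>\<^bsub>M\<^esub> x) = r \<odot>\<^bsub>N\<^esub> h x)}"

definition bold_homs ::
  "('r, 'x) bold_ring_scheme \<Rightarrow> ('r, 'm, 'y) bold_module_scheme \<Rightarrow> ('r, 'n, 'z) bold_module_scheme
    \<Rightarrow> ('m \<Rightarrow> 'n) set" where
  "bold_homs R M N =
     {h \<in> linear_maps R M N. \<forall>x\<in>carrier M. h (tau M x) = tau N (h x)}"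

text \<open>
  The \<open>F\<close>-module of homomorphisms, where \<open>F\<close> acts through \<open>c\<close>, a map from \<open>F\<close> to the
  \<open>\<sigma>\<close>-invariants of \<open>R\<close>.
\<close>

definition bold_Hom ::
  "('f \<Rightarrow> 'r) \<Rightarrow> ('r, 'x) bold_ring_scheme \<Rightarrow> ('r, 'm, 'y) bold_module_scheme
    \<Rightarrow> ('r, 'n, 'z) bold_module_scheme \<Rightarrow> ('f, 'm \<Rightarrow> 'n) module" where
  "bold_Hom c R M N =
     \<lparr>carrier = bold_homs R M N, monoid.mult = undefined, one = undefined,
      ring.zero = (\<lambda>x\<in>carrier M. \<zero>\<^bsub>N\<^esub>),
      ring.add = (\<lambda>g h. \<lambda>x\<in>carrier M. g x \<oplus>\<^bsub>N\<^esub> h x),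
      smult = (\<lambda>a h. \<lambda>x\<in>carrier M. c a \<odot>\<^bsub>N\<^esub> h x)\<rparr>"

definition scalar_extension ::
  "('s, 'x) bold_ring_scheme \<Rightarrow> ('s \<Rightarrow> 'r) \<Rightarrow> ('r, 'y) bold_ring_scheme
    \<Rightarrow> ('s, 'm, 'z) bold_module_scheme \<Rightarrow> ('r, ('r, 'm) tensor) bold_module" where
  "scalar_extension S \<phi> R M =
    (let T = tensor_group S (restrict_scalars \<phi> R) M;
         p = tensor_pure S (restrict_scalars \<phi> R) M in
     \<lparr>carrier = carrier T, monoid.mult = undefined, one = undefined,
      ring.zero = \<zero>\<^bsub>T\<^esub>, ring.add = (\<oplus>\<^bsub>T\<^esub>),
      smult = (\<lambda>r. tensor_lift T (\<lambda>(a, m). p (r \<otimes>\<^bsub>R\<^esub> a) m)),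
      tau = tensor_lift T (\<lambda>(a, m). p (endo R a) (tau M m))\<rparr>)"

definition scalar_extension_map ::
  "('s, 'x) bold_ring_scheme \<Rightarrow> ('s \<Rightarrow> 'r) \<Rightarrow> ('r, 'y) bold_ring_scheme
    \<Rightarrow> ('s, 'm, 'z) bold_module_scheme \<Rightarrow> ('s, 'n, 'w) bold_module_scheme
    \<Rightarrow> ('m \<Rightarrow> 'n) \<Rightarrow> ('r, 'm) tensor \<Rightarrow> ('r, 'n) tensor" where
  "scalar_extension_map S \<phi> R M N h =
     (\<lambda>U\<in>carrier (scalar_extension S \<phi> R M).
        tensor_lift (scalar_extension S \<phi> R N)
          (\<lambda>(a, m). tensor_pure S (restrict_scalars \<phi> R) N a (h m)) U)"

section \<open>Restricted modules\<close>

definition finitely_generated ::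
  "('r, 'x) ring_scheme \<Rightarrow> ('r, 'm, 'y) module_scheme \<Rightarrow> bool" where
  "finitely_generated R M \<longleftrightarrow>
     (\<exists>A. finite A \<and> A \<subseteq> carrier M \<and>
        (\<forall>x\<in>carrier M. \<exists>c\<in>A \<rightarrow> carrier R. x = (\<Oplus>\<^bsub>M\<^esub>a\<in>A. c a \<odot>\<^bsub>M\<^esub> a)))"

definition free_module :: "('r, 'x) ring_scheme \<Rightarrow> 'i set \<Rightarrow> ('r, 'i \<Rightarrow> 'r) module" where
  "free_module R I =
     \<lparr>carrier = {f \<in> I \<rightarrow>\<^sub>E carrier R. finite {i \<in> I. f i \<noteq> \<zero>\<^bsub>R\<^esub>}},
      monoid.mult = undefined, one = undefined,
      ring.zero = (\<lambda>i\<in>I. \<zero>\<^bsub>R\<^esub>),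
      ring.add = (\<lambda>f g. \<lambda>i\<in>I. f i \<oplus>\<^bsub>R\<^esub> g i),
      smult = (\<lambda>r f. \<lambda>i\<in>I. r \<otimes>\<^bsub>R\<^esub> f i)\<rparr>"

text \<open>
  Projective: a direct summand of a free module. Index sets in the type of elements of \<open>M\<close>
  suffice, as \<open>M\<close> is a quotient of the free module on its own carrier.
\<close>

definition projective ::
  "('r, 'x) ring_scheme \<Rightarrow> ('r, 'm, 'y) module_scheme \<Rightarrow> bool" where
  "projective R M \<longleftrightarrow>
     (\<exists>(I :: 'm set) s p. s \<in> linear_maps R M (free_module R I) \<and>
        p \<in> linear_maps R (free_module R I) M \<and> (\<forall>x\<in>carrier M. p (s x) = x))"

text \<open>The linearisation is defined on the tensor product of \<open>R\<close>, viewed as an \<open>R\<close>-module via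
  its endomorphism, with \<open>M\<close>.\<close>

definition tau_lin ::
  "('r, 'm, 'y) bold_module_scheme \<Rightarrow> ('r, 'm) tensor \<Rightarrow> 'm" where
  "tau_lin M = tensor_lift M (\<lambda>(r, m). r \<odot>\<^bsub>M\<^esub> tau M m)"

definition restricted ::
  "('r, 'x) bold_ring_scheme \<Rightarrow> ('r, 'm, 'y) bold_module_scheme \<Rightarrow> bool" where
  "restricted R M \<longleftrightarrow>
     bold_module R M \<and> finitely_generated R M \<and> projective R M \<and>
     bij_betw (tau_lin M) (carrier (tensor_group R (restrict_scalars (endo R) R) M)) (carrier M)"

text \<open>
  Simple and semisimple objects refer to the category of restricted \<open>R\<close>-modules: subobjects
  are the \<open>\<tau>\<close>-stable submodules that are themselves restricted. A semisimple object is
  an internal direct sum of simple ones; the sum is finite as the modules are finitely generated.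
\<close>

definition subobject ::
  "('r, 'x) bold_ring_scheme \<Rightarrow> 'm set \<Rightarrow> ('r, 'm, 'y) bold_module_scheme \<Rightarrow> bool" where
  "subobject R N M \<longleftrightarrow>
     submodule N R M \<and> tau M ` N \<subseteq> N \<and> restricted R (M\<lparr>carrier := N\<rparr>)"

definition simple_object ::
  "('r, 'x) bold_ring_scheme \<Rightarrow> ('r, 'm, 'y) bold_module_scheme \<Rightarrow> bool" where
  "simple_object R M \<longleftrightarrow>
     restricted R M \<and> carrier M \<noteq> {\<zero>\<^bsub>M\<^esub>} \<and>
     (\<forall>N. subobject R N M \<longrightarrow> N = {\<zero>\<^bsub>M\<^esub>} \<or> N = carrier M)"

definition semisimple_object ::
  "('r, 'x) bold_ring_scheme \<Rightarrow> ('r, 'm, 'y) bold_module_scheme \<Rightarrow> bool" where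
  "semisimple_object R M \<longleftrightarrow>
     restricted R M \<and>
     (\<exists>(n::nat) N.
        (\<forall>i<n. subobject R (N i) M \<and> simple_object R (M\<lparr>carrier := N i\<rparr>)) \<and>
        (\<forall>x\<in>carrier M. \<exists>!f. f \<in> (\<Pi>\<^sub>E i\<in>{..<n}. N i) \<and> x = (\<Oplus>\<^bsub>M\<^esub>i\<in>{..<n}. f i)))"

section \<open>The bold ring attached to a pair of fields\<close>

definition bold_frac ::
  "('q, 'x) ring_scheme \<Rightarrow> ('q \<Rightarrow> 'f) \<Rightarrow> ('f, 'y) ring_scheme \<Rightarrow> ('q \<Rightarrow> 'k) \<Rightarrow> ('k, 'z) ring_scheme
    \<Rightarrow> (('f, 'k) tensor \<times> ('f, 'k) tensor) set bold_ring" where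
  "bold_frac Q i F j K =
    (let A = tensor_algebra Q i F j K; L = total_fractions A in
     \<lparr>carrier = carrier L, monoid.mult = (\<otimes>\<^bsub>L\<^esub>), one = \<one>\<^bsub>L\<^esub>,
      ring.zero = \<zero>\<^bsub>L\<^esub>, ring.add = (\<oplus>\<^bsub>L\<^esub>),
      endo = frac_map A (tensor_lift A
        (\<lambda>(a, c). algebra_pure Q i F j K a (c [^]\<^bsub>K\<^esub> card (carrier Q))))\<rparr>)"

definition bold_frac_const ::
  "('q, 'x) ring_scheme \<Rightarrow> ('q \<Rightarrow> 'f) \<Rightarrow> ('f, 'y) ring_scheme \<Rightarrow> ('q \<Rightarrow> 'k) \<Rightarrow> ('k, 'z) ring_scheme
    \<Rightarrow> 'f \<Rightarrow> (('f, 'k) tensor \<times> ('f, 'k) tensor) set" where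
  "bold_frac_const Q i F j K a =
    (let A = tensor_algebra Q i F j K in fraction A (algebra_pure Q i F j K a \<one>\<^bsub>K\<^esub>) \<one>\<^bsub>A\<^esub>)"

definition bold_frac_map ::
  "('q, 'x) ring_scheme \<Rightarrow> ('q \<Rightarrow> 'f) \<Rightarrow> ('f \<Rightarrow> 'g) \<Rightarrow> ('g, 'w) ring_scheme \<Rightarrow> ('q \<Rightarrow> 'k)
    \<Rightarrow> ('k, 'z) ring_scheme
    \<Rightarrow> (('f, 'k) tensor \<times> ('f, 'k) tensor) set \<Rightarrow> (('g, 'k) tensor \<times> ('g, 'k) tensor) set" where
  "bold_frac_map Q i e F' j K =
    (let A' = tensor_algebra Q (e \<circ> i) F' j K in
     frac_map A' (tensor_lift A' (\<lambda>(a, c). algebra_pure Q (e \<circ> i) F' j K (e a) c)))"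

section \<open>Relative full faithfulness and separability\<close>

text \<open>
  For objects \<open>M\<close>, \<open>N\<close> of an \<open>F\<close>-linear category, \<open>HC\<close> is the \<open>F\<close>-module \<open>Hom(M, N)\<close>, \<open>HD\<close> is
  the \<open>F'\<close>-module \<open>Hom(V M, V N)\<close> and \<open>V\<close> is the action of the functor on \<open>Hom(M, N)\<close>.
\<close>

definition fully_faithful_on ::
  "('f, 'x) ring_scheme \<Rightarrow> ('f \<Rightarrow> 'g) \<Rightarrow> ('g, 'y) ring_scheme \<Rightarrow> ('f, 'h, 'z) module_scheme
    \<Rightarrow> ('g, 'k, 'w) module_scheme \<Rightarrow> ('h \<Rightarrow> 'k) \<Rightarrow> bool" where
  "fully_faithful_on F e F' HC HD V \<longleftrightarrow>
     bij_betw (tensor_lift HD (\<lambda>(a, h). a \<odot>\<^bsub>HD\<^esub> V h))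
       (carrier (tensor_group F (restrict_scalars e F') HC)) (carrier HD)"

definition reduced :: "('a, 'x) ring_scheme \<Rightarrow> bool" where
  "reduced A \<longleftrightarrow> (\<forall>x\<in>carrier A. \<forall>n::nat. x [^]\<^bsub>A\<^esub> n = \<zero>\<^bsub>A\<^esub> \<longrightarrow> x = \<zero>\<^bsub>A\<^esub>)"

text \<open>
  A definition in HOL cannot quantify over all types, so \<open>F''\<close> ranges over all extension fields
  with elements in the type that HOL-Algebra uses for the algebraic closure of \<open>F\<close>. This is no
  restriction: a nilpotent element of the tensor product of \<open>F'\<close> with any field extension
  already lies in the tensor product with a finitely generated subextension, whose cardinality
  is at most that of \<open>F\<close> or countable, so that it has an isomorphic copy in this type.
\<close>

definition separable_extension ::
  "('f, 'x) ring_scheme \<Rightarrow> ('f \<Rightarrow> 'g) \<Rightarrow> ('g, 'y) ring_scheme \<Rightarrow> bool" where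
  "separable_extension F e F' \<longleftrightarrow>
     (\<forall>(F'' :: (('f list \<times> nat) multiset \<Rightarrow> 'f) ring) g.
        field F'' \<and> g \<in> ring_hom F F'' \<longrightarrow> reduced (tensor_algebra F e F' g F''))"

definition roots_of_unity :: "('k, 'x) ring_scheme \<Rightarrow> 'k set" where
  "roots_of_unity K = {x \<in> carrier K. \<exists>n::nat. n > 0 \<and> x [^]\<^bsub>K\<^esub> n = \<one>\<^bsub>K\<^esub>}"

end

theory Submission
  imports Defs
begin

text \<open>
Call a bold ring \<open>R\<close> simple if \<open>0\<close> and \<open>R\<close> are its only \<open>\<sigma>\<close>-stable ideals. Over such a ring one
argument replaces linear algebra over a field: in a \<open>\<sigma>\<close>-stable submodule of a free module, the
coefficients that occur at one place of vectors of shortest support form a \<open>\<sigma>\<close>-stable ideal, so \<open>1\<close>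
occurs, and a shortest vector with a coefficient \<open>1\<close> is \<open>\<sigma>\<close>-invariant (\<open>invariant_vector\<close>).
Let \<open>F\<close> be the field of invariants of \<open>R\<close> and let \<open>R \<rightarrow> R'\<close> be a homomorphism of bold rings such that
\<open>F'\<close> maps to the invariants of \<open>R'\<close>. Then elements of \<open>F'\<close> that are independent over \<open>F\<close> stay
independent over \<open>R\<close> (\<open>linearly_disjoint\<close>). If \<open>R'\<close> moreover consists of fractions of sums
\<open>\<Sum> b \<cdot> r\<close> with \<open>b\<close> from \<open>F'\<close> and \<open>r\<close> from \<open>R\<close>, then \<open>R'\<close> is again simple, with \<open>F'\<close> as its
invariants (\<open>simple_R'\<close>, \<open>invariants_R'\<close>). Starting from the field \<open>K\<close> with its \<open>q\<close>-Frobenius, whose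
invariants are the field \<open>Q\<close> of \<open>q\<close> elements, this applies to \<open>F \<otimes> K\<close>, to its ring of fractions, and
to the map between the rings of fractions that belong to \<open>F\<close> and \<open>F'\<close> (\<open>FK_pair_descent\<close>).

Over a simple bold ring the restricted modules are the modules with a finite dual basis whose dual also
carries a \<open>\<tau>\<close> (\<open>restricted_imp_dual_module\<close>, \<open>dual_module_restricted\<close>). A rank defined by minors shows
that every \<open>\<tau>\<close>-stable submodule is a direct summand, hence restricted, and that the rank grows
strictly along inclusions (\<open>summand\<close>, \<open>rk_strict\<close>).

For full faithfulness, let \<open>h'\<close> be a homomorphism between the extensions of \<open>M\<close> and \<open>N\<close>. The common
denominators of the values of \<open>h'\<close> on \<open>M\<close> generate a stable ideal, so \<open>1\<close> is one of them. Thus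
\<open>h' = \<Sum> b \<cdot> h\<^sub>b\<close> on \<open>M\<close> with independent \<open>b\<close>, and uniqueness makes each \<open>h\<^sub>b\<close> a homomorphism
(\<open>hom_decomposition\<close>).

For semisimplicity it suffices to treat a simple \<open>M\<close> with extension \<open>M'\<close>. Its endomorphisms are a skew
field of finite dimension over \<open>F\<close>. A shortest combination \<open>\<Sum> b \<cdot> m\<^sub>b\<close> in a nonzero submodule \<open>N\<close> of \<open>M'\<close>
gives a nonzero endomorphism \<open>w\<close> of \<open>M'\<close> with values in \<open>N\<close> (\<open>endomorphism_into\<close>). If all such \<open>w\<close>
killed \<open>N\<close>, there would be a two-sided ideal of square zero, and its shortest element would be a nonzero
element of square zero in \<open>F' \<otimes> Z\<close> for the centre \<open>Z\<close>, a field (\<open>square_zero_central\<close>). This is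
impossible when \<open>F'/F\<close> is separable (\<open>separable_square_zero\<close>). Hence some \<open>w\<close> is nonzero on \<open>N\<close>, so that the
kernel of \<open>w\<close> is a submodule of smaller rank which together with \<open>N\<close>, for \<open>N\<close> simple, spans \<open>M'\<close>;
induction on the rank writes \<open>M'\<close> as a sum of simple modules.
\<close>

text \<open>In the terms below, \<open>El M\<close> is the set of elements of \<open>M\<close>, and a plain subscript names the structure of an operation.\<close>

abbreviation El :: "('a, 'b) partial_object_scheme \<Rightarrow> 'a set" where "El M \<equiv> carrier M"

syntax "_index" :: "logic \<Rightarrow> index" ("\<^sub>_" [1000] 1000)

section \<open>The universal property of the tensor product\<close>

definition balanced ::
 "('s, 'x) ring_scheme => ('s, 'm, 'y) module_scheme => ('s, 'n, 'z) module_scheme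
  => ('p, 'w) ring_scheme => ('m \<times> 'n => 'p) => bool" where
 "balanced S M N P f \<longleftrightarrow>
   (\<forall>x\<in>El M. \<forall>y\<in>El N. f (x, y) \<in> El P) \<and>
   (\<forall>x\<in>El M. \<forall>x'\<in>El M. \<forall>y\<in>El N.
    f (x \<oplus>\<^sub>M x', y) = f (x, y) \<oplus>\<^sub>P f (x', y)) \<and>
   (\<forall>x\<in>El M. \<forall>y\<in>El N. \<forall>y'\<in>El N.
    f (x, y \<oplus>\<^sub>N y') = f (x, y) \<oplus>\<^sub>P f (x, y')) \<and>
   (\<forall>s\<in>El S. \<forall>x\<in>El M. \<forall>y\<in>El N.
    f (s \<odot>\<^sub>M x, y) = f (x, s \<odot>\<^sub>N y))"

definition additive_map ::
 "('a, 'x) ring_scheme => ('b, 'y) ring_scheme => ('a => 'b) => bool" where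
 "additive_map A B g \<longleftrightarrow>
   (\<forall>x\<in>El A. g x \<in> El B) \<and>
   (\<forall>x\<in>El A. \<forall>y\<in>El A. g (x \<oplus>\<^sub>A y) = g x \<oplus>\<^sub>B g y)"

lemma additive_map_closed: "additive_map A B g ==> x \<in> El A ==> g x \<in> El B"
 and additive_map_add: "additive_map A B g ==> x \<in> El A ==> y \<in> El A ==>
  g (x \<oplus>\<^sub>A y) = g x \<oplus>\<^sub>B g y"
 by (auto simp: additive_map_def)

lemma additive_map_zero:
 assumes "abelian_group A" "abelian_group B" "additive_map A B g"
 shows "g \<zero>\<^sub>A = \<zero>\<^sub>B"
proof -
 interpret A: abelian_group A by fact
 interpret B: abelian_group B by fact
 have c: "g \<zero>\<^sub>A \<in> El B" using assms(3) by (simp add: additive_map_def)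
 have "g \<zero>\<^sub>A \<oplus>\<^sub>B g \<zero>\<^sub>A = g \<zero>\<^sub>A"
  using additive_map_add[OF assms(3) A.zero_closed A.zero_closed] by simp
 thus ?thesis using c by (metis B.add.r_cancel_one')
qed

lemma additive_map_neg:
 assumes "abelian_group A" "abelian_group B" "additive_map A B g" "x \<in> El A"
 shows "g (\<ominus>\<^sub>A x) = \<ominus>\<^sub>B g x"
proof -
 interpret A: abelian_group A by fact
 interpret B: abelian_group B by fact
 have "g (\<ominus>\<^sub>A x) \<oplus>\<^sub>B g x = \<zero>\<^sub>B"
  using additive_map_add[OF assms(3), of "\<ominus>\<^sub>A x" x] additive_map_zero[OF assms(1-3)] assms(4)
  by (simp add: A.l_neg)
 thus ?thesis
  using assms(3,4) by (intro B.minus_equality[symmetric]) (auto simp: additive_map_def)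
qed

lemma additive_map_finsum:
 assumes "abelian_group A" "abelian_group B" "additive_map A B g" "f \<in> I \<rightarrow> El A"
 shows "g (\<Oplus>\<^sub>A i\<in>I. f i) = (\<Oplus>\<^sub>B i\<in>I. g (f i))"
proof -
 interpret A: abelian_group A by fact
 interpret B: abelian_group B by fact
 show ?thesis
  using assms(4)
 proof (induction I rule: infinite_finite_induct)
  case (insert i I)
  hence fi: "f i \<in> El A" "f \<in> I \<rightarrow> El A" by auto
  have "(%i. g (f i)) \<in> I \<rightarrow> El B" "g (f i) \<in> El B"
   using fi additive_map_closed[OF assms(3)] by auto
  thus ?case
   using insert fi by (simp add: A.finsum_insert B.finsum_insert
     additive_map_add[OF assms(3)] A.finsum_closed)
 qed (simp_all add: additive_map_zero[OF assms(1-3)])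
qed


lemma restrict_scalars_simps [simp]:
 "El (restrict_scalars \<phi> R) = El R"
 "(\<oplus>\<^bsub>restrict_scalars \<phi> R\<^esub>) = (\<oplus>\<^sub>R)"
 "(\<otimes>\<^bsub>restrict_scalars \<phi> R\<^esub>) = (\<otimes>\<^sub>R)"
 "\<zero>\<^bsub>restrict_scalars \<phi> R\<^esub> = \<zero>\<^sub>R"
 "\<one>\<^bsub>restrict_scalars \<phi> R\<^esub> = \<one>\<^sub>R"
 "s \<odot>\<^bsub>restrict_scalars \<phi> R\<^esub> r = \<phi> s \<otimes>\<^sub>R r"
 by (simp_all add: restrict_scalars_def)

lemma abelian_group_cong:
 assumes "abelian_group R" "El T = El R" "(\<oplus>\<^sub>T) = (\<oplus>\<^sub>R)" "\<zero>\<^sub>T = \<zero>\<^sub>R"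
 shows "abelian_group T"
proof -
 interpret abelian_group R by fact
 show ?thesis
  by (rule abelian_groupI)
    (use assms a_assoc a_comm in \<open>auto intro: bexI[of _ "\<ominus>\<^sub>R x" for x] simp: l_neg\<close>)
qed

lemma restrict_scalars_module:
 assumes "cring S" "cring R" "\<phi> \<in> ring_hom S R"
 shows "module S (restrict_scalars \<phi> R)"
proof -
 interpret S: cring S by fact
 interpret R: cring R by fact
 have "abelian_group (restrict_scalars \<phi> R)"
  by (rule abelian_group_cong[OF R.is_abelian_group]) auto
 thus ?thesis
  by (intro moduleI)
    (use assms in \<open>auto simp: ring_hom_closed ring_hom_add ring_hom_mult ring_hom_one
     R.l_distr R.r_distr R.m_assoc\<close>)
qed

locale tensor = S: cring S + M: module S M + N: module S N
 for S :: "('s, 'x) ring_scheme"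
  and M :: "('s, 'm, 'y) module_scheme" and N :: "('s, 'n, 'z) module_scheme"
begin

abbreviation "Free \<equiv> free_Abelian_group (El M \<times> El N)"
abbreviation "Ker \<equiv> tensor_kernel S M N"
abbreviation "T \<equiv> tensor_group S M N"
abbreviation "pure \<equiv> tensor_pure S M N"

lemma relations_closed: "tensor_relations S M N <= El Free"
proof -
 have *: "Poly_Mapping.keys (frag_of a - frag_of b - frag_of c) <= U"
  if "a \<in> U" "b \<in> U" "c \<in> U" for a b c and U :: "('m \<times> 'n) set"
  using that keys_diff[of "frag_of a - frag_of b" "frag_of c"] keys_diff[of "frag_of a" "frag_of b"]
  by auto
 have **: "Poly_Mapping.keys (frag_of a - frag_of b) <= U"
  if "a \<in> U" "b \<in> U" for a b and U :: "('m \<times> 'n) set"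
  using that keys_diff[of "frag_of a" "frag_of b"] by auto
 show ?thesis
 proof
  fix r assume "r \<in> tensor_relations S M N"
  thus "r \<in> El Free"
   unfolding tensor_relations_def carrier_free_Abelian_group_iff by (elim UnE CollectE exE conjE) (simp_all add: * **)
 qed
qed

sublocale Free: comm_group Free
 by (rule abelian_free_Abelian_group)

lemma kernel_subgroup: "subgroup Ker Free"
 unfolding tensor_kernel_def by (rule Free.generate_is_subgroup[OF relations_closed])

lemma kernel_normal: "Ker \<lhd> Free"
 using Free.normal_iff_subgroup kernel_subgroup by blast

lemma T_simps:
 "El T = rcosets\<^bsub>Free\<^esub> Ker" "U \<oplus>\<^sub>T V = U <#>\<^sub>Free V" "\<zero>\<^sub>T = Ker"
 by (simp_all add: tensor_group_def Let_def FactGroup_def)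

lemma T_abelian_group: "abelian_group T"
proof -
 have "comm_group (Free Mod Ker)"
  by (rule Free.abelian_FactGroup[OF kernel_subgroup])
 then interpret Q: comm_group "Free Mod Ker" .
 have T: "El T = El (Free Mod Ker)" "U \<oplus>\<^sub>T V = U \<otimes>\<^bsub>Free Mod Ker\<^esub> V"
  "\<zero>\<^sub>T = \<one>\<^bsub>Free Mod Ker\<^esub>" for U V
  by (simp_all add: tensor_group_def Let_def)
 show ?thesis
 proof (rule abelian_groupI, unfold T)
  show "\<exists>y\<in>El (Free Mod Ker). y \<otimes>\<^bsub>Free Mod Ker\<^esub> x = \<one>\<^bsub>Free Mod Ker\<^esub>"
   if "x \<in> El (Free Mod Ker)" for x
   using that Q.l_inv Q.inv_closed by blast
 qed (simp_all add: Q.m_assoc Q.m_comm Q.m_lcomm del: mult_FactGroup one_FactGroup carrier_FactGroup)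
qed

sublocale T: abelian_group T
 by (rule T_abelian_group)

abbreviation "coset u \<equiv> Ker #>\<^sub>Free u"

lemma coset_closed: "u \<in> El Free ==> coset u \<in> El T"
 unfolding T_simps RCOSETS_def by auto

lemma coset_add: "u \<in> El Free ==> v \<in> El Free ==> coset u \<oplus>\<^sub>T coset v = coset (u + v)"
 using normal.rcos_sum[OF kernel_normal, of u v] by (simp add: T_simps)

lemma T_elem: assumes "U \<in> El T" obtains u where "u \<in> El Free" "U = coset u"
 using assms unfolding T_simps RCOSETS_def by auto

lemma coset_eq: assumes "u \<in> El Free" "v \<in> El Free" "u - v \<in> Ker" shows "coset u = coset v"
proof -
 have "u \<in> coset v"
  using assms(3) by (auto simp: r_coset_def intro!: bexI[of _ "u - v"])
 thus ?thesis
  using Free.repr_independence[OF _ assms(2) kernel_subgroup] by blast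
qed

lemma pure_closed [intro, simp]: "x \<in> El M ==> y \<in> El N ==> pure x y \<in> El T"
 unfolding tensor_pure_def by (rule coset_closed) simp

lemma relation_kernel: "r \<in> tensor_relations S M N ==> r \<in> Ker"
 unfolding tensor_kernel_def by (rule generate.incl)

lemma pure_add_l:
 assumes "x \<in> El M" "x' \<in> El M" "y \<in> El N"
 shows "pure (x \<oplus>\<^sub>M x') y = pure x y \<oplus>\<^sub>T pure x' y"
proof -
 have 1: "frag_of (x \<oplus>\<^sub>M x', y) - (frag_of (x, y) + frag_of (x', y)) \<in> Ker"
  unfolding diff_diff_eq[symmetric]
  by (rule relation_kernel) (use assms in \<open>auto simp: tensor_relations_def\<close>)
 have 2: "frag_of (x, y) + frag_of (x', y) \<in> El Free"
  using Free.m_closed[of "frag_of (x, y)" "frag_of (x', y)"] assms by simp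
 show ?thesis
  unfolding tensor_pure_def using coset_eq[OF _ 2 1] assms by (simp add: coset_add)
qed

lemma pure_add_r:
 assumes "x \<in> El M" "y \<in> El N" "y' \<in> El N"
 shows "pure x (y \<oplus>\<^sub>N y') = pure x y \<oplus>\<^sub>T pure x y'"
proof -
 have 1: "frag_of (x, y \<oplus>\<^sub>N y') - (frag_of (x, y) + frag_of (x, y')) \<in> Ker"
  unfolding diff_diff_eq[symmetric]
  by (rule relation_kernel) (use assms in \<open>auto simp: tensor_relations_def\<close>)
 have 2: "frag_of (x, y) + frag_of (x, y') \<in> El Free"
  using Free.m_closed[of "frag_of (x, y)" "frag_of (x, y')"] assms by simp
 show ?thesis
  unfolding tensor_pure_def using coset_eq[OF _ 2 1] assms by (simp add: coset_add)
qed

lemma pure_smult: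
 assumes "s \<in> El S" "x \<in> El M" "y \<in> El N"
 shows "pure (s \<odot>\<^sub>M x) y = pure x (s \<odot>\<^sub>N y)"
proof -
 have 1: "frag_of (s \<odot>\<^sub>M x, y) - frag_of (x, s \<odot>\<^sub>N y) \<in> Ker"
  by (rule relation_kernel) (use assms in \<open>auto simp: tensor_relations_def\<close>)
 show ?thesis
  unfolding tensor_pure_def using coset_eq[OF _ _ 1] assms by simp
qed

lemma pure_balanced: "balanced S M N T (%(x, y). pure x y)"
 unfolding balanced_def by (simp add: pure_add_l pure_add_r pure_smult)

lemma pure_zero_l: assumes "y \<in> El N" shows "pure \<zero>\<^sub>M y = \<zero>\<^sub>T"
proof -
 have "additive_map M T (%x. pure x y)"
  unfolding additive_map_def using assms by (auto simp: pure_add_l)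
 thus ?thesis
  using additive_map_zero[OF module.axioms(2)[OF M.module_axioms] T_abelian_group] by auto
qed

lemma pure_neg: assumes "x \<in> El M" "y \<in> El N" shows "pure (\<ominus>\<^sub>M x) y = \<ominus>\<^sub>T pure x y"
proof -
 have "additive_map M T (%x. pure x y)"
  unfolding additive_map_def using assms by (auto simp: pure_add_l)
 thus ?thesis
  using additive_map_neg[OF module.axioms(2)[OF M.module_axioms] T_abelian_group] assms by auto
qed

lemma T_induct [consumes 1, case_names pure add]:
 assumes "U \<in> El T"
  and pure: "\<And>x y. x \<in> El M ==> y \<in> El N ==> P (pure x y)"
  and add: "\<And>U V. U \<in> El T ==> V \<in> El T ==> P U ==> P V ==> P (U \<oplus>\<^sub>T V)"
 shows "P U"
proof -
 obtain u where u: "u \<in> El Free" "U = coset u" using T_elem[OF assms(1)] .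
 have neg: "coset (- v) = \<ominus>\<^sub>T coset v" if "v \<in> El Free" for v
 proof (rule T.minus_equality[symmetric])
  show "coset (- v) \<oplus>\<^sub>T coset v = \<zero>\<^sub>T"
   using coset_add[of "- v" v] that
    Free.coset_mult_one[OF subgroup.subset[OF kernel_subgroup]]
   by (simp add: T_simps)
  show "coset v \<in> El T" "coset (- v) \<in> El T"
   using that by (auto intro!: coset_closed)
 qed
 have "Poly_Mapping.keys u <= El M \<times> El N" using u(1) by simp
 hence "P (coset u) \<and> P (\<ominus>\<^sub>T coset u)"
 proof (rule free_Abelian_group_induct)
  have "coset 0 = pure \<zero>\<^sub>M \<zero>\<^sub>N"
   using Free.coset_mult_one[OF subgroup.subset[OF kernel_subgroup]]
   by (simp add: pure_zero_l T_simps)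
  hence "P (coset 0)" "coset 0 = \<zero>\<^sub>T"
   using pure[of "\<zero>\<^sub>M" "\<zero>\<^sub>N"] by (simp_all add: pure_zero_l)
  moreover have "\<ominus>\<^sub>T \<zero>\<^sub>T = \<zero>\<^sub>T" by (rule T.minus_equality) simp_all
  ultimately show "P (coset 0) \<and> P (\<ominus>\<^sub>T coset 0)" by (simp only:) 
 next
  fix x y :: "('m \<times> 'n) \<Rightarrow>\<^sub>0 int"
  assume 2: "Poly_Mapping.keys x <= El M \<times> El N" "Poly_Mapping.keys y <= El M \<times> El N"
   "P (coset x) \<and> P (\<ominus>\<^sub>T coset x)" "P (coset y) \<and> P (\<ominus>\<^sub>T coset y)"
  have eq: "coset (x - y) = coset x \<oplus>\<^sub>T \<ominus>\<^sub>T coset y"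
   using coset_add[of x "- y"] neg[of y] 2(1,2) by simp
  have c: "coset x \<in> El T" "coset y \<in> El T"
   using 2(1,2) by (auto intro!: coset_closed)
  have eq2: "\<ominus>\<^sub>T coset (x - y) = \<ominus>\<^sub>T coset x \<oplus>\<^sub>T coset y"
   unfolding eq using c by (simp add: T.minus_add)
  show "P (coset (x - y)) \<and> P (\<ominus>\<^sub>T coset (x - y))"
   unfolding eq2 unfolding eq using 2(3,4) c by (auto intro!: add)
 next
  fix a assume "a \<in> El M \<times> El N"
  then obtain x y where a: "a = (x, y)" "x \<in> El M" "y \<in> El N" by auto
  have "coset (frag_of a) = pure x y" by (simp add: a tensor_pure_def)
  thus "P (coset (frag_of a)) \<and> P (\<ominus>\<^sub>T coset (frag_of a))"
   using pure[OF a(2,3)] pure[OF M.a_inv_closed[OF a(2)] a(3)] pure_neg[OF a(2,3)] by simp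
 qed
 thus ?thesis using u by simp
qed

context
 fixes P :: "('p, 'w) ring_scheme" and f :: "'m \<times> 'n => 'p"
 assumes P: "abelian_group P" and f: "balanced S M N P f"
begin

interpretation P: abelian_group P by (rule P)

lemma f_closed: "k \<in> El M \<times> El N ==> f k \<in> El P"
 using f by (auto simp: balanced_def)

lemma free_lift_superset:
 assumes "finite D" "Poly_Mapping.keys u <= D" "D <= El M \<times> El N"
 shows "free_lift P f u = (\<Oplus>\<^sub>P k\<in>D. add_pow P (Poly_Mapping.lookup u k) (f k))"
 unfolding free_lift_def
proof (rule P.add.finprod_mono_neutral_cong_left[OF assms(1,2)])
 show "(%k. [Poly_Mapping.lookup u k] \<cdot>\<^sub>P f k) \<in> D \<rightarrow> El P"
  using f_closed assms(3) by (auto intro!: P.add.int_pow_closed)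
 show "[Poly_Mapping.lookup u i] \<cdot>\<^sub>P f i = \<zero>\<^sub>P" if "i \<in> D - Poly_Mapping.keys u" for i
  using that by (simp add: in_keys_iff add_pow_def)
qed auto

lemma free_lift_closed: "u \<in> El Free ==> free_lift P f u \<in> El P"
 unfolding free_lift_def using f_closed by (intro P.finsum_closed) (auto intro!: P.add.int_pow_closed)

lemma free_lift_add:
 assumes "u \<in> El Free" "v \<in> El Free"
 shows "free_lift P f (u + v) = free_lift P f u \<oplus>\<^sub>P free_lift P f v"
proof -
 let ?D = "Poly_Mapping.keys u \<union> Poly_Mapping.keys v"
 have X: "finite ?D" "?D <= El M \<times> El N" using assms by auto
 have "free_lift P f (u + v) = (\<Oplus>\<^sub>P k\<in>?D. add_pow P (Poly_Mapping.lookup (u + v) k) (f k))"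
  by (rule free_lift_superset[OF X(1) _ X(2)]) (rule Poly_Mapping.keys_add)
 also have "... = (\<Oplus>\<^sub>P k\<in>?D. add_pow P (Poly_Mapping.lookup u k) (f k) \<oplus>\<^sub>P
               add_pow P (Poly_Mapping.lookup v k) (f k))"
  using X(2) f_closed
  by (intro P.finsum_cong') (auto simp: lookup_add P.add.int_pow_mult intro!: P.add.int_pow_closed)
 also have "... = free_lift P f u \<oplus>\<^sub>P free_lift P f v"
  using X(2) f_closed free_lift_superset[OF X(1) _ X(2)]
  by (subst P.finsum_addf) (auto intro!: P.add.int_pow_closed)
 finally show ?thesis .
qed

lemma free_lift_frag_of: "k \<in> El M \<times> El N ==> free_lift P f (frag_of k) = f k"
 unfolding free_lift_def using f_closed[of k] by (simp add: P.finsum_insert P.add.int_pow_1)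

lemma free_lift_diff:
 assumes "u \<in> El Free" "v \<in> El Free"
 shows "free_lift P f (u - v) = free_lift P f u \<ominus>\<^sub>P free_lift P f v"
proof -
 have c: "u - v \<in> El Free" using assms keys_diff[of u v] by auto
 have "free_lift P f u = free_lift P f (u - v) \<oplus>\<^sub>P free_lift P f v"
  using free_lift_add[OF c assms(2)] by simp
 thus ?thesis
  using free_lift_closed[OF c] free_lift_closed[OF assms(2)]
  by (simp add: P.minus_eq P.a_assoc P.r_neg)
qed

lemma free_lift_kernel: "u \<in> Ker ==> u \<in> El Free \<and> free_lift P f u = \<zero>\<^sub>P"
proof -
 have rel: "free_lift P f r = \<zero>\<^sub>P" if "r \<in> tensor_relations S M N" for r
 proof -
  have d: "frag_of a - frag_of b \<in> El Free" if "a \<in> El M \<times> El N" "b \<in> El M \<times> El N" for a b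
   using that keys_diff[of "frag_of a" "frag_of b"] by auto
  have 3: "free_lift P f (frag_of a - frag_of b - frag_of c) = \<zero>\<^sub>P"
   if "a \<in> El M \<times> El N" "b \<in> El M \<times> El N" "c \<in> El M \<times> El N" "f a = f b \<oplus>\<^sub>P f c" for a b c
  proof -
   have "free_lift P f (frag_of a - frag_of b - frag_of c) = f a \<ominus>\<^sub>P f b \<ominus>\<^sub>P f c"
    using that(1-3) by (subst free_lift_diff[OF d], (simp; fail)+) (simp add: free_lift_diff free_lift_frag_of)
   also have "... = \<zero>\<^sub>P"
    unfolding that(4) using f_closed[OF that(2)] f_closed[OF that(3)]
     P.r_neg[of "f b \<oplus>\<^sub>P f c"] by (simp add: P.minus_eq P.a_assoc P.minus_add)
   finally show ?thesis .
  qed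
  have 2: "free_lift P f (frag_of a - frag_of b) = \<zero>\<^sub>P"
   if "a \<in> El M \<times> El N" "b \<in> El M \<times> El N" "f a = f b" for a b
   using that f_closed by (subst free_lift_diff) (auto simp: free_lift_frag_of P.r_neg P.minus_eq)
  show ?thesis
   using that f unfolding tensor_relations_def balanced_def by (auto intro!: 2 3)
 qed
 assume "u \<in> Ker"
 thus ?thesis
  unfolding tensor_kernel_def
 proof (induction u rule: generate.induct)
  case one
  thus ?case by (simp add: free_lift_def)
 next
  case (incl h)
  thus ?case using rel subsetD[OF relations_closed] by blast
 next
  case (inv h)
  hence h: "h \<in> El Free" using relations_closed by blast
  have "free_lift P f (0 - h) = free_lift P f 0 \<ominus>\<^sub>P free_lift P f h"
   using h by (intro free_lift_diff) auto
  thus ?case using h rel[OF inv] by (auto simp: free_lift_def P.minus_eq)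
 next
  case (eng h1 h2)
  thus ?case using free_lift_add[of h1 h2] Free.m_closed[of h1 h2] by simp
 qed
qed

lemma lift_coset: assumes "u \<in> El Free" shows "tensor_lift P f (coset u) = free_lift P f u"
proof -
 have "free_lift P f ` coset u = {free_lift P f u}"
 proof (rule equalityI; rule subsetI)
  fix z assume "z \<in> free_lift P f ` coset u"
  then obtain k where "k \<in> Ker" "z = free_lift P f (k + u)" by (auto simp: r_coset_def)
  thus "z \<in> {free_lift P f u}"
   using free_lift_kernel[of k] free_lift_add[of k u] assms free_lift_closed[OF assms] by simp
 next
  fix z assume "z \<in> {free_lift P f u}"
  moreover have "u \<in> coset u"
   using Free.rcos_self[OF assms kernel_subgroup] .
  ultimately show "z \<in> free_lift P f ` coset u" by auto
 qed
 thus ?thesis by (simp add: tensor_lift_def)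
qed

lemma lift_pure [simp]:
 "x \<in> El M ==> y \<in> El N ==> tensor_lift P f (pure x y) = f (x, y)"
 unfolding tensor_pure_def by (subst lift_coset) (auto simp: free_lift_frag_of)

lemma lift_additive: "additive_map T P (tensor_lift P f)"
 unfolding additive_map_def
proof (intro conjI ballI)
 fix U assume "U \<in> El T"
 then obtain u where u: "u \<in> El Free" "U = coset u" by (rule T_elem)
 thus "tensor_lift P f U \<in> El P" by (simp add: lift_coset free_lift_closed)
 fix V assume "V \<in> El T"
 then obtain v where v: "v \<in> El Free" "V = coset v" by (rule T_elem)
 have "u + v \<in> El Free" using Free.m_closed[OF u(1) v(1)] by simp
 thus "tensor_lift P f (U \<oplus>\<^sub>T V) = tensor_lift P f U \<oplus>\<^sub>P tensor_lift P f V"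
  using u v by (simp only: coset_add lift_coset free_lift_add)
qed


end


end

section \<open>Tensor products of algebras\<close>

locale tensor_of_algebras = S: cring S + A: cring A + B: cring B
 for S :: "('s, 'x) ring_scheme" and i :: "'s => 'a" and A :: "('a, 'y) ring_scheme"
  and j :: "'s => 'b" and B :: "('b, 'z) ring_scheme" +
 assumes i_hom: "i \<in> ring_hom S A" and j_hom: "j \<in> ring_hom S B"
begin

sublocale X: tensor S "restrict_scalars i A" "restrict_scalars j B"
 by (intro tensor.intro restrict_scalars_module S.cring_axioms A.cring_axioms B.cring_axioms
   i_hom j_hom)

abbreviation "TA \<equiv> tensor_algebra S i A j B"
abbreviation "ap \<equiv> algebra_pure S i A j B"

lemma TA_simps:
 "El TA = El X.T" "(\<oplus>\<^sub>TA) = (\<oplus>\<^sub>X.T)" "\<zero>\<^sub>TA = \<zero>\<^sub>X.T" "\<one>\<^sub>TA = ap \<one>\<^sub>A \<one>\<^sub>B"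
 by (simp_all add: tensor_algebra_def Let_def algebra_pure_def)

lemma TA_abelian_group: "abelian_group TA"
 by (rule abelian_group_cong[OF X.T_abelian_group]) (simp_all add: TA_simps)

sublocale TA: abelian_group TA
 by (rule TA_abelian_group)

lemma ap_closed [intro, simp]: "a \<in> El A ==> b \<in> El B ==> ap a b \<in> El TA"
 by (simp add: TA_simps algebra_pure_def)

lemma ap_add_l: "a \<in> El A ==> a' \<in> El A ==> b \<in> El B ==>
  ap (a \<oplus>\<^sub>A a') b = ap a b \<oplus>\<^sub>TA ap a' b"
 using X.pure_add_l[of a a' b] by (simp add: TA_simps algebra_pure_def)

lemma ap_add_r: "a \<in> El A ==> b \<in> El B ==> b' \<in> El B ==>
  ap a (b \<oplus>\<^sub>B b') = ap a b \<oplus>\<^sub>TA ap a b'"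
 using X.pure_add_r[of a b b'] by (simp add: TA_simps algebra_pure_def)

lemma ap_smult: "s \<in> El S ==> a \<in> El A ==> b \<in> El B ==>
  ap (i s \<otimes>\<^sub>A a) b = ap a (j s \<otimes>\<^sub>B b)"
 using X.pure_smult[of s a b] by (simp add: algebra_pure_def)

lemma TA_induct [consumes 1, case_names pure add]:
 assumes "U \<in> El TA"
  and pure: "\<And>x y. x \<in> El A ==> y \<in> El B ==> P (ap x y)"
  and add: "\<And>U V. U \<in> El TA ==> V \<in> El TA ==> P U ==> P V ==> P (U \<oplus>\<^sub>TA V)"
 shows "P U"
 using assms unfolding TA_simps algebra_pure_def
 using X.T_induct[of U P] by simp

abbreviation "bal \<equiv> balanced S (restrict_scalars i A) (restrict_scalars j B)"

lemma balancedI: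
 assumes "\<And>a b. a \<in> El A ==> b \<in> El B ==> f (a, b) \<in> El P"
  and "\<And>a a' b. a \<in> El A ==> a' \<in> El A ==> b \<in> El B ==>
   f (a \<oplus>\<^sub>A a', b) = f (a, b) \<oplus>\<^sub>P f (a', b)"
  and "\<And>a b b'. a \<in> El A ==> b \<in> El B ==> b' \<in> El B ==>
   f (a, b \<oplus>\<^sub>B b') = f (a, b) \<oplus>\<^sub>P f (a, b')"
  and "\<And>s a b. s \<in> El S ==> a \<in> El A ==> b \<in> El B ==>
   f (i s \<otimes>\<^sub>A a, b) = f (a, j s \<otimes>\<^sub>B b)"
 shows "bal P f"
 using assms by (simp add: balanced_def)

lemma lift_TA:
 assumes "abelian_group P" "bal P f"
 shows "additive_map TA P (tensor_lift P f)"
  and "\<And>a b. a \<in> El A ==> b \<in> El B ==> tensor_lift P f (ap a b) = f (a, b)"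
 using X.lift_additive[OF assms] X.lift_pure[OF assms]
 by (simp_all add: additive_map_def TA_simps algebra_pure_def)

lemma balanced_inner:
 assumes "a \<in> El A" "b \<in> El B"
 shows "bal TA (%(a', b'). ap (a \<otimes>\<^sub>A a') (b \<otimes>\<^sub>B b'))"
proof (rule balancedI)
 fix s a' b' assume s: "s \<in> El S" and a': "a' \<in> El A" and b': "b' \<in> El B"
 have "i s \<in> El A" "j s \<in> El B" using i_hom j_hom s by (auto simp: ring_hom_closed)
 hence "a \<otimes>\<^sub>A (i s \<otimes>\<^sub>A a') = i s \<otimes>\<^sub>A (a \<otimes>\<^sub>A a')" "b \<otimes>\<^sub>B (j s \<otimes>\<^sub>B b') = j s \<otimes>\<^sub>B (b \<otimes>\<^sub>B b')"
  using a' b' assms by (auto simp: A.m_lcomm B.m_lcomm)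
 thus "(case (i s \<otimes>\<^sub>A a', b') of (a', b') => ap (a \<otimes>\<^sub>A a') (b \<otimes>\<^sub>B b')) =
   (case (a', j s \<otimes>\<^sub>B b') of (a', b') => ap (a \<otimes>\<^sub>A a') (b \<otimes>\<^sub>B b'))"
  using ap_smult[OF s] a' b' assms by simp
qed (use assms in \<open>auto simp: A.r_distr B.r_distr ap_add_l ap_add_r\<close>)

definition mul_by where
 "mul_by a b = tensor_lift TA (%(a', b'). ap (a \<otimes>\<^sub>A a') (b \<otimes>\<^sub>B b'))"

lemma mul_by_additive: "a \<in> El A ==> b \<in> El B ==> additive_map TA TA (mul_by a b)"
 unfolding mul_by_def by (rule lift_TA[OF TA_abelian_group balanced_inner])

lemma mul_by_pure: "a \<in> El A ==> b \<in> El B ==> a' \<in> El A ==> b' \<in> El B ==>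
  mul_by a b (ap a' b') = ap (a \<otimes>\<^sub>A a') (b \<otimes>\<^sub>B b')"
 unfolding mul_by_def by (simp add: lift_TA(2)[OF TA_abelian_group balanced_inner])

lemma mult_eq: "U \<otimes>\<^sub>TA V = tensor_lift TA (%(a, b). mul_by a b V) U"
proof -
 have "tensor_lift TA f = tensor_lift X.T f" for f :: "'a \<times> 'b => _"
 proof -
  have 1: "add_monoid TA = add_monoid X.T" unfolding TA_simps by simp
  have "free_lift TA f = free_lift X.T f" for f :: "'a \<times> 'b => _"
   unfolding free_lift_def finsum_def add_pow_def 1 ..
  thus ?thesis unfolding tensor_lift_def by (simp add: fun_eq_iff)
 qed
 thus ?thesis
  unfolding mul_by_def by (simp add: tensor_algebra_def Let_def algebra_pure_def)
qed

lemma balanced_outer: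
 assumes V: "V \<in> El TA"
 shows "bal TA (%(a, b). mul_by a b V)"
proof -
 have [simp]: "mul_by a b U \<in> El TA" if "a \<in> El A" "b \<in> El B" "U \<in> El TA" for a b U
  using mul_by_additive[OF that(1,2)] that(3) by (rule additive_map_closed)
 have add: "mul_by a b (U \<oplus>\<^sub>TA U') = mul_by a b U \<oplus>\<^sub>TA mul_by a b U'"
  if "a \<in> El A" "b \<in> El B" "U \<in> El TA" "U' \<in> El TA" for a b U U'
  using mul_by_additive[OF that(1,2)] that(3,4) by (rule additive_map_add)
 have ij: "i s \<in> El A" "j s \<in> El B" if "s \<in> El S" for s
  using i_hom j_hom that by (auto simp: ring_hom_closed)
 show ?thesis
 proof (rule balancedI)
  fix a a' b assume h: "a \<in> El A" "a' \<in> El A" "b \<in> El B"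
  show "(case (a \<oplus>\<^sub>A a', b) of (a, b) => mul_by a b V) =
    (case (a, b) of (a, b) => mul_by a b V) \<oplus>\<^sub>TA (case (a', b) of (a, b) => mul_by a b V)"
   unfolding prod.case using V
   by (induction rule: TA_induct)
     (use h in \<open>simp_all add: mul_by_pure A.l_distr ap_add_l add TA.a_ac\<close>)
 next
  fix a b b' assume h: "a \<in> El A" "b \<in> El B" "b' \<in> El B"
  show "(case (a, b \<oplus>\<^sub>B b') of (a, b) => mul_by a b V) =
    (case (a, b) of (a, b) => mul_by a b V) \<oplus>\<^sub>TA (case (a, b') of (a, b) => mul_by a b V)"
   unfolding prod.case using V
   by (induction rule: TA_induct)
     (use h in \<open>simp_all add: mul_by_pure B.l_distr ap_add_r add TA.a_ac\<close>)
 next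
  fix s a b assume h: "s \<in> El S" "a \<in> El A" "b \<in> El B"
  show "(case (i s \<otimes>\<^sub>A a, b) of (a, b) => mul_by a b V) =
    (case (a, j s \<otimes>\<^sub>B b) of (a, b) => mul_by a b V)"
   unfolding prod.case using V
   by (induction rule: TA_induct)
     (use h ij[OF h(1)] in \<open>simp_all add: mul_by_pure A.m_assoc B.m_assoc ap_smult add\<close>)
 qed (use V in auto)
qed

lemma mult_pure [simp]:
 "a \<in> El A ==> b \<in> El B ==> a' \<in> El A ==> b' \<in> El B ==>
  ap a b \<otimes>\<^sub>TA ap a' b' = ap (a \<otimes>\<^sub>A a') (b \<otimes>\<^sub>B b')"
 by (simp add: mult_eq lift_TA(2)[OF TA_abelian_group balanced_outer] mul_by_pure)

lemma mult_additive_l: "V \<in> El TA ==> additive_map TA TA (%U. U \<otimes>\<^sub>TA V)"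
 unfolding mult_eq by (rule lift_TA[OF TA_abelian_group balanced_outer])

lemma mult_closed: "U \<in> El TA ==> V \<in> El TA ==> U \<otimes>\<^sub>TA V \<in> El TA"
 using additive_map_closed[OF mult_additive_l] by blast

lemma mult_add_l: "U \<in> El TA ==> U' \<in> El TA ==> V \<in> El TA ==>
  (U \<oplus>\<^sub>TA U') \<otimes>\<^sub>TA V = U \<otimes>\<^sub>TA V \<oplus>\<^sub>TA U' \<otimes>\<^sub>TA V"
 using additive_map_add[OF mult_additive_l] by blast

lemma mult_add_r:
 assumes "U \<in> El TA" "V \<in> El TA" "V' \<in> El TA"
 shows "U \<otimes>\<^sub>TA (V \<oplus>\<^sub>TA V') = U \<otimes>\<^sub>TA V \<oplus>\<^sub>TA U \<otimes>\<^sub>TA V'"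
 using assms(1)
proof (induction rule: TA_induct)
 case (pure x y)
 have "ap x y \<otimes>\<^sub>TA W = mul_by x y W" if "W \<in> El TA" for W
  using pure that by (simp add: mult_eq lift_TA(2)[OF TA_abelian_group balanced_outer])
 thus ?case
  using additive_map_add[OF mul_by_additive[OF pure] assms(2,3)] assms(2,3) by simp
qed (use assms(2,3) in \<open>simp add: mult_add_l TA.a_ac mult_closed\<close>)

lemma mult_comm: assumes "U \<in> El TA" "V \<in> El TA" shows "U \<otimes>\<^sub>TA V = V \<otimes>\<^sub>TA U"
 using assms(1)
proof (induction rule: TA_induct)
 case (pure x y)
 show ?case using assms(2)
  by (induction rule: TA_induct) (use pure in \<open>simp_all add: A.m_comm B.m_comm mult_add_l mult_add_r\<close>)
qed (use assms(2) in \<open>simp add: mult_add_l mult_add_r\<close>)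

lemma mult_assoc:
 assumes "U \<in> El TA" "V \<in> El TA" "W \<in> El TA"
 shows "(U \<otimes>\<^sub>TA V) \<otimes>\<^sub>TA W = U \<otimes>\<^sub>TA (V \<otimes>\<^sub>TA W)"
 using assms(1)
proof (induction rule: TA_induct)
 case p: (pure x y)
 show ?case using assms(2)
 proof (induction rule: TA_induct)
  case q: (pure x' y')
  show ?case using assms(3)
   by (induction rule: TA_induct)
     (use p q in \<open>simp_all add: A.m_assoc B.m_assoc mult_add_l mult_add_r mult_closed\<close>)
 qed (use p assms(3) in \<open>simp add: mult_add_l mult_add_r mult_closed\<close>)
qed (use assms(2,3) in \<open>simp add: mult_add_l mult_add_r mult_closed\<close>)

lemma TA_cring: "cring TA"
proof (rule cringI[OF TA_abelian_group])
 have one: "\<one>\<^sub>TA \<otimes>\<^sub>TA U = U" if "U \<in> El TA" for U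
  using that by (induction rule: TA_induct)
   (simp_all add: TA_simps(4) mult_add_r)
 show "comm_monoid TA"
 proof (rule comm_monoidI)
  show "\<one>\<^sub>TA \<in> El TA" by (simp add: TA_simps(4))
 qed (simp_all add: mult_closed mult_assoc one, rule mult_comm)
qed (rule mult_add_l)

sublocale TA: cring TA
 by (rule TA_cring)

text \<open>The tensor product of algebras is their coproduct among commutative algebras.\<close>

lemma lift_ring_hom:
 assumes C: "cring C" and \<alpha>: "\<alpha> \<in> ring_hom A C" and \<beta>: "\<beta> \<in> ring_hom B C"
  and \<alpha>\<beta>: "\<And>s. s \<in> El S ==> \<alpha> (i s) = \<beta> (j s)"
  and f: "\<And>a b. a \<in> El A ==> b \<in> El B ==> f (a, b) = \<alpha> a \<otimes>\<^sub>C \<beta> b"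
 shows "bal C f" "tensor_lift C f \<in> ring_hom TA C"
  "\<And>a b. a \<in> El A ==> b \<in> El B ==> tensor_lift C f (ap a b) = f (a, b)"
proof -
 interpret C: cring C by fact
 have cl [simp]: "\<And>a. a \<in> El A ==> \<alpha> a \<in> El C" "\<And>b. b \<in> El B ==> \<beta> b \<in> El C"
  using \<alpha> \<beta> by (auto simp: ring_hom_closed)
 have ij: "i s \<in> El A" "j s \<in> El B" if "s \<in> El S" for s
  using i_hom j_hom that by (auto simp: ring_hom_closed)
 show bal: "bal C f"
 proof (rule balancedI)
  fix s a b assume s: "s \<in> El S" and a: "a \<in> El A" and b: "b \<in> El B"
  note ij[OF s, simp]
  show "f (i s \<otimes>\<^sub>A a, b) = f (a, j s \<otimes>\<^sub>B b)"
   using a b s by (simp add: f ring_hom_mult[OF \<alpha>] ring_hom_mult[OF \<beta>] \<alpha>\<beta> C.m_ac)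
    (use cl(2)[OF ij(2)[OF s]] in \<open>simp add: C.m_ac\<close>)?
 qed (simp_all add: f ring_hom_add[OF \<alpha>] ring_hom_add[OF \<beta>] C.l_distr C.r_distr)
 let ?h = "tensor_lift C f"
 note l = lift_TA[OF C.is_abelian_group bal]
 show val: "?h (ap a b) = f (a, b)" if "a \<in> El A" "b \<in> El B" for a b
  using l(2) that by simp
 note [simp] = additive_map_closed[OF l(1)] additive_map_add[OF l(1)]
 show "?h \<in> ring_hom TA C"
 proof (rule ring_hom_memI)
  show "?h \<one>\<^sub>TA = \<one>\<^sub>C"
   by (simp add: TA_simps(4) val f ring_hom_one[OF \<alpha>] ring_hom_one[OF \<beta>])
  fix U V assume UV: "U \<in> El TA" "V \<in> El TA"
  from UV(1) show "?h (U \<otimes>\<^sub>TA V) = ?h U \<otimes>\<^sub>C ?h V"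
  proof (induction rule: TA_induct)
   case p: (pure x y)
   from UV(2) show ?case
    by (induction rule: TA_induct)
      (use p in \<open>simp_all add: val f ring_hom_mult[OF \<alpha>] ring_hom_mult[OF \<beta>] TA.r_distr C.r_distr C.m_ac\<close>)
  qed (use UV(2) in \<open>simp add: TA.l_distr C.l_distr\<close>)
 qed simp_all
qed

lemma ap_left_hom: "(%a. ap a \<one>\<^sub>B) \<in> ring_hom A TA"
 by (rule ring_hom_memI) (simp_all add: ap_add_l TA_simps(4))

lemma ap_right_hom: "(%b. ap \<one>\<^sub>A b) \<in> ring_hom B TA"
 by (rule ring_hom_memI) (simp_all add: ap_add_r TA_simps(4))

lemma ap_scalar: assumes "s \<in> El S" shows "ap (i s) \<one>\<^sub>B = ap \<one>\<^sub>A (j s)"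
 using ap_smult[of s "\<one>\<^sub>A" "\<one>\<^sub>B"] assms i_hom j_hom by (simp add: ring_hom_closed)


end

section \<open>Total rings of fractions\<close>

context cring
begin

abbreviation "NZ \<equiv> nonzerodivisors R"
abbreviation "Fr \<equiv> total_fractions R"
abbreviation "fr \<equiv> fraction R"

lemma NZ_carrier: "s \<in> NZ ==> s \<in> El R"
 by (simp add: nonzerodivisors_def)

lemma NZ_cancel: "s \<in> NZ ==> a \<in> El R ==> s \<otimes> a = \<zero> ==> a = \<zero>"
 by (simp add: nonzerodivisors_def)

lemma NZ_cancel_eq:
 assumes "s \<in> NZ" "a \<in> El R" "b \<in> El R" "s \<otimes> a = s \<otimes> b" shows "a = b"
proof -
 have "s \<otimes> (a \<ominus> b) = \<zero>"
  using assms NZ_carrier[OF assms(1)] by (simp add: minus_eq r_distr r_minus r_neg)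
 hence "a \<ominus> b = \<zero>" using NZ_cancel[OF assms(1)] assms(2,3) by simp
 thus ?thesis using assms(2,3) by simp
qed

lemma NZ_one: "\<one> \<in> NZ"
 by (simp add: nonzerodivisors_def)

lemma NZ_I: "s \<in> El R ==> (\<And>a. a \<in> El R ==> s \<otimes> a = \<zero> ==> a = \<zero>) ==> s \<in> NZ"
 unfolding nonzerodivisors_def by blast

lemma NZ_mult: assumes "s \<in> NZ" "t \<in> NZ" shows "s \<otimes> t \<in> NZ"
proof (rule NZ_I)
 show "s \<otimes> t \<in> El R" using assms by (auto dest: NZ_carrier)
 fix a assume a: "a \<in> El R" "s \<otimes> t \<otimes> a = \<zero>"
 hence "s \<otimes> (t \<otimes> a) = \<zero>" using assms by (simp add: m_assoc NZ_carrier)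
 hence "t \<otimes> a = \<zero>" by (rule NZ_cancel[OF assms(1), rotated]) (use assms a in \<open>auto dest: NZ_carrier\<close>)
 thus "a = \<zero>" by (rule NZ_cancel[OF assms(2) a(1)])
qed

lemma frac_mem: "(b, t) \<in> fr a s \<longleftrightarrow> b \<in> El R \<and> t \<in> NZ \<and> a \<otimes> t = b \<otimes> s"
 by (simp add: fraction_def)

lemma frac_trans:
 assumes "a \<in> El R" "b \<in> El R" "c \<in> El R" "s \<in> NZ" "t \<in> NZ" "u \<in> NZ"
  and "a \<otimes> t = b \<otimes> s" "b \<otimes> u = c \<otimes> t"
 shows "a \<otimes> u = c \<otimes> s"
proof (rule NZ_cancel_eq[OF assms(5)])
 note [simp] = assms(1-3) NZ_carrier[OF assms(4)] NZ_carrier[OF assms(5)] NZ_carrier[OF assms(6)]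
 have "t \<otimes> (a \<otimes> u) = (a \<otimes> t) \<otimes> u" by (simp add: m_ac)
 also have "... = (b \<otimes> u) \<otimes> s" by (simp add: assms(7) m_ac)
 also have "... = t \<otimes> (c \<otimes> s)" by (simp add: assms(8) m_ac)
 finally show "t \<otimes> (a \<otimes> u) = t \<otimes> (c \<otimes> s)" .
qed (simp_all add: assms NZ_carrier)

lemma frac_eq_iff:
 assumes "a \<in> El R" "b \<in> El R" "s \<in> NZ" "t \<in> NZ"
 shows "fr a s = fr b t \<longleftrightarrow> a \<otimes> t = b \<otimes> s"
proof
 assume "fr a s = fr b t"
 hence "(b, t) \<in> fr a s" using assms by (simp add: frac_mem)
 thus "a \<otimes> t = b \<otimes> s" by (simp add: frac_mem)
next
 assume eq: "a \<otimes> t = b \<otimes> s"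
 show "fr a s = fr b t"
  by (auto simp: fraction_def intro: frac_trans[OF _ _ _ _ _ _ eq] frac_trans[OF _ _ _ _ _ _ eq[symmetric]] assms)
qed

lemma Fr_simps:
 "\<one>\<^sub>Fr = fr \<one> \<one>" "\<zero>\<^sub>Fr = fr \<zero> \<one>"
 by (simp_all add: total_fractions_def)

lemma Fr_elem: assumes "U \<in> El Fr"
 obtains a s where "a \<in> El R" "s \<in> NZ" "U = fr a s"
 using assms by (auto simp: total_fractions_def)

lemma frac_closed [simp]: "a \<in> El R ==> s \<in> NZ ==> fr a s \<in> El Fr"
 by (auto simp: total_fractions_def)

lemma Union_frac:
 assumes "a \<in> El R" "s \<in> NZ"
  and "\<And>a' s'. a' \<in> El R ==> s' \<in> NZ ==> a \<otimes> s' = a' \<otimes> s ==> G a' s' = V"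
 shows "(\<Union>(a', s')\<in>fr a s. G a' s') = V"
proof -
 have "(a, s) \<in> fr a s" using assms(1,2) by (simp add: frac_mem)
 moreover have "G a' s' = V" if "(a', s') \<in> fr a s" for a' s'
  using that assms(3) by (simp add: frac_mem)
 ultimately show ?thesis by fastforce
qed

lemma frac_mult:
 assumes "a \<in> El R" "b \<in> El R" "s \<in> NZ" "t \<in> NZ"
 shows "fr a s \<otimes>\<^sub>Fr fr b t = fr (a \<otimes> b) (s \<otimes> t)"
proof -
 have "fr (a' \<otimes> b') (s' \<otimes> t') = fr (a \<otimes> b) (s \<otimes> t)"
  if h: "a' \<in> El R" "s' \<in> NZ" "a \<otimes> s' = a' \<otimes> s" "b' \<in> El R" "t' \<in> NZ" "b \<otimes> t' = b' \<otimes> t"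
  for a' s' b' t'
 proof -
  note [simp] = assms(1,2) h(1,4) NZ_carrier[OF assms(3)] NZ_carrier[OF assms(4)] NZ_carrier[OF h(2)] NZ_carrier[OF h(5)]
  have "(a' \<otimes> b') \<otimes> (s \<otimes> t) = (a' \<otimes> s) \<otimes> (b' \<otimes> t)" by (simp add: m_ac)
  also have "... = (a \<otimes> s') \<otimes> (b \<otimes> t')" by (simp add: h(3,6))
  also have "... = (a \<otimes> b) \<otimes> (s' \<otimes> t')" by (simp add: m_ac)
  finally show ?thesis using assms h by (subst frac_eq_iff) (auto intro: NZ_mult)
 qed
 hence "(\<Union>(a', s')\<in>fr a s. \<Union>(b', t')\<in>fr b t. fr (a' \<otimes> b') (s' \<otimes> t')) = fr (a \<otimes> b) (s \<otimes> t)"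
  by (intro Union_frac assms)
 thus ?thesis by (simp add: total_fractions_def)
qed

lemma frac_add:
 assumes "a \<in> El R" "b \<in> El R" "s \<in> NZ" "t \<in> NZ"
 shows "fr a s \<oplus>\<^sub>Fr fr b t = fr (a \<otimes> t \<oplus> b \<otimes> s) (s \<otimes> t)"
proof -
 have "fr (a' \<otimes> t' \<oplus> b' \<otimes> s') (s' \<otimes> t') = fr (a \<otimes> t \<oplus> b \<otimes> s) (s \<otimes> t)"
  if h: "a' \<in> El R" "s' \<in> NZ" "a \<otimes> s' = a' \<otimes> s" "b' \<in> El R" "t' \<in> NZ" "b \<otimes> t' = b' \<otimes> t"
  for a' s' b' t'
 proof -
  note [simp] = assms(1,2) h(1,4) NZ_carrier[OF assms(3)] NZ_carrier[OF assms(4)] NZ_carrier[OF h(2)] NZ_carrier[OF h(5)]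
  have "(a' \<otimes> t' \<oplus> b' \<otimes> s') \<otimes> (s \<otimes> t) = (a' \<otimes> s) \<otimes> (t \<otimes> t') \<oplus> (b' \<otimes> t) \<otimes> (s \<otimes> s')"
   by (simp add: l_distr r_distr m_ac)
  also have "... = (a \<otimes> s') \<otimes> (t \<otimes> t') \<oplus> (b \<otimes> t') \<otimes> (s \<otimes> s')" by (simp add: h(3,6))
  also have "... = (a \<otimes> t \<oplus> b \<otimes> s) \<otimes> (s' \<otimes> t')" by (simp add: l_distr r_distr m_ac)
  finally show ?thesis using assms h by (subst frac_eq_iff) (auto intro: NZ_mult)
 qed
 hence "(\<Union>(a', s')\<in>fr a s. \<Union>(b', t')\<in>fr b t. fr (a' \<otimes> t' \<oplus> b' \<otimes> s') (s' \<otimes> t')) = fr (a \<otimes> t \<oplus> b \<otimes> s) (s \<otimes> t)"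
  by (intro Union_frac assms)
 thus ?thesis by (simp add: total_fractions_def)
qed

lemma Fr_cring: "cring Fr"
proof (rule cringI)
 show "abelian_group Fr"
 proof (rule abelian_groupI)
  fix x y assume "x \<in> El Fr" "y \<in> El Fr"
  from \<open>x \<in> El Fr\<close> obtain a s where h0: "a \<in> El R" "s \<in> NZ" "x = fr a s"
   by (rule Fr_elem)
  from \<open>y \<in> El Fr\<close> obtain b t where h1: "b \<in> El R" "t \<in> NZ" "y = fr b t"
   by (rule Fr_elem)
  note h = h0 h1
  from h show "x \<oplus>\<^sub>Fr y \<in> El Fr" "x \<oplus>\<^sub>Fr y = y \<oplus>\<^sub>Fr x"
   using NZ_carrier[OF h(2)] NZ_carrier[OF h(5)]
   by (simp_all add: frac_add NZ_mult m_comm a_comm)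
  fix z assume "z \<in> El Fr"
  from \<open>z \<in> El Fr\<close> obtain c u where k0: "c \<in> El R" "u \<in> NZ" "z = fr c u"
   by (rule Fr_elem)
  note k = k0
  show "(x \<oplus>\<^sub>Fr y) \<oplus>\<^sub>Fr z = x \<oplus>\<^sub>Fr (y \<oplus>\<^sub>Fr z)"
   using h k NZ_carrier[OF h(2)] NZ_carrier[OF h(5)] NZ_carrier[OF k(2)]
   by (simp add: frac_add NZ_mult m_ac a_ac l_distr r_distr)
 next
  show "\<zero>\<^sub>Fr \<in> El Fr" by (simp add: Fr_simps NZ_one)
  fix x assume "x \<in> El Fr"
  from \<open>x \<in> El Fr\<close> obtain a s where h0: "a \<in> El R" "s \<in> NZ" "x = fr a s"
   by (rule Fr_elem)
  note h = h0
  note [simp] = NZ_carrier[OF h(2)]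
  show "\<zero>\<^sub>Fr \<oplus>\<^sub>Fr x = x"
   using h by (simp add: Fr_simps frac_add NZ_one)
  have "fr (\<ominus> a) s \<oplus>\<^sub>Fr x = \<zero>\<^sub>Fr"
   using h NZ_mult[OF h(2) h(2)]
   by (simp add: Fr_simps frac_add frac_eq_iff NZ_one l_minus l_neg)
  thus "\<exists>y\<in>El Fr. y \<oplus>\<^sub>Fr x = \<zero>\<^sub>Fr"
   using h by (intro bexI[of _ "fr (\<ominus> a) s"]) auto
 qed
 show "comm_monoid Fr"
 proof (rule comm_monoidI)
  show "\<one>\<^sub>Fr \<in> El Fr" by (simp add: Fr_simps NZ_one)
  fix x y assume "x \<in> El Fr" "y \<in> El Fr"
  from \<open>x \<in> El Fr\<close> obtain a s where h0: "a \<in> El R" "s \<in> NZ" "x = fr a s"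
   by (rule Fr_elem)
  from \<open>y \<in> El Fr\<close> obtain b t where h1: "b \<in> El R" "t \<in> NZ" "y = fr b t"
   by (rule Fr_elem)
  note h = h0 h1
  from h show "x \<otimes>\<^sub>Fr y \<in> El Fr" "x \<otimes>\<^sub>Fr y = y \<otimes>\<^sub>Fr x" "\<one>\<^sub>Fr \<otimes>\<^sub>Fr x = x"
   using NZ_carrier[OF h(2)] NZ_carrier[OF h(5)]
   by (simp_all add: frac_mult NZ_mult m_comm Fr_simps NZ_one)
  fix z assume "z \<in> El Fr"
  from \<open>z \<in> El Fr\<close> obtain c u where k0: "c \<in> El R" "u \<in> NZ" "z = fr c u"
   by (rule Fr_elem)
  note k = k0
  show "(x \<otimes>\<^sub>Fr y) \<otimes>\<^sub>Fr z = x \<otimes>\<^sub>Fr (y \<otimes>\<^sub>Fr z)"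
   using h k NZ_carrier[OF h(2)] NZ_carrier[OF h(5)] NZ_carrier[OF k(2)]
   by (simp add: frac_mult NZ_mult m_ac)
 qed
 fix x y z assume "x \<in> El Fr" "y \<in> El Fr" "z \<in> El Fr"
 from \<open>x \<in> El Fr\<close> obtain a s where h0: "a \<in> El R" "s \<in> NZ" "x = fr a s"
   by (rule Fr_elem)
  from \<open>y \<in> El Fr\<close> obtain b t where h1: "b \<in> El R" "t \<in> NZ" "y = fr b t"
   by (rule Fr_elem)
  from \<open>z \<in> El Fr\<close> obtain c u where h2: "c \<in> El R" "u \<in> NZ" "z = fr c u"
   by (rule Fr_elem)
  note h = h0 h1 h2
 note [simp] = NZ_carrier[OF h(2)] NZ_carrier[OF h(5)] NZ_carrier[OF h(8)]
 show "(x \<oplus>\<^sub>Fr y) \<otimes>\<^sub>Fr z = x \<otimes>\<^sub>Fr z \<oplus>\<^sub>Fr y \<otimes>\<^sub>Fr z"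
  using h by (simp add: frac_mult frac_add NZ_mult frac_eq_iff) (simp add: m_ac l_distr r_distr)
qed

lemma frac_one_hom: "(%a. fr a \<one>) \<in> ring_hom R Fr"
 by (rule ring_hom_memI) (simp_all add: NZ_one frac_mult frac_add Fr_simps)

lemma frac_one_inj: "a \<in> El R ==> b \<in> El R ==> fr a \<one> = fr b \<one> \<longleftrightarrow> a = b"
 by (simp add: frac_eq_iff NZ_one)

lemma frac_denominator:
 assumes "a \<in> El R" "s \<in> NZ"
 shows "fr s \<one> \<otimes>\<^sub>Fr fr a s = fr a \<one>" "fr s \<one> \<otimes>\<^sub>Fr fr \<one> s = \<one>\<^sub>Fr"
 using assms NZ_carrier[OF assms(2)]
 by (simp_all add: frac_mult frac_eq_iff NZ_one Fr_simps m_comm)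

end

text \<open>A homomorphism that preserves non-zero-divisors extends to fractions.\<close>

lemma
 assumes A: "cring A" and B: "cring B" and h: "h \<in> ring_hom A B"
  and nz: "\<And>s. s \<in> nonzerodivisors A ==> h s \<in> nonzerodivisors B"
 shows frac_map_frac: "a \<in> El A ==> s \<in> nonzerodivisors A ==>
   frac_map B h (fraction A a s) = fraction B (h a) (h s)"
  and frac_map_hom: "frac_map B h \<in> ring_hom (total_fractions A) (total_fractions B)"
proof -
 interpret A: cring A by fact
 interpret B: cring B by fact
 note [simp] = ring_hom_closed[OF h] ring_hom_mult[OF h] ring_hom_add[OF h] ring_hom_one[OF h] nz
 show val: "frac_map B h (fraction A a s) = fraction B (h a) (h s)"
  if "a \<in> El A" "s \<in> nonzerodivisors A" for a s
  unfolding frac_map_def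
 proof (rule A.Union_frac[OF that])
  fix a' s' assume "a' \<in> El A" "s' \<in> nonzerodivisors A" "a \<otimes>\<^sub>A s' = a' \<otimes>\<^sub>A s"
  thus "fraction B (h a') (h s') = fraction B (h a) (h s)"
   using that A.NZ_carrier[of s] A.NZ_carrier[of s']
   by (subst B.frac_eq_iff) (auto simp flip: ring_hom_mult[OF h])
 qed
 show "frac_map B h \<in> ring_hom (total_fractions A) (total_fractions B)"
 proof (rule ring_hom_memI)
  fix x y assume "x \<in> El A.Fr" "y \<in> El A.Fr"
  from \<open>x \<in> El A.Fr\<close> obtain a s where k0: "a \<in> El A" "s \<in> A.NZ" "x = A.fr a s"
   by (rule A.Fr_elem)
  from \<open>y \<in> El A.Fr\<close> obtain b t where k1: "b \<in> El A" "t \<in> A.NZ" "y = A.fr b t"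
   by (rule A.Fr_elem)
  note k = k0 k1
  note [simp] = A.NZ_carrier[OF k(2)] A.NZ_carrier[OF k(5)] A.NZ_mult[OF k(2,5)]
  show "frac_map B h x \<in> El B.Fr"
   "frac_map B h (x \<otimes>\<^sub>A.Fr y) = frac_map B h x \<otimes>\<^sub>B.Fr frac_map B h y"
   "frac_map B h (x \<oplus>\<^sub>A.Fr y) = frac_map B h x \<oplus>\<^sub>B.Fr frac_map B h y"
   using k by (simp_all add: val A.frac_mult A.frac_add B.frac_mult B.frac_add)
 qed (simp add: A.Fr_simps B.Fr_simps val A.NZ_one)
qed

section \<open>Bold rings without invariant ideals\<close>

inductive_set ideal_gen :: "('r, 'x) ring_scheme => 'r set => 'r set"
 for R :: "('r, 'x) ring_scheme" and S where
 base: "s \<in> S ==> s \<in> ideal_gen R S"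
| add: "x \<in> ideal_gen R S ==> y \<in> ideal_gen R S ==> x \<oplus>\<^sub>R y \<in> ideal_gen R S"
| mult: "r \<in> El R ==> x \<in> ideal_gen R S ==> r \<otimes>\<^sub>R x \<in> ideal_gen R S"

context bold_ring
begin

abbreviation "sg \<equiv> endo R"

lemma sigma_closed [simp]: "x \<in> El R ==> sg x \<in> El R"
 and sigma_mult: "x \<in> El R ==> y \<in> El R ==> sg (x \<otimes> y) = sg x \<otimes> sg y"
 and sigma_add: "x \<in> El R ==> y \<in> El R ==> sg (x \<oplus> y) = sg x \<oplus> sg y"
 and sigma_one [simp]: "sg \<one> = \<one>"
 using endo_hom by (auto simp: ring_hom_closed ring_hom_mult ring_hom_add ring_hom_one)

lemma sigma_additive: "additive_map R R sg"
 by (simp add: additive_map_def sigma_add)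

lemma sigma_zero [simp]: "sg \<zero> = \<zero>"
 by (rule additive_map_zero[OF is_abelian_group is_abelian_group sigma_additive])

lemma sigma_neg: "x \<in> El R ==> sg (\<ominus> x) = \<ominus> sg x"
 by (rule additive_map_neg[OF is_abelian_group is_abelian_group sigma_additive])

end

locale simple_bold_ring = bold_ring +
 assumes one_not_zero: "\<one> ~= \<zero>"
  and no_ideal: "\<And>I. ideal I R ==> sg ` I <= I ==> I = {\<zero>} \<or> I = El R"
begin

text \<open>Simplicity in the form in which it is used: a stable additive subset that is closed under multiples
needs only one nonzero element to contain \<open>1\<close>.\<close>
lemma stable_ideal_one:
 assumes "I <= El R" "\<And>x y. x \<in> I ==> y \<in> I ==> x \<oplus> y \<in> I"
  and "\<And>r x. r \<in> El R ==> x \<in> I ==> r \<otimes> x \<in> I" "\<And>x. x \<in> I ==> sg x \<in> I"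
  and "x \<in> I" "x ~= \<zero>"
 shows "\<one> \<in> I"
proof -
 have neg: "\<ominus> y \<in> I" if "y \<in> I" for y
  using assms(3)[of "\<ominus> \<one>" y] that assms(1) by (auto simp: l_minus)
 have zero: "\<zero> \<in> I" using assms(2)[OF assms(5) neg[OF assms(5)]] assms(1,5) by (auto simp: r_neg)
 have "ideal I R"
 proof (rule idealI)
  show "ring R" ..
  show "subgroup I (add_monoid R)"
   by (rule add.subgroupI) (use assms(1,2,5) neg in \<open>auto simp flip: a_inv_def\<close>)
  show "x \<otimes> a \<in> I" "a \<otimes> x \<in> I" if "a \<in> I" "x \<in> El R" for a x
   using that assms(1) assms(3)[OF that(2,1)] m_comm[of a x] by auto
 qed
 hence "I = {\<zero>} \<or> I = El R" using no_ideal assms(4) by auto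
 thus ?thesis using assms(5,6) by auto
qed

lemma stable_generators_one:
 assumes "S <= El R" "sg ` S <= S" "s \<in> S" "s ~= \<zero>"
 shows "\<one> \<in> ideal_gen R S"
proof (rule stable_ideal_one)
 have c: "x \<in> El R" if "x \<in> ideal_gen R S" for x
  using that by induction (use assms(1) in auto)
 thus "ideal_gen R S <= El R" by auto
 show "sg x \<in> ideal_gen R S" if "x \<in> ideal_gen R S" for x
  using that
 proof induction
  case (base s)
  thus ?case using assms(2) by (auto intro: ideal_gen.base)
 qed (simp_all add: sigma_add sigma_mult c ideal_gen.add ideal_gen.mult)
qed (use assms in \<open>auto intro: ideal_gen.intros\<close>)

lemma sigma_inj: assumes "x \<in> El R" "sg x = \<zero>" shows "x = \<zero>"
proof (rule ccontr)
 assume "x ~= \<zero>"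
 hence "\<one> \<in> {x \<in> El R. sg x = \<zero>}"
  by (rule stable_ideal_one[rotated -1]) (use assms in \<open>auto simp: sigma_add sigma_mult\<close>)
 thus False using one_not_zero by simp
qed

text \<open>Every element \<open>y\<close> of the stable ideal generated by the elements of square zero has the property that each \<open>w \<noteq> 0\<close>
has a nonzero multiple killed by \<open>y\<close>. The element \<open>1\<close> has not.\<close>
lemma square_zero: assumes x: "x \<in> El R" "x \<otimes> x = \<zero>" shows "x = \<zero>"
proof (rule ccontr)
 assume nz: "x ~= \<zero>"
 define S where "S = {y \<in> El R. y \<otimes> y = \<zero>}"
 have S: "S <= El R" by (auto simp: S_def)
 have one: "\<one> \<in> ideal_gen R S"
 proof (rule stable_generators_one)
  show "sg ` S <= S" by (auto simp: S_def simp flip: sigma_mult)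
  show "x \<in> S" using x by (simp add: S_def)
 qed (use nz S in auto)
 have "y \<in> El R \<and> (\<forall>w\<in>El R. w ~= \<zero> --> (\<exists>v\<in>El R. v \<otimes> w ~= \<zero> \<and> v \<otimes> w \<otimes> y = \<zero>))"
  if "y \<in> ideal_gen R S" for y
  using that
 proof induction
  case (base s)
  show ?case
  proof (intro conjI ballI impI)
   show s: "s \<in> El R" using base S by auto
   fix w assume w: "w \<in> El R" "w ~= \<zero>"
   show "\<exists>v\<in>El R. v \<otimes> w ~= \<zero> \<and> v \<otimes> w \<otimes> s = \<zero>"
   proof (cases "w \<otimes> s = \<zero>")
    case True
    thus ?thesis using w by (intro bexI[of _ \<one>]) auto
   next
    case False
    have "s \<otimes> w \<otimes> s = w \<otimes> (s \<otimes> s)" using w s by (simp add: m_ac)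
    thus ?thesis using False w s base by (intro bexI[of _ s]) (auto simp: m_comm S_def)
   qed
  qed
 next
  case (add x y)
  show ?case
  proof (intro conjI ballI impI)
   fix w assume w: "w \<in> El R" "w ~= \<zero>"
   then obtain v where v: "v \<in> El R" "v \<otimes> w ~= \<zero>" "v \<otimes> w \<otimes> x = \<zero>" using add by blast
   then obtain u where u: "u \<in> El R" "u \<otimes> (v \<otimes> w) ~= \<zero>" "u \<otimes> (v \<otimes> w) \<otimes> y = \<zero>"
    using add w by (meson m_closed)
   have "u \<otimes> (v \<otimes> w) \<otimes> x = u \<otimes> (v \<otimes> w \<otimes> x)" using u v w add by (simp add: m_assoc)
   hence "u \<otimes> (v \<otimes> w) \<otimes> (x \<oplus> y) = \<zero>" using u v w add by (simp add: r_distr)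
   thus "\<exists>v\<in>El R. v \<otimes> w ~= \<zero> \<and> v \<otimes> w \<otimes> (x \<oplus> y) = \<zero>"
    using u v w by (intro bexI[of _ "u \<otimes> v"]) (auto simp: m_assoc)
  qed (use add in auto)
 next
  case (mult r x)
  show ?case
  proof (intro conjI ballI impI)
   fix w assume w: "w \<in> El R" "w ~= \<zero>"
   then obtain v where v: "v \<in> El R" "v \<otimes> w ~= \<zero>" "v \<otimes> w \<otimes> x = \<zero>" using mult by blast
   have "v \<otimes> w \<otimes> (r \<otimes> x) = r \<otimes> (v \<otimes> w \<otimes> x)" using v w mult by (simp add: m_ac)
   thus "\<exists>v\<in>El R. v \<otimes> w ~= \<zero> \<and> v \<otimes> w \<otimes> (r \<otimes> x) = \<zero>" using v w mult by auto
  qed (use mult in auto)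
 qed
 from this[OF one] show False using one_not_zero by auto
qed

lemma reduced_R: "reduced R"
 unfolding reduced_def
proof (intro ballI allI impI)
 fix x and n :: nat assume x: "x \<in> El R" "x [^] n = \<zero>"
 thus "x = \<zero>"
 proof (induction n rule: less_induct)
  case (less n)
  consider "n = 0" | "n = 1" | "n \<ge> 2" by linarith
  thus ?case
  proof cases
   case 1
   thus ?thesis using less one_not_zero by simp
  next
   case 2
   thus ?thesis using less by simp
  next
   case 3
   let ?m = "n - 1"
   have "?m + ?m = n + (n - 2)" using 3 by simp
   hence "x [^] ?m \<otimes> x [^] ?m = x [^] n \<otimes> x [^] (n - 2)"
    using less(2) nat_pow_mult[of x ?m ?m] nat_pow_mult[of x n "n - 2"] by simp
   hence "x [^] ?m = \<zero>" using square_zero[of "x [^] ?m"] less(2,3) by simp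
   thus ?thesis using less(1)[of ?m] less(2) 3 by simp
  qed
 qed
qed

end

text \<open>Among the families in \<open>U\<close> that do not vanish on \<open>S\<close>, one of smallest support: a family of \<open>U\<close>
supported in it that vanishes at one more place must vanish on all of \<open>S\<close>.\<close>
lemma minimal_support:
 fixes U :: "('i => 'a) set"
 assumes "finite S" "u0 \<in> U" "i0 \<in> S" "u0 i0 ~= z"
 shows "\<exists>u\<in>U. \<exists>i\<in>S. u i ~= z \<and>
  (\<forall>v\<in>U. (\<forall>j\<in>S. u j = z --> v j = z) --> v i = z --> (\<forall>j\<in>S. v j = z))"
proof -
 let ?s = "%u. {j \<in> S. u j ~= z}"
 obtain u where u: "u \<in> U \<and> ?s u ~= {}" "\<And>v. v \<in> U \<and> ?s v ~= {} ==> card (?s u) \<le> card (?s v)"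
  using arg_min_nat_lemma[of "%u. u \<in> U \<and> ?s u ~= {}" u0 "%u. card (?s u)"] assms by blast
 then obtain i where i: "i \<in> S" "u i ~= z" by auto
 have "\<forall>j\<in>S. v j = z" if v: "v \<in> U" "\<forall>j\<in>S. u j = z --> v j = z" "v i = z" for v
 proof -
  have "?s v \<subset> ?s u" using v i by auto
  hence "card (?s v) < card (?s u)" using assms(1) by (intro psubset_card_mono) auto
  thus "\<forall>j\<in>S. v j = z" using u(2)[of v] v(1) by auto
 qed
 thus ?thesis using u(1) i by blast
qed

text \<open>At a place \<open>i\<close> in the support of a shortest family \<open>u\<close>, the values at \<open>i\<close> of the families supported
where \<open>u\<close> is form a stable ideal, so one of them is \<open>1\<close>. Applying \<open>\<sigma>\<close> to that family and subtracting it
gives a shorter one, that is, zero.\<close>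
lemma (in simple_bold_ring) invariant_vector:
 assumes "finite S" "u0 \<in> U" "i0 \<in> S" "u0 i0 ~= \<zero>"
  and closed: "\<And>u i. u \<in> U ==> i \<in> S ==> u i \<in> El R"
  and add: "\<And>u v. u \<in> U ==> v \<in> U ==> (%i. u i \<oplus> v i) \<in> U"
  and mult: "\<And>r u. r \<in> El R ==> u \<in> U ==> (%i. r \<otimes> u i) \<in> U"
  and sig: "\<And>u. u \<in> U ==> (%i. sg (u i)) \<in> U"
 obtains u i where "u \<in> U" "i \<in> S" "u i ~= \<zero>" "\<And>j. j \<in> S ==> sg (u j) = u j"
proof -
 obtain u i where u: "u \<in> U" "i \<in> S" "u i ~= \<zero>"
  and min: "\<forall>v\<in>U. (\<forall>j\<in>S. u j = \<zero> --> v j = \<zero>) --> v i = \<zero> --> (\<forall>j\<in>S. v j = \<zero>)"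
  using minimal_support[OF assms(1-4)] by blast
 define V where "V = {v \<in> U. \<forall>j\<in>S. u j = \<zero> --> v j = \<zero>}"
 have "\<one> \<in> (%v. v i) ` V"
 proof (rule stable_ideal_one)
  show "(%v. v i) ` V <= El R" using closed u by (auto simp: V_def)
  show "x \<oplus> y \<in> (%v. v i) ` V" if xy: "x \<in> (%v. v i) ` V" "y \<in> (%v. v i) ` V" for x y
  proof -
   from xy(1) obtain v where "v \<in> V" "x = v i" by auto
   moreover from xy(2) obtain w where "w \<in> V" "y = w i" by auto
   ultimately show ?thesis using add by (intro image_eqI[of _ _ "%i. v i \<oplus> w i"]) (auto simp: V_def)
  qed
  show "r \<otimes> x \<in> (%v. v i) ` V" if rx: "r \<in> El R" "x \<in> (%v. v i) ` V" for r x
  proof -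
   from rx(2) obtain v where "v \<in> V" "x = v i" by auto
   thus ?thesis using mult rx by (intro image_eqI[of _ _ "%i. r \<otimes> v i"]) (auto simp: V_def)
  qed
  show "sg x \<in> (%v. v i) ` V" if x: "x \<in> (%v. v i) ` V" for x
  proof -
   from x obtain v where "v \<in> V" "x = v i" by auto
   thus ?thesis using sig by (intro image_eqI[of _ _ "%i. sg (v i)"]) (auto simp: V_def)
  qed
  show "u i \<in> (%v. v i) ` V" using u by (auto simp: V_def)
 qed (use u in auto)
 then obtain v where v: "v \<in> V" "v i = \<one>" by auto
 let ?w = "%j. sg (v j) \<oplus> (\<ominus> \<one>) \<otimes> v j"
 have vc: "v j \<in> El R" if "j \<in> S" for j using v closed that by (auto simp: V_def)
 have wU: "?w \<in> U" using v by (intro add sig mult) (auto simp: V_def)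
 have "\<forall>j\<in>S. u j = \<zero> --> ?w j = \<zero>" "?w i = \<zero>" using v by (auto simp: V_def r_neg)
 hence w: "\<forall>j\<in>S. ?w j = \<zero>" using bspec[OF min wU] by simp
 have "sg (v j) = v j" if "j \<in> S" for j
 proof -
  have "sg (v j) \<ominus> v j = \<zero>" using bspec[OF w that] vc[OF that] by (simp add: l_minus minus_eq)
  thus ?thesis using vc[OF that] by simp
 qed
 thus ?thesis using that[of v i] v u one_not_zero by (auto simp: V_def)
qed

section \<open>Finite combinations over a field extension\<close>

locale field_hom = F: field F + F': field F'
 for F :: "('f, 'x2) ring_scheme" and e :: "'f => 'g" and F' :: "('g, 'x3) ring_scheme" +
 assumes e_hom: "e \<in> ring_hom F F'"
begin

abbreviation "FF' \<equiv> restrict_scalars e F'"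

lemma e_closed [simp]: "a \<in> El F ==> e a \<in> El F'"
 using e_hom by (rule ring_hom_closed)

lemma e_additive: "additive_map F F' e"
 using e_hom by (simp add: additive_map_def ring_hom_add)

lemma e_inj: assumes "a \<in> El F" "e a = \<zero>\<^sub>F'" shows "a = \<zero>\<^sub>F"
proof (rule ccontr)
 assume "a ~= \<zero>\<^sub>F"
 hence "a \<in> Units F" using assms(1) F.field_Units by auto
 hence "e a \<otimes>\<^sub>F' e (inv\<^bsub>F\<^esub> a) = \<one>\<^sub>F'"
  using assms(1) by (simp flip: ring_hom_mult[OF e_hom] add: ring_hom_one[OF e_hom])
 thus False using assms \<open>a \<in> Units F\<close> by simp
qed

lemma module_FF': "module F FF'"
 by (rule restrict_scalars_module[OF F.cring_axioms F'.cring_axioms e_hom])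

definition indep :: "'g set => bool" where
 "indep S \<longleftrightarrow> finite S \<and> S <= El F' \<and>
   (\<forall>a\<in>S \<rightarrow> El F. (\<Oplus>\<^sub>F' b\<in>S. e (a b) \<otimes>\<^sub>F' b) = \<zero>\<^sub>F' --> (\<forall>b\<in>S. a b = \<zero>\<^sub>F))"

lemma indepD: "indep S ==> finite S" "indep S ==> S <= El F'"
 "indep S ==> a \<in> S \<rightarrow> El F ==> (\<Oplus>\<^sub>F' b\<in>S. e (a b) \<otimes>\<^sub>F' b) = \<zero>\<^sub>F' ==>
  b \<in> S ==> a b = \<zero>\<^sub>F"
 by (auto simp: indep_def)

lemma balancedD:
 assumes "balanced F FF' V G f"
 shows "b \<in> El F' ==> v \<in> El V ==> f (b, v) \<in> El G"
  and "b \<in> El F' ==> b' \<in> El F' ==> v \<in> El V ==>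
   f (b \<oplus>\<^sub>F' b', v) = f (b, v) \<oplus>\<^sub>G f (b', v)"
  and "b \<in> El F' ==> v \<in> El V ==> v' \<in> El V ==>
   f (b, v \<oplus>\<^sub>V v') = f (b, v) \<oplus>\<^sub>G f (b, v')"
  and "a \<in> El F ==> b \<in> El F' ==> v \<in> El V ==>
   f (e a \<otimes>\<^sub>F' b, v) = f (b, a \<odot>\<^sub>V v)"
 using assms by (auto simp: balanced_def)

text \<open>A linear relation over \<open>F\<close> among the left factors expresses one of them by the others and moves its
right factor to them. Removing elements in this way ends with an independent set, and the set is
the same for all families of right factors.\<close>
lemma balanced_reduce:
 assumes "module F V" "abelian_group G" "balanced F FF' V G f" "finite S0" "S0 <= El F'"
 shows "\<exists>S\<subseteq>S0. indep S \<and> (\<forall>v\<in>S0 \<rightarrow> El V. \<exists>v'\<in>S \<rightarrow> El V.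
      (\<Oplus>\<^sub>G b\<in>S0. f (b, v b)) = (\<Oplus>\<^sub>G b\<in>S. f (b, v' b)))"
 using assms(4,5)
proof (induction S0 rule: finite_psubset_induct)
 case (psubset S0)
 interpret V: module F V by fact
 interpret G: abelian_group G by fact
 note bal = balancedD[OF assms(3)]
 show ?case
 proof (cases "indep S0")
  case True
  thus ?thesis by (intro exI[of _ S0]) auto
 next
  case False
  then obtain a t where a: "a \<in> S0 \<rightarrow> El F" "(\<Oplus>\<^sub>F' b\<in>S0. e (a b) \<otimes>\<^sub>F' b) = \<zero>\<^sub>F'"
   and t: "t \<in> S0" "a t ~= \<zero>\<^sub>F"
   using psubset(1,3) by (auto simp: indep_def)
  let ?S = "S0 - {t}"
  have tF: "t \<in> El F'" and at: "a t \<in> El F" and atU: "a t \<in> Units F"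
   using t a psubset(3) F.field_Units by auto
  define k where "k b = \<ominus>\<^sub>F (inv\<^bsub>F\<^esub> (a t) \<otimes>\<^sub>F a b)" for b
  have k: "k b \<in> El F" if "b \<in> S0" for b
   using a(1) that atU by (auto simp: k_def)
  have S: "finite ?S" "?S <= El F'" "?S \<subset> S0" using psubset t by auto
  have tk: "t = (\<Oplus>\<^sub>F' b\<in>?S. e (k b) \<otimes>\<^sub>F' b)"
  proof -
   have cl: "(%b. e (a b) \<otimes>\<^sub>F' b) \<in> ?S \<rightarrow> El F'" "e (a t) \<otimes>\<^sub>F' t \<in> El F'"
    using a(1) S(2) at tF by (auto simp: subset_iff Pi_iff)
   let ?s = "(\<Oplus>\<^sub>F' b\<in>?S. e (a b) \<otimes>\<^sub>F' b)"
   have s: "?s \<in> El F'" using cl(1) by (rule F'.finsum_closed)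
   have "S0 = insert t ?S" using t by auto
   hence "\<zero>\<^sub>F' = e (a t) \<otimes>\<^sub>F' t \<oplus>\<^sub>F' ?s"
    using a(2) F'.finsum_insert[OF S(1) _ cl] by simp
   hence eq: "e (a t) \<otimes>\<^sub>F' t = \<ominus>\<^sub>F' ?s"
    using cl(2) s by (metis F'.minus_equality)
   have ei: "e (inv\<^bsub>F\<^esub> (a t)) \<in> El F'" "e (inv\<^bsub>F\<^esub> (a t)) \<otimes>\<^sub>F' e (a t) = \<one>\<^sub>F'"
    using atU at by (simp_all flip: ring_hom_mult[OF e_hom] add: ring_hom_one[OF e_hom])
   have "t = e (inv\<^bsub>F\<^esub> (a t)) \<otimes>\<^sub>F' (e (a t) \<otimes>\<^sub>F' t)"
    using ei at tF by (simp flip: F'.m_assoc)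
   also have "... = \<ominus>\<^sub>F' (e (inv\<^bsub>F\<^esub> (a t))) \<otimes>\<^sub>F' ?s"
    unfolding eq using ei(1) s by (simp add: F'.l_minus F'.r_minus)
   also have "... = (\<Oplus>\<^sub>F' b\<in>?S. \<ominus>\<^sub>F' (e (inv\<^bsub>F\<^esub> (a t))) \<otimes>\<^sub>F' (e (a b) \<otimes>\<^sub>F' b))"
    using ei(1) cl(1) S(1) by (intro F'.finsum_rdistr) auto
   also have "... = (\<Oplus>\<^sub>F' b\<in>?S. e (k b) \<otimes>\<^sub>F' b)"
   proof (rule F'.finsum_cong')
    fix b assume b: "b \<in> ?S"
    hence [simp]: "b \<in> El F'" "a b \<in> El F" using S a by auto
    show "\<ominus>\<^sub>F' (e (inv\<^bsub>F\<^esub> (a t))) \<otimes>\<^sub>F' (e (a b) \<otimes>\<^sub>F' b) = e (k b) \<otimes>\<^sub>F' b"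
     using atU ei(1) by (simp add: k_def ring_hom_mult[OF e_hom] F'.l_minus F'.m_assoc
       additive_map_neg[OF F.is_abelian_group F'.is_abelian_group e_additive])
   qed (use k S in auto)
   finally show ?thesis .
  qed
  have red: "f (t, w) = (\<Oplus>\<^sub>G b\<in>?S. f (b, k b \<odot>\<^sub>V w))" if w: "w \<in> El V" for w
  proof -
   have am: "additive_map F' G (%b. f (b, w))"
    using w by (simp add: additive_map_def bal)
   have "f (t, w) = (\<Oplus>\<^sub>G b\<in>?S. f (e (k b) \<otimes>\<^sub>F' b, w))"
    by (subst tk, subst additive_map_finsum[OF F'.is_abelian_group assms(2) am]) (use k S in auto)
   also have "... = (\<Oplus>\<^sub>G b\<in>?S. f (b, k b \<odot>\<^sub>V w))"
    using k S w by (intro G.finsum_cong') (auto simp: bal subset_iff)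
   finally show ?thesis .
  qed
  obtain S1 where S1: "S1 <= ?S" "indep S1"
   "\<And>v. v \<in> ?S \<rightarrow> El V ==> \<exists>v'\<in>S1 \<rightarrow> El V.
      (\<Oplus>\<^sub>G b\<in>?S. f (b, v b)) = (\<Oplus>\<^sub>G b\<in>S1. f (b, v' b))"
   using psubset.IH[OF S(3,2)] by auto
  have "\<exists>v'\<in>S1 \<rightarrow> El V. (\<Oplus>\<^sub>G b\<in>S0. f (b, v b)) = (\<Oplus>\<^sub>G b\<in>S1. f (b, v' b))"
   if v: "v \<in> S0 \<rightarrow> El V" for v
  proof -
   let ?v = "%b. v b \<oplus>\<^sub>V k b \<odot>\<^sub>V v t"
   have vt: "v t \<in> El V" using v t by auto
   have vS: "v b \<in> El V" "k b \<in> El F" "b \<in> El F'" if "b \<in> ?S" for b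
    using v that k S(2) by auto
   have "(\<Oplus>\<^sub>G b\<in>S0. f (b, v b)) = (\<Oplus>\<^sub>G b\<in>insert t ?S. f (b, v b))"
    using t by (simp add: insert_absorb)
   also have "... = f (t, v t) \<oplus>\<^sub>G (\<Oplus>\<^sub>G b\<in>?S. f (b, v b))"
    using S vS vt tF by (intro G.finsum_insert) (auto simp: bal)
   also have "... = (\<Oplus>\<^sub>G b\<in>?S. f (b, v b)) \<oplus>\<^sub>G (\<Oplus>\<^sub>G b\<in>?S. f (b, k b \<odot>\<^sub>V v t))"
    using red[OF vt] vS vt tF by (subst G.a_comm) (auto simp: bal intro!: G.finsum_closed)
   also have "... = (\<Oplus>\<^sub>G b\<in>?S. f (b, v b) \<oplus>\<^sub>G f (b, k b \<odot>\<^sub>V v t))"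
    using vS vt by (intro G.finsum_addf[symmetric]) (auto simp: bal)
   also have "... = (\<Oplus>\<^sub>G b\<in>?S. f (b, ?v b))"
    using vS vt by (intro G.finsum_cong') (auto simp: bal)
   finally have eq: "(\<Oplus>\<^sub>G b\<in>S0. f (b, v b)) = (\<Oplus>\<^sub>G b\<in>?S. f (b, ?v b))" .
   have "?v \<in> ?S \<rightarrow> El V" using vS vt by auto
   from S1(3)[OF this] show ?thesis unfolding eq .
  qed
  thus ?thesis using S1(1,2) by blast
 qed
qed

lemma balanced_extend:
 assumes "module F V" "abelian_group G" "balanced F FF' V G f"
  and "finite S'" "S <= S'" "S' <= El F'" "v \<in> S \<rightarrow> El V"
 shows "(\<Oplus>\<^sub>G b\<in>S. f (b, v b)) = (\<Oplus>\<^sub>G b\<in>S'. f (b, if b \<in> S then v b else \<zero>\<^sub>V))"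
proof -
 interpret V: module F V by fact
 interpret G: abelian_group G by fact
 note bal = balancedD[OF assms(3)]
 have z: "f (b, \<zero>\<^sub>V) = \<zero>\<^sub>G" if "b \<in> El F'" for b
 proof -
  have "additive_map V G (%v. f (b, v))"
   unfolding additive_map_def using that by (auto simp: bal)
  thus ?thesis
   using additive_map_zero[OF module.axioms(2)[OF assms(1)] assms(2)] by auto
 qed
 show ?thesis
  using assms(4-7)
  by (intro G.add.finprod_mono_neutral_cong_left) (auto simp: z bal subset_iff Pi_iff)
qed

lemma balanced_add:
 assumes "module F V" "abelian_group G" "balanced F FF' V G f"
  and "S <= El F'" "v \<in> S \<rightarrow> El V" "w \<in> S \<rightarrow> El V"
 shows "(\<Oplus>\<^sub>G b\<in>S. f (b, v b \<oplus>\<^sub>V w b)) = (\<Oplus>\<^sub>G b\<in>S. f (b, v b)) \<oplus>\<^sub>G (\<Oplus>\<^sub>G b\<in>S. f (b, w b))"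
proof -
 interpret V: module F V by fact
 interpret G: abelian_group G by fact
 note bal = balancedD[OF assms(3)]
 have c: "b \<in> El F'" "v b \<in> El V" "w b \<in> El V" if "b \<in> S" for b
  using assms(4-6) that by auto
 have "(\<Oplus>\<^sub>G b\<in>S. f (b, v b \<oplus>\<^sub>V w b)) = (\<Oplus>\<^sub>G b\<in>S. f (b, v b) \<oplus>\<^sub>G f (b, w b))"
  using c by (intro G.finsum_cong') (auto simp: bal)
 thus ?thesis using c by (simp add: G.finsum_addf bal Pi_iff)
qed

lemma balanced_combination_add:
 assumes "module F V" "abelian_group G" "balanced F FF' V G f"
  and "finite S1" "S1 <= El F'" "v1 \<in> S1 \<rightarrow> El V" "finite S2" "S2 <= El F'" "v2 \<in> S2 \<rightarrow> El V"
 shows "\<exists>v\<in>S1 \<union> S2 \<rightarrow> El V.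
  (\<Oplus>\<^sub>G b\<in>S1. f (b, v1 b)) \<oplus>\<^sub>G (\<Oplus>\<^sub>G b\<in>S2. f (b, v2 b)) = (\<Oplus>\<^sub>G b\<in>S1 \<union> S2. f (b, v b))"
proof -
 interpret V: module F V by fact
 define w1 where "w1 b = (if b \<in> S1 then v1 b else \<zero>\<^sub>V)" for b
 define w2 where "w2 b = (if b \<in> S2 then v2 b else \<zero>\<^sub>V)" for b
 have w: "w1 \<in> S1 \<union> S2 \<rightarrow> El V" "w2 \<in> S1 \<union> S2 \<rightarrow> El V"
  using assms(6,9) by (auto simp: w1_def w2_def)
 have "(\<Oplus>\<^sub>G b\<in>S1. f (b, v1 b)) = (\<Oplus>\<^sub>G b\<in>S1 \<union> S2. f (b, w1 b))"
  "(\<Oplus>\<^sub>G b\<in>S2. f (b, v2 b)) = (\<Oplus>\<^sub>G b\<in>S1 \<union> S2. f (b, w2 b))"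
  unfolding w1_def w2_def
  by (rule balanced_extend[OF assms(1-3)]; use assms(4-9) in auto)+
 thus ?thesis
  using balanced_add[OF assms(1-3) _ w] w assms(5,8)
  by (intro bexI[of _ "%b. w1 b \<oplus>\<^sub>V w2 b"]) auto
qed

text \<open>The form in which elements of a tensor product over a field are compared: independent left factors
make the right factors unique in every target where independence persists.\<close>
lemma tensor_combination:
 assumes V: "module F V" and U: "U \<in> El (tensor_group F FF' V)"
 obtains S v where "indep S" "v \<in> S \<rightarrow> El V"
  "U = (\<Oplus>\<^bsub>tensor_group F FF' V\<^esub>b\<in>S. tensor_pure F FF' V b (v b))"
proof -
 interpret tensor F FF' V
  by (intro tensor.intro F.cring_axioms module_FF' V)
 let ?c = "%S v. \<Oplus>\<^sub>T b\<in>S. pure b (v b)"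
 have "\<exists>S v. finite S \<and> S <= El F' \<and> v \<in> S \<rightarrow> El V \<and> U = ?c S v"
  using U
 proof (induction rule: T_induct)
  case (pure x y)
  thus ?case by (intro exI[of _ "{x}"] exI[of _ "%_. y"]) simp
 next
  case (add U1 U2)
  then obtain S1 v1 S2 v2 where h: "finite S1" "S1 <= El F'" "v1 \<in> S1 \<rightarrow> El V" "U1 = ?c S1 v1"
   "finite S2" "S2 <= El F'" "v2 \<in> S2 \<rightarrow> El V" "U2 = ?c S2 v2" by blast
  from balanced_combination_add[OF V T_abelian_group pure_balanced h(1-3,5-7)]
  obtain w where "w \<in> S1 \<union> S2 \<rightarrow> El V" "U1 \<oplus>\<^sub>T U2 = ?c (S1 \<union> S2) w"
   unfolding h(4,8) by auto
  thus ?case using h(1,2,5,6) by (intro exI[of _ "S1 \<union> S2"] exI[of _ w]) auto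
 qed
 then obtain S0 v where S0: "finite S0" "S0 <= El F'" "v \<in> S0 \<rightarrow> El V" "U = ?c S0 v" by blast
 from balanced_reduce[OF V T_abelian_group pure_balanced S0(1,2)] S0(3)
 obtain S v' where "indep S" "v' \<in> S \<rightarrow> El V" "?c S0 v = ?c S v'" by auto
 thus ?thesis using that S0(4) by auto
qed

end

section \<open>Descent along an extension of the field of invariants\<close>

locale descent = field_hom F e F' + R: simple_bold_ring R + R': bold_ring R'
 for F :: "('f, 'x2) ring_scheme" and e :: "'f => 'g" and F' :: "('g, 'x3) ring_scheme"
  and R :: "('r, 'y1) bold_ring_scheme" and R' :: "('s, 'y2) bold_ring_scheme" +
 fixes c :: "'f => 'r" and \<phi> :: "'r => 's" and c' :: "'g => 's"
 assumes c_hom: "c \<in> ring_hom F R" and \<phi>_hom: "\<phi> \<in> ring_hom R R'" and c'_hom: "c' \<in> ring_hom F' R'"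
  and \<phi>_sigma: "r \<in> El R ==> \<phi> (endo R r) = endo R' (\<phi> r)"
  and \<phi>_c: "a \<in> El F ==> \<phi> (c a) = c' (e a)"
  and c_invariant: "a \<in> El F ==> endo R (c a) = c a"
  and c'_invariant: "b \<in> El F' ==> endo R' (c' b) = c' b"
  and invariants: "r \<in> El R ==> endo R r = r ==> \<exists>a\<in>El F. r = c a"
  and nontrivial: "\<one>\<^sub>R' ~= \<zero>\<^sub>R'"
begin

lemma c_closed [simp]: "a \<in> El F ==> c a \<in> El R"
 and \<phi>_closed [simp]: "r \<in> El R ==> \<phi> r \<in> El R'"
 and c'_closed [simp]: "b \<in> El F' ==> c' b \<in> El R'"
 using c_hom \<phi>_hom c'_hom by (auto simp: ring_hom_closed)

lemma \<phi>_additive: "additive_map R R' \<phi>" and c'_additive: "additive_map F' R' c'"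
 using \<phi>_hom c'_hom by (simp_all add: additive_map_def ring_hom_add)

lemma c'_inj: assumes "b \<in> El F'" "c' b = \<zero>\<^sub>R'" shows "b = \<zero>\<^sub>F'"
proof (rule ccontr)
 assume "b ~= \<zero>\<^sub>F'"
 hence "b \<in> Units F'" using assms(1) F'.field_Units by auto
 hence "c' b \<otimes>\<^sub>R' c' (inv\<^bsub>F'\<^esub> b) = \<one>\<^sub>R'"
  using assms(1) by (simp flip: ring_hom_mult[OF c'_hom] add: ring_hom_one[OF c'_hom])
 thus False using assms \<open>b \<in> Units F'\<close> nontrivial by simp
qed

lemma module_R: "module F (restrict_scalars c R)"
 by (rule restrict_scalars_module[OF F.cring_axioms R.cring_axioms c_hom])

abbreviation "comb S r \<equiv> \<Oplus>\<^sub>R' b\<in>S. c' b \<otimes>\<^sub>R' \<phi> (r b)"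

lemma balanced_R: "balanced F FF' (restrict_scalars c R) R' (%(b, r). c' b \<otimes>\<^sub>R' \<phi> r)"
 by (simp add: balanced_def ring_hom_add[OF \<phi>_hom] ring_hom_add[OF c'_hom] ring_hom_mult[OF \<phi>_hom]
   ring_hom_mult[OF c'_hom] \<phi>_c R'.l_distr R'.r_distr R'.m_ac)

lemma comb_closed: "S <= El F' ==> r \<in> S \<rightarrow> El R ==> comb S r \<in> El R'"
 by (rule R'.finsum_closed) (auto simp: subset_iff Pi_iff)

lemma comb_add:
 assumes "S <= El F'" "r \<in> S \<rightarrow> El R" "s \<in> S \<rightarrow> El R"
 shows "comb S (%b. r b \<oplus>\<^sub>R s b) = comb S r \<oplus>\<^sub>R' comb S s"
 using balanced_add[OF module_R R'.is_abelian_group balanced_R] assms by simp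

lemma comb_mult:
 assumes "S <= El F'" "finite S" "r \<in> S \<rightarrow> El R" "x \<in> El R"
 shows "comb S (%b. x \<otimes>\<^sub>R r b) = \<phi> x \<otimes>\<^sub>R' comb S r"
proof -
 have "\<phi> x \<otimes>\<^sub>R' comb S r = (\<Oplus>\<^sub>R' b\<in>S. \<phi> x \<otimes>\<^sub>R' (c' b \<otimes>\<^sub>R' \<phi> (r b)))"
  using assms by (intro R'.finsum_rdistr) (auto simp: subset_iff Pi_iff)
 also have "... = comb S (%b. x \<otimes>\<^sub>R r b)"
  using assms by (intro R'.finsum_cong') (auto simp: ring_hom_mult[OF \<phi>_hom] subset_iff Pi_iff R'.m_lcomm)
 finally show ?thesis by simp
qed

lemma comb_sigma:
 assumes "S <= El F'" "r \<in> S \<rightarrow> El R"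
 shows "comb S (%b. endo R (r b)) = endo R' (comb S r)"
proof -
 have "endo R' (comb S r) = (\<Oplus>\<^sub>R' b\<in>S. endo R' (c' b \<otimes>\<^sub>R' \<phi> (r b)))"
  using assms by (intro additive_map_finsum[OF R'.is_abelian_group R'.is_abelian_group R'.sigma_additive])
   (auto simp: subset_iff Pi_iff)
 also have "... = comb S (%b. endo R (r b))"
  using assms by (intro R'.finsum_cong') (auto simp: R'.sigma_mult c'_invariant \<phi>_sigma subset_iff Pi_iff)
 finally show ?thesis by simp
qed

lemma comb_invariant:
 assumes "S <= El F'" "r \<in> S \<rightarrow> El R" "\<And>b. b \<in> S ==> endo R (r b) = r b"
 obtains a where "a \<in> S \<rightarrow> El F" "\<And>b. b \<in> S ==> r b = c (a b)"
  "comb S r = c' (\<Oplus>\<^sub>F' b\<in>S. e (a b) \<otimes>\<^sub>F' b)"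
proof -
 have "\<forall>b\<in>S. \<exists>a. a \<in> El F \<and> r b = c a"
  using assms(2,3) invariants by (metis PiE)
 hence "\<exists>a. \<forall>b\<in>S. a b \<in> El F \<and> r b = c (a b)" by (rule bchoice)
 then obtain a where a: "\<And>b. b \<in> S ==> a b \<in> El F" "\<And>b. b \<in> S ==> r b = c (a b)" by auto
 have "c' (\<Oplus>\<^sub>F' b\<in>S. e (a b) \<otimes>\<^sub>F' b) = (\<Oplus>\<^sub>R' b\<in>S. c' (e (a b) \<otimes>\<^sub>F' b))"
  using a(1) assms(1)
  by (intro additive_map_finsum[OF F'.is_abelian_group R'.is_abelian_group c'_additive]) auto
 also have "... = comb S r"
  using a assms(1) by (intro R'.finsum_cong') (auto simp: ring_hom_mult[OF c'_hom] \<phi>_c R'.m_comm subset_iff)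
 finally show ?thesis using that[of a] a by auto
qed

text \<open>The relations among the elements of \<open>S\<close> with coefficients in \<open>R\<close> are stable under multiples and \<open>\<sigma>\<close>. If
there were a nonzero one there would be one with invariant coefficients, a relation over \<open>F\<close>.\<close>
lemma linearly_disjoint:
 assumes S: "indep S" and r: "r \<in> S \<rightarrow> El R" and zero: "comb S r = \<zero>\<^sub>R'" and b: "b \<in> S"
 shows "r b = \<zero>\<^sub>R"
proof (rule ccontr)
 assume nz: "r b ~= \<zero>\<^sub>R"
 let ?U = "{r \<in> S \<rightarrow> El R. comb S r = \<zero>\<^sub>R'}"
 note S' = indepD(1,2)[OF S]
 obtain u i where u: "u \<in> ?U" "i \<in> S" "u i ~= \<zero>\<^sub>R" "\<And>j. j \<in> S ==> endo R (u j) = u j"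
 proof (rule R.invariant_vector[where S = S and U = ?U and ?u0.0 = r and ?i0.0 = b, OF S'(1) _ b nz])
  show "r \<in> ?U" using r zero by simp
  show "(%i. u i \<oplus>\<^sub>R v i) \<in> ?U" if "u \<in> ?U" "v \<in> ?U" for u v
   using that comb_add[OF S'(2)] by auto
  show "(%i. x \<otimes>\<^sub>R u i) \<in> ?U" if "x \<in> El R" "u \<in> ?U" for x u
   using that comb_mult[OF S'(2,1)] by auto
  show "(%i. endo R (u i)) \<in> ?U" if "u \<in> ?U" for u
   using that comb_sigma[OF S'(2)] by (auto simp: Pi_iff)
 qed auto
 obtain a where a: "a \<in> S \<rightarrow> El F" "\<And>b. b \<in> S ==> u b = c (a b)"
  "comb S u = c' (\<Oplus>\<^sub>F' b\<in>S. e (a b) \<otimes>\<^sub>F' b)"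
  using comb_invariant[OF S'(2), of u] u by auto
 have "(\<Oplus>\<^sub>F' b\<in>S. e (a b) \<otimes>\<^sub>F' b) = \<zero>\<^sub>F'"
  using a(1,3) u(1) S'(2) by (intro c'_inj F'.finsum_closed) (auto simp: Pi_iff subset_iff)
 hence "a i = \<zero>\<^sub>F" using indepD(3)[OF S a(1)] u(2) by blast
 moreover have "c \<zero>\<^sub>F = \<zero>\<^sub>R"
  using ring_hom_zero[OF c_hom F.ring_axioms R.ring_axioms] .
 ultimately show False using u(2,3) a(2) by simp
qed

definition span :: "'s set" where
 "span = {comb S r | S r. finite S \<and> S <= El F' \<and> r \<in> S \<rightarrow> El R}"

lemma span_indep: assumes "x \<in> span"
 obtains S r where "indep S" "r \<in> S \<rightarrow> El R" "x = comb S r"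
proof -
 obtain S0 r where S0: "finite S0" "S0 <= El F'" "r \<in> S0 \<rightarrow> El R" "x = comb S0 r"
  using assms by (auto simp: span_def)
 from balanced_reduce[OF module_R R'.is_abelian_group balanced_R S0(1,2)] S0(3)
 obtain S r' where "indep S" "r' \<in> S \<rightarrow> El R" "comb S0 r = comb S r'" by auto
 thus ?thesis using that S0(4) by auto
qed

lemma span_carrier: "span <= El R'"
 by (auto simp: span_def intro!: comb_closed[unfolded Pi_iff])

lemma span_pure: "b \<in> El F' ==> r \<in> El R ==> c' b \<otimes>\<^sub>R' \<phi> r \<in> span"
 unfolding span_def by (intro CollectI exI[of _ "{b}"] exI[of _ "%_. r"]) simp

lemma span_add: assumes "x \<in> span" "y \<in> span" shows "x \<oplus>\<^sub>R' y \<in> span"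
proof -
 obtain S1 r1 where 1: "finite S1" "S1 <= El F'" "r1 \<in> S1 \<rightarrow> El R" "x = comb S1 r1"
  using assms(1) by (auto simp: span_def)
 obtain S2 r2 where 2: "finite S2" "S2 <= El F'" "r2 \<in> S2 \<rightarrow> El R" "y = comb S2 r2"
  using assms(2) by (auto simp: span_def)
 from balanced_combination_add[OF module_R R'.is_abelian_group balanced_R 1(1,2) _ 2(1,2), of r1 r2] 1(3) 2(3)
 obtain r where "r \<in> S1 \<union> S2 \<rightarrow> El R" "x \<oplus>\<^sub>R' y = comb (S1 \<union> S2) r"
  unfolding 1(4) 2(4) prod.case restrict_scalars_simps by blast
 thus ?thesis
  unfolding span_def using 1(1,2) 2(1,2) by (intro CollectI exI[of _ "S1 \<union> S2"] exI[of _ r]) auto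
qed

lemma span_induct [consumes 1, case_names pure add]:
 assumes "x \<in> span"
  and pure: "\<And>b r. b \<in> El F' ==> r \<in> El R ==> P (c' b \<otimes>\<^sub>R' \<phi> r)"
  and add: "\<And>x y. x \<in> span ==> y \<in> span ==> P x ==> P y ==> P (x \<oplus>\<^sub>R' y)"
 shows "P x"
proof -
 have P0: "P \<zero>\<^sub>R'"
  using pure[of "\<zero>\<^sub>F'" "\<zero>\<^sub>R"] ring_hom_zero[OF c'_hom F'.ring_axioms R'.ring_axioms] by simp
 obtain S r where S: "finite S" "S <= El F'" "r \<in> S \<rightarrow> El R" "x = comb S r"
  using assms(1) by (auto simp: span_def)
 have "P (comb S r)"
  using S(1-3)
 proof (induction S)
  case (insert b S)
  have "comb (insert b S) r = c' b \<otimes>\<^sub>R' \<phi> (r b) \<oplus>\<^sub>R' comb S r"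
   using insert by (intro R'.finsum_insert) (auto simp: subset_iff Pi_iff)
  moreover have "comb S r \<in> span" using insert by (auto simp: span_def)
  ultimately show ?case using insert by (auto intro!: add pure span_pure)
 qed (use P0 in simp)
 thus ?thesis using S(4) by simp
qed

lemma span_mult: assumes "x \<in> span" "y \<in> span" shows "x \<otimes>\<^sub>R' y \<in> span"
 using assms(1)
proof (induction rule: span_induct)
 case p: (pure b r)
 show ?case using assms(2)
 proof (induction rule: span_induct)
  case (pure b' r')
  have "c' b \<otimes>\<^sub>R' \<phi> r \<otimes>\<^sub>R' (c' b' \<otimes>\<^sub>R' \<phi> r') = c' (b \<otimes>\<^sub>F' b') \<otimes>\<^sub>R' \<phi> (r \<otimes>\<^sub>R r')"
   using p pure by (simp add: ring_hom_mult[OF \<phi>_hom] ring_hom_mult[OF c'_hom] R'.m_ac)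
  thus ?case using span_pure p pure by simp
 next
  case (add x y)
  thus ?case using p span_carrier by (subst R'.r_distr) (auto intro: span_add)
 qed
next
 case (add x1 x2)
 thus ?case using assms(2) span_carrier by (subst R'.l_distr) (auto intro: span_add)
qed

lemma span_sigma: assumes "x \<in> span" shows "endo R' x \<in> span"
proof -
 obtain S r where S: "finite S" "S <= El F'" "r \<in> S \<rightarrow> El R" "x = comb S r"
  using assms by (auto simp: span_def)
 have "(%b. endo R (r b)) \<in> S \<rightarrow> El R" using S(3) by (auto simp: Pi_iff)
 thus ?thesis
  unfolding S(4) comb_sigma[OF S(2,3), symmetric] span_def using S(1,2) by (intro CollectI exI[of _ S] exI[of _ "%b. endo R (r b)"]) auto
qed

text \<open>The coefficient families of the elements of \<open>I\<close> in the span are stable, so that \<open>I\<close> contains a nonzero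
element with invariant coefficients. This is a nonzero element of the field \<open>F'\<close>, hence a unit.\<close>
lemma stable_subgroup_one:
 assumes I: "I <= El R'" "\<And>x y. x \<in> I ==> y \<in> I ==> x \<oplus>\<^sub>R' y \<in> I"
  and \<phi>: "\<And>r x. r \<in> El R ==> x \<in> I ==> \<phi> r \<otimes>\<^sub>R' x \<in> I"
  and c': "\<And>b x. b \<in> El F' ==> x \<in> I ==> c' b \<otimes>\<^sub>R' x \<in> I"
  and sig: "\<And>x. x \<in> I ==> endo R' x \<in> I"
  and d: "d \<in> I" "d \<in> span" "d ~= \<zero>\<^sub>R'"
 shows "\<one>\<^sub>R' \<in> I"
proof -
 obtain S r where S: "indep S" "r \<in> S \<rightarrow> El R" "d = comb S r"
  using span_indep[OF d(2)] .
 note S' = indepD(1,2)[OF S(1)]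
 have "\<exists>b\<in>S. r b ~= \<zero>\<^sub>R"
 proof (rule ccontr)
  assume "\<not> (\<exists>b\<in>S. r b ~= \<zero>\<^sub>R)"
  hence "comb S r = \<zero>\<^sub>R'"
   using S'(2) ring_hom_zero[OF \<phi>_hom R.ring_axioms R'.ring_axioms]
   by (intro R'.add.finprod_one_eqI) auto
  thus False using S(3) d(3) by simp
 qed
 then obtain b where b: "b \<in> S" "r b ~= \<zero>\<^sub>R" by auto
 let ?U = "{r \<in> S \<rightarrow> El R. comb S r \<in> I}"
 obtain u i where u: "u \<in> ?U" "i \<in> S" "u i ~= \<zero>\<^sub>R" "\<And>j. j \<in> S ==> endo R (u j) = u j"
 proof (rule R.invariant_vector[where S = S and U = ?U and ?u0.0 = r and ?i0.0 = b, OF S'(1) _ b])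
  show "r \<in> ?U" using S d by simp
  show "(%i. u i \<oplus>\<^sub>R v i) \<in> ?U" if "u \<in> ?U" "v \<in> ?U" for u v
   using that comb_add[OF S'(2)] I(2) by auto
  show "(%i. x \<otimes>\<^sub>R u i) \<in> ?U" if "x \<in> El R" "u \<in> ?U" for x u
   using that comb_mult[OF S'(2,1)] \<phi> by auto
  show "(%i. endo R (u i)) \<in> ?U" if "u \<in> ?U" for u
   using that comb_sigma[OF S'(2)] sig by (auto simp: Pi_iff)
 qed auto
 obtain a where a: "a \<in> S \<rightarrow> El F" "\<And>b. b \<in> S ==> u b = c (a b)"
  "comb S u = c' (\<Oplus>\<^sub>F' b\<in>S. e (a b) \<otimes>\<^sub>F' b)"
  using comb_invariant[OF S'(2), of u] u by auto
 let ?b = "\<Oplus>\<^sub>F' b\<in>S. e (a b) \<otimes>\<^sub>F' b"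
 have bF: "?b \<in> El F'" using a(1) S'(2) by (intro F'.finsum_closed) (auto simp: Pi_iff subset_iff)
 have "?b ~= \<zero>\<^sub>F'"
  using indepD(3)[OF S(1) a(1) _ u(2)] a(2)[OF u(2)] u(3) ring_hom_zero[OF c_hom F.ring_axioms R.ring_axioms]
  by auto
 hence bU: "?b \<in> Units F'" using bF F'.field_Units by auto
 have "c' (inv\<^bsub>F'\<^esub> ?b) \<otimes>\<^sub>R' c' ?b \<in> I" using u(1) a(3) bU by (intro c') auto
 moreover have "c' (inv\<^bsub>F'\<^esub> ?b) \<otimes>\<^sub>R' c' ?b = \<one>\<^sub>R'"
  using bU bF by (simp flip: ring_hom_mult[OF c'_hom] add: ring_hom_one[OF c'_hom])
 ultimately show ?thesis by simp
qed

lemma span_invariant: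
 assumes "x \<in> span" "endo R' x = x" shows "\<exists>b\<in>El F'. x = c' b"
proof -
 obtain S r where S: "indep S" "r \<in> S \<rightarrow> El R" "x = comb S r"
  using span_indep[OF assms(1)] .
 note S' = indepD(1,2)[OF S(1)]
 have m: "(%b. (\<ominus>\<^sub>R \<one>\<^sub>R) \<otimes>\<^sub>R r b) \<in> S \<rightarrow> El R" "(%b. endo R (r b)) \<in> S \<rightarrow> El R"
  using S(2) by (auto simp: Pi_iff)
 have xc: "x \<in> El R'" using assms(1) span_carrier by auto
 have "comb S (%b. endo R (r b) \<oplus>\<^sub>R (\<ominus>\<^sub>R \<one>\<^sub>R) \<otimes>\<^sub>R r b) = endo R' x \<oplus>\<^sub>R' \<phi> (\<ominus>\<^sub>R \<one>\<^sub>R) \<otimes>\<^sub>R' x"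
  unfolding comb_add[OF S'(2) m(2,1)] comb_mult[OF S'(2,1) S(2) R.a_inv_closed[OF R.one_closed]]
   comb_sigma[OF S'(2) S(2)] S(3) ..
 also have "... = \<zero>\<^sub>R'"
  using xc assms(2) ring_hom_one[OF \<phi>_hom]
   additive_map_neg[OF R.is_abelian_group R'.is_abelian_group \<phi>_additive R.one_closed]
  by (simp add: R'.l_minus R'.r_neg)
 finally have z0: "comb S (%b. endo R (r b) \<oplus>\<^sub>R (\<ominus>\<^sub>R \<one>\<^sub>R) \<otimes>\<^sub>R r b) = \<zero>\<^sub>R'" .
 have z: "endo R (r b) \<oplus>\<^sub>R (\<ominus>\<^sub>R \<one>\<^sub>R) \<otimes>\<^sub>R r b = \<zero>\<^sub>R" if "b \<in> S" for b
  by (rule linearly_disjoint[OF S(1) _ _ that, of "%b. endo R (r b) \<oplus>\<^sub>R (\<ominus>\<^sub>R \<one>\<^sub>R) \<otimes>\<^sub>R r b"])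
    (use m S(2) z0 in auto)
 have inv: "endo R (r b) = r b" if "b \<in> S" for b
 proof -
  have rb: "r b \<in> El R" using S(2) that by auto
  hence "endo R (r b) \<ominus>\<^sub>R r b = \<zero>\<^sub>R" using z[OF that] by (simp add: R.l_minus R.minus_eq)
  thus ?thesis using rb by simp
 qed
 obtain a where a: "a \<in> S \<rightarrow> El F" "comb S r = c' (\<Oplus>\<^sub>F' b\<in>S. e (a b) \<otimes>\<^sub>F' b)"
  by (rule comb_invariant[OF S'(2) S(2) inv])
 have "(\<Oplus>\<^sub>F' b\<in>S. e (a b) \<otimes>\<^sub>F' b) \<in> El F'"
  using a(1) S'(2) by (intro F'.finsum_closed) (auto simp: Pi_iff subset_iff)
 thus ?thesis using a(2) S(3) by auto
qed

lemma c'_span: "b \<in> El F' ==> c' b \<in> span"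
 using span_pure[of b "\<one>\<^sub>R"] by (simp add: ring_hom_one[OF \<phi>_hom])

lemma \<phi>_span: "r \<in> El R ==> \<phi> r \<in> span"
 using span_pure[of "\<one>\<^sub>F'" r] by (simp add: ring_hom_one[OF c'_hom])

end

text \<open>Here every element of \<open>R'\<close> is a fraction with numerator and denominator in the span.\<close>

locale fraction_descent = descent +
 assumes fractions: "x \<in> El R' ==> \<exists>d\<in>span. d \<in> Units R' \<and> d \<otimes>\<^sub>R' x \<in> span"
begin

lemma unit_not_zero: "d \<in> Units R' ==> d ~= \<zero>\<^sub>R'"
 using nontrivial R'.Units_r_inv[of d] R'.l_null[of "inv\<^bsub>R'\<^esub> d"] R'.Units_inv_closed[of d] by metis

lemma simple_R': "simple_bold_ring R'"
proof unfold_locales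
 fix I assume I: "ideal I R'" "endo R' ` I <= I"
 interpret I: ideal I R' by (rule I(1))
 show "I = {\<zero>\<^sub>R'} \<or> I = El R'"
 proof (rule disjCI)
  assume "I ~= El R'"
  hence one: "\<one>\<^sub>R' \<notin> I" using I.one_imp_carrier by blast
  have "x = \<zero>\<^sub>R'" if x: "x \<in> I" for x
  proof (rule ccontr)
   assume nz: "x ~= \<zero>\<^sub>R'"
   have xc: "x \<in> El R'" using x I.a_subset by auto
   obtain d where d: "d \<in> span" "d \<in> Units R'" "d \<otimes>\<^sub>R' x \<in> span" using fractions[OF xc] by auto
   have dx: "d \<otimes>\<^sub>R' x \<in> I" using x d(2) by (intro I.I_l_closed) auto
   have "d \<otimes>\<^sub>R' x ~= \<zero>\<^sub>R'"
   proof
    assume "d \<otimes>\<^sub>R' x = \<zero>\<^sub>R'"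
    hence "inv\<^bsub>R'\<^esub> d \<otimes>\<^sub>R' (d \<otimes>\<^sub>R' x) = \<zero>\<^sub>R'" using d(2) by simp
    moreover have "inv\<^bsub>R'\<^esub> d \<otimes>\<^sub>R' (d \<otimes>\<^sub>R' x) = x"
     using d(2) xc R'.m_assoc[of "inv\<^bsub>R'\<^esub> d" d x] R'.Units_l_inv[OF d(2)] R'.Units_inv_closed[OF d(2)]
      R'.Units_closed[OF d(2)] by simp
    ultimately show False using nz by simp
   qed
   hence "\<one>\<^sub>R' \<in> I"
    by (intro stable_subgroup_one[of I, OF _ _ _ _ _ dx d(3)])
      (use I I.a_subset in \<open>auto intro: I.I_l_closed\<close>)
   thus False using one by simp
  qed
  thus "I = {\<zero>\<^sub>R'}" using I.zero_closed by blast
 qed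
qed (rule nontrivial)


lemma invariants_R':
 assumes "x \<in> El R'" "endo R' x = x" shows "\<exists>b\<in>El F'. x = c' b"
proof -
 define I where "I = {d \<in> span. d \<otimes>\<^sub>R' x \<in> span}"
 obtain d where d: "d \<in> span" "d \<in> Units R'" "d \<otimes>\<^sub>R' x \<in> span" using fractions[OF assms(1)] by auto
 have "\<one>\<^sub>R' \<in> I"
 proof (rule stable_subgroup_one)
  show "d \<in> I" "d \<in> span" "d ~= \<zero>\<^sub>R'" using d unit_not_zero by (auto simp: I_def)
  show "I <= El R'" using span_carrier by (auto simp: I_def)
  show "a \<oplus>\<^sub>R' b \<in> I" if "a \<in> I" "b \<in> I" for a b
   using that assms span_carrier by (auto simp: I_def R'.l_distr span_add subset_iff)
  show "endo R' a \<in> I" if "a \<in> I" for a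
  proof -
   have "endo R' (a \<otimes>\<^sub>R' x) = endo R' a \<otimes>\<^sub>R' x"
    using that assms span_carrier by (auto simp: I_def R'.sigma_mult subset_iff)
   thus ?thesis using that span_sigma[of "a \<otimes>\<^sub>R' x"] span_sigma[of a] by (auto simp: I_def)
  qed
  have m: "y \<otimes>\<^sub>R' a \<in> I" if "a \<in> I" "y \<in> span" for a y
  proof -
   have "y \<otimes>\<^sub>R' a \<otimes>\<^sub>R' x = y \<otimes>\<^sub>R' (a \<otimes>\<^sub>R' x)"
    using that assms span_carrier by (auto simp: I_def R'.m_assoc subset_iff)
   thus ?thesis using that by (auto simp: I_def span_mult)
  qed
  show "\<phi> r \<otimes>\<^sub>R' a \<in> I" if "r \<in> El R" "a \<in> I" for r a using that m \<phi>_span by blast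
  show "c' b \<otimes>\<^sub>R' a \<in> I" if "b \<in> El F'" "a \<in> I" for b a using that m c'_span by blast
 qed
 hence "x \<in> span" using assms by (simp add: I_def)
 thus ?thesis using span_invariant assms(2) by blast
qed

end

section \<open>Frames and rank\<close>

lemma (in cring) finsum_delta:
 assumes "finite A" "i \<in> A" "g i \<in> El R"
 shows "(\<Oplus>p\<in>A. if p = i then g p else \<zero>) = g i"
 using assms
 by (subst add.finprod_mono_neutral_cong_right[of A "{i}" _ g]) auto

lemma (in cring) neg_cancel:
 assumes "a \<in> El R" "b \<in> El R"
 shows "a \<otimes> b \<oplus> (\<ominus> b) \<otimes> a = \<zero>" "a \<otimes> b \<oplus> (\<ominus> a) \<otimes> b = \<zero>"
 using assms by (simp_all add: l_minus r_neg m_comm[of b a])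

lemma (in cring) add_eq_diff:
 assumes "a \<in> El R" "b \<in> El R" "a \<oplus> b = c" shows "b = c \<ominus> a"
proof -
 have "c \<ominus> a = b \<oplus> a \<oplus> \<ominus> a" using assms by (simp add: minus_eq a_comm)
 also have "... = b" using assms(1,2) by (simp add: a_assoc r_neg)
 finally show ?thesis by simp
qed

context simple_bold_ring
begin

text \<open>A matrix \<open>f \<cdot> 1\<close> of size larger than \<open>card A\<close> that factors through \<open>R\<^sup>A\<close> vanishes. Without division, an element of \<open>A\<close> is
eliminated by cross-multiplication, which introduces further factors; reducedness removes them.\<close>
lemma matrix_bound:
 assumes "finite A" "finite I" "card A < card I"
  and "\<And>p a. p \<in> I ==> a \<in> A ==> \<alpha> p a \<in> El R" "\<And>a q. q \<in> I ==> a \<in> A ==> \<beta> a q \<in> El R"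
  and "f \<in> El R"
  and "\<And>p q. p \<in> I ==> q \<in> I ==> (\<Oplus>a\<in>A. \<alpha> p a \<otimes> \<beta> a q) = (if p = q then f else \<zero>)"
 shows "f = \<zero>"
 using assms
proof (induction A arbitrary: I \<alpha> f rule: finite_induct)
 case empty
 then obtain p where "p \<in> I" by (metis card.empty all_not_in_conv less_irrefl)
 thus ?case using empty.prems(6)[of p p] by simp
next
 case (insert t A)
 note al = insert.prems(3) and be = insert.prems(4) and f = insert.prems(5) and eq = insert.prems(6)
 have cards: "card A < card I" "\<And>p. p \<in> I ==> card A < card (I - {p})"
  using insert.prems(1,2) insert.hyps by auto
 have split: "(\<Oplus>a\<in>insert t A. \<alpha>' a \<otimes> \<beta> a q) = \<alpha>' t \<otimes> \<beta> t q \<oplus> (\<Oplus>a\<in>A. \<alpha>' a \<otimes> \<beta> a q)"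
  if "q \<in> I" "\<And>a. a \<in> insert t A ==> \<alpha>' a \<in> El R" for \<alpha>' q
  using insert.hyps that be by (intro finsum_insert) auto
 have lin: "(\<Oplus>a\<in>A. (u \<otimes> \<alpha>' a \<oplus> v \<otimes> \<alpha>'' a) \<otimes> \<beta> a q) =
   u \<otimes> (\<Oplus>a\<in>A. \<alpha>' a \<otimes> \<beta> a q) \<oplus> v \<otimes> (\<Oplus>a\<in>A. \<alpha>'' a \<otimes> \<beta> a q)"
  if "q \<in> I" "u \<in> El R" "v \<in> El R" "\<And>a. a \<in> A ==> \<alpha>' a \<in> El R" "\<And>a. a \<in> A ==> \<alpha>'' a \<in> El R"
  for \<alpha>' \<alpha>'' u v q
 proof -
  have "(\<Oplus>a\<in>A. (u \<otimes> \<alpha>' a \<oplus> v \<otimes> \<alpha>'' a) \<otimes> \<beta> a q)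
    = (\<Oplus>a\<in>A. u \<otimes> (\<alpha>' a \<otimes> \<beta> a q) \<oplus> v \<otimes> (\<alpha>'' a \<otimes> \<beta> a q))"
   using that be by (intro finsum_cong') (auto simp: l_distr m_assoc)
  also have "... = (\<Oplus>a\<in>A. u \<otimes> (\<alpha>' a \<otimes> \<beta> a q)) \<oplus> (\<Oplus>a\<in>A. v \<otimes> (\<alpha>'' a \<otimes> \<beta> a q))"
   using that be by (intro finsum_addf) auto
  also have "... = u \<otimes> (\<Oplus>a\<in>A. \<alpha>' a \<otimes> \<beta> a q) \<oplus> v \<otimes> (\<Oplus>a\<in>A. \<alpha>'' a \<otimes> \<beta> a q)"
   using that be insert.hyps(1) by (simp add: finsum_rdistr Pi_iff)
  finally show ?thesis .
 qed
 have ft: "f \<otimes> \<alpha> p0 t = \<zero>" if p0: "p0 \<in> I" for p0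
 proof -
  let ?u = "\<alpha> p0 t"
  have u: "?u \<in> El R" using al p0 by auto
  have "?u \<otimes> f = \<zero>"
  proof (rule insert.IH[of "I - {p0}" "%p a. ?u \<otimes> \<alpha> p a \<oplus> (\<ominus> \<alpha> p t) \<otimes> \<alpha> p0 a"])
   fix p q assume p: "p \<in> I - {p0}" and q: "q \<in> I - {p0}"
   have pt: "\<alpha> p t \<in> El R" using al p by auto
   have s: "(\<Oplus>a\<in>A. \<alpha> p' a \<otimes> \<beta> a q) = (if p' = q then f else \<zero>) \<ominus> \<alpha> p' t \<otimes> \<beta> t q" if "p' \<in> I" for p'
   proof -
    have cl: "\<alpha> p' t \<otimes> \<beta> t q \<in> El R" "(\<Oplus>a\<in>A. \<alpha> p' a \<otimes> \<beta> a q) \<in> El R"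
     using al be that q by (auto intro!: finsum_closed)
    have "\<alpha> p' t \<otimes> \<beta> t q \<oplus> (\<Oplus>a\<in>A. \<alpha> p' a \<otimes> \<beta> a q) = (if p' = q then f else \<zero>)"
     using split[of q "\<alpha> p'"] eq[of p' q] that q al by simp
    thus ?thesis by (rule add_eq_diff[OF cl])
   qed
   have bt: "\<beta> t q \<in> El R" using be q by auto
   have "(\<Oplus>a\<in>A. (?u \<otimes> \<alpha> p a \<oplus> (\<ominus> \<alpha> p t) \<otimes> \<alpha> p0 a) \<otimes> \<beta> a q) =
     ?u \<otimes> ((if p = q then f else \<zero>) \<ominus> \<alpha> p t \<otimes> \<beta> t q) \<oplus> (\<ominus> \<alpha> p t) \<otimes> (\<zero> \<ominus> ?u \<otimes> \<beta> t q)"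
    using lin[of q ?u "\<ominus> \<alpha> p t" "\<alpha> p" "\<alpha> p0"] s[of p] s[OF p0] p q p0 al u
    by (cases "p0 = q") simp_all
   also have "... = ?u \<otimes> (if p = q then f else \<zero>) \<oplus>
     (\<ominus> (?u \<otimes> (\<alpha> p t \<otimes> \<beta> t q)) \<oplus> ?u \<otimes> (\<alpha> p t \<otimes> \<beta> t q))"
    using u pt bt f by (simp add: minus_eq r_distr l_minus r_minus m_lcomm a_assoc)
   also have "... = (if p = q then ?u \<otimes> f else \<zero>)"
    using u pt bt f by (simp add: l_neg)
   finally show "(\<Oplus>a\<in>A. (?u \<otimes> \<alpha> p a \<oplus> (\<ominus> \<alpha> p t) \<otimes> \<alpha> p0 a) \<otimes> \<beta> a q) = (if p = q then ?u \<otimes> f else \<zero>)" .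
  qed (use insert.prems(1) cards(2)[OF p0] al be p0 u f in auto)
  thus ?thesis using u f by (simp add: m_comm)
 qed
 have "f \<otimes> f = \<zero>"
 proof (rule insert.IH[of I "%p a. f \<otimes> \<alpha> p a"])
  fix p q assume p: "p \<in> I" and q: "q \<in> I"
  have z: "(f \<otimes> \<alpha> p t) \<otimes> \<beta> t q = \<zero>" using ft[OF p] be q by simp
  have "(\<Oplus>a\<in>A. (f \<otimes> \<alpha> p a) \<otimes> \<beta> a q) = (\<Oplus>a\<in>insert t A. (f \<otimes> \<alpha> p a) \<otimes> \<beta> a q)"
   using split[of q "%a. f \<otimes> \<alpha> p a"] z q al p f be by (simp add: finsum_closed Pi_iff)
  also have "... = (\<Oplus>a\<in>insert t A. f \<otimes> (\<alpha> p a \<otimes> \<beta> a q))"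
   using al be p q f by (intro finsum_cong') (auto simp: m_assoc)
  also have "... = f \<otimes> (\<Oplus>a\<in>insert t A. \<alpha> p a \<otimes> \<beta> a q)"
   using al be p q f insert.hyps(1) by (intro finsum_rdistr[symmetric]) auto
  finally show "(\<Oplus>a\<in>A. (f \<otimes> \<alpha> p a) \<otimes> \<beta> a q) = (if p = q then f \<otimes> f else \<zero>)"
   using eq[OF p q] f by auto
 qed (use insert.prems(1) cards(1) al be f in auto)
 thus ?case by (rule square_zero[OF f])
qed

text \<open>A substitute for a nonvanishing minor of size \<open>r\<close>: multiplying by the adjugate turns a square matrix
of values of functionals into \<open>f\<close> times the identity, \<open>f\<close> being its determinant.\<close>
definition frame :: "('v => 'a) set => nat => (nat => 'v => 'a) => (nat => 'v) => 'a => bool" where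
 "frame \<Phi> r \<phi> x f \<longleftrightarrow> f \<in> El R \<and> (\<forall>p<r. \<phi> p \<in> \<Phi>) \<and>
   (\<forall>p<r. \<forall>q<r. \<phi> p (x q) = (if p = q then f else \<zero>))"

definition linear_family :: "('v => 'a) set => 'v set => bool" where
 "linear_family \<Phi> V \<longleftrightarrow> (\<forall>\<phi>\<in>\<Phi>. \<forall>v\<in>V. \<phi> v \<in> El R) \<and> (%v. \<zero>) \<in> \<Phi> \<and>
   (\<forall>\<phi>\<in>\<Phi>. \<forall>\<psi>\<in>\<Phi>. (%v. \<phi> v \<oplus> \<psi> v) \<in> \<Phi>) \<and> (\<forall>r\<in>El R. \<forall>\<phi>\<in>\<Phi>. (%v. r \<otimes> \<phi> v) \<in> \<Phi>)"

lemma linear_family_sum: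
 assumes "linear_family \<Phi> V" "finite P" "\<And>p. p \<in> P ==> \<phi> p \<in> \<Phi>" "\<And>p. p \<in> P ==> r p \<in> El R"
 shows "\<exists>\<chi>\<in>\<Phi>. \<forall>v\<in>V. \<chi> v = (\<Oplus>p\<in>P. r p \<otimes> \<phi> p v)"
 using assms(2-4)
proof (induction P)
 case empty
 thus ?case using assms(1) by (auto simp: linear_family_def)
next
 case (insert p P)
 then obtain \<chi> where \<chi>: "\<chi> \<in> \<Phi>" "\<forall>v\<in>V. \<chi> v = (\<Oplus>p\<in>P. r p \<otimes> \<phi> p v)" by auto
 have "(%v. r p \<otimes> \<phi> p v \<oplus> \<chi> v) \<in> \<Phi>"
  using assms(1) insert.prems \<chi>(1) unfolding linear_family_def by auto
 moreover have "r p \<otimes> \<phi> p v \<oplus> \<chi> v = (\<Oplus>p\<in>insert p P. r p \<otimes> \<phi> p v)" if "v \<in> V" for v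
 proof -
  have "\<And>q. q \<in> insert p P ==> r q \<otimes> \<phi> q v \<in> El R"
   using assms(1) insert.prems that unfolding linear_family_def by auto
  thus ?thesis using insert.hyps \<chi>(2) that by (subst finsum_insert) auto
 qed
 ultimately show ?case by (intro bexI[of _ "%v. r p \<otimes> \<phi> p v \<oplus> \<chi> v"]) auto
qed

text \<open>The new scalar is, up to the factor \<open>f\<close>, the bordered determinant; its vanishing expresses that \<open>y\<close> depends
on the \<open>x p\<close>.\<close>
lemma frame_Suc:
 assumes lf: "linear_family \<Phi> V" and fr: "frame \<Phi> r \<phi> x f" and xV: "\<And>p. p < r ==> x p \<in> V"
  and \<psi>: "\<psi> \<in> \<Phi>" and y: "y \<in> V"
 shows "\<exists>\<phi>'. frame \<Phi> (Suc r) \<phi>' (x(r := y))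
  (f \<otimes> (f \<otimes> \<psi> y \<oplus> (\<Oplus>p\<in>{..<r}. (\<ominus> \<psi> (x p)) \<otimes> \<phi> p y)))"
proof -
 have cl: "\<And>\<chi> v. \<chi> \<in> \<Phi> ==> v \<in> V ==> \<chi> v \<in> El R"
  using lf by (auto simp: linear_family_def)
 have f: "f \<in> El R" and \<phi>: "\<And>p. p < r ==> \<phi> p \<in> \<Phi>"
  and \<phi>x: "\<And>p q. p < r ==> q < r ==> \<phi> p (x q) = (if p = q then f else \<zero>)"
  using fr by (auto simp: frame_def)
 obtain \<chi> where \<chi>: "\<chi> \<in> \<Phi>" "\<And>v. v \<in> V ==> \<chi> v = (\<Oplus>p\<in>{..<r}. (\<ominus> \<psi> (x p)) \<otimes> \<phi> p v)"
  using linear_family_sum[OF lf, of "{..<r}" \<phi> "%p. \<ominus> \<psi> (x p)"] \<phi> \<psi> xV cl by auto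
 define \<psi>' where "\<psi>' v = f \<otimes> \<psi> v \<oplus> \<chi> v" for v
 have \<psi>': "\<psi>' \<in> \<Phi>" using lf f \<psi> \<chi>(1) unfolding \<psi>'_def[abs_def] linear_family_def by auto
 have \<psi>'x: "\<psi>' (x q) = \<zero>" if q: "q < r" for q
 proof -
  have "\<chi> (x q) = (\<Oplus>p\<in>{..<r}. if p = q then (\<ominus> \<psi> (x p)) \<otimes> f else \<zero>)"
   unfolding \<chi>(2)[OF xV[OF q]]
   using q \<phi>x cl \<psi> xV f by (intro finsum_cong') (auto simp: Pi_iff)
  also have "... = (\<ominus> \<psi> (x q)) \<otimes> f"
   using q cl \<psi> xV f by (subst finsum_delta) auto
  finally show ?thesis
   unfolding \<psi>'_def using cl[OF \<psi> xV[OF q]] f neg_cancel(1)[of f "\<psi> (x q)"] by simp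
 qed
 let ?g = "\<psi>' y"
 have g: "?g \<in> El R" using cl \<psi>' y by auto
 define \<phi>' where "\<phi>' p = (if p < r then (%v. ?g \<otimes> \<phi> p v \<oplus> (\<ominus> \<phi> p y) \<otimes> \<psi>' v) else (%v. f \<otimes> \<psi>' v))" for p
 have "frame \<Phi> (Suc r) \<phi>' (x(r := y)) (f \<otimes> ?g)"
  unfolding frame_def
 proof (intro conjI allI impI)
  show "f \<otimes> ?g \<in> El R" using f g by simp
  show "\<phi>' p \<in> \<Phi>" if p: "p < Suc r" for p
  proof (cases "p < r")
   case True
   have n: "\<ominus> \<phi> p y \<in> El R" using cl[OF \<phi>[OF True] y] by simp
   show ?thesis
    using lf g \<phi>[OF True] \<psi>' n unfolding \<phi>'_def linear_family_def by (simp add: True)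
  next
   case False
   thus ?thesis using lf f \<psi>' unfolding \<phi>'_def linear_family_def by simp
  qed
  fix p q assume p: "p < Suc r" and q: "q < Suc r"
  consider "p < r" "q < r" | "p < r" "q = r" | "p = r" "q < r" | "p = r" "q = r" using p q by linarith
  thus "\<phi>' p ((x(r := y)) q) = (if p = q then f \<otimes> ?g else \<zero>)"
  proof cases
   case 1
   thus ?thesis using g f cl \<phi> y by (auto simp: \<phi>'_def \<psi>'x \<phi>x m_comm)
  next
   case 2
   thus ?thesis using g cl[OF \<phi>[OF 2(1)] y] neg_cancel(1)[of ?g "\<phi> p y"] by (simp add: \<phi>'_def)
  qed (use f in \<open>simp_all add: \<phi>'_def \<psi>'x\<close>)
 qed
 thus ?thesis unfolding \<psi>'_def using \<chi>(2)[OF y] by auto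
qed

lemma frame_bound:
 assumes fr: "frame \<Phi> r \<phi> x f" and xV: "\<And>p. p < r ==> x p \<in> V" and r: "card T < r" and T: "finite T"
  and \<kappa>: "\<And>t v. t \<in> T ==> v \<in> V ==> \<kappa> t v \<in> El R"
  and \<Phi>: "\<And>\<phi>. \<phi> \<in> \<Phi> ==> \<exists>\<theta>. (\<forall>t\<in>T. \<theta> t \<in> El R) \<and> (\<forall>v\<in>V. \<phi> v = (\<Oplus>t\<in>T. \<theta> t \<otimes> \<kappa> t v))"
 shows "f = \<zero>"
proof -
 have "\<forall>p. \<exists>\<theta>. p < r --> (\<forall>t\<in>T. \<theta> t \<in> El R) \<and> (\<forall>v\<in>V. \<phi> p v = (\<Oplus>t\<in>T. \<theta> t \<otimes> \<kappa> t v))"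
 proof
  fix p
  show "\<exists>\<theta>. p < r --> (\<forall>t\<in>T. \<theta> t \<in> El R) \<and> (\<forall>v\<in>V. \<phi> p v = (\<Oplus>t\<in>T. \<theta> t \<otimes> \<kappa> t v))"
  proof (cases "p < r")
   case True
   hence "\<phi> p \<in> \<Phi>" using fr by (simp add: frame_def)
   from \<Phi>[OF this] show ?thesis by simp
  qed simp
 qed
 from choice[OF this] obtain \<theta> where \<theta>:
  "\<And>p. p < r ==> (\<forall>t\<in>T. \<theta> p t \<in> El R) \<and> (\<forall>v\<in>V. \<phi> p v = (\<Oplus>t\<in>T. \<theta> p t \<otimes> \<kappa> t v))"
  by blast
 have f: "f \<in> El R" and \<phi>: "\<And>p q. p < r ==> q < r ==> \<phi> p (x q) = (if p = q then f else \<zero>)"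
  using fr by (simp_all add: frame_def)
 have "(\<Oplus>a\<in>T. \<theta> p a \<otimes> \<kappa> a (x q)) = (if p = q then f else \<zero>)" if "p < r" "q < r" for p q
 proof -
  have "\<phi> p (x q) = (\<Oplus>a\<in>T. \<theta> p a \<otimes> \<kappa> a (x q))"
   using \<theta>[OF that(1)] xV[OF that(2)] by blast
  thus ?thesis unfolding \<phi>[OF that] by (rule sym)
 qed
 thus ?thesis
  using matrix_bound[OF T, of "{..<r}" \<theta> "%t q. \<kappa> t (x q)" f] r \<theta> \<kappa> xV f by simp
qed

end

section \<open>Modules with a dual\<close>

inductive_set module_span :: "('r, 'x) ring_scheme => ('r, 'm, 'y) module_scheme => 'm set => 'm set"
 for R :: "('r, 'x) ring_scheme" and M :: "('r, 'm, 'y) module_scheme" and S where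
 zero: "\<zero>\<^sub>M \<in> module_span R M S"
| base: "s \<in> S ==> s \<in> module_span R M S"
| add: "x \<in> module_span R M S ==> y \<in> module_span R M S ==> x \<oplus>\<^sub>M y \<in> module_span R M S"
| smult: "r \<in> El R ==> x \<in> module_span R M S ==> r \<odot>\<^sub>M x \<in> module_span R M S"

definition functional :: "('r, 'x) ring_scheme => ('r, 'm, 'y) module_scheme => ('m => 'r) => bool" where
 "functional R M \<phi> \<longleftrightarrow> additive_map M R \<phi> \<and>
   (\<forall>r\<in>El R. \<forall>x\<in>El M. \<phi> (r \<odot>\<^sub>M x) = r \<otimes>\<^sub>R \<phi> x)"

definition linear_map ::
 "('r, 'x) ring_scheme => ('r, 'm, 'y) module_scheme => ('r, 'n, 'z) module_scheme => ('m => 'n) => bool" where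
 "linear_map R M N h \<longleftrightarrow> additive_map M N h \<and>
   (\<forall>r\<in>El R. \<forall>x\<in>El M. h (r \<odot>\<^sub>M x) = r \<odot>\<^sub>N h x)"

lemma functionalD:
 assumes "functional R M \<phi>"
 shows "x \<in> El M ==> \<phi> x \<in> El R"
  and "x \<in> El M ==> y \<in> El M ==> \<phi> (x \<oplus>\<^sub>M y) = \<phi> x \<oplus>\<^sub>R \<phi> y"
  and "r \<in> El R ==> x \<in> El M ==> \<phi> (r \<odot>\<^sub>M x) = r \<otimes>\<^sub>R \<phi> x"
  and "additive_map M R \<phi>"
 using assms by (auto simp: functional_def additive_map_def)

lemma linear_mapD:
 assumes "linear_map R M N h"
 shows "x \<in> El M ==> h x \<in> El N"
  and "x \<in> El M ==> y \<in> El M ==> h (x \<oplus>\<^sub>M y) = h x \<oplus>\<^sub>N h y"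
  and "r \<in> El R ==> x \<in> El M ==> h (r \<odot>\<^sub>M x) = r \<odot>\<^sub>N h x"
  and "additive_map M N h"
 using assms by (auto simp: linear_map_def additive_map_def)

definition tau_submodule ::
 "('r, 'x) bold_ring_scheme => ('r, 'm, 'y) bold_module_scheme => 'm set => bool" where
 "tau_submodule R M N \<longleftrightarrow> submodule N R M \<and> tau M ` N <= N"

definition dual_basis ::
 "('r, 'x) ring_scheme => ('r, 'm, 'y) module_scheme => 'm set => ('m => 'm => 'r) => bool" where
 "dual_basis R M A f \<longleftrightarrow> finite A \<and> A <= El M \<and> (\<forall>a\<in>A. functional R M (f a)) \<and>
   (\<forall>x\<in>El M. x = (\<Oplus>\<^sub>M a\<in>A. f a x \<odot>\<^sub>M a))"

context module
begin

lemma module_span_carrier: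
 assumes "S <= El M" shows "module_span R M S <= El M"
proof
 fix x assume "x \<in> module_span R M S"
 thus "x \<in> El M" by induction (use assms in auto)
qed

lemma module_span_submodule:
 assumes "S <= El M" shows "submodule (module_span R M S) R M"
proof (rule submoduleI)
 show "module_span R M S <= El M" by (rule module_span_carrier[OF assms])
 show "\<ominus>\<^sub>M x \<in> module_span R M S" if "x \<in> module_span R M S" for x
  using module_span.smult[OF _ that, of "\<ominus> \<one>"] subsetD[OF module_span_carrier[OF assms] that]
  by (simp add: smult_l_minus)
qed (auto intro: module_span.intros)

lemma submodule_carrier: "submodule N R M ==> x \<in> N ==> x \<in> El M"
 and submodule_add: "submodule N R M ==> x \<in> N ==> y \<in> N ==> x \<oplus>\<^sub>M y \<in> N"
 and submodule_smult: "submodule N R M ==> r \<in> El R ==> x \<in> N ==> r \<odot>\<^sub>M x \<in> N"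
 and submodule_neg: "submodule N R M ==> x \<in> N ==> \<ominus>\<^sub>M x \<in> N"
 by (blast dest: submoduleE)+

lemma submodule_zero: assumes "submodule N R M" shows "\<zero>\<^sub>M \<in> N"
proof -
 interpret submodule N R M by fact
 show ?thesis using one_closed by simp
qed

lemma module_span_least:
 assumes "submodule N R M" "S <= N" shows "module_span R M S <= N"
proof
 fix x assume "x \<in> module_span R M S"
 thus "x \<in> N"
  by induction (use assms submodule_zero submodule_add submodule_smult in auto)
qed

lemma submodule_sum:
 assumes "submodule N R M" "\<And>i. i \<in> I ==> h i \<in> N"
 shows "(\<Oplus>\<^sub>M i\<in>I. h i) \<in> N"
 using assms(2)
proof (induction I rule: infinite_finite_induct)
 case (insert i I)
 hence "(\<Oplus>\<^sub>M i\<in>insert i I. h i) = h i \<oplus>\<^sub>M (\<Oplus>\<^sub>M i\<in>I. h i)"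
  using submodule_carrier[OF assms(1)] by (intro M.finsum_insert) auto
 thus ?case using insert submodule_add[OF assms(1)] by auto
qed (use submodule_zero[OF assms(1)] in auto)

lemma linear_map_finsum:
 assumes "module R N" "linear_map R M N h" "x \<in> I \<rightarrow> El M"
 shows "h (\<Oplus>\<^sub>M i\<in>I. x i) = (\<Oplus>\<^sub>N i\<in>I. h (x i))"
 using additive_map_finsum[OF M.abelian_group_axioms module.axioms(2)[OF assms(1)] linear_mapD(4)[OF assms(2)] assms(3)] .

lemma functional_finsum:
 assumes "functional R M \<phi>" "x \<in> I \<rightarrow> El M"
 shows "\<phi> (\<Oplus>\<^sub>M i\<in>I. x i) = (\<Oplus>i\<in>I. \<phi> (x i))"
 using additive_map_finsum[OF M.abelian_group_axioms R.is_abelian_group functionalD(4)[OF assms(1)] assms(2)] .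

lemma functional_zero: "functional R M (%v. \<zero>)"
 by (simp add: functional_def additive_map_def)

lemma functional_add: "functional R M \<phi> ==> functional R M \<psi> ==> functional R M (%v. \<phi> v \<oplus> \<psi> v)"
 by (auto simp: functional_def additive_map_def R.r_distr R.a_ac)

lemma functional_smult: "functional R M \<phi> ==> r \<in> El R ==> functional R M (%v. r \<otimes> \<phi> v)"
 by (auto simp: functional_def additive_map_def R.r_distr R.m_lcomm)

lemma functional_sum:
 assumes "finite P" "\<And>p. p \<in> P ==> functional R M (\<phi> p)" "\<And>p. p \<in> P ==> r p \<in> El R"
 shows "functional R M (%v. \<Oplus>p\<in>P. r p \<otimes> \<phi> p v)"
proof -
 have cl: "r p \<otimes> \<phi> p v \<in> El R" if "p \<in> P" "v \<in> El M" for p v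
  using assms that functionalD(1)[OF assms(2)] by auto
 have "(\<Oplus>p\<in>P. r p \<otimes> \<phi> p (x \<oplus>\<^sub>M y)) = (\<Oplus>p\<in>P. r p \<otimes> \<phi> p x) \<oplus> (\<Oplus>p\<in>P. r p \<otimes> \<phi> p y)"
  if "x \<in> El M" "y \<in> El M" for x y
 proof -
  have "(\<Oplus>p\<in>P. r p \<otimes> \<phi> p (x \<oplus>\<^sub>M y)) = (\<Oplus>p\<in>P. r p \<otimes> \<phi> p x \<oplus> r p \<otimes> \<phi> p y)"
   using that assms cl functionalD[OF assms(2)] by (intro R.finsum_cong') (auto simp: R.r_distr)
  thus ?thesis using cl that by (simp add: R.finsum_addf Pi_iff)
 qed
 moreover have "(\<Oplus>p\<in>P. r p \<otimes> \<phi> p (s \<odot>\<^sub>M x)) = s \<otimes> (\<Oplus>p\<in>P. r p \<otimes> \<phi> p x)"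
  if "s \<in> El R" "x \<in> El M" for s x
 proof -
  have "(\<Oplus>p\<in>P. r p \<otimes> \<phi> p (s \<odot>\<^sub>M x)) = (\<Oplus>p\<in>P. s \<otimes> (r p \<otimes> \<phi> p x))"
   using that assms cl functionalD[OF assms(2)] by (intro R.finsum_cong') (auto simp: R.m_lcomm)
  thus ?thesis using cl that assms(1) by (simp add: R.finsum_rdistr Pi_iff)
 qed
 ultimately show ?thesis
  using cl by (auto simp: functional_def additive_map_def intro!: R.finsum_closed)
qed

lemma linear_map_add:
 assumes "linear_map R M M g" "linear_map R M M h"
 shows "linear_map R M M (%x. g x \<oplus>\<^sub>M h x)"
 using linear_mapD[OF assms(1)] linear_mapD[OF assms(2)]
 by (auto simp: linear_map_def additive_map_def smult_r_distr M.a_ac)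

lemma linear_map_smult:
 assumes "linear_map R M M g" "r \<in> El R"
 shows "linear_map R M M (%x. r \<odot>\<^sub>M g x)"
 using linear_mapD[OF assms(1)] assms(2)
 by (auto simp: linear_map_def additive_map_def smult_r_distr smult_assoc1[symmetric] R.m_comm)

lemma rank_one_linear_map:
 assumes "functional R M \<phi>" "x \<in> El M" shows "linear_map R M M (%v. \<phi> v \<odot>\<^sub>M x)"
 using functionalD[OF assms(1)] assms(2)
 by (auto simp: linear_map_def additive_map_def smult_l_distr smult_assoc1)

lemma dual_basisD:
 assumes "dual_basis R M A f"
 shows "finite A" "a \<in> A ==> a \<in> El M" "a \<in> A ==> functional R M (f a)"
  and "x \<in> El M ==> (\<Oplus>\<^sub>M a\<in>A. f a x \<odot>\<^sub>M a) = x"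
  and "a \<in> A ==> x \<in> El M ==> f a x \<in> El R"
 using assms by (auto simp: dual_basis_def functionalD(1))

lemma functional_expand:
 assumes "dual_basis R M A f" "functional R M \<phi>" "x \<in> El M"
 shows "\<phi> x = (\<Oplus>a\<in>A. \<phi> a \<otimes> f a x)"
proof -
 note db = dual_basisD[OF assms(1)]
 have "\<phi> x = \<phi> (\<Oplus>\<^sub>M a\<in>A. f a x \<odot>\<^sub>M a)" using db(4)[OF assms(3)] by simp
 also have "... = (\<Oplus>a\<in>A. \<phi> (f a x \<odot>\<^sub>M a))"
  using db assms(3) by (intro functional_finsum[OF assms(2)]) auto
 also have "... = (\<Oplus>a\<in>A. \<phi> a \<otimes> f a x)"
  using db assms(3) functionalD[OF assms(2)] by (intro R.finsum_cong') (auto simp: R.m_comm)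
 finally show ?thesis .
qed

lemma functionals_separate:
 assumes "dual_basis R M A f" "x \<in> El M" "\<And>\<psi>. functional R M \<psi> ==> \<psi> x = \<zero>"
 shows "x = \<zero>\<^sub>M"
proof -
 note db = dual_basisD[OF assms(1)]
 have "x = (\<Oplus>\<^sub>M a\<in>A. f a x \<odot>\<^sub>M a)" using db(4)[OF assms(2)] by simp
 also have "... = \<zero>\<^sub>M"
  using db(2) assms(3)[OF db(3)] by (intro M.add.finprod_one_eqI) auto
 finally show ?thesis .
qed

end

text \<open>The second assumption is the dual \<open>\<tau>\<close>: it asks that composing a functional with the inverse of the
linearisation of \<open>\<tau>\<close> gives a functional again, without mentioning that inverse. Unlike bijectivity
of the linearisation, it passes to summands and to base changes at once.\<close>
locale dual_module = R?: simple_bold_ring R + bold_module R M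
 for R (structure) and M (structure) +
 assumes dual_basis_exists: "\<exists>A f. dual_basis R M A f"
  and dual_tau: "functional R M \<phi> ==>
   \<exists>\<psi>. functional R M \<psi> \<and> (\<forall>x\<in>El M. \<psi> (tau M x) = endo R (\<phi> x))"
begin

lemma tau_in [simp]: "x \<in> El M ==> tau M x \<in> El M"
 using tau_closed by auto

lemma tau_additive: "additive_map M M (tau M)"
 by (simp add: additive_map_def tau_add)

lemma tau_zero [simp]: "tau M \<zero>\<^sub>M = \<zero>\<^sub>M"
 by (rule additive_map_zero[OF M.abelian_group_axioms M.abelian_group_axioms tau_additive])

lemma functionals_linear_family: "linear_family {\<phi>. functional R M \<phi>} (El M)"
 unfolding linear_family_def by (simp add: functional_zero functional_add functional_smult functionalD(1))

definition minors :: "nat => 'c set => 'a set" where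
 "minors r N = {f. \<exists>\<phi> x. frame {\<phi>. functional R M \<phi>} r \<phi> x f \<and> (\<forall>p<r. x p \<in> N)}"

lemma minors_bound:
 assumes "dual_basis R M A f" "card A < r" "N <= El M" "d \<in> minors r N"
 shows "d = \<zero>"
proof -
 note db = dual_basisD[OF assms(1)]
 obtain \<phi> x where fr: "frame {\<phi>. functional R M \<phi>} r \<phi> x d" "\<And>p. p < r ==> x p \<in> N"
  using assms(4) by (auto simp: minors_def)
 show ?thesis
 proof (rule frame_bound[OF fr(1) _ assms(2) db(1)])
  show "x p \<in> El M" if "p < r" for p using fr(2)[OF that] assms(3) by auto
  show "f t v \<in> El R" if "t \<in> A" "v \<in> El M" for t v using db(5) that by blast
  show "\<exists>\<theta>. (\<forall>t\<in>A. \<theta> t \<in> El R) \<and> (\<forall>v\<in>El M. \<phi> v = (\<Oplus>t\<in>A. \<theta> t \<otimes> f t v))"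
   if "\<phi> \<in> {\<phi>. functional R M \<phi>}" for \<phi>
   using that functional_expand[OF assms(1), of \<phi>] functionalD(1)[of R M \<phi>] db(2) by (intro exI[of _ \<phi>]) simp
 qed
qed

lemma minors_carrier: "minors r N <= El R"
 by (auto simp: minors_def frame_def)

lemma minors_mono: "N <= N' ==> minors r N <= minors r N'"
 unfolding minors_def by blast

text \<open>The dual \<open>\<tau>\<close> carries the functionals of a frame along with its vectors.\<close>
lemma minors_sigma:
 assumes N: "N <= El M" and f: "f \<in> minors r N" shows "endo R f \<in> minors r (tau M ` N)"
proof -
 obtain \<phi> x where fr: "frame {\<phi>. functional R M \<phi>} r \<phi> x f" "\<forall>p<r. x p \<in> N"
  using f by (auto simp: minors_def)
 have \<phi>: "functional R M (\<phi> p)" if "p < r" for p using fr(1) that by (simp add: frame_def)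
 have "\<forall>p. \<exists>\<psi>. p < r --> functional R M \<psi> \<and> (\<forall>x\<in>El M. \<psi> (tau M x) = endo R (\<phi> p x))"
  using dual_tau[OF \<phi>] by blast
 from choice[OF this] obtain \<psi> where
  \<psi>: "\<And>p. p < r ==> functional R M (\<psi> p) \<and> (\<forall>x\<in>El M. \<psi> p (tau M x) = endo R (\<phi> p x))" by blast
 have "frame {\<phi>. functional R M \<phi>} r \<psi> (%p. tau M (x p)) (endo R f)"
  using fr \<psi> N unfolding frame_def by (auto simp: subset_iff)
 thus ?thesis using fr(2) unfolding minors_def by blast
qed

lemma frame_identity:
 assumes N: "submodule N R M" and fr: "frame {\<phi>. functional R M \<phi>} r \<phi> x f" "\<And>p. p < r ==> x p \<in> N"
  and max: "minors (Suc r) N <= {\<zero>}" and y: "y \<in> N"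
 shows "(f \<otimes> f) \<odot>\<^sub>M y = (\<Oplus>\<^sub>M p\<in>{..<r}. (f \<otimes> \<phi> p y) \<odot>\<^sub>M x p)"
proof -
 obtain A g where db: "dual_basis R M A g" using dual_basis_exists by blast
 have f: "f \<in> El R" and \<phi>: "\<And>p. p < r ==> functional R M (\<phi> p)"
  using fr(1) by (simp_all add: frame_def)
 have yc: "y \<in> El M" and xc: "\<And>p. p < r ==> x p \<in> El M"
  using submodule_carrier[OF N] y fr(2) by auto
 have \<phi>y: "\<phi> p y \<in> El R" if "p < r" for p using functionalD(1)[OF \<phi>[OF that] yc] .
 let ?s = "\<Oplus>\<^sub>M p\<in>{..<r}. (f \<otimes> \<phi> p y) \<odot>\<^sub>M x p"
 let ?z = "(f \<otimes> f) \<odot>\<^sub>M y \<oplus>\<^sub>M (\<ominus> \<one>) \<odot>\<^sub>M ?s"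
 have sc: "?s \<in> El M" using f \<phi>y xc by (intro M.finsum_closed) auto
 have "?z = \<zero>\<^sub>M"
 proof (rule functionals_separate[OF db])
  show "?z \<in> El M" using f yc sc by auto
  fix \<psi> assume \<psi>: "functional R M \<psi>"
  note \<psi>D = functionalD[OF \<psi>]
  have \<psi>x: "\<psi> (x p) \<in> El R" if "p < r" for p using \<psi>D(1) xc that by auto
  let ?h = "f \<otimes> (f \<otimes> \<psi> y \<oplus> (\<Oplus>p\<in>{..<r}. (\<ominus> \<psi> (x p)) \<otimes> \<phi> p y))"
  obtain \<phi>' where "frame {\<phi>. functional R M \<phi>} (Suc r) \<phi>' (x(r := y)) ?h"
   using frame_Suc[OF functionals_linear_family fr(1) xc _ yc, of \<psi>] \<psi> by auto
  hence "?h \<in> minors (Suc r) N"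
   using fr(2) y unfolding minors_def by (auto simp: less_Suc_eq intro!: exI[of _ \<phi>'] exI[of _ "x(r := y)"])
  hence h0: "?h = \<zero>" using max by auto
  have "\<psi> ?s = (\<Oplus>p\<in>{..<r}. \<psi> ((f \<otimes> \<phi> p y) \<odot>\<^sub>M x p))"
   using f \<phi>y xc by (intro functional_finsum[OF \<psi>]) auto
  also have "... = (\<Oplus>p\<in>{..<r}. (\<ominus> f) \<otimes> ((\<ominus> \<psi> (x p)) \<otimes> \<phi> p y))"
   using f \<phi>y xc \<psi>x \<psi>D(3) by (intro R.finsum_cong') (auto simp: l_minus r_minus m_ac)
  also have "... = (\<ominus> f) \<otimes> (\<Oplus>p\<in>{..<r}. (\<ominus> \<psi> (x p)) \<otimes> \<phi> p y)"
   using f \<phi>y \<psi>x by (intro R.finsum_rdistr[symmetric]) auto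
  finally have s: "\<psi> ?s = (\<ominus> f) \<otimes> (\<Oplus>p\<in>{..<r}. (\<ominus> \<psi> (x p)) \<otimes> \<phi> p y)" .
  have c: "(\<Oplus>p\<in>{..<r}. (\<ominus> \<psi> (x p)) \<otimes> \<phi> p y) \<in> El R" "\<psi> y \<in> El R"
   using \<phi>y \<psi>x \<psi>D(1)[OF yc] by (auto intro!: R.finsum_closed)
  have "\<psi> ?z = (f \<otimes> f) \<otimes> \<psi> y \<oplus> (\<ominus> \<one>) \<otimes> \<psi> ?s"
   using f yc sc by (simp add: \<psi>D)
  also have "... = ?h" unfolding s using f c by (simp add: r_distr l_minus m_assoc)
  finally show "\<psi> ?z = \<zero>" using h0 by simp
 qed
 hence "(f \<otimes> f) \<odot>\<^sub>M y \<oplus>\<^sub>M (\<ominus>\<^sub>M ?s) = \<zero>\<^sub>M"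
  using sc by (simp add: smult_l_minus)
 from M.minus_equality[OF this] show ?thesis using sc f yc by simp
qed

text \<open>If all larger minors vanish, a minor \<open>f\<close> of \<open>N\<close> provides a linear map into \<open>N\<close> that acts on \<open>N'\<close> as a
multiple of \<open>f\<^sup>2\<close> (\<open>frame_identity\<close>). The scalars obtained in this way from all minors are stable under \<open>\<sigma>\<close>,
so they generate \<open>1\<close>, and the same combination of the maps is the identity on \<open>N'\<close>.\<close>
lemma projection:
 assumes N: "tau_submodule R M N" and N': "submodule N' R M"
  and f: "f \<in> minors r N" "f ~= \<zero>" and max: "minors (Suc r) N' <= {\<zero>}" and sub: "N <= N'"
 shows "\<exists>\<pi>. linear_map R M M \<pi> \<and> (\<forall>x\<in>El M. \<pi> x \<in> N) \<and> (\<forall>y\<in>N'. \<pi> y = y)"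
proof -
 have Ns: "submodule N R M" and Nt: "tau M ` N <= N" using N by (auto simp: tau_submodule_def)
 have Nc: "N <= El M" using submodule_carrier[OF Ns] by auto
 let ?S = "{g \<otimes> g | g. g \<in> minors r N}"
 have "\<one> \<in> ideal_gen R ?S"
 proof (rule stable_generators_one)
  show "?S <= El R" using minors_carrier by auto
  show "endo R ` ?S <= ?S"
  proof
   fix z assume "z \<in> endo R ` ?S"
   then obtain g where g: "g \<in> minors r N" "z = endo R (g \<otimes> g)" by auto
   hence "z = endo R g \<otimes> endo R g" using subsetD[OF minors_carrier g(1)] by (simp add: sigma_mult)
   moreover have "endo R g \<in> minors r N" using minors_sigma[OF Nc g(1)] minors_mono[OF Nt] by auto
   ultimately show "z \<in> ?S" by blast
  qed
  show "f \<otimes> f \<in> ?S" using f by blast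
  show "f \<otimes> f ~= \<zero>" using square_zero[of f] f minors_carrier by auto
 qed
 moreover have "z \<in> El R \<and> (\<exists>\<pi>. linear_map R M M \<pi> \<and> (\<forall>x\<in>El M. \<pi> x \<in> N) \<and> (\<forall>y\<in>N'. \<pi> y = z \<odot>\<^sub>M y))"
  if "z \<in> ideal_gen R ?S" for z
  using that
 proof induction
  case (base s)
  then obtain g where g: "g \<in> minors r N" "s = g \<otimes> g" by auto
  then obtain \<phi> x where fr: "frame {\<phi>. functional R M \<phi>} r \<phi> x g" "\<And>p. p < r ==> x p \<in> N"
   by (auto simp: minors_def)
  have gc: "g \<in> El R" and \<phi>: "\<And>p. p < r ==> functional R M (\<phi> p)"
   using fr(1) by (simp_all add: frame_def)
  let ?\<pi> = "%y. \<Oplus>\<^sub>M p\<in>{..<r}. (g \<otimes> \<phi> p y) \<odot>\<^sub>M x p"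
  have lin: "linear_map R M M (%y. \<Oplus>\<^sub>M p\<in>{..<k}. (g \<otimes> \<phi> p y) \<odot>\<^sub>M x p)" if "k \<le> r" for k
   using that
  proof (induction k)
   case 0
   thus ?case by (simp add: linear_map_def additive_map_def)
  next
   case (Suc k)
   have xk: "x k \<in> El M" using fr(2)[of k] Suc Nc by auto
   have l1: "linear_map R M M (%y. (g \<otimes> \<phi> k y) \<odot>\<^sub>M x k)"
    using Suc by (intro rank_one_linear_map functional_smult \<phi> gc xk) simp
   have eq: "(\<Oplus>\<^sub>M p\<in>{..<Suc k}. (g \<otimes> \<phi> p y) \<odot>\<^sub>M x p) =
     (g \<otimes> \<phi> k y) \<odot>\<^sub>M x k \<oplus>\<^sub>M (\<Oplus>\<^sub>M p\<in>{..<k}. (g \<otimes> \<phi> p y) \<odot>\<^sub>M x p)" if "y \<in> El M" for y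
    unfolding lessThan_Suc using that Suc.prems xk gc functionalD(1)[OF \<phi>] subsetD[OF Nc fr(2)]
    by (intro M.finsum_insert) auto
   from linear_map_add[OF l1 Suc.IH] Suc.prems show ?case
    by (auto simp: linear_map_def additive_map_def eq)
  qed
  have "?\<pi> y \<in> N" if "y \<in> El M" for y
   using that fr(2) gc functionalD(1)[OF \<phi>] by (intro submodule_sum[OF Ns] submodule_smult[OF Ns]) auto
  moreover have "?\<pi> y = s \<odot>\<^sub>M y" if "y \<in> N'" for y
   unfolding g(2) by (rule frame_identity[OF N' fr(1) subsetD[OF sub fr(2)] max that, symmetric])
  ultimately show ?case using lin[of r] gc g(2) by (intro conjI exI[of _ ?\<pi>]) auto
 next
  case (add z1 z2)
  then obtain \<pi>1 \<pi>2 where 1: "linear_map R M M \<pi>1" "\<forall>x\<in>El M. \<pi>1 x \<in> N" "\<forall>y\<in>N'. \<pi>1 y = z1 \<odot>\<^sub>M y"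
   and 2: "linear_map R M M \<pi>2" "\<forall>x\<in>El M. \<pi>2 x \<in> N" "\<forall>y\<in>N'. \<pi>2 y = z2 \<odot>\<^sub>M y" by blast
  show ?case
   using add 1 2 linear_map_add[OF 1(1) 2(1)] submodule_add[OF Ns] submodule_carrier[OF N']
   by (intro conjI exI[of _ "%x. \<pi>1 x \<oplus>\<^sub>M \<pi>2 x"]) (auto simp: smult_l_distr)
 next
  case (mult s z)
  then obtain \<pi> where 1: "linear_map R M M \<pi>" "\<forall>x\<in>El M. \<pi> x \<in> N" "\<forall>y\<in>N'. \<pi> y = z \<odot>\<^sub>M y" by blast
  show ?case
   using mult 1 linear_map_smult[OF 1(1) mult.hyps(1)] submodule_smult[OF Ns] submodule_carrier[OF N']
   by (intro conjI exI[of _ "%x. s \<odot>\<^sub>M \<pi> x"]) (auto simp: smult_assoc1)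
 qed
 ultimately obtain \<pi> where "linear_map R M M \<pi>" "\<forall>x\<in>El M. \<pi> x \<in> N" "\<forall>y\<in>N'. \<pi> y = \<one> \<odot>\<^sub>M y"
  by blast
 thus ?thesis using submodule_carrier[OF N'] by (intro exI[of _ \<pi>]) auto
qed

definition rk :: "'c set => nat" where
 "rk N = Max {r. \<exists>f\<in>minors r N. f ~= \<zero>}"

lemma rk_set:
 assumes "N <= El M"
 shows "finite {r. \<exists>f\<in>minors r N. f ~= \<zero>}" "0 \<in> {r. \<exists>f\<in>minors r N. f ~= \<zero>}"
proof -
 obtain A f where "dual_basis R M A f" using dual_basis_exists by blast
 from minors_bound[OF this _ assms] have "{r. \<exists>f\<in>minors r N. f ~= \<zero>} <= {..card A}"
  by (auto simp: not_less[symmetric])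
 thus "finite {r. \<exists>f\<in>minors r N. f ~= \<zero>}" by (rule finite_subset) simp
 have "\<one> \<in> minors 0 N" by (simp add: minors_def frame_def)
 thus "0 \<in> {r. \<exists>f\<in>minors r N. f ~= \<zero>}" using one_not_zero by blast
qed

lemma rk_attained: assumes "N <= El M" shows "\<exists>f\<in>minors (rk N) N. f ~= \<zero>"
 using Max_in[OF rk_set(1)[OF assms]] rk_set(2)[OF assms] unfolding rk_def by blast

lemma rk_max: assumes "N <= El M" shows "minors (Suc (rk N)) N <= {\<zero>}"
proof (rule ccontr)
 assume "\<not> ?thesis"
 hence "Suc (rk N) \<in> {r. \<exists>f\<in>minors r N. f ~= \<zero>}" by auto
 from Max_ge[OF rk_set(1)[OF assms] this] show False by (simp add: rk_def)
qed

lemma rk_mono: assumes "N <= N'" "N' <= El M" shows "rk N \<le> rk N'"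
proof -
 have "rk N \<in> {r. \<exists>f\<in>minors r N'. f ~= \<zero>}"
  using rk_attained[of N] minors_mono[OF assms(1)] assms by blast
 from Max_ge[OF rk_set(1)[OF assms(2)] this] show ?thesis by (simp add: rk_def)
qed

lemma summand:
 assumes "tau_submodule R M N"
 shows "\<exists>\<pi>. linear_map R M M \<pi> \<and> (\<forall>x\<in>El M. \<pi> x \<in> N) \<and> (\<forall>y\<in>N. \<pi> y = y)"
proof -
 have Ns: "submodule N R M" using assms by (simp add: tau_submodule_def)
 hence Nc: "N <= El M" using submodule_carrier by auto
 obtain f where "f \<in> minors (rk N) N" "f ~= \<zero>" using rk_attained[OF Nc] by blast
 from projection[OF assms Ns this rk_max[OF Nc] order.refl] show ?thesis .
qed

text \<open>With equal ranks the projection onto \<open>N\<close> would be the identity on \<open>N'\<close> as well.\<close>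
lemma rk_strict:
 assumes "tau_submodule R M N" "tau_submodule R M N'" "N \<subset> N'"
 shows "rk N < rk N'"
proof (rule ccontr)
 assume "\<not> rk N < rk N'"
 have s: "submodule N R M" "submodule N' R M" using assms by (auto simp: tau_submodule_def)
 hence c: "N <= El M" "N' <= El M" using submodule_carrier by auto
 have eq: "rk N = rk N'" using rk_mono[of N N'] c assms(3) \<open>\<not> rk N < rk N'\<close> by auto
 obtain f where f: "f \<in> minors (rk N) N" "f ~= \<zero>" using rk_attained[OF c(1)] by blast
 have max: "minors (Suc (rk N)) N' <= {\<zero>}" using rk_max[OF c(2)] eq by simp
 from projection[OF assms(1) s(2) f max psubset_imp_subset[OF assms(3)]]
 obtain \<pi> where \<pi>: "\<forall>x\<in>El M. \<pi> x \<in> N" "\<forall>y\<in>N'. \<pi> y = y" by blast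
 hence "N' <= N" using c(2) by (metis subsetD subsetI)
 thus False using assms(3) by auto
qed

lemma tau_generates:
 assumes N: "tau_submodule R M N" shows "module_span R M (tau M ` N) = N"
proof -
 let ?N = "module_span R M (tau M ` N)"
 have Ns: "submodule N R M" and Nt: "tau M ` N <= N" using assms by (auto simp: tau_submodule_def)
 have Nc: "N <= El M" using submodule_carrier[OF Ns] by auto
 have sub: "?N <= N" by (rule module_span_least[OF Ns Nt])
 have s: "submodule ?N R M" using Nc by (intro module_span_submodule) auto
 have ts: "tau_submodule R M ?N"
  using s sub by (auto simp: tau_submodule_def intro: module_span.base)
 obtain f where f: "f \<in> minors (rk N) N" "f ~= \<zero>" using rk_attained[OF Nc] by blast
 have "endo R f \<in> minors (rk N) ?N"
  using minors_sigma[OF Nc f(1)] minors_mono[of "tau M ` N" ?N] by (auto intro: module_span.base)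
 moreover have "endo R f ~= \<zero>" using sigma_inj f minors_carrier by auto
 ultimately have "rk N \<in> {r. \<exists>f\<in>minors r ?N. f ~= \<zero>}" by auto
 hence "rk N \<le> rk ?N" unfolding rk_def[of ?N] using rk_set(1)[of ?N] sub Nc by (intro Max_ge) auto
 thus ?thesis using rk_strict[OF ts N] sub by auto
qed

lemma carrier_tau_submodule: "tau_submodule R M (El M)"
 using carrier_is_submodule by (auto simp: tau_submodule_def)

end

section \<open>Base change\<close>

definition module_along ::
 "('f => 'r) => ('r, 'm, 'y) module_scheme => ('f, 'm) module" where
 "module_along c M =
   \<lparr>carrier = El M, monoid.mult = undefined, one = undefined,
   ring.zero = \<zero>\<^sub>M, ring.add = (\<oplus>\<^sub>M), smult = (%a x. c a \<odot>\<^sub>M x)\<rparr>"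

lemma module_along_simps [simp]:
 "El (module_along c M) = El M" "(\<oplus>\<^bsub>module_along c M\<^esub>) = (\<oplus>\<^sub>M)"
 "\<zero>\<^bsub>module_along c M\<^esub> = \<zero>\<^sub>M" "a \<odot>\<^bsub>module_along c M\<^esub> x = c a \<odot>\<^sub>M x"
 by (simp_all add: module_along_def)

lemma module_along_module:
 assumes "cring F" "module R M" "c \<in> ring_hom F R"
 shows "module F (module_along c M)"
proof -
 interpret F: cring F by fact
 interpret M: module R M by fact
 have "abelian_group (module_along c M)"
  by (rule abelian_group_cong[OF M.abelian_group_axioms]) auto
 thus ?thesis
  by (intro moduleI)
    (use assms in \<open>auto simp: ring_hom_closed ring_hom_add ring_hom_mult ring_hom_one
     M.smult_l_distr M.smult_r_distr M.smult_assoc1\<close>)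
qed

lemma linear_map_eq_on_span:
 assumes "module R M" "module R N" "linear_map R M N g" "linear_map R M N h" "S <= El M"
  and "\<And>s. s \<in> S ==> g s = h s" "x \<in> module_span R M S"
 shows "g x = h x"
proof -
 interpret M: module R M by fact
 note c = subsetD[OF M.module_span_carrier[OF assms(5)]]
 show ?thesis using assms(7)
 proof induction
  case zero
  show ?case
   using additive_map_zero[OF module.axioms(2)[OF assms(1)] module.axioms(2)[OF assms(2)]]
    linear_mapD(4)[OF assms(3)] linear_mapD(4)[OF assms(4)] by (metis (no_types))
 qed (use assms(6) c linear_mapD[OF assms(3)] linear_mapD[OF assms(4)] in auto)
qed

text \<open>The map \<open>\<iota>\<close> exhibits \<open>M'\<close> as the scalar extension of \<open>M\<close>. Extension of functionals replaces the universal
property; together with generation it makes \<open>M'\<close> unique, and it passes to direct summands.\<close>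
locale base_change = fraction_descent F e F' R R' c \<phi> c' +
  M: dual_module R M + M': dual_module R' M'
 for F :: "('f, 'x2) ring_scheme" and e :: "'f => 'g" and F' :: "('g, 'x3) ring_scheme"
  and R :: "('r, 'y1) bold_ring_scheme" and R' :: "('s, 'y2) bold_ring_scheme"
  and c \<phi> c' and M :: "('r, 'm, 'z1) bold_module_scheme" and M' :: "('s, 'n, 'z2) bold_module_scheme" +
 fixes \<iota> :: "'m => 'n"
 assumes \<iota>_additive: "additive_map M M' \<iota>"
  and \<iota>_smult: "r \<in> El R ==> x \<in> El M ==> \<iota> (r \<odot>\<^sub>M x) = \<phi> r \<odot>\<^sub>M' \<iota> x"
  and \<iota>_tau: "x \<in> El M ==> \<iota> (tau M x) = tau M' (\<iota> x)"
  and \<iota>_generates: "module_span R' M' (\<iota> ` El M) = El M'"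
  and functional_extends: "functional R M f ==>
   \<exists>f'. functional R' M' f' \<and> (\<forall>x\<in>El M. f' (\<iota> x) = \<phi> (f x))"
begin

lemma \<iota>_closed [simp]: "x \<in> El M ==> \<iota> x \<in> El M'"
 using \<iota>_additive by (auto simp: additive_map_def)

lemma \<iota>_add: "x \<in> El M ==> y \<in> El M ==> \<iota> (x \<oplus>\<^sub>M y) = \<iota> x \<oplus>\<^sub>M' \<iota> y"
 using \<iota>_additive by (auto simp: additive_map_def)

abbreviation "MF \<equiv> module_along c M"

lemma module_MF: "module F MF"
 by (rule module_along_module[OF F.cring_axioms M.module_axioms c_hom])

lemma M'_ab: "abelian_group M'"
 by (rule module.axioms(2)[OF M'.module_axioms])

abbreviation "mcomb S v \<equiv> \<Oplus>\<^sub>M' b\<in>S. c' b \<odot>\<^sub>M' \<iota> (v b)"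

lemma balanced_M: "balanced F FF' MF M' (%(b, x). c' b \<odot>\<^sub>M' \<iota> x)"
 by (simp add: balanced_def \<iota>_add \<iota>_smult M'.smult_r_distr M'.smult_l_distr ring_hom_add[OF c'_hom]
   ring_hom_mult[OF c'_hom] \<phi>_c M'.smult_assoc1[symmetric] R'.m_comm)

lemma mcomb_closed: "S <= El F' ==> v \<in> S \<rightarrow> El M ==> mcomb S v \<in> El M'"
 by (rule M'.M.finsum_closed) (auto simp: Pi_iff subset_iff)

lemma mcomb_add:
 assumes "S <= El F'" "v \<in> S \<rightarrow> El M" "w \<in> S \<rightarrow> El M"
 shows "mcomb S (%b. v b \<oplus>\<^sub>M w b) = mcomb S v \<oplus>\<^sub>M' mcomb S w"
 using balanced_add[OF module_MF M'_ab balanced_M] assms by simp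

lemma mcomb_smult:
 assumes "S <= El F'" "finite S" "v \<in> S \<rightarrow> El M" "r \<in> El R"
 shows "mcomb S (%b. r \<odot>\<^sub>M v b) = \<phi> r \<odot>\<^sub>M' mcomb S v"
proof -
 have cl: "b \<in> El F'" "v b \<in> El M" if "b \<in> S" for b using assms that by auto
 have "\<phi> r \<odot>\<^sub>M' mcomb S v = (\<Oplus>\<^sub>M' b\<in>S. \<phi> r \<odot>\<^sub>M' (c' b \<odot>\<^sub>M' \<iota> (v b)))"
  using assms(2,4) cl by (intro M'.finsum_smult_ldistr) auto
 also have "... = mcomb S (%b. r \<odot>\<^sub>M v b)"
  using assms(4) cl
  by (intro M'.M.finsum_cong') (auto simp: \<iota>_smult M'.smult_assoc1[symmetric] R'.m_comm)
 finally show ?thesis by simp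
qed

lemma mcomb_tau:
 assumes "S <= El F'" "v \<in> S \<rightarrow> El M"
 shows "mcomb S (%b. tau M (v b)) = tau M' (mcomb S v)"
proof -
 have cl: "b \<in> El F'" "v b \<in> El M" if "b \<in> S" for b using assms that by auto
 have "tau M' (mcomb S v) = (\<Oplus>\<^sub>M' b\<in>S. tau M' (c' b \<odot>\<^sub>M' \<iota> (v b)))"
  using cl by (intro additive_map_finsum[OF M'_ab M'_ab M'.tau_additive]) auto
 also have "... = mcomb S (%b. tau M (v b))"
  using cl by (intro M'.M.finsum_cong') (auto simp: \<iota>_tau M'.tau_smult c'_invariant)
 finally show ?thesis by simp
qed

lemma mcomb_zero:
 assumes "indep S" "v \<in> S \<rightarrow> El M" "mcomb S v = \<zero>\<^sub>M'" "b \<in> S"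
 shows "v b = \<zero>\<^sub>M"
proof -
 obtain A f where db: "dual_basis R M A f" using M.dual_basis_exists by blast
 note S = indepD(1,2)[OF assms(1)]
 have cl: "b \<in> El F'" "v b \<in> El M" if "b \<in> S" for b using assms S that by auto
 show ?thesis
 proof (rule M.functionals_separate[OF db])
  show "v b \<in> El M" using cl assms(4) by auto
  fix \<psi> assume \<psi>: "functional R M \<psi>"
  obtain \<psi>' where \<psi>': "functional R' M' \<psi>'" "\<And>x. x \<in> El M ==> \<psi>' (\<iota> x) = \<phi> (\<psi> x)"
   using functional_extends[OF \<psi>] by blast
  have "comb S (%b. \<psi> (v b)) = (\<Oplus>\<^sub>R' b\<in>S. \<psi>' (c' b \<odot>\<^sub>M' \<iota> (v b)))"
   using cl functionalD(1)[OF \<psi>] by (intro R'.finsum_cong') (auto simp: functionalD(3)[OF \<psi>'(1)] \<psi>'(2))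
  also have "... = \<psi>' (mcomb S v)"
   using cl by (intro M'.functional_finsum[OF \<psi>'(1), symmetric]) auto
  also have "... = \<zero>\<^sub>R'"
   using additive_map_zero[OF M'_ab R'.is_abelian_group functionalD(4)[OF \<psi>'(1)]] assms(3) by simp
  finally show "\<psi> (v b) = \<zero>\<^sub>R"
   using cl functionalD(1)[OF \<psi>] by (intro linearly_disjoint[OF assms(1) _ _ assms(4), of "%b. \<psi> (v b)"]) auto
 qed
qed

lemma mcomb_unique:
 assumes "indep S" "v \<in> S \<rightarrow> El M" "w \<in> S \<rightarrow> El M" "mcomb S v = mcomb S w" "b \<in> S"
 shows "v b = w b"
proof -
 note S = indepD(1,2)[OF assms(1)]
 let ?u = "%b. (\<ominus>\<^sub>R \<one>\<^sub>R) \<odot>\<^sub>M w b"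
 have u: "?u \<in> S \<rightarrow> El M" using assms(3) by auto
 have wc: "mcomb S w \<in> El M'" by (rule mcomb_closed[OF S(2) assms(3)])
 have "mcomb S (%b. v b \<oplus>\<^sub>M ?u b) = mcomb S v \<oplus>\<^sub>M' \<phi> (\<ominus>\<^sub>R \<one>\<^sub>R) \<odot>\<^sub>M' mcomb S w"
  unfolding mcomb_add[OF S(2) assms(2) u] mcomb_smult[OF S(2,1) assms(3) R.a_inv_closed[OF R.one_closed]] ..
 also have "... = \<zero>\<^sub>M'"
  using wc additive_map_neg[OF R.is_abelian_group R'.is_abelian_group \<phi>_additive R.one_closed]
  by (simp add: assms(4) ring_hom_one[OF \<phi>_hom] M'.smult_l_minus M'.M.r_neg)
 finally have "v b \<oplus>\<^sub>M ?u b = \<zero>\<^sub>M"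
  using assms(2) u by (intro mcomb_zero[OF assms(1) _ _ assms(5)]) auto
 moreover have c: "v b \<in> El M" "w b \<in> El M" using assms by auto
 ultimately have "v b \<oplus>\<^sub>M (\<ominus>\<^sub>M w b) = \<zero>\<^sub>M" by (simp add: M.smult_l_minus)
 from M.M.minus_equality[OF this] show ?thesis using c by simp
qed

definition mspan :: "'n set" where
 "mspan = {mcomb S v | S v. finite S \<and> S <= El F' \<and> v \<in> S \<rightarrow> El M}"

lemma mspanI: "finite S ==> S <= El F' ==> v \<in> S \<rightarrow> El M ==> x = mcomb S v ==> x \<in> mspan"
 unfolding mspan_def by blast

lemma mspan_carrier: "x \<in> mspan ==> x \<in> El M'"
 unfolding mspan_def using mcomb_closed by blast

lemma mspan_pure: "b \<in> El F' ==> x \<in> El M ==> c' b \<odot>\<^sub>M' \<iota> x \<in> mspan"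
 by (rule mspanI[of "{b}" "%_. x"]) simp_all

lemma mspan_zero: "\<zero>\<^sub>M' \<in> mspan"
 by (rule mspanI[of "{}" "%_. \<zero>\<^sub>M"]) simp_all

lemma mspan_add: assumes "x \<in> mspan" "y \<in> mspan" shows "x \<oplus>\<^sub>M' y \<in> mspan"
proof -
 obtain S1 v1 where 1: "finite S1" "S1 <= El F'" "v1 \<in> S1 \<rightarrow> El M" "x = mcomb S1 v1"
  using assms(1) by (auto simp: mspan_def)
 obtain S2 v2 where 2: "finite S2" "S2 <= El F'" "v2 \<in> S2 \<rightarrow> El M" "y = mcomb S2 v2"
  using assms(2) by (auto simp: mspan_def)
 from balanced_combination_add[OF module_MF M'_ab balanced_M 1(1,2) _ 2(1,2), of v1 v2] 1(3) 2(3)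
 obtain v where "v \<in> S1 \<union> S2 \<rightarrow> El M" "x \<oplus>\<^sub>M' y = mcomb (S1 \<union> S2) v"
  unfolding 1(4) 2(4) prod.case module_along_simps by blast
 thus ?thesis using 1(1,2) 2(1,2) by (intro mspanI[of "S1 \<union> S2" v]) auto
qed

lemma mspan_induct [consumes 1, case_names pure add]:
 assumes "x \<in> mspan"
  and pure: "\<And>b y. b \<in> El F' ==> y \<in> El M ==> P (c' b \<odot>\<^sub>M' \<iota> y)"
  and add: "\<And>x y. x \<in> mspan ==> y \<in> mspan ==> P x ==> P y ==> P (x \<oplus>\<^sub>M' y)"
 shows "P x"
proof -
 have P0: "P \<zero>\<^sub>M'"
  using pure[of "\<zero>\<^sub>F'" "\<zero>\<^sub>M"] ring_hom_zero[OF c'_hom F'.ring_axioms R'.ring_axioms] by simp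
 obtain S v where S: "finite S" "S <= El F'" "v \<in> S \<rightarrow> El M" "x = mcomb S v"
  using assms(1) by (auto simp: mspan_def)
 have "P (mcomb S v)"
  using S(1-3)
 proof (induction S)
  case (insert b S)
  have "mcomb (insert b S) v = c' b \<odot>\<^sub>M' \<iota> (v b) \<oplus>\<^sub>M' mcomb S v"
   using insert by (intro M'.M.finsum_insert) (auto simp: Pi_iff subset_iff)
  moreover have "mcomb S v \<in> mspan" using insert by (intro mspanI[of S v]) auto
  ultimately show ?case using insert by (auto intro!: add pure mspan_pure)
 qed (use P0 in simp)
 thus ?thesis using S(4) by simp
qed

lemma mspan_smult: assumes "d \<in> span" "x \<in> mspan" shows "d \<odot>\<^sub>M' x \<in> mspan"
 using assms(1)
proof (induction rule: span_induct)
 case p: (pure b r)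
 show ?case using assms(2)
 proof (induction rule: mspan_induct)
  case (pure b' y)
  have "(c' b \<otimes>\<^sub>R' \<phi> r) \<odot>\<^sub>M' (c' b' \<odot>\<^sub>M' \<iota> y) = c' (b \<otimes>\<^sub>F' b') \<odot>\<^sub>M' \<iota> (r \<odot>\<^sub>M y)"
   using p pure by (simp add: \<iota>_smult ring_hom_mult[OF c'_hom] M'.smult_assoc1[symmetric] R'.m_ac)
  thus ?case using mspan_pure p pure by simp
 next
  case (add x y)
  thus ?case using p mspan_carrier by (subst M'.smult_r_distr) (auto intro: mspan_add)
 qed
next
 case (add x1 x2)
 thus ?case using assms(2) mspan_carrier span_carrier by (subst M'.smult_l_distr) (auto intro: mspan_add)
qed

lemma mspan_tau: assumes "x \<in> mspan" shows "tau M' x \<in> mspan"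
proof -
 obtain S v where S: "finite S" "S <= El F'" "v \<in> S \<rightarrow> El M" "x = mcomb S v"
  using assms by (auto simp: mspan_def)
 thus ?thesis
  by (intro mspanI[of S "%b. tau M (v b)"]) (auto simp: mcomb_tau Pi_iff)
qed


lemma module_denominator:
 assumes "x \<in> El M'"
 shows "\<exists>d\<in>span. d \<in> Units R' \<and> d \<odot>\<^sub>M' x \<in> mspan"
proof -
 have one: "\<one>\<^sub>R' \<in> span" using c'_span[OF F'.one_closed] by (simp add: ring_hom_one[OF c'_hom])
 have c: "x \<in> El M'" if "x \<in> module_span R' M' (\<iota> ` El M)" for x
  using that \<iota>_generates by simp
 have "x \<in> module_span R' M' (\<iota> ` El M)" using assms \<iota>_generates by simp
 thus ?thesis
 proof induction
  case zero
  show ?case using one mspan_zero by (intro bexI[of _ "\<one>\<^sub>R'"]) auto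
 next
  case (base s)
  then obtain y where y: "y \<in> El M" "s = \<iota> y" by auto
  thus ?case
   using one mspan_pure[OF F'.one_closed y(1)]
   by (intro bexI[of _ "\<one>\<^sub>R'"]) (auto simp: ring_hom_one[OF c'_hom])
 next
  case (add x y)
  then obtain d d' where d: "d \<in> span" "d \<in> Units R'" "d \<odot>\<^sub>M' x \<in> mspan"
   and d': "d' \<in> span" "d' \<in> Units R'" "d' \<odot>\<^sub>M' y \<in> mspan" by blast
  have dc: "d \<in> El R'" "d' \<in> El R'" using d d' by auto
  have "(d \<otimes>\<^sub>R' d') \<odot>\<^sub>M' (x \<oplus>\<^sub>M' y) = d' \<odot>\<^sub>M' (d \<odot>\<^sub>M' x) \<oplus>\<^sub>M' d \<odot>\<^sub>M' (d' \<odot>\<^sub>M' y)"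
   using dc c[OF add.hyps(1)] c[OF add.hyps(2)]
   by (simp add: M'.smult_r_distr M'.smult_assoc1[symmetric] R'.m_comm)
  thus ?case
   using d d' span_mult by (intro bexI[of _ "d \<otimes>\<^sub>R' d'"]) (auto intro: mspan_add mspan_smult)
 next
  case (smult r x)
  then obtain d where d: "d \<in> span" "d \<in> Units R'" "d \<odot>\<^sub>M' x \<in> mspan" by blast
  obtain d' where d': "d' \<in> span" "d' \<in> Units R'" "d' \<otimes>\<^sub>R' r \<in> span" using fractions smult by blast
  have dc: "d \<in> El R'" "d' \<in> El R'" using d d' by auto
  have "(d \<otimes>\<^sub>R' d') \<odot>\<^sub>M' (r \<odot>\<^sub>M' x) = (d' \<otimes>\<^sub>R' r) \<odot>\<^sub>M' (d \<odot>\<^sub>M' x)"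
   using dc c[OF smult.hyps(2)] smult.hyps(1) by (simp add: M'.smult_assoc1[symmetric] R'.m_ac)
  thus ?case
   using d d' span_mult by (intro bexI[of _ "d \<otimes>\<^sub>R' d'"]) (auto intro: mspan_smult)
 qed
qed

lemma extension_unique:
 assumes "module R' N'" "linear_map R' M' N' g" "linear_map R' M' N' h"
  and "\<And>x. x \<in> El M ==> g (\<iota> x) = h (\<iota> x)" "x \<in> El M'"
 shows "g x = h x"
proof (rule linear_map_eq_on_span[OF M'.module_axioms assms(1-3)])
 show "x \<in> module_span R' M' (\<iota> ` El M)" using assms(5) \<iota>_generates by simp
qed (use assms(4) in auto)

lemma extension_exists:
 assumes N': "module R' N'" and g: "additive_map M N' g"
  and g_smult: "\<And>r x. r \<in> El R ==> x \<in> El M ==> g (r \<odot>\<^sub>M x) = \<phi> r \<odot>\<^sub>N' g x"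
 shows "\<exists>h'. linear_map R' M' N' h' \<and> (\<forall>x\<in>El M. h' (\<iota> x) = g x)"
proof -
 interpret N': module R' N' by fact
 obtain A f where db: "dual_basis R M A f" using M.dual_basis_exists by blast
 note dbD = M.dual_basisD[OF db]
 have "\<forall>a\<in>A. \<exists>f'. functional R' M' f' \<and> (\<forall>x\<in>El M. f' (\<iota> x) = \<phi> (f a x))"
  using functional_extends dbD(3) by blast
 from bchoice[OF this] obtain f' where
  f': "\<And>a. a \<in> A ==> functional R' M' (f' a)" "\<And>a x. a \<in> A ==> x \<in> El M ==> f' a (\<iota> x) = \<phi> (f a x)" by blast
 have gc: "g a \<in> El N'" if "a \<in> A" for a using additive_map_closed[OF g dbD(2)[OF that]] .
 have lin: "linear_map R' M' N' (%x. \<Oplus>\<^sub>N' a\<in>B. f' a x \<odot>\<^sub>N' g a)" if "finite B" "B <= A" for B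
  using that
 proof (induction B)
  case empty
  thus ?case by (simp add: linear_map_def additive_map_def)
 next
  case (insert b B)
  have bA: "b \<in> A" "B <= A" using insert by auto
  note fb = functionalD[OF f'(1)]
  have eq: "(\<Oplus>\<^sub>N' a\<in>insert b B. f' a x \<odot>\<^sub>N' g a) =
    f' b x \<odot>\<^sub>N' g b \<oplus>\<^sub>N' (\<Oplus>\<^sub>N' a\<in>B. f' a x \<odot>\<^sub>N' g a)" if "x \<in> El M'" for x
   using insert.hyps that bA gc fb(1) by (intro N'.M.finsum_insert) (auto simp: subset_iff)
  note IH = linear_mapD[OF insert.IH[OF bA(2)]]
  show ?case
   using IH(1-3) fb(1-3)[OF bA(1)] gc[OF bA(1)] bA
   by (auto simp: linear_map_def additive_map_def eq N'.smult_l_distr N'.smult_r_distr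
     N'.smult_assoc1 N'.M.a_ac)
 qed
 have "(\<Oplus>\<^sub>N' a\<in>A. f' a (\<iota> x) \<odot>\<^sub>N' g a) = g x" if x: "x \<in> El M" for x
 proof -
  have "(\<Oplus>\<^sub>N' a\<in>A. f' a (\<iota> x) \<odot>\<^sub>N' g a) = (\<Oplus>\<^sub>N' a\<in>A. g (f a x \<odot>\<^sub>M a))"
   using f' x dbD gc by (intro N'.M.finsum_cong') (auto simp: g_smult)
  also have "... = g (\<Oplus>\<^sub>M a\<in>A. f a x \<odot>\<^sub>M a)"
   using x dbD
   by (intro additive_map_finsum[OF _ _ g, symmetric] module.axioms(2)[OF N'] module.axioms(2)[OF M.module_axioms]) auto
  finally show ?thesis using dbD(4)[OF x] by simp
 qed
 thus ?thesis using lin[OF dbD(1) order.refl] by (intro exI[of _ "%x. \<Oplus>\<^sub>N' a\<in>A. f' a x \<odot>\<^sub>N' g a"]) auto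
qed

lemma extension_tau:
 assumes N': "bold_module R' N'" and h': "linear_map R' M' N' h'"
  and eq: "\<And>x. x \<in> El M ==> h' (tau M' (\<iota> x)) = tau N' (h' (\<iota> x))" and x: "x \<in> El M'"
 shows "h' (tau M' x) = tau N' (h' x)"
proof -
 interpret N': bold_module R' N' by fact
 note hD = linear_mapD[OF h']
 have c: "x \<in> El M'" if "x \<in> module_span R' M' (\<iota> ` El M)" for x
  using that \<iota>_generates by simp
 have N'ab: "abelian_group N'" by (rule module.axioms(2)[OF N'.module_axioms])
 have "x \<in> module_span R' M' (\<iota> ` El M)" using x \<iota>_generates by simp
 thus ?thesis
 proof induction
  case zero
  have "additive_map N' N' (tau N')" using N'.tau_closed by (auto simp: additive_map_def N'.tau_add)
  thus ?case
   using additive_map_zero[OF M'_ab N'ab hD(4)] additive_map_zero[OF N'ab N'ab, of "tau N'"] by simp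
 next
  case (base s)
  thus ?case using eq by auto
 next
  case (add x y)
  thus ?case using c[OF add.hyps(1)] c[OF add.hyps(2)] hD by (simp add: M'.tau_add N'.tau_add)
 next
  case (smult r x)
  thus ?case using c[OF smult.hyps(2)] hD by (simp add: M'.tau_smult N'.tau_smult)
 qed
qed

end

locale base_change_pair =
 BM: base_change F e F' R R' c \<phi> c' M M' \<iota> + BN: base_change F e F' R R' c \<phi> c' N N' \<kappa>
 for F :: "('f, 'x2) ring_scheme" and e :: "'f => 'g" and F' :: "('g, 'x3) ring_scheme"
  and R :: "('r, 'y1) bold_ring_scheme" and R' :: "('s, 'y2) bold_ring_scheme"
  and c \<phi> c' and M :: "('r, 'm, 'z1) bold_module_scheme" and M' :: "('s, 'm', 'z2) bold_module_scheme" and \<iota>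
  and N :: "('r, 'n, 'w1) bold_module_scheme" and N' :: "('s, 'n', 'w2) bold_module_scheme" and \<kappa>
begin

text \<open>The scalars \<open>d\<close> such that \<open>d \<odot> h'\<close> maps \<open>M\<close> into sums \<open>\<Sum> b \<cdot> n\<close> form a stable subgroup, which contains a common
denominator for a finite set of generators and therefore \<open>1\<close>. The components with respect to independent
\<open>b\<close> are linear and commute with \<open>\<tau>\<close> by uniqueness.\<close>
theorem hom_decomposition:
 assumes h': "linear_map R' M' N' h'" and h'_tau: "\<And>x. x \<in> El M' ==> h' (tau M' x) = tau N' (h' x)"
 shows "\<exists>S h. BM.indep S \<and>
  (\<forall>b\<in>S. linear_map R M N (h b) \<and> (\<forall>x\<in>El M. h b (tau M x) = tau N (h b x))) \<and>
  (\<forall>x\<in>El M. h' (\<iota> x) = BN.mcomb S (%b. h b x))"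
proof -
 note hD = linear_mapD[OF h']
 obtain A f where db: "dual_basis R M A f" using BM.M.dual_basis_exists by blast
 note dbD = BM.M.dual_basisD[OF db]
 have generated: "x \<in> P" if "submodule P R M" "A <= P" "x \<in> El M" for x P
 proof -
  have "(\<Oplus>\<^sub>M a\<in>A. f a x \<odot>\<^sub>M a) \<in> P"
   using that dbD by (intro BM.M.submodule_sum[OF that(1)] BM.M.submodule_smult[OF that(1)]) auto
  thus ?thesis using dbD(4)[OF that(3)] by simp
 qed
 define I where "I = {d \<in> El R'. \<forall>x\<in>El M. d \<odot>\<^sub>N' h' (\<iota> x) \<in> BN.mspan}"
 have sub: "submodule {x \<in> El M. d \<odot>\<^sub>N' h' (\<iota> x) \<in> BN.mspan} R M" if d: "d \<in> El R'" for d
 proof (rule BM.M.submoduleI)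
  have smult: "r \<odot>\<^sub>M x \<in> {x \<in> El M. d \<odot>\<^sub>N' h' (\<iota> x) \<in> BN.mspan}"
   if "r \<in> El R" "x \<in> {x \<in> El M. d \<odot>\<^sub>N' h' (\<iota> x) \<in> BN.mspan}" for r x
  proof -
   have "d \<odot>\<^sub>N' h' (\<iota> (r \<odot>\<^sub>M x)) = \<phi> r \<odot>\<^sub>N' (d \<odot>\<^sub>N' h' (\<iota> x))"
    using that d hD by (auto simp: BM.\<iota>_smult BN.M'.smult_assoc1[symmetric] BM.R'.m_comm)
   thus ?thesis using that BM.\<phi>_span BN.mspan_smult by auto
  qed
  thus "\<And>r x. r \<in> El R ==> x \<in> {x \<in> El M. d \<odot>\<^sub>N' h' (\<iota> x) \<in> BN.mspan} ==>
    r \<odot>\<^sub>M x \<in> {x \<in> El M. d \<odot>\<^sub>N' h' (\<iota> x) \<in> BN.mspan}" .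
  show "\<ominus>\<^sub>M x \<in> {x \<in> El M. d \<odot>\<^sub>N' h' (\<iota> x) \<in> BN.mspan}"
   if "x \<in> {x \<in> El M. d \<odot>\<^sub>N' h' (\<iota> x) \<in> BN.mspan}" for x
   using smult[of "\<ominus>\<^sub>R \<one>\<^sub>R" x] that by (simp add: BM.M.smult_l_minus)
  show "\<zero>\<^sub>M \<in> {x \<in> El M. d \<odot>\<^sub>N' h' (\<iota> x) \<in> BN.mspan}"
   using d BN.mspan_zero additive_map_zero[OF BM.M'_ab BN.M'_ab hD(4)]
    additive_map_zero[OF module.axioms(2)[OF BM.M.module_axioms] BM.M'_ab BM.\<iota>_additive] by simp
  show "x \<oplus>\<^sub>M y \<in> {x \<in> El M. d \<odot>\<^sub>N' h' (\<iota> x) \<in> BN.mspan}"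
   if "x \<in> {x \<in> El M. d \<odot>\<^sub>N' h' (\<iota> x) \<in> BN.mspan}" "y \<in> {x \<in> El M. d \<odot>\<^sub>N' h' (\<iota> x) \<in> BN.mspan}" for x y
   using that d hD BN.mspan_add by (auto simp: BM.\<iota>_add BN.M'.smult_r_distr)
 qed auto
 have "\<one>\<^sub>R' \<in> I"
 proof -
  have "\<exists>d\<in>BM.span. d \<in> Units R' \<and> (\<forall>a\<in>B. d \<odot>\<^sub>N' h' (\<iota> a) \<in> BN.mspan)" if "finite B" "B <= A" for B
   using that
  proof (induction B)
   case empty
   thus ?case using BM.c'_span[OF BM.F'.one_closed]
    by (auto simp: ring_hom_one[OF BM.c'_hom] intro!: bexI[of _ "\<one>\<^sub>R'"])
  next
   case (insert a B)
   then obtain d where d: "d \<in> BM.span" "d \<in> Units R'" "\<forall>a\<in>B. d \<odot>\<^sub>N' h' (\<iota> a) \<in> BN.mspan" by auto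
   have hc: "h' (\<iota> b) \<in> El N'" if "b \<in> insert a B" for b using insert that dbD(2) hD(1) by auto
   obtain d' where d': "d' \<in> BM.span" "d' \<in> Units R'" "d' \<odot>\<^sub>N' h' (\<iota> a) \<in> BN.mspan"
    using BN.module_denominator[OF hc[of a]] by auto
   have dc: "d \<in> El R'" "d' \<in> El R'" using d d' by auto
   show ?case
   proof (intro bexI[of _ "d' \<otimes>\<^sub>R' d"] conjI ballI)
    fix t assume t: "t \<in> insert a B"
    have "(d' \<otimes>\<^sub>R' d) \<odot>\<^sub>N' h' (\<iota> t) = d' \<odot>\<^sub>N' (d \<odot>\<^sub>N' h' (\<iota> t))"
     "(d' \<otimes>\<^sub>R' d) \<odot>\<^sub>N' h' (\<iota> t) = d \<odot>\<^sub>N' (d' \<odot>\<^sub>N' h' (\<iota> t))"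
     using dc hc[OF t] by (simp_all add: BN.M'.smult_assoc1[symmetric] BM.R'.m_comm)
    thus "(d' \<otimes>\<^sub>R' d) \<odot>\<^sub>N' h' (\<iota> t) \<in> BN.mspan"
     using t d d' BN.mspan_smult by (cases "t = a") auto
   qed (use d d' BM.span_mult in auto)
  qed
  then obtain d where d: "d \<in> BM.span" "d \<in> Units R'" "\<forall>a\<in>A. d \<odot>\<^sub>N' h' (\<iota> a) \<in> BN.mspan"
   using dbD(1) by blast
  have dc: "d \<in> El R'" using d by auto
  have dI: "d \<in> I"
   using generated[OF sub[OF dc]] d(3) dbD(2) dc by (auto simp: I_def)
  have hc: "h' (\<iota> x) \<in> El N'" if "x \<in> El M" for x using hD(1) that by auto
  have mult: "s \<otimes>\<^sub>R' y \<in> I" if "s \<in> BM.span" "y \<in> I" for s y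
   using that BM.span_carrier hc BN.mspan_smult by (auto simp: I_def BN.M'.smult_assoc1 subset_iff)
  show ?thesis
  proof (rule BM.stable_subgroup_one[OF _ _ _ _ _ dI d(1) BM.unit_not_zero[OF d(2)]])
   show "I <= El R'" by (auto simp: I_def)
   show "x \<oplus>\<^sub>R' y \<in> I" if "x \<in> I" "y \<in> I" for x y
    using that hc BN.mspan_add by (auto simp: I_def BN.M'.smult_l_distr)
   show "\<phi> r \<otimes>\<^sub>R' x \<in> I" if "r \<in> El R" "x \<in> I" for r x using that BM.\<phi>_span mult by blast
   show "c' b \<otimes>\<^sub>R' x \<in> I" if "b \<in> El F'" "x \<in> I" for b x using that BM.c'_span mult by blast
   show "endo R' x \<in> I" if x: "x \<in> I" for x
   proof -
    have xc: "x \<in> El R'" "endo R' x \<in> El R'" using x by (auto simp: I_def)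
    let ?P = "{y \<in> El M. endo R' x \<odot>\<^sub>N' h' (\<iota> y) \<in> BN.mspan}"
    have "tau M ` El M <= ?P"
    proof
     fix z assume "z \<in> tau M ` El M"
     then obtain y where y: "y \<in> El M" "z = tau M y" by auto
     have "endo R' x \<odot>\<^sub>N' h' (\<iota> z) = tau N' (x \<odot>\<^sub>N' h' (\<iota> y))"
      using y xc hc h'_tau by (simp add: BM.\<iota>_tau BN.M'.tau_smult)
     thus "z \<in> ?P" using x y BN.mspan_tau by (auto simp: I_def)
    qed
    from BM.M.module_span_least[OF sub[OF xc(2)] this]
    have "El M <= ?P" using BM.M.tau_generates[OF BM.M.carrier_tau_submodule] by simp
    thus ?thesis using xc by (auto simp: I_def)
   qed
  qed
 qed
 hence hm: "h' (\<iota> x) \<in> BN.mspan" if "x \<in> El M" for x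
  using that hD(1) by (auto simp: I_def dest!: bspec[of _ _ x])
 have "\<exists>S. finite S \<and> S <= El F' \<and> (\<forall>a\<in>B. \<exists>v\<in>S \<rightarrow> El N. h' (\<iota> a) = BN.mcomb S v)" if "finite B" "B <= A" for B
  using that
 proof (induction B)
  case (insert a B)
  then obtain S where S: "finite S" "S <= El F'" "\<forall>a\<in>B. \<exists>v\<in>S \<rightarrow> El N. h' (\<iota> a) = BN.mcomb S v" by auto
  have "h' (\<iota> a) \<in> BN.mspan" using insert dbD(2) hm by auto
  then obtain S2 v2 where S2: "finite S2" "S2 <= El F'" "v2 \<in> S2 \<rightarrow> El N" "h' (\<iota> a) = BN.mcomb S2 v2"
   unfolding BN.mspan_def by auto
  have ext: "\<exists>v'\<in>S \<union> S2 \<rightarrow> El N. BN.mcomb S1 v = BN.mcomb (S \<union> S2) v'"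
   if "v \<in> S1 \<rightarrow> El N" "S1 <= S \<union> S2" for v S1
   using BM.balanced_extend[OF BN.module_MF BN.M'_ab BN.balanced_M _ that(2), of v,
     unfolded module_along_simps prod.case] S S2 that
   by (intro bexI[of _ "%b. if b \<in> S1 then v b else \<zero>\<^sub>N"]) auto
  have "\<exists>v\<in>S \<union> S2 \<rightarrow> El N. h' (\<iota> t) = BN.mcomb (S \<union> S2) v" if t: "t \<in> insert a B" for t
  proof (cases "t = a")
   case True
   thus ?thesis using ext[OF S2(3)] S2(4) by auto
  next
   case False
   then obtain v where "v \<in> S \<rightarrow> El N" "h' (\<iota> t) = BN.mcomb S v" using t S(3) by auto
   thus ?thesis using ext[of v S] by auto
  qed
  thus ?case using S S2 by (intro exI[of _ "S \<union> S2"]) auto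
 qed auto
 from this[OF dbD(1) order.refl] obtain S0 where S0: "finite S0" "S0 <= El F'"
  "\<forall>a\<in>A. \<exists>v\<in>S0 \<rightarrow> El N. h' (\<iota> a) = BN.mcomb S0 v" by blast
 from BM.balanced_reduce[OF BN.module_MF BN.M'_ab BN.balanced_M S0(1,2)]
 obtain S where S: "BM.indep S" "\<And>v. v \<in> S0 \<rightarrow> El N ==> \<exists>v'\<in>S \<rightarrow> El N. BN.mcomb S0 v = BN.mcomb S v'"
  by auto
 note S' = BM.indepD(1,2)[OF S(1)]
 let ?P = "{x \<in> El M. \<exists>v\<in>S \<rightarrow> El N. h' (\<iota> x) = BN.mcomb S v}"
 have "submodule ?P R M"
 proof (rule BM.M.submoduleI)
  have smult: "r \<odot>\<^sub>M x \<in> ?P" if rx: "r \<in> El R" "x \<in> ?P" for r x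
  proof -
   from rx(2) obtain v where v: "v \<in> S \<rightarrow> El N" "h' (\<iota> x) = BN.mcomb S v" by auto
   have "h' (\<iota> (r \<odot>\<^sub>M x)) = BN.mcomb S (%b. r \<odot>\<^sub>N v b)"
    using rx hD(3) v(2) BN.mcomb_smult[OF S'(2,1) v(1) rx(1)] by (simp add: BM.\<iota>_smult)
   thus ?thesis using rx v(1) by (auto intro!: bexI[of _ "%b. r \<odot>\<^sub>N v b"])
  qed
  thus "\<And>r x. r \<in> El R ==> x \<in> ?P ==> r \<odot>\<^sub>M x \<in> ?P" .
  show "\<ominus>\<^sub>M x \<in> ?P" if "x \<in> ?P" for x
   using smult[of "\<ominus>\<^sub>R \<one>\<^sub>R" x] that by (simp add: BM.M.smult_l_minus)
  have "BN.mcomb S (%b. \<zero>\<^sub>N) = \<zero>\<^sub>N'"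
   using S'(2) additive_map_zero[OF module.axioms(2)[OF BN.M.module_axioms] BN.M'_ab BN.\<iota>_additive]
   by (intro BN.M'.M.add.finprod_one_eqI) auto
  thus "\<zero>\<^sub>M \<in> ?P"
   using additive_map_zero[OF BM.M'_ab BN.M'_ab hD(4)]
    additive_map_zero[OF module.axioms(2)[OF BM.M.module_axioms] BM.M'_ab BM.\<iota>_additive]
   by (auto intro!: bexI[of _ "%b. \<zero>\<^sub>N"])
  show "x \<oplus>\<^sub>M y \<in> ?P" if xy: "x \<in> ?P" "y \<in> ?P" for x y
  proof -
   from xy(1) obtain v where v: "v \<in> S \<rightarrow> El N" "h' (\<iota> x) = BN.mcomb S v" by auto
   from xy(2) obtain w where w: "w \<in> S \<rightarrow> El N" "h' (\<iota> y) = BN.mcomb S w" by auto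
   have "h' (\<iota> (x \<oplus>\<^sub>M y)) = BN.mcomb S (%b. v b \<oplus>\<^sub>N w b)"
    using xy hD(2) v(2) w(2) BN.mcomb_add[OF S'(2) v(1) w(1)] by (simp add: BM.\<iota>_add)
   thus ?thesis using xy v(1) w(1) by (auto intro!: bexI[of _ "%b. v b \<oplus>\<^sub>N w b"])
  qed
 qed auto
 moreover have "A <= ?P"
 proof
  fix a assume a: "a \<in> A"
  then obtain v where "v \<in> S0 \<rightarrow> El N" "h' (\<iota> a) = BN.mcomb S0 v" using S0(3) by auto
  thus "a \<in> ?P" using S(2)[of v] dbD(2)[OF a] by auto
 qed
 ultimately have "\<forall>x\<in>El M. \<exists>v. v \<in> S \<rightarrow> El N \<and> h' (\<iota> x) = BN.mcomb S v"
  using generated by blast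
 from bchoice[OF this] obtain v where
  v: "\<And>x. x \<in> El M ==> v x \<in> S \<rightarrow> El N" "\<And>x. x \<in> El M ==> h' (\<iota> x) = BN.mcomb S (v x)" by blast
 have vc: "v x b \<in> El N" if "x \<in> El M" "b \<in> S" for x b using v(1) that by auto
 have lin: "linear_map R M N (%x. v x b)" and tau: "\<And>x. x \<in> El M ==> v (tau M x) b = tau N (v x b)" if b: "b \<in> S" for b
 proof -
  have "v (x \<oplus>\<^sub>M y) b = v x b \<oplus>\<^sub>N v y b" if xy: "x \<in> El M" "y \<in> El M" for x y
  proof (rule BN.mcomb_unique[OF S(1) _ _ _ b, of "v (x \<oplus>\<^sub>M y)" "%b. v x b \<oplus>\<^sub>N v y b"])
   show "BN.mcomb S (v (x \<oplus>\<^sub>M y)) = BN.mcomb S (%b. v x b \<oplus>\<^sub>N v y b)"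
    using xy v(2)[of "x \<oplus>\<^sub>M y"] v(2)[OF xy(1)] v(2)[OF xy(2)] hD(2)[of "\<iota> x" "\<iota> y"]
    by (simp add: BN.mcomb_add[OF S'(2) v(1)[OF xy(1)] v(1)[OF xy(2)]] BM.\<iota>_add)
  qed (use xy vc v(1) in auto)
  moreover have "v (r \<odot>\<^sub>M x) b = r \<odot>\<^sub>N v x b" if rx: "r \<in> El R" "x \<in> El M" for r x
  proof (rule BN.mcomb_unique[OF S(1) _ _ _ b, of "v (r \<odot>\<^sub>M x)" "%b. r \<odot>\<^sub>N v x b"])
   show "BN.mcomb S (v (r \<odot>\<^sub>M x)) = BN.mcomb S (%b. r \<odot>\<^sub>N v x b)"
    using rx v(2)[of "r \<odot>\<^sub>M x"] v(2)[OF rx(2)] hD(3)[of "\<phi> r" "\<iota> x"]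
    by (simp add: BN.mcomb_smult[OF S'(2,1) v(1)[OF rx(2)] rx(1)] BM.\<iota>_smult)
  qed (use rx vc v(1) in auto)
  ultimately show "linear_map R M N (%x. v x b)"
   using vc b by (auto simp: linear_map_def additive_map_def)
  show "v (tau M x) b = tau N (v x b)" if x: "x \<in> El M" for x
  proof (rule BN.mcomb_unique[OF S(1) _ _ _ b, of "v (tau M x)" "%b. tau N (v x b)"])
   show "BN.mcomb S (v (tau M x)) = BN.mcomb S (%b. tau N (v x b))"
    using x v(2)[of "tau M x"] v(2)[OF x] h'_tau[of "\<iota> x"]
    by (simp add: BN.mcomb_tau[OF S'(2) v(1)[OF x]] BM.\<iota>_tau)
  qed (use x vc v(1) in auto)
 qed
 show ?thesis
  using S(1) lin tau v(2) by (intro exI[of _ S] exI[of _ "%b x. v x b"]) auto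
qed

end

section \<open>Endomorphisms of a simple module\<close>

definition bold_map ::
 "('r, 'x) bold_ring_scheme => ('r, 'm, 'y) bold_module_scheme => ('r, 'n, 'z) bold_module_scheme
  => ('m => 'n) => bool" where
 "bold_map R M N h \<longleftrightarrow> linear_map R M N h \<and> (\<forall>x\<in>El M. h (tau M x) = tau N (h x))"

lemma bold_homs_iff:
 "h \<in> bold_homs R M N \<longleftrightarrow> bold_map R M N h \<and> h \<in> extensional (El M)"
 by (auto simp: bold_homs_def bold_map_def linear_maps_def linear_map_def additive_map_def PiE_def)

definition simple_sub ::
 "('r, 'x) bold_ring_scheme => ('r, 'm, 'y) bold_module_scheme => 'm set => bool" where
 "simple_sub R M N \<longleftrightarrow> tau_submodule R M N \<and> N ~= {\<zero>\<^sub>M} \<and>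
   (\<forall>N'. tau_submodule R M N' --> N' <= N --> N' = {\<zero>\<^sub>M} \<or> N' = N)"

context dual_module
begin

lemma tau_submoduleI:
 assumes "N <= El M" "\<zero>\<^sub>M \<in> N" "\<And>x y. x \<in> N ==> y \<in> N ==> x \<oplus>\<^sub>M y \<in> N"
  and "\<And>r x. r \<in> El R ==> x \<in> N ==> r \<odot>\<^sub>M x \<in> N" "\<And>x. x \<in> N ==> tau M x \<in> N"
 shows "tau_submodule R M N"
proof -
 have "\<ominus>\<^sub>M x \<in> N" if "x \<in> N" for x
  using assms(4)[of "\<ominus> \<one>" x] assms(1) that by (auto simp: smult_l_minus)
 hence "submodule N R M" by (intro submoduleI assms) auto
 thus ?thesis using assms(5) by (auto simp: tau_submodule_def)
qed

lemma tau_submoduleD: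
 assumes "tau_submodule R M N"
 shows "x \<in> N ==> x \<in> El M" "\<zero>\<^sub>M \<in> N" "x \<in> N ==> y \<in> N ==> x \<oplus>\<^sub>M y \<in> N"
  "r \<in> El R ==> x \<in> N ==> r \<odot>\<^sub>M x \<in> N" "x \<in> N ==> tau M x \<in> N" "x \<in> N ==> \<ominus>\<^sub>M x \<in> N"
proof -
 have s: "submodule N R M" and t: "tau M ` N <= N" using assms by (auto simp: tau_submodule_def)
 show "x \<in> N ==> x \<in> El M" by (rule submodule_carrier[OF s])
 show "\<zero>\<^sub>M \<in> N" by (rule submodule_zero[OF s])
 show "x \<in> N ==> y \<in> N ==> x \<oplus>\<^sub>M y \<in> N" by (rule submodule_add[OF s])
 show "r \<in> El R ==> x \<in> N ==> r \<odot>\<^sub>M x \<in> N" by (rule submodule_smult[OF s])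
 show "x \<in> N ==> tau M x \<in> N" using t by auto
 show "x \<in> N ==> \<ominus>\<^sub>M x \<in> N" by (rule submodule_neg[OF s])
qed

lemma bold_mapD:
 assumes "bold_map R M M h"
 shows "x \<in> El M ==> h x \<in> El M"
  and "x \<in> El M ==> y \<in> El M ==> h (x \<oplus>\<^sub>M y) = h x \<oplus>\<^sub>M h y"
  and "r \<in> El R ==> x \<in> El M ==> h (r \<odot>\<^sub>M x) = r \<odot>\<^sub>M h x"
  and "x \<in> El M ==> h (tau M x) = tau M (h x)"
  and "additive_map M M h" "h \<zero>\<^sub>M = \<zero>\<^sub>M" "linear_map R M M h"
proof -
 have l: "linear_map R M M h" and t: "\<forall>x\<in>El M. h (tau M x) = tau M (h x)"
  using assms by (auto simp: bold_map_def)
 note lD = linear_mapD[OF l]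
 show "x \<in> El M ==> h x \<in> El M" by (rule lD)
 show "x \<in> El M ==> y \<in> El M ==> h (x \<oplus>\<^sub>M y) = h x \<oplus>\<^sub>M h y" by (rule lD)
 show "r \<in> El R ==> x \<in> El M ==> h (r \<odot>\<^sub>M x) = r \<odot>\<^sub>M h x" by (rule lD)
 show "x \<in> El M ==> h (tau M x) = tau M (h x)" using t by simp
 show "additive_map M M h" by (rule lD)
 show "h \<zero>\<^sub>M = \<zero>\<^sub>M"
  by (rule additive_map_zero[OF M.abelian_group_axioms M.abelian_group_axioms lD(4)])
 show "linear_map R M M h" by (rule l)
qed

lemma bold_map_comp:
 assumes "bold_map R M M g" "bold_map R M M h" shows "bold_map R M M (%x. g (h x))"
 unfolding bold_map_def linear_map_def additive_map_def
 using bold_mapD(1-4)[OF assms(1)] bold_mapD(1-4)[OF assms(2)] by auto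

lemma bold_map_add:
 assumes "bold_map R M M g" "bold_map R M M h" shows "bold_map R M M (%x. g x \<oplus>\<^sub>M h x)"
proof -
 have "linear_map R M M (%x. g x \<oplus>\<^sub>M h x)"
  by (rule linear_map_add[OF bold_mapD(7)[OF assms(1)] bold_mapD(7)[OF assms(2)]])
 thus ?thesis
  unfolding bold_map_def using bold_mapD(1,4)[OF assms(1)] bold_mapD(1,4)[OF assms(2)] by (auto simp: tau_add)
qed

lemma bold_map_neg:
 assumes "bold_map R M M g" shows "bold_map R M M (%x. (\<ominus> \<one>) \<odot>\<^sub>M g x)"
proof -
 have "linear_map R M M (%x. (\<ominus> \<one>) \<odot>\<^sub>M g x)"
  by (rule linear_map_smult[OF bold_mapD(7)[OF assms]]) simp
 thus ?thesis
  unfolding bold_map_def using bold_mapD(1,4)[OF assms] by (auto simp: tau_smult sigma_neg)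
qed

lemma bold_map_id: "bold_map R M M (%x. x)"
 by (simp add: bold_map_def linear_map_def additive_map_def)

lemma kernel_tau_submodule:
 assumes "bold_map R M M h" shows "tau_submodule R M {x \<in> El M. h x = \<zero>\<^sub>M}"
 using bold_mapD[OF assms] by (intro tau_submoduleI) auto

lemma image_tau_submodule:
 assumes h: "bold_map R M M h" and N: "tau_submodule R M N" shows "tau_submodule R M (h ` N)"
proof -
 note hD = bold_mapD[OF h] and ND = tau_submoduleD[OF N]
 show ?thesis
 proof (rule tau_submoduleI)
  show "h ` N <= El M" using hD(1) ND(1) by auto
  show "\<zero>\<^sub>M \<in> h ` N" using hD(6) ND(2) by (metis image_eqI)
  show "x \<oplus>\<^sub>M y \<in> h ` N" if xy: "x \<in> h ` N" "y \<in> h ` N" for x y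
  proof -
   from xy obtain a b where "a \<in> N" "b \<in> N" "x = h a" "y = h b" by auto
   thus ?thesis using hD(2) ND by (intro image_eqI[of _ _ "a \<oplus>\<^sub>M b"]) auto
  qed
  show "r \<odot>\<^sub>M x \<in> h ` N" if rx: "r \<in> El R" "x \<in> h ` N" for r x
  proof -
   from rx obtain a where "a \<in> N" "x = h a" by auto
   thus ?thesis using rx hD(3) ND by (intro image_eqI[of _ _ "r \<odot>\<^sub>M a"]) auto
  qed
  show "tau M x \<in> h ` N" if x: "x \<in> h ` N" for x
  proof -
   from x obtain a where "a \<in> N" "x = h a" by auto
   thus ?thesis using hD(4) ND by (intro image_eqI[of _ _ "tau M a"]) auto
  qed
 qed
qed

lemma inter_tau_submodule:
 assumes "tau_submodule R M N" "tau_submodule R M N'" shows "tau_submodule R M (N \<inter> N')"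
 using tau_submoduleD[OF assms(1)] tau_submoduleD[OF assms(2)] by (intro tau_submoduleI) auto

lemma zero_tau_submodule: "tau_submodule R M {\<zero>\<^sub>M}"
 by (intro tau_submoduleI) auto

lemma span_tau_submodule:
 assumes "S <= El M" "tau M ` S <= module_span R M S" shows "tau_submodule R M (module_span R M S)"
proof (rule tau_submoduleI)
 note c = subsetD[OF module_span_carrier[OF assms(1)]]
 show "tau M x \<in> module_span R M S" if "x \<in> module_span R M S" for x
  using that
  by induction (use assms(2) c in \<open>auto simp: tau_add tau_smult intro: module_span.intros\<close>)
qed (use module_span_carrier[OF assms(1)] in \<open>auto intro: module_span.intros\<close>)

text \<open>The kernel and the image are \<open>\<tau>\<close>-stable, hence trivial.\<close>
lemma schur:
 assumes s: "simple_sub R M (El M)" and h: "bold_map R M M h" and x: "x \<in> El M" "h x ~= \<zero>\<^sub>M"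
 shows "bij_betw h (El M) (El M)"
proof -
 note hD = bold_mapD[OF h]
 have "{x \<in> El M. h x = \<zero>\<^sub>M} = {\<zero>\<^sub>M}"
  using s kernel_tau_submodule[OF h] x unfolding simple_sub_def by blast
 hence ker: "y = \<zero>\<^sub>M" if "y \<in> El M" "h y = \<zero>\<^sub>M" for y using that by auto
 have "h ` El M = El M"
  using s image_tau_submodule[OF h carrier_tau_submodule] x hD(1) unfolding simple_sub_def
  by (metis (no_types, lifting) image_eqI image_subsetI singletonD)
 moreover have "inj_on h (El M)"
 proof (rule inj_onI)
  fix y z assume yz: "y \<in> El M" "z \<in> El M" "h y = h z"
  have "h (y \<oplus>\<^sub>M (\<ominus>\<^sub>M z)) = \<zero>\<^sub>M"
   using yz hD(1) additive_map_neg[OF M.abelian_group_axioms M.abelian_group_axioms hD(5) yz(2)]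
   by (simp add: hD(2) M.r_neg)
  hence "y \<oplus>\<^sub>M (\<ominus>\<^sub>M z) = \<zero>\<^sub>M" using yz ker[of "y \<oplus>\<^sub>M (\<ominus>\<^sub>M z)"] by simp
  from M.minus_equality[OF this] show "y = z" using yz by simp
 qed
 ultimately show ?thesis by (simp add: bij_betw_def)
qed

lemma inverse_bold_map:
 assumes h: "bold_map R M M h" and b: "bij_betw h (El M) (El M)"
 shows "\<exists>g. bold_map R M M g \<and> (\<forall>x\<in>El M. h (g x) = x \<and> g (h x) = x)"
proof -
 note hD = bold_mapD[OF h]
 let ?g = "the_inv_into (El M) h"
 have inj: "inj_on h (El M)" and im: "h ` El M = El M" using b by (auto simp: bij_betw_def)
 have gc: "?g x \<in> El M" and hg: "h (?g x) = x" and gh: "?g (h x) = x" if "x \<in> El M" for x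
  using that im the_inv_into_into[OF inj, of x] f_the_inv_into_f[OF inj, of x] the_inv_into_f_f[OF inj, of x] by auto
 have eq: "?g y = x" if "x \<in> El M" "h x = y" for x y using gh that by auto
 have "bold_map R M M ?g"
  unfolding bold_map_def linear_map_def additive_map_def
  using gc hg hD by (auto intro!: eq)
 thus ?thesis using hg gh by blast
qed

subsection \<open>The endomorphism algebra is finite-dimensional\<close>

text \<open>A linear endomorphism is given by its matrix with respect to a dual basis, and more than
\<open>card (A \<times> A)\<close> independent maps would contradict the bound on frames.\<close>
lemma independent_bound:
 assumes db: "dual_basis R M A f" and h: "\<And>j. j < k ==> linear_map R M M (h j)"
  and ind: "\<And>r. r \<in> {..<k} \<rightarrow> El R ==> (\<And>x. x \<in> El M ==> (\<Oplus>\<^sub>M j\<in>{..<k}. r j \<odot>\<^sub>M h j x) = \<zero>\<^sub>M) ==>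
   (\<forall>j<k. r j = \<zero>)"
 shows "k \<le> card (A \<times> A)"
proof -
 note dbD = dual_basisD[OF db]
 define V where "V = h ` {..<k}"
 define \<kappa> where "\<kappa> t g = f (snd t) (g (fst t))" for t :: "'c \<times> 'c" and g :: "'c => 'c"
 define \<Phi> where "\<Phi> = {\<theta>. \<exists>t. (\<forall>p\<in>A \<times> A. t p \<in> El R) \<and> (\<forall>g\<in>V. \<theta> g = (\<Oplus>p\<in>A \<times> A. t p \<otimes> \<kappa> p g))}"
 have \<kappa>c: "\<kappa> p g \<in> El R" if "p \<in> A \<times> A" "g \<in> V" for p g
  using that dbD linear_mapD(1)[OF h] by (auto simp: \<kappa>_def V_def)
 have fin: "finite (A \<times> A)" using dbD(1) by simp
 have lf: "linear_family \<Phi> V"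
  unfolding linear_family_def
 proof (intro conjI ballI)
  fix \<theta> g assume "\<theta> \<in> \<Phi>" "g \<in> V"
  thus "\<theta> g \<in> El R" using \<kappa>c by (auto simp: \<Phi>_def intro!: R.finsum_closed)
 next
  show "(%v. \<zero>) \<in> \<Phi>" unfolding \<Phi>_def using \<kappa>c
   by (intro CollectI exI[of _ "%p. \<zero>"]) (auto intro!: R.add.finprod_one_eqI[symmetric])
 next
  fix \<theta> \<eta> assume "\<theta> \<in> \<Phi>" "\<eta> \<in> \<Phi>"
  then obtain t u where t: "\<forall>p\<in>A \<times> A. t p \<in> El R" "\<forall>g\<in>V. \<theta> g = (\<Oplus>p\<in>A \<times> A. t p \<otimes> \<kappa> p g)"
   and u: "\<forall>p\<in>A \<times> A. u p \<in> El R" "\<forall>g\<in>V. \<eta> g = (\<Oplus>p\<in>A \<times> A. u p \<otimes> \<kappa> p g)" unfolding \<Phi>_def by auto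
  have "\<theta> g \<oplus> \<eta> g = (\<Oplus>p\<in>A \<times> A. (t p \<oplus> u p) \<otimes> \<kappa> p g)" if g: "g \<in> V" for g
  proof -
   have "(\<Oplus>p\<in>A \<times> A. (t p \<oplus> u p) \<otimes> \<kappa> p g) = (\<Oplus>p\<in>A \<times> A. t p \<otimes> \<kappa> p g \<oplus> u p \<otimes> \<kappa> p g)"
    using t(1) u(1) \<kappa>c[OF _ g] by (intro R.finsum_cong') (auto simp: R.l_distr)
   also have "... = (\<Oplus>p\<in>A \<times> A. t p \<otimes> \<kappa> p g) \<oplus> (\<Oplus>p\<in>A \<times> A. u p \<otimes> \<kappa> p g)"
    using t(1) u(1) \<kappa>c[OF _ g] by (intro R.finsum_addf) auto
   finally show ?thesis using t(2) u(2) g by simp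
  qed
  thus "(%v. \<theta> v \<oplus> \<eta> v) \<in> \<Phi>"
   unfolding \<Phi>_def using t(1) u(1) by (intro CollectI exI[of _ "%p. t p \<oplus> u p"]) auto
 next
  fix r \<theta> assume r: "r \<in> El R" and "\<theta> \<in> \<Phi>"
  then obtain t where t: "\<forall>p\<in>A \<times> A. t p \<in> El R" "\<forall>g\<in>V. \<theta> g = (\<Oplus>p\<in>A \<times> A. t p \<otimes> \<kappa> p g)"
   unfolding \<Phi>_def by auto
  have "r \<otimes> \<theta> g = (\<Oplus>p\<in>A \<times> A. (r \<otimes> t p) \<otimes> \<kappa> p g)" if g: "g \<in> V" for g
  proof -
   have "r \<otimes> (\<Oplus>p\<in>A \<times> A. t p \<otimes> \<kappa> p g) = (\<Oplus>p\<in>A \<times> A. r \<otimes> (t p \<otimes> \<kappa> p g))"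
    using t(1) \<kappa>c[OF _ g] r fin by (intro R.finsum_rdistr) auto
   also have "... = (\<Oplus>p\<in>A \<times> A. (r \<otimes> t p) \<otimes> \<kappa> p g)"
    using t(1) \<kappa>c[OF _ g] r by (intro R.finsum_cong') (auto simp: R.m_assoc)
   finally show ?thesis using t(2) g by simp
  qed
  thus "(%v. r \<otimes> \<theta> v) \<in> \<Phi>"
   unfolding \<Phi>_def using t(1) r by (intro CollectI exI[of _ "%p. r \<otimes> t p"]) auto
 qed
 have \<kappa>\<Phi>: "\<kappa> p \<in> \<Phi>" if p: "p \<in> A \<times> A" for p
 proof -
  have "\<kappa> p g = (\<Oplus>q\<in>A \<times> A. (if q = p then \<one> else \<zero>) \<otimes> \<kappa> q g)" if g: "g \<in> V" for g
  proof -
   have "(\<Oplus>q\<in>A \<times> A. (if q = p then \<one> else \<zero>) \<otimes> \<kappa> q g) = (\<Oplus>q\<in>A \<times> A. if q = p then \<kappa> q g else \<zero>)"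
    using \<kappa>c[OF _ g] by (intro R.finsum_cong') auto
   thus ?thesis using R.finsum_delta[OF fin p, of "%q. \<kappa> q g"] \<kappa>c[OF p g] by simp
  qed
  thus ?thesis unfolding \<Phi>_def by (intro CollectI exI[of _ "%q. if q = p then \<one> else \<zero>"]) auto
 qed
 have "\<exists>\<phi> d. d ~= \<zero> \<and> frame \<Phi> l \<phi> h d" if "l \<le> k" for l
  using that
 proof (induction l)
  case 0
  have "frame \<Phi> 0 (%_. undefined) h \<one>" by (simp add: frame_def)
  thus ?case using one_not_zero by blast
 next
  case (Suc l)
  then obtain \<phi> d where d: "d ~= \<zero>" and fr: "frame \<Phi> l \<phi> h d" by auto
  have dc: "d \<in> El R" using fr by (simp add: frame_def)
  have hV: "h p \<in> V" if "p < k" for p using that by (auto simp: V_def)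
  have hl: "h l \<in> V" using hV Suc.prems by auto
  have \<phi>c: "\<phi> p (h l) \<in> El R" if "p < l" for p
  proof -
   have "\<phi> p \<in> \<Phi>" using fr that by (simp add: frame_def)
   thus ?thesis using lf hl unfolding linear_family_def by blast
  qed
  have same: "h(l := h l) = h" by simp
  show ?case
  proof (rule ccontr)
   assume contra: "\<not> ?case"
   have zero: "d \<otimes> (d \<otimes> \<kappa> p (h l) \<oplus> (\<Oplus>j\<in>{..<l}. (\<ominus> \<kappa> p (h j)) \<otimes> \<phi> j (h l))) = \<zero>" if p: "p \<in> A \<times> A" for p
   proof -
    have hp: "\<And>p. p < l ==> h p \<in> V" using hV Suc.prems by auto
    from frame_Suc[OF lf fr hp \<kappa>\<Phi>[OF p] hl] contra show ?thesis unfolding same by blast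
   qed
   define r where "r j = (if j < l then \<ominus> (d \<otimes> \<phi> j (h l)) else if j = l then d \<otimes> d else \<zero>)" for j
   have rc: "r \<in> {..<k} \<rightarrow> El R" using dc \<phi>c by (auto simp: r_def)
   have "\<forall>j<k. r j = \<zero>"
   proof (rule ind[OF rc])
    have lk: "{..<Suc l} <= {..<k}" "l < k" using Suc.prems by auto
    have rjc: "r j \<in> El R" if "j < k" for j using rc that by auto
    have hc: "h j x \<in> El M" if "j < k" "x \<in> El M" for j x using linear_mapD(1)[OF h] that by auto
    have S0: "(\<Oplus>\<^sub>M j\<in>{..<k}. r j \<odot>\<^sub>M h j a) = \<zero>\<^sub>M" if a: "a \<in> A" for a
    proof -
     have ac: "a \<in> El M" using dbD(2) a by auto
     let ?s = "\<Oplus>\<^sub>M j\<in>{..<k}. r j \<odot>\<^sub>M h j a"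
     have sc: "?s \<in> El M" using rjc hc ac by (intro M.finsum_closed) auto
     have "f b ?s = \<zero>" if b: "b \<in> A" for b
     proof -
      have \<kappa>h: "\<kappa> (a, b) (h j) \<in> El R" if "j < k" for j using \<kappa>c hV that a b by auto
      have "f b ?s = (\<Oplus>j\<in>{..<k}. f b (r j \<odot>\<^sub>M h j a))"
       using rjc hc ac by (intro functional_finsum[OF dbD(3)[OF b]]) auto
      also have "... = (\<Oplus>j\<in>{..<k}. r j \<otimes> \<kappa> (a, b) (h j))"
       using rjc hc ac \<kappa>h by (intro R.finsum_cong') (auto simp: functionalD(3)[OF dbD(3)[OF b]] \<kappa>_def)
      also have "... = (\<Oplus>j\<in>{..<Suc l}. r j \<otimes> \<kappa> (a, b) (h j))"
       using lk rjc \<kappa>h by (intro R.add.finprod_mono_neutral_cong_right) (auto simp: r_def)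
      also have "... = r l \<otimes> \<kappa> (a, b) (h l) \<oplus> (\<Oplus>j\<in>{..<l}. r j \<otimes> \<kappa> (a, b) (h j))"
       unfolding lessThan_Suc using lk rjc \<kappa>h by (intro R.finsum_insert) auto
      also have "(\<Oplus>j\<in>{..<l}. r j \<otimes> \<kappa> (a, b) (h j)) = (\<Oplus>j\<in>{..<l}. d \<otimes> ((\<ominus> \<kappa> (a, b) (h j)) \<otimes> \<phi> j (h l)))"
       using lk dc \<phi>c \<kappa>h by (intro R.finsum_cong') (auto simp: r_def R.l_minus R.r_minus R.m_ac)
      also have "... = d \<otimes> (\<Oplus>j\<in>{..<l}. (\<ominus> \<kappa> (a, b) (h j)) \<otimes> \<phi> j (h l))"
       using lk dc \<phi>c \<kappa>h by (intro R.finsum_rdistr[symmetric]) auto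
      also have "r l \<otimes> \<kappa> (a, b) (h l) \<oplus> d \<otimes> (\<Oplus>j\<in>{..<l}. (\<ominus> \<kappa> (a, b) (h j)) \<otimes> \<phi> j (h l)) =
        d \<otimes> (d \<otimes> \<kappa> (a, b) (h l) \<oplus> (\<Oplus>j\<in>{..<l}. (\<ominus> \<kappa> (a, b) (h j)) \<otimes> \<phi> j (h l)))"
      proof -
       have "(\<Oplus>j\<in>{..<l}. (\<ominus> \<kappa> (a, b) (h j)) \<otimes> \<phi> j (h l)) \<in> El R"
        using \<phi>c \<kappa>h lk by (intro R.finsum_closed) auto
       thus ?thesis using dc \<kappa>h[OF lk(2)] by (simp add: r_def R.r_distr R.m_assoc)
      qed
      also have "... = \<zero>" using zero a b by simp
      finally show ?thesis .
     qed
     hence "(\<Oplus>\<^sub>M b\<in>A. f b ?s \<odot>\<^sub>M b) = \<zero>\<^sub>M"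
      using dbD(2) by (intro M.add.finprod_one_eqI) auto
     thus ?thesis using dbD(4)[OF sc] by simp
    qed
    fix x assume x: "x \<in> El M"
    let ?g = "%x. \<Oplus>\<^sub>M j\<in>{..<k}. r j \<odot>\<^sub>M h j x"
    have lin: "linear_map R M M (%x. \<Oplus>\<^sub>M j\<in>J. r j \<odot>\<^sub>M h j x)" if "finite J" "J <= {..<k}" for J
     using that
    proof (induction J)
     case empty
     thus ?case by (simp add: linear_map_def additive_map_def)
    next
     case (insert j J)
     have eq: "(\<Oplus>\<^sub>M j\<in>insert j J. r j \<odot>\<^sub>M h j x) = r j \<odot>\<^sub>M h j x \<oplus>\<^sub>M (\<Oplus>\<^sub>M j\<in>J. r j \<odot>\<^sub>M h j x)"
      if "x \<in> El M" for x
      using insert that rjc hc by (intro M.finsum_insert) auto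
     have "linear_map R M M (%x. r j \<odot>\<^sub>M h j x)" using insert.prems h rjc by (intro linear_map_smult) auto
     from linear_map_add[OF this insert.IH] insert.prems show ?case
      by (auto simp: linear_map_def additive_map_def eq)
    qed
    note gl = lin[of "{..<k}", simplified]
    have "?g x = ?g (\<Oplus>\<^sub>M a\<in>A. f a x \<odot>\<^sub>M a)" using dbD(4)[OF x] by simp
    also have "... = (\<Oplus>\<^sub>M a\<in>A. ?g (f a x \<odot>\<^sub>M a))"
     using x dbD by (intro linear_map_finsum[OF module_axioms gl]) auto
    also have "... = \<zero>\<^sub>M"
    proof (rule M.add.finprod_one_eqI)
     fix a assume a: "a \<in> A"
     have "?g (f a x \<odot>\<^sub>M a) = f a x \<odot>\<^sub>M ?g a"
      using linear_mapD(3)[OF gl] dbD(2)[OF a] dbD(5)[OF a x] by blast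
     thus "?g (f a x \<odot>\<^sub>M a) = \<zero>\<^sub>M" using S0[OF a] dbD(5)[OF a x] by simp
    qed
    finally show "?g x = \<zero>\<^sub>M" .
   qed
   hence "r l = \<zero>" using Suc.prems by auto
   hence "d \<otimes> d = \<zero>" by (simp add: r_def)
   thus False using square_zero[OF dc] d by simp
  qed
 qed
 then obtain \<phi> d where d: "d ~= \<zero>" and fr: "frame \<Phi> k \<phi> h d" by blast
 show ?thesis
 proof (rule ccontr)
  assume "\<not> ?thesis"
  hence "d = \<zero>"
   by (intro frame_bound[OF fr _ _ fin \<kappa>c]) (auto simp: \<Phi>_def V_def)
  thus False using d by simp
 qed
qed

end

context base_change
begin

text \<open>The relations with coefficients in \<open>R\<close> are stable because the maps commute with \<open>\<tau>\<close> and the image of \<open>\<tau>\<close>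
generates \<open>M\<close>. A shortest one is invariant, hence a relation over \<open>F\<close>.\<close>
lemma invariant_maps_independent:
 fixes k :: nat
 assumes h: "\<And>j. j < k ==> bold_map R M M (h j)"
  and ind: "\<And>a. a \<in> {..<k} \<rightarrow> El F ==>
   (\<And>x. x \<in> El M ==> (\<Oplus>\<^sub>M j\<in>{..<k}. c (a j) \<odot>\<^sub>M h j x) = \<zero>\<^sub>M) ==> (\<forall>j<k. a j = \<zero>\<^sub>F)"
  and r: "r \<in> {..<k} \<rightarrow> El R" "\<And>x. x \<in> El M ==> (\<Oplus>\<^sub>M j\<in>{..<k}. r j \<odot>\<^sub>M h j x) = \<zero>\<^sub>M"
 shows "\<forall>j<k. r j = \<zero>\<^sub>R"
proof (rule ccontr)
 assume "\<not> ?thesis"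
 then obtain j where j: "j \<in> {..<k}" "r j ~= \<zero>\<^sub>R" by auto
 let ?g = "%r x. \<Oplus>\<^sub>M j\<in>{..<k}. r j \<odot>\<^sub>M h j x"
 let ?U = "{r \<in> {..<k} \<rightarrow> El R. \<forall>x\<in>El M. ?g r x = \<zero>\<^sub>M}"
 have hc: "h j x \<in> El M" if "j < k" "x \<in> El M" for j x using M.bold_mapD(1)[OF h] that by auto
 obtain u i where u: "u \<in> ?U" "i \<in> {..<k}" "u i ~= \<zero>\<^sub>R" "\<And>j. j \<in> {..<k} ==> endo R (u j) = u j"
 proof (rule R.invariant_vector[where S = "{..<k}" and U = ?U and ?u0.0 = r and ?i0.0 = j, OF _ _ j])
  show "r \<in> ?U" using r by simp
  show "(%i. u i \<oplus>\<^sub>R v i) \<in> ?U" if uv: "u \<in> ?U" "v \<in> ?U" for u v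
  proof -
   have c: "u j \<in> El R" "v j \<in> El R" if "j < k" for j using uv that by auto
   have "?g (%i. u i \<oplus>\<^sub>R v i) x = \<zero>\<^sub>M" if x: "x \<in> El M" for x
   proof -
    have "?g (%i. u i \<oplus>\<^sub>R v i) x = (\<Oplus>\<^sub>M j\<in>{..<k}. u j \<odot>\<^sub>M h j x \<oplus>\<^sub>M v j \<odot>\<^sub>M h j x)"
     using c hc x by (intro M.M.finsum_cong') (auto simp: M.smult_l_distr)
    also have "... = ?g u x \<oplus>\<^sub>M ?g v x" using c hc x by (intro M.M.finsum_addf) auto
    finally show ?thesis using uv x by simp
   qed
   thus ?thesis using c by auto
  qed
  show "(%i. s \<otimes>\<^sub>R u i) \<in> ?U" if su: "s \<in> El R" "u \<in> ?U" for s u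
  proof -
   have c: "u j \<in> El R" if "j < k" for j using su that by auto
   have "?g (%i. s \<otimes>\<^sub>R u i) x = \<zero>\<^sub>M" if x: "x \<in> El M" for x
   proof -
    have "s \<odot>\<^sub>M ?g u x = (\<Oplus>\<^sub>M j\<in>{..<k}. s \<odot>\<^sub>M (u j \<odot>\<^sub>M h j x))"
     using c hc x su by (intro M.finsum_smult_ldistr) auto
    also have "... = ?g (%i. s \<otimes>\<^sub>R u i) x"
     using c hc x su by (intro M.M.finsum_cong') (auto simp: M.smult_assoc1)
    finally show ?thesis using su x by simp
   qed
   thus ?thesis using c su by auto
  qed
  show "(%i. endo R (u i)) \<in> ?U" if u: "u \<in> ?U" for u
  proof -
   have c: "u j \<in> El R" if "j < k" for j using u that by auto
   let ?s = "%i. endo R (u i)"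
   have gc: "?g ?s x \<in> El M" if "x \<in> El M" for x
    using c hc that by (intro M.M.finsum_closed) auto
   let ?P = "{x \<in> El M. ?g ?s x = \<zero>\<^sub>M}"
   have "submodule ?P R M"
   proof (rule M.submoduleI)
    have smult: "s \<odot>\<^sub>M x \<in> ?P" if sx: "s \<in> El R" "x \<in> ?P" for s x
    proof -
     have "s \<odot>\<^sub>M ?g ?s x = (\<Oplus>\<^sub>M j\<in>{..<k}. s \<odot>\<^sub>M (?s j \<odot>\<^sub>M h j x))"
      using c hc sx by (intro M.finsum_smult_ldistr) auto
     also have "... = ?g ?s (s \<odot>\<^sub>M x)"
      using c hc sx M.bold_mapD(3)[OF h]
      by (intro M.M.finsum_cong') (auto simp: M.smult_assoc1[symmetric] R.m_comm)
     finally show ?thesis using sx by simp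
    qed
    thus "\<And>s x. s \<in> El R ==> x \<in> ?P ==> s \<odot>\<^sub>M x \<in> ?P" .
    show "\<ominus>\<^sub>M x \<in> ?P" if "x \<in> ?P" for x
     using smult[of "\<ominus>\<^sub>R \<one>\<^sub>R" x] that by (simp add: M.smult_l_minus)
    show "\<zero>\<^sub>M \<in> ?P" using c M.bold_mapD(6)[OF h] by (auto intro!: M.M.add.finprod_one_eqI)
    show "x \<oplus>\<^sub>M y \<in> ?P" if xy: "x \<in> ?P" "y \<in> ?P" for x y
    proof -
     have "?g ?s (x \<oplus>\<^sub>M y) = (\<Oplus>\<^sub>M j\<in>{..<k}. ?s j \<odot>\<^sub>M h j x \<oplus>\<^sub>M ?s j \<odot>\<^sub>M h j y)"
      using c hc xy M.bold_mapD(2)[OF h] by (intro M.M.finsum_cong') (auto simp: M.smult_r_distr)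
     also have "... = ?g ?s x \<oplus>\<^sub>M ?g ?s y" using c hc xy by (intro M.M.finsum_addf) auto
     finally show ?thesis using xy by simp
    qed
   qed auto
   moreover have "tau M ` El M <= ?P"
   proof
    fix z assume "z \<in> tau M ` El M"
    then obtain y where y: "y \<in> El M" "z = tau M y" by auto
    have "tau M (?g u y) = (\<Oplus>\<^sub>M j\<in>{..<k}. tau M (u j \<odot>\<^sub>M h j y))"
     using c hc y
     by (intro additive_map_finsum[OF _ _ M.tau_additive] module.axioms(2)[OF M.module_axioms]) auto
    also have "... = ?g ?s z"
     using c hc y M.bold_mapD(4)[OF h] by (intro M.M.finsum_cong') (auto simp: M.tau_smult)
    finally show "z \<in> ?P" using u y by simp
   qed
   ultimately have "El M <= ?P"
    using M.module_span_least[of ?P "tau M ` El M"] M.tau_generates[OF M.carrier_tau_submodule] by simp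
   thus ?thesis using c by auto
  qed
 qed auto
 have "\<forall>j\<in>{..<k}. \<exists>a. a \<in> El F \<and> u j = c a"
  using u(1,4) invariants by (metis (no_types, lifting) PiE mem_Collect_eq)
 from bchoice[OF this] obtain a where a: "\<And>j. j < k ==> a j \<in> El F" "\<And>j. j < k ==> u j = c (a j)" by auto
 have "\<forall>j<k. a j = \<zero>\<^sub>F"
 proof (rule ind)
  show "a \<in> {..<k} \<rightarrow> El F" using a by auto
  fix x assume x: "x \<in> El M"
  have "(\<Oplus>\<^sub>M j\<in>{..<k}. c (a j) \<odot>\<^sub>M h j x) = ?g u x"
   using a hc x by (intro M.M.finsum_cong') auto
  thus "(\<Oplus>\<^sub>M j\<in>{..<k}. c (a j) \<odot>\<^sub>M h j x) = \<zero>\<^sub>M" using u(1) x by simp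
 qed
 thus False
  using u(2,3) a(2)[of i] ring_hom_zero[OF c_hom F.ring_axioms R.ring_axioms] by auto
qed

lemma endomorphisms_finite_dimensional:
 "\<exists>k h. (\<forall>j<k. bold_map R M M (h j)) \<and>
  (\<forall>d. bold_map R M M d --> (\<exists>a\<in>{..<k::nat} \<rightarrow> El F. \<forall>x\<in>El M. d x = (\<Oplus>\<^sub>M j\<in>{..<k}. c (a j) \<odot>\<^sub>M h j x)))"
proof -
 obtain A f where db: "dual_basis R M A f" using M.dual_basis_exists by blast
 let ?ind = "%k h. \<forall>a\<in>{..<k::nat} \<rightarrow> El F.
   (\<forall>x\<in>El M. (\<Oplus>\<^sub>M j\<in>{..<k}. c (a j) \<odot>\<^sub>M h j x) = \<zero>\<^sub>M) --> (\<forall>j<k. a j = \<zero>\<^sub>F)"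
 let ?P = "%k. \<exists>h. (\<forall>j<k. bold_map R M M (h j)) \<and> ?ind k h"
 have bound: "k \<le> card (A \<times> A)" if P: "?P k" for k
 proof -
  from P obtain h where h: "\<forall>j<k. bold_map R M M (h j)" "?ind k h" by blast
  show ?thesis
  proof (rule M.independent_bound[OF db])
   show "linear_map R M M (h j)" if "j < k" for j using h(1) that by (auto simp: bold_map_def)
   fix r assume r: "r \<in> {..<k} \<rightarrow> El R" "\<And>x. x \<in> El M ==> (\<Oplus>\<^sub>M j\<in>{..<k}. r j \<odot>\<^sub>M h j x) = \<zero>\<^sub>M"
   show "\<forall>j<k. r j = \<zero>\<^sub>R"
    by (rule invariant_maps_independent[of k h r]) (use h r in blast)+
  qed
 qed
 have "?P 0" by auto
 define k where "k = (GREATEST k. ?P k)"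
 have "?P k" unfolding k_def using \<open>?P 0\<close> bound by (rule GreatestI_nat)
 then obtain h where h: "\<And>j. j < k ==> bold_map R M M (h j)" "?ind k h" by blast
 have hc: "h j x \<in> El M" if "j < k" "x \<in> El M" for j x using M.bold_mapD(1)[OF h(1)] that by auto
 have "\<exists>a\<in>{..<k} \<rightarrow> El F. \<forall>x\<in>El M. d x = (\<Oplus>\<^sub>M j\<in>{..<k}. c (a j) \<odot>\<^sub>M h j x)"
  if d: "bold_map R M M d" for d
 proof -
  let ?h = "h(k := d)"
  have "\<not> ?P (Suc k)"
  proof
   assume "?P (Suc k)"
   hence "Suc k \<le> (GREATEST k. ?P k)" using bound by (rule Greatest_le_nat)
   thus False by (simp flip: k_def)
  qed
  have bm: "\<forall>j<Suc k. bold_map R M M (?h j)" using h(1) d by (auto simp: less_Suc_eq)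
  have "\<not> ?ind (Suc k) ?h"
  proof
   assume i: "?ind (Suc k) ?h"
   have "?P (Suc k)" by (rule exI[of _ ?h], rule conjI[OF bm i])
   with \<open>\<not> ?P (Suc k)\<close> show False by (rule notE)
  qed
  hence "\<exists>a j0. a \<in> {..<Suc k} \<rightarrow> El F \<and> j0 < Suc k \<and> a j0 ~= \<zero>\<^sub>F \<and>
   (\<forall>x\<in>El M. (\<Oplus>\<^sub>M j\<in>{..<Suc k}. c (a j) \<odot>\<^sub>M ?h j x) = \<zero>\<^sub>M)"
   unfolding Ball_def not_all not_imp by (elim exE conjE) (intro exI conjI)
  then obtain a j0 where a: "a \<in> {..<Suc k} \<rightarrow> El F" "j0 < Suc k" "a j0 ~= \<zero>\<^sub>F"
   "\<forall>x\<in>El M. (\<Oplus>\<^sub>M j\<in>{..<Suc k}. c (a j) \<odot>\<^sub>M ?h j x) = \<zero>\<^sub>M" by (elim exE conjE)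
  have ac: "a j \<in> El F" if "j < Suc k" for j using a(1) that by auto
  have split: "c (a k) \<odot>\<^sub>M d x \<oplus>\<^sub>M (\<Oplus>\<^sub>M j\<in>{..<k}. c (a j) \<odot>\<^sub>M h j x) = \<zero>\<^sub>M" if x: "x \<in> El M" for x
  proof -
   have "(\<Oplus>\<^sub>M j\<in>{..<Suc k}. c (a j) \<odot>\<^sub>M ?h j x) =
     c (a k) \<odot>\<^sub>M ?h k x \<oplus>\<^sub>M (\<Oplus>\<^sub>M j\<in>{..<k}. c (a j) \<odot>\<^sub>M ?h j x)"
    unfolding lessThan_Suc using ac hc x M.bold_mapD(1)[OF d] by (intro M.M.finsum_insert) auto
   also have "(\<Oplus>\<^sub>M j\<in>{..<k}. c (a j) \<odot>\<^sub>M ?h j x) = (\<Oplus>\<^sub>M j\<in>{..<k}. c (a j) \<odot>\<^sub>M h j x)"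
    using ac hc x by (intro M.M.finsum_cong') auto
   finally show ?thesis using bspec[OF a(4) x] by simp
  qed
  have "a k ~= \<zero>\<^sub>F"
  proof
   assume ak: "a k = \<zero>\<^sub>F"
   have "(\<Oplus>\<^sub>M j\<in>{..<k}. c (a j) \<odot>\<^sub>M h j x) = \<zero>\<^sub>M" if x: "x \<in> El M" for x
   proof -
    have "(\<Oplus>\<^sub>M j\<in>{..<k}. c (a j) \<odot>\<^sub>M h j x) \<in> El M"
     using ac hc x by (intro M.M.finsum_closed) auto
    thus ?thesis
     using split[OF x] ak M.bold_mapD(1)[OF d x] ring_hom_zero[OF c_hom F.ring_axioms R.ring_axioms] by simp
   qed
   moreover have "a \<in> {..<k} \<rightarrow> El F" using ac by auto
   ultimately have "\<forall>j<k. a j = \<zero>\<^sub>F" by (intro mp[OF bspec[OF h(2)]] ballI)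
   thus False using a(2,3) ak by (auto simp: less_Suc_eq)
  qed
  hence akU: "a k \<in> Units F" using ac[of k] F.field_Units by auto
  define b where "b j = (\<ominus>\<^sub>F (inv\<^bsub>F\<^esub> (a k))) \<otimes>\<^sub>F a j" for j
  have bc: "b j \<in> El F" if "j < k" for j using akU ac[of j] that by (auto simp: b_def)
  have "d x = (\<Oplus>\<^sub>M j\<in>{..<k}. c (b j) \<odot>\<^sub>M h j x)" if x: "x \<in> El M" for x
  proof -
   let ?i = "c (\<ominus>\<^sub>F (inv\<^bsub>F\<^esub> (a k)))" and ?s = "\<Oplus>\<^sub>M j\<in>{..<k}. c (a j) \<odot>\<^sub>M h j x"
   have ic: "?i \<in> El R" using akU by simp
   have dx: "d x \<in> El M" by (rule M.bold_mapD(1)[OF d x])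
   have sc: "?s \<in> El M" using ac hc x by (intro M.M.finsum_closed) auto
   have "?i \<otimes>\<^sub>R c (a k) = c (\<ominus>\<^sub>F \<one>\<^sub>F)"
    using akU ac[of k] by (simp add: ring_hom_mult[OF c_hom, symmetric] F.l_minus)
   also have "... = \<ominus>\<^sub>R \<one>\<^sub>R"
    using additive_map_neg[OF F.is_abelian_group R.is_abelian_group, of c "\<one>\<^sub>F"] ring_hom_one[OF c_hom]
     ring_hom_add[OF c_hom] by (simp add: additive_map_def)
   finally have "?i \<odot>\<^sub>M (c (a k) \<odot>\<^sub>M d x) = \<ominus>\<^sub>M d x"
    using ic ac[of k] dx by (simp add: M.smult_assoc1[symmetric] M.smult_l_minus)
   moreover have "?i \<odot>\<^sub>M (c (a k) \<odot>\<^sub>M d x \<oplus>\<^sub>M ?s) = \<zero>\<^sub>M" using split[OF x] ic by simp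
   ultimately have "\<ominus>\<^sub>M d x \<oplus>\<^sub>M ?i \<odot>\<^sub>M ?s = \<zero>\<^sub>M"
    using ic ac[of k] dx sc by (simp add: M.smult_r_distr)
   hence "?i \<odot>\<^sub>M ?s \<oplus>\<^sub>M \<ominus>\<^sub>M d x = \<zero>\<^sub>M" using ic sc dx by (simp add: M.M.a_comm)
   from M.M.minus_equality[OF this] have "d x = ?i \<odot>\<^sub>M ?s" using ic sc dx by simp
   also have "... = (\<Oplus>\<^sub>M j\<in>{..<k}. ?i \<odot>\<^sub>M (c (a j) \<odot>\<^sub>M h j x))"
    using ic ac hc x by (intro M.finsum_smult_ldistr) auto
   also have "... = (\<Oplus>\<^sub>M j\<in>{..<k}. c (b j) \<odot>\<^sub>M h j x)"
    using ic ac hc x akU bc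
    by (intro M.M.finsum_cong') (auto simp: b_def ring_hom_mult[OF c_hom] M.smult_assoc1)
   finally show ?thesis .
  qed
  thus ?thesis using bc by (intro bexI[of _ b]) auto
 qed
 thus ?thesis using h(1) by (intro exI[of _ k] exI[of _ h]) auto
qed

end

definition center_ring ::
 "('r, 'x) bold_ring_scheme => ('r, 'm, 'y) bold_module_scheme => ('m => 'm) ring" where
 "center_ring R M =
   \<lparr>carrier = {z \<in> bold_homs R M M. \<forall>a. bold_map R M M a --> (\<forall>x\<in>El M. a (z x) = z (a x))},
   monoid.mult = compose (El M), one = (\<lambda>x\<in>El M. x),
   ring.zero = (\<lambda>x\<in>El M. \<zero>\<^sub>M),
   ring.add = (%g h. \<lambda>x\<in>El M. g x \<oplus>\<^sub>M h x)\<rparr>"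

context dual_module
begin

lemma bold_map_cong:
 assumes "bold_map R M M h" "\<And>x. x \<in> El M ==> g x = h x" shows "bold_map R M M g"
 using assms by (simp add: bold_map_def linear_map_def additive_map_def)

lemma restrict_bold_homs: "bold_map R M M h ==> restrict h (El M) \<in> bold_homs R M M"
 unfolding bold_homs_iff by (auto intro: bold_map_cong)

lemma center_ring_field:
 assumes s: "simple_sub R M (El M)" shows "field (center_ring R M)"
proof -
 let ?Z = "center_ring R M"
 have Z: "z \<in> El ?Z \<longleftrightarrow> bold_map R M M z \<and> z \<in> extensional (El M) \<and>
   (\<forall>a. bold_map R M M a --> (\<forall>x\<in>El M. a (z x) = z (a x)))" for z
  by (auto simp: center_ring_def bold_homs_iff)
 have mult: "g \<otimes>\<^sub>?Z h = (\<lambda>x\<in>El M. g (h x))" for g h by (simp add: center_ring_def compose_def)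
 have add: "g \<oplus>\<^sub>?Z h = (\<lambda>x\<in>El M. g x \<oplus>\<^sub>M h x)" for g h by (simp add: center_ring_def)
 have zero: "\<zero>\<^sub>?Z = (\<lambda>x\<in>El M. \<zero>\<^sub>M)" and one: "\<one>\<^sub>?Z = (\<lambda>x\<in>El M. x)"
  by (simp_all add: center_ring_def)
 have bm: "bold_map R M M z" if "z \<in> El ?Z" for z using that Z by blast
 have ex: "z \<in> extensional (El M)" if "z \<in> El ?Z" for z using that Z by blast
 have cen: "a (z x) = z (a x)" if "z \<in> El ?Z" "bold_map R M M a" "x \<in> El M" for z a x
  using that Z by blast
 have cl: "z x \<in> El M" if "z \<in> El ?Z" "x \<in> El M" for z x
  using bold_mapD(1)[OF bm[OF that(1)] that(2)] .
 have zadd: "z (x \<oplus>\<^sub>M y) = z x \<oplus>\<^sub>M z y" if "z \<in> El ?Z" "x \<in> El M" "y \<in> El M" for z x y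
  using bold_mapD(2)[OF bm[OF that(1)] that(2,3)] .
 have I: "(\<lambda>x\<in>El M. h x) \<in> El ?Z"
  if "bold_map R M M h" "\<And>a x. bold_map R M M a ==> x \<in> El M ==> a (h x) = h (a x)" for h
  using that restrict_bold_homs[OF that(1)] bold_mapD(1) unfolding Z bold_homs_iff by auto
 have addc: "g \<oplus>\<^sub>?Z h \<in> El ?Z" if g: "g \<in> El ?Z" and h: "h \<in> El ?Z" for g h
  unfolding add
 proof (rule I[OF bold_map_add[OF bm[OF g] bm[OF h]]])
  fix a x assume a: "bold_map R M M a" "x \<in> El M"
  show "a (g x \<oplus>\<^sub>M h x) = g (a x) \<oplus>\<^sub>M h (a x)"
   using bold_mapD(2)[OF a(1) cl[OF g a(2)] cl[OF h a(2)]] cen[OF g a] cen[OF h a] by simp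
 qed
 have multc: "g \<otimes>\<^sub>?Z h \<in> El ?Z" if g: "g \<in> El ?Z" and h: "h \<in> El ?Z" for g h
  unfolding mult
 proof (rule I[OF bold_map_comp[OF bm[OF g] bm[OF h]]])
  fix a x assume a: "bold_map R M M a" "x \<in> El M"
  show "a (g (h x)) = g (h (a x))"
   using cen[OF g a(1) cl[OF h a(2)]] cen[OF h a] by simp
 qed
 have zeroc: "\<zero>\<^sub>?Z \<in> El ?Z"
  unfolding zero
 proof (rule I)
  show "bold_map R M M (%x. \<zero>\<^sub>M)" by (simp add: bold_map_def linear_map_def additive_map_def)
 qed (use bold_mapD(6) in auto)
 have onec: "\<one>\<^sub>?Z \<in> El ?Z"
  unfolding one by (rule I[OF bold_map_id]) auto
 have negc: "(\<lambda>x\<in>El M. (\<ominus> \<one>) \<odot>\<^sub>M z x) \<in> El ?Z" if z: "z \<in> El ?Z" for z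
 proof (rule I[OF bold_map_neg[OF bm[OF z]]])
  fix a x assume a: "bold_map R M M a" "x \<in> El M"
  show "a ((\<ominus> \<one>) \<odot>\<^sub>M z x) = (\<ominus> \<one>) \<odot>\<^sub>M z (a x)"
   using bold_mapD(3)[OF a(1) _ cl[OF z a(2)], of "\<ominus> \<one>"] cen[OF z a] by simp
 qed
 have eqI: "g = h" if "g \<in> El ?Z" "h \<in> El ?Z" "\<And>x. x \<in> El M ==> g x = h x" for g h
  using that ex by (intro extensionalityI[of _ "El M"]) auto
 have ab: "abelian_group ?Z"
 proof (rule abelian_groupI)
  fix x y assume xy: "x \<in> El ?Z" "y \<in> El ?Z"
  show "x \<oplus>\<^sub>?Z y \<in> El ?Z" by (rule addc[OF xy])
  show "x \<oplus>\<^sub>?Z y = y \<oplus>\<^sub>?Z x"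
   by (rule eqI[OF addc[OF xy] addc[OF xy(2,1)]]) (use xy cl in \<open>simp add: add M.a_comm\<close>)
  fix z assume z: "z \<in> El ?Z"
  show "x \<oplus>\<^sub>?Z y \<oplus>\<^sub>?Z z = x \<oplus>\<^sub>?Z (y \<oplus>\<^sub>?Z z)"
   by (rule eqI[OF addc[OF addc[OF xy] z] addc[OF xy(1) addc[OF xy(2) z]]]) (use xy z cl in \<open>simp add: add M.a_assoc\<close>)
 next
  fix x assume x: "x \<in> El ?Z"
  show "\<zero>\<^sub>?Z \<oplus>\<^sub>?Z x = x"
   by (rule eqI[OF addc[OF zeroc x] x]) (use x cl in \<open>simp add: add zero\<close>)
  have "(\<lambda>y\<in>El M. (\<ominus> \<one>) \<odot>\<^sub>M x y) \<oplus>\<^sub>?Z x = \<zero>\<^sub>?Z"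
   by (rule eqI[OF addc[OF negc[OF x] x] zeroc]) (use x cl in \<open>simp add: add zero smult_l_minus M.l_neg\<close>)
  thus "\<exists>y\<in>El ?Z. y \<oplus>\<^sub>?Z x = \<zero>\<^sub>?Z" using negc[OF x] by blast
 qed (rule zeroc)
 have cm: "comm_monoid ?Z"
 proof (rule comm_monoidI)
  fix x y assume xy: "x \<in> El ?Z" "y \<in> El ?Z"
  show "x \<otimes>\<^sub>?Z y \<in> El ?Z" by (rule multc[OF xy])
  show "x \<otimes>\<^sub>?Z y = y \<otimes>\<^sub>?Z x"
   by (rule eqI[OF multc[OF xy] multc[OF xy(2,1)]]) (use cen[OF xy(2) bm[OF xy(1)]] in \<open>simp add: mult\<close>)
  fix z assume z: "z \<in> El ?Z"
  show "x \<otimes>\<^sub>?Z y \<otimes>\<^sub>?Z z = x \<otimes>\<^sub>?Z (y \<otimes>\<^sub>?Z z)"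
   by (rule eqI[OF multc[OF multc[OF xy] z] multc[OF xy(1) multc[OF xy(2) z]]]) (use z cl in \<open>simp add: mult\<close>)
 next
  fix x assume x: "x \<in> El ?Z"
  show "\<one>\<^sub>?Z \<otimes>\<^sub>?Z x = x"
   by (rule eqI[OF multc[OF onec x] x]) (use x cl in \<open>simp add: mult one\<close>)
 qed (rule onec)
 interpret Z: cring ?Z
 proof (rule cringI[OF ab cm])
  fix x y z assume h: "x \<in> El ?Z" "y \<in> El ?Z" "z \<in> El ?Z"
  show "(x \<oplus>\<^sub>?Z y) \<otimes>\<^sub>?Z z = x \<otimes>\<^sub>?Z z \<oplus>\<^sub>?Z y \<otimes>\<^sub>?Z z"
   by (rule eqI[OF multc[OF addc[OF h(1,2)] h(3)] addc[OF multc[OF h(1,3)] multc[OF h(2,3)]]])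
     (use h cl in \<open>simp add: mult add\<close>)
 qed
 obtain x0 where x0: "x0 \<in> El M" "x0 ~= \<zero>\<^sub>M"
  using s carrier_tau_submodule tau_submoduleD(2)[OF carrier_tau_submodule] unfolding simple_sub_def by auto
 show ?thesis
 proof (rule Z.cring_fieldI2)
  show "\<zero>\<^sub>?Z ~= \<one>\<^sub>?Z"
  proof
   assume "\<zero>\<^sub>?Z = \<one>\<^sub>?Z"
   hence "(\<lambda>x\<in>El M. \<zero>\<^sub>M) x0 = (\<lambda>x\<in>El M. x) x0" unfolding zero one by (rule fun_cong)
   thus False using x0 by simp
  qed
  fix z assume z: "z \<in> El ?Z" "z ~= \<zero>\<^sub>?Z"
  obtain x where x: "x \<in> El M" "z x ~= \<zero>\<^sub>M"
   using z(2) eqI[OF z(1) zeroc] unfolding zero by auto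
  obtain g where g: "bold_map R M M g" "\<And>x. x \<in> El M ==> z (g x) = x" "\<And>x. x \<in> El M ==> g (z x) = x"
   using inverse_bold_map[OF bm[OF z(1)] schur[OF s bm[OF z(1)] x]] by blast
  have gZ: "(\<lambda>x\<in>El M. g x) \<in> El ?Z"
  proof (rule I[OF g(1)])
   fix a x assume a: "bold_map R M M a" "x \<in> El M"
   have gx: "g x \<in> El M" using bold_mapD(1)[OF g(1) a(2)] .
   have "a x = z (a (g x))" using cen[OF z(1) a(1) gx] g(2)[OF a(2)] by simp
   hence "g (a x) = g (z (a (g x)))" by simp
   thus "a (g x) = g (a x)" using g(3)[OF bold_mapD(1)[OF a(1) gx]] by simp
  qed
  have "z \<otimes>\<^sub>?Z (\<lambda>x\<in>El M. g x) = \<one>\<^sub>?Z"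
   by (rule eqI[OF multc[OF z(1) gZ] onec]) (use g(2) in \<open>simp add: mult one\<close>)
  thus "\<exists>b\<in>El ?Z. z \<otimes>\<^sub>?Z b = \<one>\<^sub>?Z" using gZ by blast
 qed
qed

end

context base_change
begin

lemma mspan_indep: assumes "x \<in> mspan"
 shows "\<exists>S v. indep S \<and> v \<in> S \<rightarrow> El M \<and> x = mcomb S v"
proof -
 obtain S0 v where S0: "finite S0" "S0 <= El F'" "v \<in> S0 \<rightarrow> El M" "x = mcomb S0 v"
  using assms by (auto simp: mspan_def)
 from balanced_reduce[OF module_MF M'_ab balanced_M S0(1,2)] S0(3)
 obtain S v' where "indep S" "v' \<in> S \<rightarrow> El M" "mcomb S0 v = mcomb S v'" by auto
 thus ?thesis using S0(4) by blast
qed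

lemma bold_extension:
 assumes g: "additive_map M M' g"
  and "\<And>r x. r \<in> El R ==> x \<in> El M ==> g (r \<odot>\<^sub>M x) = \<phi> r \<odot>\<^sub>M' g x"
  and g_tau: "\<And>x. x \<in> El M ==> g (tau M x) = tau M' (g x)"
 shows "\<exists>w. bold_map R' M' M' w \<and> (\<forall>x\<in>El M. w (\<iota> x) = g x)"
proof -
 obtain w where w: "linear_map R' M' M' w" "\<forall>x\<in>El M. w (\<iota> x) = g x"
  using extension_exists[OF M'.module_axioms assms(1,2)] by blast
 have "w (tau M' x) = tau M' (w x)" if "x \<in> El M'" for x
 proof (rule extension_tau[OF M'.bold_module_axioms w(1) _ that])
  fix y assume y: "y \<in> El M"
  have "w (tau M' (\<iota> y)) = w (\<iota> (tau M y))" using y by (simp add: \<iota>_tau)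
  thus "w (tau M' (\<iota> y)) = tau M' (w (\<iota> y))" using y w(2) g_tau by simp
 qed
 thus ?thesis using w unfolding bold_map_def by blast
qed

lemma endo_extension:
 assumes a: "bold_map R M M a"
 shows "\<exists>a'. bold_map R' M' M' a' \<and> (\<forall>x\<in>El M. a' (\<iota> x) = \<iota> (a x))"
proof (rule bold_extension)
 note aD = M.bold_mapD[OF a]
 show "additive_map M M' (%x. \<iota> (a x))" using aD by (simp add: additive_map_def \<iota>_add)
qed (use M.bold_mapD[OF a] in \<open>simp_all add: \<iota>_smult \<iota>_tau\<close>)

lemma map_mcomb:
 assumes a': "bold_map R' M' M' a'" and eq: "\<And>x. x \<in> El M ==> a' (\<iota> x) = \<iota> (a x)"
  and S: "S <= El F'" "v \<in> S \<rightarrow> El M" and ac: "\<And>x. x \<in> El M ==> a x \<in> El M"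
 shows "a' (mcomb S v) = mcomb S (%b. a (v b))"
proof -
 have cl: "b \<in> El F'" "v b \<in> El M" if "b \<in> S" for b using S that by auto
 have "a' (mcomb S v) = (\<Oplus>\<^sub>M' b\<in>S. a' (c' b \<odot>\<^sub>M' \<iota> (v b)))"
  using cl by (intro additive_map_finsum[OF M'_ab M'_ab M'.bold_mapD(5)[OF a']]) auto
 also have "... = mcomb S (%b. a (v b))"
  using cl ac eq M'.bold_mapD(3)[OF a'] by (intro M'.M.finsum_cong') auto
 finally show ?thesis .
qed

text \<open>A simple module has, in every nonzero \<open>\<tau>\<close>-stable submodule of its base change, the image of
  a nonzero endomorphism: a vector of minimal length determines one.\<close>

lemma endomorphism_into:
 assumes s: "simple_sub R M (El M)" and N: "tau_submodule R' M' N" "N ~= {\<zero>\<^sub>M'}"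
 shows "\<exists>S d i w. indep S \<and> i \<in> S \<and> (\<forall>b\<in>S. bold_map R M M (d b)) \<and> (\<forall>x\<in>El M. d i x = x) \<and>
  bold_map R' M' M' w \<and> (\<forall>x\<in>El M'. w x \<in> N) \<and> (\<forall>x\<in>El M. w (\<iota> x) = mcomb S (%b. d b x))"
proof -
 note ND = M'.tau_submoduleD[OF N(1)]
 obtain n where n: "n \<in> N" "n ~= \<zero>\<^sub>M'" using N(2) ND(2) by auto
 obtain t where t: "t \<in> Units R'" "t \<odot>\<^sub>M' n \<in> mspan" using module_denominator[OF ND(1)[OF n(1)]] by blast
 have tn: "t \<odot>\<^sub>M' n \<in> N" using ND(4) t(1) n(1) by auto
 have tn0: "t \<odot>\<^sub>M' n ~= \<zero>\<^sub>M'"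
 proof
  assume "t \<odot>\<^sub>M' n = \<zero>\<^sub>M'"
  hence "inv\<^bsub>R'\<^esub> t \<odot>\<^sub>M' (t \<odot>\<^sub>M' n) = \<zero>\<^sub>M'" using t(1) by simp
  thus False
   using t(1) ND(1)[OF n(1)] n(2) by (simp add: M'.smult_assoc1[symmetric] R'.Units_closed)
 qed
 obtain S v0 where S: "indep S" "v0 \<in> S \<rightarrow> El M" "t \<odot>\<^sub>M' n = mcomb S v0" using mspan_indep[OF t(2)] by blast
 note S' = indepD(1,2)[OF S(1)]
 have \<iota>0: "\<iota> \<zero>\<^sub>M = \<zero>\<^sub>M'"
  by (rule additive_map_zero[OF module.axioms(2)[OF M.module_axioms] M'_ab \<iota>_additive])
 have "\<exists>i0\<in>S. v0 i0 ~= \<zero>\<^sub>M"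
 proof (rule ccontr)
  assume "\<not> (\<exists>i0\<in>S. v0 i0 ~= \<zero>\<^sub>M)"
  hence "mcomb S v0 = \<zero>\<^sub>M'" using S'(2) \<iota>0 by (intro M'.M.add.finprod_one_eqI) auto
  thus False using S(3) tn0 by simp
 qed
 then obtain i0 where i0: "i0 \<in> S" "v0 i0 ~= \<zero>\<^sub>M" by blast
 define U where "U = {v \<in> S \<rightarrow> El M. mcomb S v \<in> N}"
 have v0U: "v0 \<in> U" using S tn by (simp add: U_def)
 obtain u i where u: "u \<in> U" "i \<in> S" "u i ~= \<zero>\<^sub>M"
  and min: "\<forall>v\<in>U. (\<forall>j\<in>S. u j = \<zero>\<^sub>M --> v j = \<zero>\<^sub>M) --> v i = \<zero>\<^sub>M --> (\<forall>j\<in>S. v j = \<zero>\<^sub>M)"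
  using minimal_support[OF S'(1) v0U i0] by blast
 define V where "V = {v \<in> U. \<forall>j\<in>S. u j = \<zero>\<^sub>M --> v j = \<zero>\<^sub>M}"
 have Vc: "v \<in> S \<rightarrow> El M" "mcomb S v \<in> N" if "v \<in> V" for v using that by (auto simp: V_def U_def)
 have Vcj: "v j \<in> El M" if "v \<in> V" "j \<in> S" for v j using Vc(1)[OF that(1)] that(2) by auto
 have V0: "v j = \<zero>\<^sub>M" if "v \<in> V" "j \<in> S" "u j = \<zero>\<^sub>M" for v j using that by (simp add: V_def)
 have VI: "v \<in> V" if "\<And>j. j \<in> S ==> v j \<in> El M" "mcomb S v \<in> N"
  "\<And>j. j \<in> S ==> u j = \<zero>\<^sub>M ==> v j = \<zero>\<^sub>M" for v
  using that by (simp add: V_def U_def Pi_iff)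
 have Vadd: "(%b. v b \<oplus>\<^sub>M w b) \<in> V" if "v \<in> V" "w \<in> V" for v w
 proof -
  have "mcomb S (%b. v b \<oplus>\<^sub>M w b) \<in> N"
   unfolding mcomb_add[OF S'(2) Vc(1)[OF that(1)] Vc(1)[OF that(2)]] using Vc that ND(3) by blast
  thus ?thesis
   by (rule VI[rotated]) (simp_all add: Vcj[OF that(1)] Vcj[OF that(2)] V0[OF that(1)] V0[OF that(2)])
 qed
 have Vsmult: "(%b. r \<odot>\<^sub>M v b) \<in> V" if "r \<in> El R" "v \<in> V" for r v
 proof -
  have "mcomb S (%b. r \<odot>\<^sub>M v b) \<in> N"
   unfolding mcomb_smult[OF S'(2,1) Vc(1)[OF that(2)] that(1)] using Vc that ND(4) by auto
  thus ?thesis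
   by (rule VI[rotated]) (simp_all add: that(1) Vcj[OF that(2)] V0[OF that(2)])
 qed
 have Vtau: "(%b. tau M (v b)) \<in> V" if "v \<in> V" for v
 proof -
  have "mcomb S (%b. tau M (v b)) \<in> N"
   unfolding mcomb_tau[OF S'(2) Vc(1)[OF that]] using Vc that ND(5) by auto
  thus ?thesis
   by (rule VI[rotated]) (simp_all add: Vcj[OF that] V0[OF that])
 qed
 have uV: "u \<in> V" using u by (simp add: V_def)
 let ?P = "(%v. v i) ` V"
 have "tau_submodule R M ?P"
 proof (rule M.tau_submoduleI)
  show "?P <= El M" using Vcj u(2) by auto
  show add: "x \<oplus>\<^sub>M y \<in> ?P" if xy: "x \<in> ?P" "y \<in> ?P" for x y
  proof -
   from xy(1) obtain v where "v \<in> V" "x = v i" by auto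
   moreover from xy(2) obtain w where "w \<in> V" "y = w i" by auto
   ultimately show ?thesis using Vadd[of v w] by (intro image_eqI[of _ _ "%b. v b \<oplus>\<^sub>M w b"]) auto
  qed
  show smult: "r \<odot>\<^sub>M x \<in> ?P" if rx: "r \<in> El R" "x \<in> ?P" for r x
  proof -
   from rx(2) obtain v where "v \<in> V" "x = v i" by auto
   thus ?thesis using Vsmult[OF rx(1), of v] by (intro image_eqI[of _ _ "%b. r \<odot>\<^sub>M v b"]) auto
  qed
  show "\<zero>\<^sub>M \<in> ?P" using smult[OF R.zero_closed, of "u i"] uV Vcj[OF uV u(2)] by auto
  show "tau M x \<in> ?P" if x: "x \<in> ?P" for x
  proof -
   from x obtain v where "v \<in> V" "x = v i" by auto
   thus ?thesis using Vtau[of v] by (intro image_eqI[of _ _ "%b. tau M (v b)"]) auto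
  qed
 qed
 moreover have "?P ~= {\<zero>\<^sub>M}" using uV u(3) by blast
 moreover have "?P <= El M" using Vcj u(2) by auto
 ultimately have P: "?P = El M" using s unfolding simple_sub_def by blast
 have uniq: "v j = w j" if vw: "v \<in> V" "w \<in> V" "v i = w i" "j \<in> S" for v w j
 proof -
  let ?d = "%b. v b \<oplus>\<^sub>M (\<ominus>\<^sub>R \<one>\<^sub>R) \<odot>\<^sub>M w b"
  have d: "?d \<in> V" using vw by (intro Vadd Vsmult) auto
  have di: "?d i = \<zero>\<^sub>M" using vw(3) Vcj[OF vw(2) u(2)] by (simp add: M.smult_l_minus M.M.r_neg)
  have "?d \<in> U" "\<forall>j\<in>S. u j = \<zero>\<^sub>M --> ?d j = \<zero>\<^sub>M" using d unfolding V_def by blast+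
  hence "?d j = \<zero>\<^sub>M" using bspec[OF min] di vw(4) by blast
  hence "v j \<oplus>\<^sub>M (\<ominus>\<^sub>M w j) = \<zero>\<^sub>M" using Vcj[OF vw(2,4)] by (simp add: M.smult_l_minus)
  from M.M.minus_equality[OF this] show ?thesis using Vcj[OF vw(1,4)] Vcj[OF vw(2,4)] by simp
 qed
 have "\<forall>x\<in>El M. \<exists>v. v \<in> V \<and> v i = x" unfolding P[symmetric] by blast
 from bchoice[OF this] obtain D where D: "\<And>x. x \<in> El M ==> D x \<in> V" "\<And>x. x \<in> El M ==> D x i = x" by blast
 have Dc: "D x j \<in> El M" if "x \<in> El M" "j \<in> S" for x j using Vcj D(1) that by blast
 have Dadd: "D (x \<oplus>\<^sub>M y) j = D x j \<oplus>\<^sub>M D y j" if "x \<in> El M" "y \<in> El M" "j \<in> S" for x y j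
  using uniq[OF D(1) Vadd[OF D(1) D(1)] _ that(3), of "x \<oplus>\<^sub>M y" x y] that D(2) by simp
 have Dsmult: "D (r \<odot>\<^sub>M x) j = r \<odot>\<^sub>M D x j" if "r \<in> El R" "x \<in> El M" "j \<in> S" for r x j
  using uniq[OF D(1) Vsmult[OF that(1) D(1)] _ that(3), of "r \<odot>\<^sub>M x" x] that D(2) by simp
 have Dtau: "D (tau M x) j = tau M (D x j)" if "x \<in> El M" "j \<in> S" for x j
  using uniq[OF D(1) Vtau[OF D(1)] _ that(2), of "tau M x" x] that D(2) by simp
 have bm: "bold_map R M M (%x. D x j)" if "j \<in> S" for j
  using that Dc Dadd Dsmult Dtau by (simp add: bold_map_def linear_map_def additive_map_def)
 let ?g = "%x. mcomb S (D x)"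
 have Dp: "D x \<in> S \<rightarrow> El M" if "x \<in> El M" for x using Dc that by auto
 have cong: "mcomb S v = mcomb S w" if "\<And>j. j \<in> S ==> v j = w j" "\<And>j. j \<in> S ==> w j \<in> El M" for v w
  using that S'(2) by (intro M'.M.finsum_cong') (auto simp: subset_iff)
 have "\<exists>w. bold_map R' M' M' w \<and> (\<forall>x\<in>El M. w (\<iota> x) = ?g x)"
 proof (rule bold_extension)
  show "additive_map M M' ?g"
   unfolding additive_map_def
  proof (intro conjI ballI)
   fix x y assume xy: "x \<in> El M" "y \<in> El M"
   have "?g (x \<oplus>\<^sub>M y) = mcomb S (%j. D x j \<oplus>\<^sub>M D y j)"
    using xy Dadd Dc by (intro cong) auto
   thus "?g (x \<oplus>\<^sub>M y) = ?g x \<oplus>\<^sub>M' ?g y" using mcomb_add[OF S'(2) Dp[OF xy(1)] Dp[OF xy(2)]] by simp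
  qed (use mcomb_closed[OF S'(2) Dp] in auto)
  show "?g (r \<odot>\<^sub>M x) = \<phi> r \<odot>\<^sub>M' ?g x" if "r \<in> El R" "x \<in> El M" for r x
  proof -
   have "?g (r \<odot>\<^sub>M x) = mcomb S (%j. r \<odot>\<^sub>M D x j)" using that Dsmult Dc by (intro cong) auto
   thus ?thesis using mcomb_smult[OF S'(2,1) Dp[OF that(2)] that(1)] by simp
  qed
  show "?g (tau M x) = tau M' (?g x)" if "x \<in> El M" for x
  proof -
   have "?g (tau M x) = mcomb S (%j. tau M (D x j))" using that Dtau Dc by (intro cong) auto
   thus ?thesis using mcomb_tau[OF S'(2) Dp[OF that]] by simp
  qed
 qed
 then obtain w where w: "bold_map R' M' M' w" "\<forall>x\<in>El M. w (\<iota> x) = ?g x" by blast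
 have "w x \<in> N" if "x \<in> El M'" for x
 proof -
  have c: "y \<in> El M'" if "y \<in> module_span R' M' (\<iota> ` El M)" for y using that \<iota>_generates by simp
  have "x \<in> module_span R' M' (\<iota> ` El M)" using that \<iota>_generates by simp
  thus ?thesis
  proof induction
   case (base y)
   thus ?case using w(2) Vc(2)[OF D(1)] by auto
  qed (use c M'.bold_mapD[OF w(1)] ND in auto)
 qed
 thus ?thesis
  using S(1) u(2) bm D(2) w by (intro exI[of _ S] exI[of _ "%b x. D x b"] exI[of _ i] exI[of _ w]) auto
qed

end

context base_change
begin



text \<open>Let \<open>W\<close> be the set of endomorphisms of \<open>M'\<close> with values in \<open>N\<close>, let \<open>L\<close> consist of the \<open>f\<close> with \<open>w f = 0\<close> for all \<open>w\<close> in \<open>W\<close>,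
and \<open>J\<close> of the \<open>f\<close> in \<open>L\<close> with \<open>f g = 0\<close> for all \<open>g\<close> in \<open>L\<close>. Then \<open>J\<close> is a two-sided ideal of square zero that contains \<open>W\<close>.
In a shortest combination \<open>\<Sum> b \<cdot> z\<^sub>b\<close> that represents an element of \<open>J\<close>, with one coefficient equal to the
identity, commuting with an endomorphism of \<open>M\<close> yields a shorter element; so the \<open>z\<^sub>b\<close> are central.\<close>
lemma square_zero_central:
 assumes s: "simple_sub R M (El M)" and N: "tau_submodule R' M' N" "N ~= {\<zero>\<^sub>M'}"
  and kill: "\<And>w x. bold_map R' M' M' w ==> (\<And>x. x \<in> El M' ==> w x \<in> N) ==> x \<in> N ==> w x = \<zero>\<^sub>M'"
 shows "\<exists>S z i f. indep S \<and> i \<in> S \<and> (\<forall>b\<in>S. z b \<in> El (center_ring R M)) \<and>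
  (\<forall>x\<in>El M. z i x = x) \<and> bold_map R' M' M' f \<and>
  (\<forall>x\<in>El M. f (\<iota> x) = mcomb S (%b. z b x)) \<and> (\<forall>x\<in>El M'. f (f x) = \<zero>\<^sub>M')"
proof -
 note ND = M'.tau_submoduleD[OF N(1)]
 note comp = M'.bold_map_comp
 define W where "W w \<longleftrightarrow> bold_map R' M' M' w \<and> (\<forall>x\<in>El M'. w x \<in> N)" for w
 define J1 where "J1 f \<longleftrightarrow> bold_map R' M' M' f \<and> (\<forall>w. W w --> (\<forall>x\<in>El M'. w (f x) = \<zero>\<^sub>M'))" for f
 define J where "J f \<longleftrightarrow> J1 f \<and> (\<forall>g. J1 g --> (\<forall>x\<in>El M'. f (g x) = \<zero>\<^sub>M'))" for f
 have Wb: "bold_map R' M' M' w" "x \<in> El M' ==> w x \<in> N" if "W w" for w x using that by (auto simp: W_def)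
 have J1b: "bold_map R' M' M' f" "W w ==> x \<in> El M' ==> w (f x) = \<zero>\<^sub>M'" if "J1 f" for f w x
  using that by (simp_all add: J1_def)
 have Jb: "J1 f" "bold_map R' M' M' f" "J1 g ==> x \<in> El M' ==> f (g x) = \<zero>\<^sub>M'" if "J f" for f g x
  using that by (simp_all add: J_def J1_def)
 have W_comp: "W (%x. w (u x))" if "W w" "bold_map R' M' M' u" for w u
  using comp[OF Wb(1)[OF that(1)] that(2)] Wb(2)[OF that(1)] M'.bold_mapD(1)[OF that(2)] by (simp add: W_def)
 have J1_comp: "J1 (%x. u (f x))" if "J1 f" "bold_map R' M' M' u" for f u
  unfolding J1_def
 proof (intro conjI allI impI ballI)
  show "bold_map R' M' M' (%x. u (f x))" by (rule comp[OF that(2) J1b(1)[OF that(1)]])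
  fix w x assume "W w" "x \<in> El M'"
  thus "w (u (f x)) = \<zero>\<^sub>M'" using J1b(2)[OF that(1) W_comp[OF _ that(2)]] by blast
 qed
 have J1_compr: "J1 (%x. f (u x))" if "J1 f" "bold_map R' M' M' u" for f u
  unfolding J1_def
 proof (intro conjI allI impI ballI)
  show "bold_map R' M' M' (%x. f (u x))" by (rule comp[OF J1b(1)[OF that(1)] that(2)])
  fix w x assume "W w" "x \<in> El M'"
  thus "w (f (u x)) = \<zero>\<^sub>M'" using J1b(2)[OF that(1)] M'.bold_mapD(1)[OF that(2)] by blast
 qed
 have W_J: "J w" if w: "W w" for w
 proof -
  have "J1 w"
   unfolding J1_def
  proof (intro conjI allI impI ballI)
   fix w' x assume w': "W w'" and x: "x \<in> El M'"
   show "w' (w x) = \<zero>\<^sub>M'" by (rule kill[OF Wb(1)[OF w'] Wb(2)[OF w'] Wb(2)[OF w x]])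
  qed (rule Wb(1)[OF w])
  moreover have "w (g x) = \<zero>\<^sub>M'" if "J1 g" "x \<in> El M'" for g x using J1b(2)[OF that(1) w that(2)] .
  ultimately show ?thesis by (simp add: J_def)
 qed
 have J_r: "J (%x. f (u x))" if "J f" "bold_map R' M' M' u" for f u
  unfolding J_def using J1_compr[OF Jb(1)[OF that(1)] that(2)] Jb(3)[OF that(1) J1_comp[OF _ that(2)]] by blast
 have J_l: "J (%x. u (f x))" if "J f" "bold_map R' M' M' u" for f u
  unfolding J_def using J1_comp[OF Jb(1)[OF that(1)] that(2)] Jb(3)[OF that(1)] M'.bold_mapD(6)[OF that(2)] by simp
 have J_diff: "J (%x. f x \<oplus>\<^sub>M' (\<ominus>\<^sub>R' \<one>\<^sub>R') \<odot>\<^sub>M' g x)" if fg: "J f" "J g" for f g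
 proof -
  have b: "bold_map R' M' M' (%x. f x \<oplus>\<^sub>M' (\<ominus>\<^sub>R' \<one>\<^sub>R') \<odot>\<^sub>M' g x)"
   by (rule M'.bold_map_add[OF Jb(2)[OF fg(1)] M'.bold_map_neg[OF Jb(2)[OF fg(2)]]])
  have fc: "f x \<in> El M'" "g x \<in> El M'" if "x \<in> El M'" for x
   using M'.bold_mapD(1)[OF Jb(2)[OF fg(1)] that] M'.bold_mapD(1)[OF Jb(2)[OF fg(2)] that] by auto
  have "J1 (%x. f x \<oplus>\<^sub>M' (\<ominus>\<^sub>R' \<one>\<^sub>R') \<odot>\<^sub>M' g x)"
   unfolding J1_def
  proof (intro conjI allI impI ballI)
   fix w x assume w: "W w" and x: "x \<in> El M'"
   note wD = M'.bold_mapD[OF Wb(1)[OF w]]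
   have "w (f x) = \<zero>\<^sub>M'" "w (g x) = \<zero>\<^sub>M'"
    using J1b(2)[OF Jb(1)[OF fg(1)] w x] J1b(2)[OF Jb(1)[OF fg(2)] w x] by auto
   thus "w (f x \<oplus>\<^sub>M' (\<ominus>\<^sub>R' \<one>\<^sub>R') \<odot>\<^sub>M' g x) = \<zero>\<^sub>M'"
    using fc[OF x] wD(2)[of "f x" "(\<ominus>\<^sub>R' \<one>\<^sub>R') \<odot>\<^sub>M' g x"] wD(3)[of "\<ominus>\<^sub>R' \<one>\<^sub>R'" "g x"] by simp
  qed (rule b)
  moreover have "f (h x) \<oplus>\<^sub>M' (\<ominus>\<^sub>R' \<one>\<^sub>R') \<odot>\<^sub>M' g (h x) = \<zero>\<^sub>M'" if "J1 h" "x \<in> El M'" for h x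
   using Jb(3)[OF fg(1) that] Jb(3)[OF fg(2) that] by simp
  ultimately show ?thesis by (simp add: J_def)
 qed
 obtain S d i0 w where S: "indep S" "i0 \<in> S" and d: "\<And>b. b \<in> S ==> bold_map R M M (d b)" "\<And>x. x \<in> El M ==> d i0 x = x"
  and w: "bold_map R' M' M' w" "\<And>x. x \<in> El M' ==> w x \<in> N"
  "\<And>x. x \<in> El M ==> w (\<iota> x) = mcomb S (%b. d b x)"
  using endomorphism_into[OF s N] by blast
 note S' = indepD(1,2)[OF S(1)]
 have wJ: "J w" using w(1,2) by (intro W_J) (simp add: W_def)
 let ?nul = "\<lambda>x\<in>El M. \<zero>\<^sub>M"
 define U where "U = {d. (\<forall>b\<in>S. d b \<in> bold_homs R M M) \<and>
  (\<exists>f. J f \<and> (\<forall>x\<in>El M. f (\<iota> x) = mcomb S (%b. d b x)))}"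
 obtain x0 where x0: "x0 \<in> El M" "x0 ~= \<zero>\<^sub>M"
  using s M.carrier_tau_submodule M.tau_submoduleD(2)[OF M.carrier_tau_submodule] unfolding simple_sub_def by auto
 let ?d = "%b. restrict (d b) (El M)"
 have dU: "?d \<in> U"
  unfolding U_def using wJ w(3) M.restrict_bold_homs[OF d(1)] by (intro CollectI conjI exI[of _ w]) auto
 have d0: "?d i0 ~= ?nul"
 proof
  assume "?d i0 = ?nul"
  hence "?d i0 x0 = ?nul x0" by (rule fun_cong)
  thus False using x0 d(2) by simp
 qed
 obtain u i where u: "u \<in> U" "i \<in> S" "u i ~= ?nul"
  and min: "\<forall>v\<in>U. (\<forall>j\<in>S. u j = ?nul --> v j = ?nul) --> v i = ?nul --> (\<forall>j\<in>S. v j = ?nul)"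
  using minimal_support[OF S'(1) dU S(2) d0] by blast
 have Ub: "bold_map R M M (v b)" "v b \<in> extensional (El M)" if "v \<in> U" "b \<in> S" for v b
  using that by (auto simp: U_def bold_homs_iff)
 have ub: "bold_map R M M (u b)" if "b \<in> S" for b using Ub(1)[OF u(1) that] .
 obtain fu where fu: "J fu" "\<And>x. x \<in> El M ==> fu (\<iota> x) = mcomb S (%b. u b x)" using u(1) by (auto simp: U_def)
 have "\<exists>x1\<in>El M. u i x1 ~= \<zero>\<^sub>M"
 proof (rule ccontr)
  assume "\<not> (\<exists>x1\<in>El M. u i x1 ~= \<zero>\<^sub>M)"
  hence "u i = ?nul" by (intro extensionalityI[OF Ub(2)[OF u(1,2)]]) simp_all
  thus False using u(3) by simp
 qed
 then obtain x1 where x1: "x1 \<in> El M" "u i x1 ~= \<zero>\<^sub>M" by blast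
 obtain g where g: "bold_map R M M g" "\<And>x. x \<in> El M ==> u i (g x) = x"
  using M.inverse_bold_map[OF ub[OF u(2)] M.schur[OF s ub[OF u(2)] x1]] by blast
 obtain g' where g': "bold_map R' M' M' g'" "\<And>x. x \<in> El M ==> g' (\<iota> x) = \<iota> (g x)" using endo_extension[OF g(1)] by blast
 define z where "z b = (\<lambda>x\<in>El M. u b (g x))" for b
 let ?f = "%x. fu (g' x)"
 have gc: "g x \<in> El M" if "x \<in> El M" for x using M.bold_mapD(1)[OF g(1) that] .
 have zb: "bold_map R M M (z b)" if "b \<in> S" for b
  unfolding z_def by (rule M.bold_map_cong[OF M.bold_map_comp[OF ub[OF that] g(1)]]) simp
 have zc: "z b x \<in> El M" if "b \<in> S" "x \<in> El M" for b x using M.bold_mapD(1)[OF zb] that by auto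
 have f: "J ?f" by (rule J_r[OF fu(1) g'(1)])
 have fv: "?f (\<iota> x) = mcomb S (%b. z b x)" if "x \<in> El M" for x
  using that g'(2) fu(2) gc by (simp add: z_def)
 have zi: "z i x = x" if "x \<in> El M" for x using that g(2) by (simp add: z_def)
 have central: "a (z b x) = z b (a x)" if a: "bold_map R M M a" and b: "b \<in> S" and x: "x \<in> El M" for a b x
 proof -
  obtain a' where a': "bold_map R' M' M' a'" "\<And>x. x \<in> El M ==> a' (\<iota> x) = \<iota> (a x)" using endo_extension[OF a] by blast
  note ac = M.bold_mapD(1)[OF a]
  define v where "v b = (\<lambda>x\<in>El M. a (z b x) \<oplus>\<^sub>M (\<ominus>\<^sub>R \<one>\<^sub>R) \<odot>\<^sub>M z b (a x))" for b
  let ?h = "%x. a' (?f x) \<oplus>\<^sub>M' (\<ominus>\<^sub>R' \<one>\<^sub>R') \<odot>\<^sub>M' ?f (a' x)"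
  have "J ?h" by (rule J_diff[OF J_l[OF f a'(1)] J_r[OF f a'(1)]])
  moreover have "?h (\<iota> x) = mcomb S (%b. v b x)" if x: "x \<in> El M" for x
  proof -
   have p1: "(%b. z b x) \<in> S \<rightarrow> El M" "(%b. a (z b x)) \<in> S \<rightarrow> El M" "(%b. z b (a x)) \<in> S \<rightarrow> El M"
    using zc ac x by auto
   have p2: "(%b. (\<ominus>\<^sub>R \<one>\<^sub>R) \<odot>\<^sub>M z b (a x)) \<in> S \<rightarrow> El M" using p1(3) by auto
   have e1: "a' (?f (\<iota> x)) = mcomb S (%b. a (z b x))"
    unfolding fv[OF x] by (rule map_mcomb[OF a'(1,2) S'(2) p1(1) ac])
   have e2: "?f (a' (\<iota> x)) = mcomb S (%b. z b (a x))"
    using fv[OF ac[OF x]] a'(2)[OF x] by simp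
   have m1: "\<phi> (\<ominus>\<^sub>R \<one>\<^sub>R) = \<ominus>\<^sub>R' \<one>\<^sub>R'"
    using additive_map_neg[OF R.is_abelian_group R'.is_abelian_group \<phi>_additive R.one_closed]
    by (simp add: ring_hom_one[OF \<phi>_hom])
   have e3: "(\<ominus>\<^sub>R' \<one>\<^sub>R') \<odot>\<^sub>M' mcomb S (%b. z b (a x)) = mcomb S (%b. (\<ominus>\<^sub>R \<one>\<^sub>R) \<odot>\<^sub>M z b (a x))"
    using mcomb_smult[OF S'(2,1) p1(3), of "\<ominus>\<^sub>R \<one>\<^sub>R"] m1 by simp
   have "?h (\<iota> x) = mcomb S (%b. a (z b x) \<oplus>\<^sub>M (\<ominus>\<^sub>R \<one>\<^sub>R) \<odot>\<^sub>M z b (a x))"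
    unfolding e1 e2 e3 by (rule mcomb_add[OF S'(2) p1(2) p2, symmetric])
   thus ?thesis using x by (simp add: v_def)
  qed
  moreover have vb: "v b \<in> bold_homs R M M" if "b \<in> S" for b
   unfolding v_def
   by (rule M.restrict_bold_homs[OF M.bold_map_add[OF M.bold_map_comp[OF a zb[OF that]]
      M.bold_map_neg[OF M.bold_map_comp[OF zb[OF that] a]]]])
  ultimately have vU: "v \<in> U" by (auto simp: U_def)
  have v_ext: "v j = ?nul" if "j \<in> S" "\<And>x. x \<in> El M ==> a (z j x) = z j (a x)" for j
   unfolding v_def using that(2) zc[OF that(1)] ac by (intro restrict_ext) (simp add: M.smult_l_minus M.M.r_neg)
  have "v j = ?nul" if j: "j \<in> S" "u j = ?nul" for j
  proof (rule v_ext[OF j(1)])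
   fix x assume x: "x \<in> El M"
   have "z j y = \<zero>\<^sub>M" if "y \<in> El M" for y using that gc by (simp add: z_def j(2))
   thus "a (z j x) = z j (a x)" using x ac M.bold_mapD(6)[OF a] by simp
  qed
  moreover have "v i = ?nul" by (rule v_ext[OF u(2)]) (simp add: zi ac)
  ultimately have "v b = ?nul" using bspec[OF min vU] b by blast
  hence "v b x = \<zero>\<^sub>M" using x by simp
  hence "a (z b x) \<oplus>\<^sub>M (\<ominus>\<^sub>M z b (a x)) = \<zero>\<^sub>M" using x zc[OF b] ac by (simp add: v_def M.smult_l_minus)
  from M.M.minus_equality[OF this] show ?thesis using x zc[OF b] ac by simp
 qed
 have "z b \<in> El (center_ring R M)" if "b \<in> S" for b
  using central[OF _ that] M.restrict_bold_homs[OF zb[OF that]]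
  by (simp add: center_ring_def z_def)
 moreover have "?f (?f x) = \<zero>\<^sub>M'" if "x \<in> El M'" for x using Jb(3)[OF f Jb(1)[OF f] that] .
 ultimately show ?thesis
  using S(1) u(2) zi fv Jb(2)[OF f] by (intro exI[of _ S] exI[of _ z] exI[of _ i] exI[of _ ?f]) auto
qed

end

context base_change
begin

definition scalar_endo :: "'f => 'm => 'm" where
 "scalar_endo a = (\<lambda>x\<in>El M. c a \<odot>\<^sub>M x)"

lemma scalar_endo_hom: "scalar_endo \<in> ring_hom F (center_ring R M)"
proof (rule ring_hom_memI)
 fix a assume a: "a \<in> El F"
 have "bold_map R M M (%x. c a \<odot>\<^sub>M x)"
  using a c_invariant
  by (auto simp: bold_map_def linear_map_def additive_map_def M.smult_r_distr M.tau_smult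
    M.smult_assoc1[symmetric] R.m_comm)
 from M.restrict_bold_homs[OF this] show "scalar_endo a \<in> El (center_ring R M)"
  using a M.bold_mapD(1,3) by (auto simp: center_ring_def scalar_endo_def)
 fix b assume b: "b \<in> El F"
 show "scalar_endo (a \<otimes>\<^sub>F b) = scalar_endo a \<otimes>\<^bsub>center_ring R M\<^esub> scalar_endo b"
  using a b by (auto simp: scalar_endo_def center_ring_def compose_def ring_hom_mult[OF c_hom] M.smult_assoc1
    intro!: restrict_ext)
 show "scalar_endo (a \<oplus>\<^sub>F b) = scalar_endo a \<oplus>\<^bsub>center_ring R M\<^esub> scalar_endo b"
  using a b by (auto simp: scalar_endo_def center_ring_def ring_hom_add[OF c_hom] M.smult_l_distr
    intro!: restrict_ext)
next
 show "scalar_endo \<one>\<^sub>F = \<one>\<^bsub>center_ring R M\<^esub>"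
  by (auto simp: scalar_endo_def center_ring_def ring_hom_one[OF c_hom] intro!: restrict_ext)
qed

text \<open>Separability is tested on field structures on one particular type. The centre fits into it, because it is
finite-dimensional over \<open>F\<close>: the value at a multiset of size \<open>j\<close> records the coordinate number \<open>j\<close>.\<close>
lemma center_embedding:
 "\<exists>\<zeta> :: ('m => 'm) => (('f list \<times> nat) multiset => 'f). inj_on \<zeta> (El (center_ring R M))"
proof -
 obtain k h where "\<And>j. j < k ==> bold_map R M M (h j)"
  and span: "\<And>d. bold_map R M M d ==>
   \<exists>a\<in>{..<k::nat} \<rightarrow> El F. \<forall>x\<in>El M. d x = (\<Oplus>\<^sub>M j\<in>{..<k}. c (a j) \<odot>\<^sub>M h j x)"
  using endomorphisms_finite_dimensional by blast
 hence hc: "h j x \<in> El M" if "j < k" "x \<in> El M" for j x using M.bold_mapD(1) that by blast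
 have "\<forall>d\<in>{d. bold_map R M M d}. \<exists>a. a \<in> {..<k} \<rightarrow> El F \<and>
   (\<forall>x\<in>El M. d x = (\<Oplus>\<^sub>M j\<in>{..<k}. c (a j) \<odot>\<^sub>M h j x))"
  using span by blast
 from bchoice[OF this] obtain a where
  a: "\<And>d. bold_map R M M d ==> a d \<in> {..<k} \<rightarrow> El F"
  "\<And>d x. bold_map R M M d ==> x \<in> El M ==> d x = (\<Oplus>\<^sub>M j\<in>{..<k}. c (a d j) \<odot>\<^sub>M h j x)" by blast
 define \<zeta> where "\<zeta> d = (%ms :: ('f list \<times> nat) multiset. a d (size ms))" for d
 have "inj_on \<zeta> (El (center_ring R M))"
 proof (rule inj_onI)
  fix d d' assume d: "d \<in> El (center_ring R M)" "d' \<in> El (center_ring R M)" and eq: "\<zeta> d = \<zeta> d'"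
  have b: "bold_map R M M d" "bold_map R M M d'" "d \<in> extensional (El M)" "d' \<in> extensional (El M)"
   using d by (auto simp: center_ring_def bold_homs_iff)
  have aa: "a d j = a d' j" for j
   using fun_cong[OF eq, of "replicate_mset j undefined"] by (simp add: \<zeta>_def)
  show "d = d'"
  proof (rule extensionalityI[OF b(3,4)])
   fix x assume x: "x \<in> El M"
   show "d x = d' x" unfolding a(2)[OF b(1) x] a(2)[OF b(2) x] aa ..
  qed
 qed
 thus ?thesis by blast
qed

text \<open>The combination \<open>\<Sum> b \<cdot> z\<^sub>b\<close> defines an element of \<open>F' \<otimes> Z\<close> for the centre \<open>Z\<close>, and its square vanishes there because
\<open>F' \<otimes> Z\<close> acts faithfully on \<open>M'\<close>. Separability makes the element zero, although one \<open>z\<^sub>b\<close> is the identity.\<close>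
lemma separable_square_zero:
 assumes s: "simple_sub R M (El M)" and sep: "separable_extension F e F'"
  and S: "indep S" "i \<in> S" and z: "\<And>b. b \<in> S ==> z b \<in> El (center_ring R M)"
  and zi: "\<And>x. x \<in> El M ==> z i x = x" and f: "bold_map R' M' M' f"
  and fv: "\<And>x. x \<in> El M ==> f (\<iota> x) = mcomb S (%b. z b x)"
  and sq: "\<And>x. x \<in> El M' ==> f (f x) = \<zero>\<^sub>M'"
 shows False
proof -
 note S' = indepD(1,2)[OF S(1)]
 let ?Z = "center_ring R M"
 interpret Z: field ?Z by (rule M.center_ring_field[OF s])
 obtain \<zeta> :: "('m => 'm) => (('f list \<times> nat) multiset => 'f)" where inj: "inj_on \<zeta> (El ?Z)"
  using center_embedding by blast
 define F2 where "F2 = image_ring \<zeta> ?Z"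
 have F2: "field F2" unfolding F2_def by (rule Z.inj_imp_image_ring_is_field[OF inj])
 interpret F2: field F2 by (rule F2)
 have \<zeta>: "\<zeta> \<in> ring_hom ?Z F2" "bij_betw \<zeta> (El ?Z) (El F2)"
  using inj_imp_image_ring_iso[OF inj] unfolding F2_def ring_iso_def by auto
 define g where "g a = \<zeta> (scalar_endo a)" for a
 have sc: "scalar_endo a \<in> El ?Z" if "a \<in> El F" for a
  using ring_hom_closed[OF scalar_endo_hom that] .
 have g: "g \<in> ring_hom F F2"
  unfolding g_def[abs_def] using ring_hom_trans[OF scalar_endo_hom \<zeta>(1)] by (simp add: comp_def)
 interpret T: tensor_of_algebras F e F' g F2
  by (intro tensor_of_algebras.intro F.cring_axioms F'.cring_axioms F2.cring_axioms
    tensor_of_algebras_axioms.intro e_hom g)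
 have red: "reduced T.TA" using sep F2 g unfolding separable_extension_def by blast
 define \<eta> where "\<eta> u = the_inv_into (El ?Z) \<zeta> u" for u
 have \<eta>: "\<eta> (\<zeta> y) = y" if "y \<in> El ?Z" for y unfolding \<eta>_def by (rule the_inv_into_f_f[OF inj that])
 have F2E: "\<exists>y\<in>El ?Z. u = \<zeta> y" if "u \<in> El F2" for u
  using \<zeta>(2) that unfolding bij_betw_def by blast
 have \<zeta>c: "\<zeta> y \<in> El F2" if "y \<in> El ?Z" for y using ring_hom_closed[OF \<zeta>(1) that] .
 have Zb: "bold_map R M M y" "y \<in> extensional (El M)" if "y \<in> El ?Z" for y
  using that by (auto simp: center_ring_def bold_homs_iff)
 have Zc: "y x \<in> El M" if "y \<in> El ?Z" "x \<in> El M" for y x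
  using M.bold_mapD(1)[OF Zb(1)[OF that(1)] that(2)] .
 have Zmult: "(y \<otimes>\<^sub>?Z y') x = y (y' x)" and Zadd: "(y \<oplus>\<^sub>?Z y') x = y x \<oplus>\<^sub>M y' x"
  if "x \<in> El M" for y y' x using that by (simp_all add: center_ring_def compose_def)
 define \<Theta> where "\<Theta> x = tensor_lift M' (%(b, u). c' b \<odot>\<^sub>M' \<iota> (\<eta> u x))" for x
 have bal: "T.bal M' (%(b, u). c' b \<odot>\<^sub>M' \<iota> (\<eta> u x))" if x: "x \<in> El M" for x
 proof (rule T.balancedI)
  fix b u assume b: "b \<in> El F'" and u: "u \<in> El F2"
  obtain y where y: "y \<in> El ?Z" "u = \<zeta> y" using F2E[OF u] by blast
  show "(case (b, u) of (b, u) => c' b \<odot>\<^sub>M' \<iota> (\<eta> u x)) \<in> El M'"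
   using b y x Zc by (simp add: \<eta>)
  show "(case (b \<oplus>\<^sub>F' b', u) of (b, u) => c' b \<odot>\<^sub>M' \<iota> (\<eta> u x)) =
    (case (b, u) of (b, u) => c' b \<odot>\<^sub>M' \<iota> (\<eta> u x)) \<oplus>\<^sub>M' (case (b', u) of (b, u) => c' b \<odot>\<^sub>M' \<iota> (\<eta> u x))"
   if "b' \<in> El F'" for b'
   using b y x Zc that by (simp add: \<eta> ring_hom_add[OF c'_hom] M'.smult_l_distr)
  show "(case (b, u \<oplus>\<^sub>F2 u') of (b, u) => c' b \<odot>\<^sub>M' \<iota> (\<eta> u x)) =
    (case (b, u) of (b, u) => c' b \<odot>\<^sub>M' \<iota> (\<eta> u x)) \<oplus>\<^sub>M' (case (b, u') of (b, u) => c' b \<odot>\<^sub>M' \<iota> (\<eta> u x))"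
   if u': "u' \<in> El F2" for u'
  proof -
   obtain y' where y': "y' \<in> El ?Z" "u' = \<zeta> y'" using F2E[OF u'] by blast
   have "u \<oplus>\<^sub>F2 u' = \<zeta> (y \<oplus>\<^sub>?Z y')" using y y' ring_hom_add[OF \<zeta>(1)] by simp
   hence "\<eta> (u \<oplus>\<^sub>F2 u') = y \<oplus>\<^sub>?Z y'" using \<eta> y y' by simp
   thus ?thesis using b y y' x Zc by (simp add: \<eta> Zadd \<iota>_add M'.smult_r_distr)
  qed
  show "(case (e a \<otimes>\<^sub>F' b, u) of (b, u) => c' b \<odot>\<^sub>M' \<iota> (\<eta> u x)) =
    (case (b, g a \<otimes>\<^sub>F2 u) of (b, u) => c' b \<odot>\<^sub>M' \<iota> (\<eta> u x))"
   if a: "a \<in> El F" for a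
  proof -
   have "g a \<otimes>\<^sub>F2 u = \<zeta> (scalar_endo a \<otimes>\<^sub>?Z y)" using y sc[OF a] ring_hom_mult[OF \<zeta>(1)] by (simp add: g_def)
   hence "\<eta> (g a \<otimes>\<^sub>F2 u) = scalar_endo a \<otimes>\<^sub>?Z y" using \<eta> y sc[OF a] by simp
   hence "\<eta> (g a \<otimes>\<^sub>F2 u) x = c a \<odot>\<^sub>M y x" using x Zc[OF y(1) x] by (simp add: Zmult scalar_endo_def)
   thus ?thesis using b y x Zc a
    by (simp add: \<eta> \<iota>_smult \<phi>_c ring_hom_mult[OF c'_hom] M'.smult_assoc1[symmetric] R'.m_comm)
  qed
 qed
 have \<Theta>a: "additive_map T.TA M' (\<Theta> x)" if "x \<in> El M" for x
  unfolding \<Theta>_def by (rule T.lift_TA(1)[OF M'_ab bal[OF that]])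
 have \<Theta>p: "\<Theta> x (T.ap b (\<zeta> y)) = c' b \<odot>\<^sub>M' \<iota> (y x)" if "x \<in> El M" "b \<in> El F'" "y \<in> El ?Z" for x b y
  unfolding \<Theta>_def using T.lift_TA(2)[OF M'_ab bal[OF that(1)] that(2) \<zeta>c[OF that(3)]] \<eta>[OF that(3)] by simp
 define U where "U = (\<Oplus>\<^sub>T.TA b\<in>S. T.ap b (\<zeta> (z b)))"
 have Sc: "b \<in> El F'" if "b \<in> S" for b using S' that by auto
 have UT: "U \<in> El T.TA" unfolding U_def using Sc z \<zeta>c by (intro T.TA.finsum_closed) auto
 have \<Theta>U: "\<Theta> x U = f (\<iota> x)" if x: "x \<in> El M" for x
 proof -
  have "\<Theta> x U = (\<Oplus>\<^sub>M' b\<in>S. \<Theta> x (T.ap b (\<zeta> (z b))))"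
   unfolding U_def using Sc z \<zeta>c by (intro additive_map_finsum[OF T.TA_abelian_group M'_ab \<Theta>a[OF x]]) auto
  also have "... = mcomb S (%b. z b x)"
   using Sc z x Zc by (intro M'.M.finsum_cong') (auto simp: \<Theta>p)
  finally show ?thesis using fv[OF x] by simp
 qed
 have fD: "f y \<in> El M'" if "y \<in> El M'" for y using M'.bold_mapD(1)[OF f that] .
 have \<Theta>mult: "\<Theta> x (U \<otimes>\<^sub>T.TA V) = f (\<Theta> x V)" if x: "x \<in> El M" and V: "V \<in> El T.TA" for x V
  using V
 proof (induction rule: T.TA_induct)
  case (pure b u)
  then obtain y where y: "y \<in> El ?Z" "u = \<zeta> y" using F2E by blast
  have am: "additive_map T.TA M' (%W. \<Theta> x (W \<otimes>\<^sub>T.TA T.ap b u))"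
   using pure additive_map_closed[OF \<Theta>a[OF x]] additive_map_add[OF \<Theta>a[OF x]]
   by (simp add: additive_map_def T.TA.l_distr)
  have yx: "y x \<in> El M" using Zc[OF y(1) x] .
  have "\<Theta> x (U \<otimes>\<^sub>T.TA T.ap b u) = (\<Oplus>\<^sub>M' t\<in>S. \<Theta> x (T.ap t (\<zeta> (z t)) \<otimes>\<^sub>T.TA T.ap b u))"
   unfolding U_def using Sc z \<zeta>c by (intro additive_map_finsum[OF T.TA_abelian_group M'_ab am]) auto
  also have "... = (\<Oplus>\<^sub>M' t\<in>S. c' b \<odot>\<^sub>M' (c' t \<odot>\<^sub>M' \<iota> (z t (y x))))"
  proof (rule M'.M.finsum_cong')
   show "(%t. c' b \<odot>\<^sub>M' (c' t \<odot>\<^sub>M' \<iota> (z t (y x)))) \<in> S \<rightarrow> El M'"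
    using pure(1) Sc z Zc yx by auto
   fix t assume t: "t \<in> S"
   have "T.ap t (\<zeta> (z t)) \<otimes>\<^sub>T.TA T.ap b u = T.ap (t \<otimes>\<^sub>F' b) (\<zeta> (z t \<otimes>\<^sub>?Z y))"
    using pure Sc[OF t] z[OF t] y \<zeta>c by (simp add: ring_hom_mult[OF \<zeta>(1)])
   hence "\<Theta> x (T.ap t (\<zeta> (z t)) \<otimes>\<^sub>T.TA T.ap b u) = c' (t \<otimes>\<^sub>F' b) \<odot>\<^sub>M' \<iota> ((z t \<otimes>\<^sub>?Z y) x)"
    using \<Theta>p[OF x, of "t \<otimes>\<^sub>F' b" "z t \<otimes>\<^sub>?Z y"] pure(1) Sc[OF t] z[OF t] y(1) by simp
   thus "\<Theta> x (T.ap t (\<zeta> (z t)) \<otimes>\<^sub>T.TA T.ap b u) = c' b \<odot>\<^sub>M' (c' t \<odot>\<^sub>M' \<iota> (z t (y x)))"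
    using pure(1) Sc[OF t] Zc[OF z[OF t] yx]
    by (simp add: Zmult[OF x] ring_hom_mult[OF c'_hom] M'.smult_assoc1[symmetric] R'.m_comm)
  qed simp
  also have "... = c' b \<odot>\<^sub>M' mcomb S (%t. z t (y x))"
   using pure(1) Sc z Zc yx S'(1) by (intro M'.finsum_smult_ldistr[symmetric]) auto
  also have "... = f (c' b \<odot>\<^sub>M' \<iota> (y x))"
   using M'.bold_mapD(3)[OF f, of "c' b" "\<iota> (y x)"] pure(1) yx fv[OF yx] by simp
  also have "... = f (\<Theta> x (T.ap b u))" using \<Theta>p[OF x pure(1) y(1)] y(2) by simp
  finally show ?case .
 next
  case (add V1 V2)
  thus ?case
   using UT additive_map_closed[OF \<Theta>a[OF x]] additive_map_add[OF \<Theta>a[OF x]] M'.bold_mapD(2)[OF f]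
   by (simp add: T.TA.r_distr)
 qed
 have \<Theta>inj: "V = \<zero>\<^sub>T.TA" if V: "V \<in> El T.TA" and zero: "\<And>x. x \<in> El M ==> \<Theta> x V = \<zero>\<^sub>M'" for V
 proof -
  have mF2: "module F (restrict_scalars g F2)" by (rule restrict_scalars_module[OF F.cring_axioms F2.cring_axioms g])
  obtain B v where B: "indep B" "v \<in> B \<rightarrow> El (restrict_scalars g F2)"
   "V = (\<Oplus>\<^sub>T.X.T b\<in>B. T.X.pure b (v b))"
   using tensor_combination[OF mF2, of V] V by (auto simp: T.TA_simps)
  have vc: "v b \<in> El F2" if "b \<in> B" for b using B(2) that by auto
  have Bc: "b \<in> El F'" if "b \<in> B" for b using indepD(2)[OF B(1)] that by auto
  have fs: "finsum T.X.T h B = finsum T.TA h B" for h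
   unfolding finsum_def by (simp add: T.TA_simps)
  have V2: "V = (\<Oplus>\<^sub>T.TA b\<in>B. T.ap b (v b))"
   unfolding B(3) fs by (simp add: algebra_pure_def)
  define y where "y b = \<eta> (v b)" for b
  have y: "y b \<in> El ?Z" "v b = \<zeta> (y b)" if b: "b \<in> B" for b
  proof -
   obtain y' where "y' \<in> El ?Z" "v b = \<zeta> y'" using F2E[OF vc[OF b]] by blast
   thus "y b \<in> El ?Z" "v b = \<zeta> (y b)" using \<eta> by (auto simp: y_def)
  qed
  have "y b x = \<zero>\<^sub>M" if b: "b \<in> B" and x: "x \<in> El M" for b x
  proof (rule mcomb_zero[OF B(1) _ _ b])
   show "(%b. y b x) \<in> B \<rightarrow> El M" using Zc[OF y(1) x] by auto
   have "\<Theta> x V = (\<Oplus>\<^sub>M' b\<in>B. \<Theta> x (T.ap b (v b)))"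
    unfolding V2 using Bc vc by (intro additive_map_finsum[OF T.TA_abelian_group M'_ab \<Theta>a[OF x]]) auto
   also have "... = mcomb B (%b. y b x)"
    using Bc y x Zc by (intro M'.M.finsum_cong') (auto simp: \<Theta>p)
   finally show "mcomb B (%b. y b x) = \<zero>\<^sub>M'" using zero[OF x] by simp
  qed
  hence "y b = \<zero>\<^sub>?Z" if "b \<in> B" for b
   using that Zb(2)[OF y(1)[OF that]]
   by (intro extensionalityI[of _ "El M"]) (auto simp: center_ring_def)
  hence v0: "v b = \<zero>\<^sub>F2" if "b \<in> B" for b
   using y(2)[OF that] that ring_hom_zero[OF \<zeta>(1) Z.ring_axioms F2.ring_axioms] by simp
  have ap0: "T.ap b \<zero>\<^sub>F2 = \<zero>\<^sub>T.TA" if "b \<in> El F'" for b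
   using additive_map_zero[OF F2.is_abelian_group T.TA_abelian_group, of "%u. T.ap b u"] that
   by (simp add: additive_map_def T.ap_add_r)
  show ?thesis unfolding V2 using v0 ap0 Bc by (intro T.TA.add.finprod_one_eqI) auto
 qed
 have "U \<otimes>\<^sub>T.TA U = \<zero>\<^sub>T.TA"
 proof (rule \<Theta>inj)
  fix x assume x: "x \<in> El M"
  show "\<Theta> x (U \<otimes>\<^sub>T.TA U) = \<zero>\<^sub>M'" unfolding \<Theta>mult[OF x UT] \<Theta>U[OF x] using x by (simp add: sq)
 qed (use UT in simp)
 hence "U [^]\<^sub>T.TA (Suc (Suc 0)) = \<zero>\<^sub>T.TA" using UT by simp
 hence U0: "U = \<zero>\<^sub>T.TA" using red UT unfolding reduced_def by blast
 obtain x0 where x0: "x0 \<in> El M" "x0 ~= \<zero>\<^sub>M"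
  using s M.carrier_tau_submodule M.tau_submoduleD(2)[OF M.carrier_tau_submodule] unfolding simple_sub_def by auto
 have "mcomb S (%b. z b x0) = \<zero>\<^sub>M'"
  using \<Theta>U[OF x0(1)] fv[OF x0(1)] additive_map_zero[OF T.TA_abelian_group M'_ab \<Theta>a[OF x0(1)]] U0 by simp
 hence "z i x0 = \<zero>\<^sub>M"
  using Zc[OF z x0(1)] by (intro mcomb_zero[OF S(1) _ _ S(2), of "%b. z b x0"]) auto
 thus False using zi[OF x0(1)] x0(2) by simp
qed

theorem splitting:
 assumes s: "simple_sub R M (El M)" and sep: "separable_extension F e F'"
  and N: "tau_submodule R' M' N" "N ~= {\<zero>\<^sub>M'}"
 shows "\<exists>w. bold_map R' M' M' w \<and> (\<forall>x\<in>El M'. w x \<in> N) \<and> (\<exists>x\<in>N. w x ~= \<zero>\<^sub>M')"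
proof (rule ccontr)
 assume contra: "\<not> ?thesis"
 have kill: "w x = \<zero>\<^sub>M'" if "bold_map R' M' M' w" "\<And>x. x \<in> El M' ==> w x \<in> N" "x \<in> N" for w x
  using contra that by blast
 have "\<exists>S z i f. indep S \<and> i \<in> S \<and> (\<forall>b\<in>S. z b \<in> El (center_ring R M)) \<and>
  (\<forall>x\<in>El M. z i x = x) \<and> bold_map R' M' M' f \<and>
  (\<forall>x\<in>El M. f (\<iota> x) = mcomb S (%b. z b x)) \<and> (\<forall>x\<in>El M'. f (f x) = \<zero>\<^sub>M')"
  by (rule square_zero_central[OF s N]) (rule kill)
 then obtain S z i f where "indep S" "i \<in> S" "\<forall>b\<in>S. z b \<in> El (center_ring R M)"
  "\<forall>x\<in>El M. z i x = x" "bold_map R' M' M' f"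
  "\<forall>x\<in>El M. f (\<iota> x) = mcomb S (%b. z b x)" "\<forall>x\<in>El M'. f (f x) = \<zero>\<^sub>M'"
  by (elim exE conjE)
 thus False by (intro separable_square_zero[OF s sep, of S i z f]) auto
qed

end

context dual_module
begin

text \<open>A nonzero stable submodule of smallest rank is simple, as the rank is strictly monotone.\<close>
lemma exists_simple_sub:
 assumes "tau_submodule R M Y" "Y ~= {\<zero>\<^sub>M}"
 shows "\<exists>N\<subseteq>Y. simple_sub R M N"
proof -
 let ?P = "%N. tau_submodule R M N \<and> N ~= {\<zero>\<^sub>M} \<and> N <= Y"
 obtain N where N: "?P N" "\<And>N'. ?P N' ==> rk N \<le> rk N'"
  using arg_min_nat_lemma[of ?P Y rk] assms by blast
 have "N' = {\<zero>\<^sub>M} \<or> N' = N" if "tau_submodule R M N'" "N' <= N" for N'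
 proof (rule ccontr)
  assume "\<not> (N' = {\<zero>\<^sub>M} \<or> N' = N)"
  hence "rk N' < rk N" "?P N'" using that N(1) rk_strict[OF that(1)] by auto
  thus False using N(2)[of N'] by simp
 qed
 thus ?thesis using N(1) unfolding simple_sub_def by blast
qed

lemma module_span_mono: "S <= module_span R M S' ==> S' <= El M ==> module_span R M S <= module_span R M S'"
 by (rule module_span_least[OF module_span_submodule])

text \<open>Induction on the rank: a simple submodule \<open>N\<close> of \<open>Y\<close> is mapped isomorphically by a suitable \<open>w\<close> with values in \<open>N\<close>,
so that \<open>Y\<close> is the sum of \<open>N\<close> and the part of the kernel of \<open>w\<close> in \<open>Y\<close>, which has smaller rank.\<close>
lemma sum_of_simples:
 assumes split: "\<And>N. tau_submodule R M N ==> N ~= {\<zero>\<^sub>M} ==>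
   \<exists>w. bold_map R M M w \<and> (\<forall>x\<in>El M. w x \<in> N) \<and> (\<exists>x\<in>N. w x ~= \<zero>\<^sub>M)"
  and Y: "tau_submodule R M Y"
 shows "\<exists>\<N>. finite \<N> \<and> (\<forall>N\<in>\<N>. simple_sub R M N) \<and> module_span R M (\<Union>\<N>) = Y"
 using Y
proof (induction "rk Y" arbitrary: Y rule: less_induct)
 case less
 note YD = tau_submoduleD[OF less.prems]
 show ?case
 proof (cases "Y = {\<zero>\<^sub>M}")
  case True
  have "module_span R M {} = {\<zero>\<^sub>M}"
  proof
   show "module_span R M {} <= {\<zero>\<^sub>M}"
    using zero_tau_submodule by (intro module_span_least) (auto simp: tau_submodule_def)
  qed (auto intro: module_span.zero)
  thus ?thesis using True by (intro exI[of _ "{}"]) simp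
 next
  case False
  obtain N where N: "N <= Y" "simple_sub R M N" using exists_simple_sub[OF less.prems False] by blast
  have Nt: "tau_submodule R M N" and N0: "N ~= {\<zero>\<^sub>M}" using N(2) by (auto simp: simple_sub_def)
  note ND = tau_submoduleD[OF Nt]
  obtain w x where w: "bold_map R M M w" "\<And>x. x \<in> El M ==> w x \<in> N" "x \<in> N" "w x ~= \<zero>\<^sub>M"
   using split[OF Nt N0] by blast
  note wD = bold_mapD[OF w(1)]
  have wN: "w ` N = N"
  proof -
   have "w ` N <= N" using w(2) ND(1) by auto
   moreover have "w ` N ~= {\<zero>\<^sub>M}" using w(3,4) by blast
   ultimately show ?thesis using N(2) image_tau_submodule[OF w(1) Nt] unfolding simple_sub_def by blast
  qed
  let ?K = "{x \<in> El M. w x = \<zero>\<^sub>M}"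
  let ?Y = "Y \<inter> ?K"
  have Y1: "tau_submodule R M ?Y" by (rule inter_tau_submodule[OF less.prems kernel_tau_submodule[OF w(1)]])
  have "?Y \<subset> Y" using w(3,4) N(1) by auto
  from rk_strict[OF Y1 less.prems this] less.hyps Y1
  obtain \<N> where \<N>: "finite \<N>" "\<forall>N\<in>\<N>. simple_sub R M N" "module_span R M (\<Union>\<N>) = ?Y" by blast
  have c: "\<Union>(insert N \<N>) <= El M"
  proof
   fix x assume "x \<in> \<Union>(insert N \<N>)"
   then obtain N' where "x \<in> N'" "simple_sub R M N'" using N(2) \<N>(2) by blast
   thus "x \<in> El M" using tau_submoduleD(1)[of N' x] by (simp add: simple_sub_def)
  qed
  have sub: "?Y <= module_span R M (\<Union>(insert N \<N>))"
   unfolding \<N>(3)[symmetric] using c by (intro module_span_mono) (auto intro: module_span.base)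
  have "module_span R M (\<Union>(insert N \<N>)) = Y"
  proof
   have "\<Union>\<N> <= Y" using \<N>(3) by (auto intro: module_span.base)
   thus "module_span R M (\<Union>(insert N \<N>)) <= Y"
    using N(1) less.prems by (intro module_span_least) (auto simp: tau_submodule_def)
   show "Y <= module_span R M (\<Union>(insert N \<N>))"
   proof
    fix y assume y: "y \<in> Y"
    have yc: "y \<in> El M" using YD(1)[OF y] .
    obtain n where n: "n \<in> N" "w n = w y" using wN w(2)[OF yc] by (metis imageE)
    have nc: "n \<in> El M" using ND(1)[OF n(1)] .
    have "y \<oplus>\<^sub>M (\<ominus>\<^sub>M n) \<in> ?Y"
     using y n yc nc YD(3)[OF y YD(6)] N(1) wD(1)
      additive_map_neg[OF M.abelian_group_axioms M.abelian_group_axioms wD(5) nc]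
     by (auto simp: wD(2) M.r_neg)
    hence "y \<oplus>\<^sub>M (\<ominus>\<^sub>M n) \<in> module_span R M (\<Union>(insert N \<N>))" using sub by blast
    moreover have "n \<in> module_span R M (\<Union>(insert N \<N>))" using n(1) by (auto intro: module_span.base)
    ultimately have "(y \<oplus>\<^sub>M (\<ominus>\<^sub>M n)) \<oplus>\<^sub>M n \<in> module_span R M (\<Union>(insert N \<N>))"
     by (rule module_span.add)
    thus "y \<in> module_span R M (\<Union>(insert N \<N>))" using yc nc by (simp add: M.a_assoc M.l_neg)
   qed
  qed
  thus ?thesis using \<N> N(2) by (intro exI[of _ "insert N \<N>"]) auto
 qed
qed

end

section \<open>Restricted modules over a bold ring without invariant ideals\<close>

lemma (in module) regroup:
 assumes "finite J" "finite B" "y ` J <= B" "B <= El M" "\<And>j. j \<in> J ==> g j \<in> El R"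
 shows "(\<Oplus>\<^sub>M b\<in>B. (\<Oplus>j\<in>J. (if y j = b then \<one> else \<zero>) \<otimes> g j) \<odot>\<^sub>M b) = (\<Oplus>\<^sub>M j\<in>J. g j \<odot>\<^sub>M y j)"
 using assms(1,3,5)
proof (induction J)
 case empty
 thus ?case using assms(4) by (auto intro!: M.add.finprod_one_eqI)
next
 case (insert j J)
 let ?s = "%J b. \<Oplus>j\<in>J. (if y j = b then \<one> else \<zero>) \<otimes> g j"
 have gj: "g j \<in> El R" and gJ: "\<And>i. i \<in> J ==> g i \<in> El R" using insert by auto
 have yj: "y j \<in> B" "y j \<in> El M" using insert assms(4) by auto
 have yJ: "\<And>i. i \<in> J ==> y i \<in> El M" using insert assms(4) by auto
 have sc: "?s J b \<in> El R" for b using gJ by (intro R.finsum_closed) auto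
 have Bc: "b \<in> El M" if "b \<in> B" for b using assms(4) that by auto
 have split: "?s (insert j J) b = (if y j = b then \<one> else \<zero>) \<otimes> g j \<oplus> ?s J b" for b
  using insert.hyps gj gJ by (intro R.finsum_insert) auto
 have "(\<Oplus>\<^sub>M b\<in>B. ?s (insert j J) b \<odot>\<^sub>M b) =
   (\<Oplus>\<^sub>M b\<in>B. (if b = y j then g j \<odot>\<^sub>M b else \<zero>\<^sub>M) \<oplus>\<^sub>M ?s J b \<odot>\<^sub>M b)"
  unfolding split using gj sc Bc by (intro M.finsum_cong') (auto simp: smult_l_distr)
 also have "... = (\<Oplus>\<^sub>M b\<in>B. if b = y j then g j \<odot>\<^sub>M b else \<zero>\<^sub>M) \<oplus>\<^sub>M (\<Oplus>\<^sub>M b\<in>B. ?s J b \<odot>\<^sub>M b)"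
  using gj sc Bc by (intro M.finsum_addf) auto
 also have "(\<Oplus>\<^sub>M b\<in>B. if b = y j then g j \<odot>\<^sub>M b else \<zero>\<^sub>M) = g j \<odot>\<^sub>M y j"
  using gj yj Bc assms(2)
  by (subst M.add.finprod_mono_neutral_cong_right[of B "{y j}" _ "%b. g j \<odot>\<^sub>M b"]) auto
 also have "(\<Oplus>\<^sub>M b\<in>B. ?s J b \<odot>\<^sub>M b) = (\<Oplus>\<^sub>M j\<in>J. g j \<odot>\<^sub>M y j)" using insert by auto
 also have "g j \<odot>\<^sub>M y j \<oplus>\<^sub>M ... = (\<Oplus>\<^sub>M j\<in>insert j J. g j \<odot>\<^sub>M y j)"
  using insert.hyps gj gJ yj yJ by (intro M.finsum_insert[symmetric]) auto
 finally show ?case .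
qed

lemma (in module) dual_basis_of_family:
 assumes J: "finite J" and y: "\<And>j. j \<in> J ==> y j \<in> El M" and g: "\<And>j. j \<in> J ==> functional R M (g j)"
  and expand: "\<And>x. x \<in> El M ==> x = (\<Oplus>\<^sub>M j\<in>J. g j x \<odot>\<^sub>M y j)"
 shows "\<exists>A f. dual_basis R M A f"
proof -
 let ?f = "%b x. \<Oplus>j\<in>J. (if y j = b then \<one> else \<zero>) \<otimes> g j x"
 have "dual_basis R M (y ` J) ?f"
  unfolding dual_basis_def
 proof (intro conjI ballI)
  show "finite (y ` J)" "y ` J <= El M" using J y by auto
  show "functional R M (?f b)" for b using J g by (intro functional_sum) auto
  fix x assume x: "x \<in> El M"
  have "(\<Oplus>\<^sub>M a\<in>y ` J. ?f a x \<odot>\<^sub>M a) = (\<Oplus>\<^sub>M j\<in>J. g j x \<odot>\<^sub>M y j)"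
   using J y functionalD(1)[OF g x] by (intro regroup) auto
  thus "x = (\<Oplus>\<^sub>M a\<in>y ` J. ?f a x \<odot>\<^sub>M a)" using expand[OF x] by simp
 qed
 thus ?thesis by blast
qed

lemma bij_betw_additiveI:
 assumes "abelian_group A" "abelian_group B" "additive_map A B g"
  and "\<And>x. x \<in> El A ==> g x = \<zero>\<^sub>B ==> x = \<zero>\<^sub>A"
  and "\<And>y. y \<in> El B ==> \<exists>x\<in>El A. g x = y"
 shows "bij_betw g (El A) (El B)"
proof -
 interpret A: abelian_group A by fact
 interpret B: abelian_group B by fact
 have "inj_on g (El A)"
 proof (rule inj_onI)
  fix x y assume xy: "x \<in> El A" "y \<in> El A" "g x = g y"
  have "g (x \<oplus>\<^sub>A (\<ominus>\<^sub>A y)) = \<zero>\<^sub>B"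
   using xy additive_map_add[OF assms(3), of x "\<ominus>\<^sub>A y"] additive_map_neg[OF assms(1-3) xy(2)]
    additive_map_closed[OF assms(3) xy(2)] by (simp add: B.r_neg)
  hence "x \<oplus>\<^sub>A (\<ominus>\<^sub>A y) = \<zero>\<^sub>A" using xy assms(4)[of "x \<oplus>\<^sub>A (\<ominus>\<^sub>A y)"] by simp
  from A.minus_equality[OF this] show "x = y" using xy by simp
 qed
 moreover have "g ` El A = El B"
  using additive_map_closed[OF assms(3)] assms(5) by (auto simp: image_iff)
 ultimately show ?thesis by (simp add: bij_betw_def)
qed

context bold_module
begin

abbreviation "TW \<equiv> tensor_group R (restrict_scalars (endo R) R) M"

lemma twist_tensor: "tensor R (restrict_scalars (endo R) R) M"
 by (intro tensor.intro R.is_cring restrict_scalars_module endo_hom module_axioms)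

lemma tau_lin_balanced: "balanced R (restrict_scalars (endo R) R) M M (%(r, m). r \<odot>\<^sub>M tau M m)"
 using tau_closed
 by (auto simp: balanced_def smult_l_distr tau_add smult_r_distr tau_smult smult_assoc1[symmetric] R.m_comm Pi_iff)

lemma tau_lin_additive: "additive_map TW M (tau_lin M)"
 unfolding tau_lin_def by (rule tensor.lift_additive[OF twist_tensor M.abelian_group_axioms tau_lin_balanced])

lemma tau_lin_pure: "r \<in> El R ==> m \<in> El M ==>
  tau_lin M (tensor_pure R (restrict_scalars (endo R) R) M r m) = r \<odot>\<^sub>M tau M m"
 unfolding tau_lin_def using tensor.lift_pure[OF twist_tensor M.abelian_group_axioms tau_lin_balanced] by simp

lemma functional_twist:
 assumes "functional R M f"
 shows "balanced R (restrict_scalars (endo R) R) M R (%(r, m). r \<otimes> endo R (f m))"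
 using functionalD[OF assms]
 by (auto simp: balanced_def R.l_distr R.r_distr sigma_add sigma_mult R.m_ac)

text \<open>The functional \<open>r \<otimes> m \<mapsto> r \<sigma>(f m)\<close> is well defined on the source of the linearisation; compose it with the inverse.\<close>
lemma bijective_imp_dual_tau:
 assumes bij: "bij_betw (tau_lin M) (El TW) (El M)" and f: "functional R M f"
 shows "\<exists>\<psi>. functional R M \<psi> \<and> (\<forall>x\<in>El M. \<psi> (tau M x) = endo R (f x))"
proof -
 interpret T: tensor R "restrict_scalars (endo R) R" M by (rule twist_tensor)
 define L where "L = tensor_lift R (%(r, m). r \<otimes> endo R (f m))"
 note fD = functionalD[OF f]
 have La: "additive_map TW R L"
  unfolding L_def by (rule T.lift_additive[OF R.is_abelian_group functional_twist[OF f]])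
 have Lp: "L (T.pure r m) = r \<otimes> endo R (f m)" if "r \<in> El R" "m \<in> El M" for r m
  unfolding L_def using T.lift_pure[OF R.is_abelian_group functional_twist[OF f]] that by simp
 let ?i = "the_inv_into (El TW) (tau_lin M)"
 have inj: "inj_on (tau_lin M) (El TW)" and im: "tau_lin M ` El TW = El M"
  using bij by (auto simp: bij_betw_def)
 have ic: "?i y \<in> El TW" and ti: "tau_lin M (?i y) = y" if "y \<in> El M" for y
  using that im the_inv_into_into[OF inj, of y] f_the_inv_into_f[OF inj, of y] by auto
 have it: "?i (tau_lin M U) = U" if "U \<in> El TW" for U using the_inv_into_f_f[OF inj that] .
 define \<psi> where "\<psi> y = L (?i y)" for y
 have act: "\<exists>U'\<in>El TW. tau_lin M U' = s \<odot>\<^sub>M tau_lin M U \<and> L U' = s \<otimes> L U"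
  if s: "s \<in> El R" and U: "U \<in> El TW" for s U
  using U
 proof (induction rule: T.T_induct)
  case (pure r m)
  hence rm: "r \<in> El R" "m \<in> El M" by auto
  have "tau M m \<in> El M" using tau_closed rm by auto
  thus ?case
   using s rm fD(1) by (intro bexI[of _ "T.pure (s \<otimes> r) m"]) (auto simp: tau_lin_pure Lp smult_assoc1 R.m_assoc)
 next
  case (add U V)
  then obtain U' V' where "U' \<in> El TW" "tau_lin M U' = s \<odot>\<^sub>M tau_lin M U" "L U' = s \<otimes> L U"
   "V' \<in> El TW" "tau_lin M V' = s \<odot>\<^sub>M tau_lin M V" "L V' = s \<otimes> L V" by blast
  thus ?case
   using s add(1,2) additive_map_closed[OF La] additive_map_closed[OF tau_lin_additive]
   by (intro bexI[of _ "U' \<oplus>\<^sub>TW V'"])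
     (auto simp: additive_map_add[OF La] additive_map_add[OF tau_lin_additive] smult_r_distr R.r_distr)
 qed
 have "functional R M \<psi>"
  unfolding functional_def additive_map_def
 proof (intro conjI ballI)
  fix x assume x: "x \<in> El M"
  show "\<psi> x \<in> El R" unfolding \<psi>_def by (rule additive_map_closed[OF La ic[OF x]])
  fix y assume y: "y \<in> El M"
  have "tau_lin M (?i x \<oplus>\<^sub>TW ?i y) = x \<oplus>\<^sub>M y"
   using x y ic ti by (simp add: additive_map_add[OF tau_lin_additive])
  hence "?i (x \<oplus>\<^sub>M y) = ?i x \<oplus>\<^sub>TW ?i y" using it[of "?i x \<oplus>\<^sub>TW ?i y"] ic x y by simp
  thus "\<psi> (x \<oplus>\<^sub>M y) = \<psi> x \<oplus> \<psi> y" unfolding \<psi>_def using ic x y by (simp add: additive_map_add[OF La])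
 next
  fix r x assume r: "r \<in> El R" and x: "x \<in> El M"
  obtain U' where U': "U' \<in> El TW" "tau_lin M U' = r \<odot>\<^sub>M x" "L U' = r \<otimes> L (?i x)"
   using act[OF r ic[OF x]] ti[OF x] by auto
  thus "\<psi> (r \<odot>\<^sub>M x) = r \<otimes> \<psi> x" unfolding \<psi>_def using it[OF U'(1)] by simp
 qed
 moreover have "\<psi> (tau M x) = endo R (f x)" if x: "x \<in> El M" for x
 proof -
  have tx: "tau M x \<in> El M" using tau_closed x by auto
  have "tau_lin M (T.pure \<one> x) = tau M x" using tau_lin_pure[of \<one> x] x tx by simp
  hence "?i (tau M x) = T.pure \<one> x" using it[of "T.pure \<one> x"] x by simp
  thus ?thesis unfolding \<psi>_def using Lp[of \<one> x] x fD(1) by simp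
 qed
 ultimately show ?thesis by blast
qed

end

lemma free_module_simps:
 "El (free_module R I) = {f \<in> I \<rightarrow>\<^sub>E El R. finite {i \<in> I. f i ~= \<zero>\<^sub>R}}"
 "f \<oplus>\<^bsub>free_module R I\<^esub> g = (\<lambda>i\<in>I. f i \<oplus>\<^sub>R g i)"
 "r \<odot>\<^bsub>free_module R I\<^esub> f = (\<lambda>i\<in>I. r \<otimes>\<^sub>R f i)"
 "\<zero>\<^bsub>free_module R I\<^esub> = (\<lambda>i\<in>I. \<zero>\<^sub>R)"
 by (simp_all add: free_module_def)

lemma (in module) projective_imp_dual_basis:
 assumes fg: "finitely_generated R M" and pr: "projective R M"
 shows "\<exists>A f. dual_basis R M A f"
proof -
 obtain A where A: "finite A" "A <= El M"
  "\<And>x. x \<in> El M ==> \<exists>c\<in>A \<rightarrow> El R. x = (\<Oplus>\<^sub>M a\<in>A. c a \<odot>\<^sub>M a)"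
  using fg unfolding finitely_generated_def by blast
 obtain I :: "'c set" and s p where s: "s \<in> linear_maps R M (free_module R I)"
  and p: "p \<in> linear_maps R (free_module R I) M" and ps: "\<And>x. x \<in> El M ==> p (s x) = x"
  using pr unfolding projective_def by blast
 let ?L = "free_module R I"
 have sc: "s x \<in> I \<rightarrow>\<^sub>E El R" "finite {i \<in> I. s x i ~= \<zero>}" if "x \<in> El M" for x
  using s that by (auto simp: linear_maps_def free_module_simps)
 have sadd: "s (x \<oplus>\<^sub>M y) i = s x i \<oplus> s y i" if "x \<in> El M" "y \<in> El M" "i \<in> I" for x y i
  using s that by (auto simp: linear_maps_def free_module_simps)
 have ssm: "s (r \<odot>\<^sub>M x) i = r \<otimes> s x i" if "r \<in> El R" "x \<in> El M" "i \<in> I" for r x i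
  using s that by (auto simp: linear_maps_def free_module_simps)
 have sfun: "functional R M (%x. s x i)" if "i \<in> I" for i
  using sc(1) sadd ssm that by (auto simp: functional_def additive_map_def)
 have pc: "p v \<in> El M" if "v \<in> El ?L" for v using p that by (auto simp: linear_maps_def)
 have padd: "p (v \<oplus>\<^sub>?L w) = p v \<oplus>\<^sub>M p w" if "v \<in> El ?L" "w \<in> El ?L" for v w
  using p that by (auto simp: linear_maps_def)
 have psm: "p (r \<odot>\<^sub>?L v) = r \<odot>\<^sub>M p v" if "r \<in> El R" "v \<in> El ?L" for r v
  using p that by (auto simp: linear_maps_def)
 define unit where "unit i = (\<lambda>j\<in>I. if j = i then \<one> else \<zero>)" for i
 have uL: "unit i \<in> El ?L" for i
  by (auto simp: unit_def free_module_simps intro: finite_subset[of _ "{i}"])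
 define I0 where "I0 = (\<Union>a\<in>A. {i \<in> I. s a i ~= \<zero>})"
 have I0: "finite I0" "I0 <= I" using A sc(2) by (auto simp: I0_def)
 have supp: "s x i = \<zero>" if x: "x \<in> El M" and i: "i \<in> I" "i \<notin> I0" for x i
 proof -
  obtain c where c: "c \<in> A \<rightarrow> El R" "x = (\<Oplus>\<^sub>M a\<in>A. c a \<odot>\<^sub>M a)" using A(3)[OF x] by blast
  have ca: "c a \<in> El R" "a \<in> El M" if "a \<in> A" for a using c(1) A(2) that by auto
  have "s x i = (\<Oplus>a\<in>A. s (c a \<odot>\<^sub>M a) i)"
   unfolding c(2) using ca by (intro functional_finsum[OF sfun[OF i(1)]]) auto
  also have "... = \<zero>"
  proof (rule R.add.finprod_one_eqI)
   fix a assume a: "a \<in> A"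
   hence "s a i = \<zero>" using i by (auto simp: I0_def)
   thus "s (c a \<odot>\<^sub>M a) i = \<zero>" using ssm[OF ca[OF a] i(1)] ca[OF a] by simp
  qed
  finally show ?thesis .
 qed
 have pz: "p (\<lambda>i\<in>I. \<zero>) = \<zero>\<^sub>M"
 proof -
  have zL: "(\<lambda>i\<in>I. \<zero>) \<in> El ?L" by (auto simp: free_module_simps)
  have "(\<lambda>i\<in>I. \<zero>) = \<zero> \<odot>\<^sub>?L (\<lambda>i\<in>I. \<zero>)" by (auto simp: free_module_simps)
  thus ?thesis using psm[OF R.zero_closed zL] pc[OF zL] by simp
 qed
 have pexp: "p (\<lambda>i\<in>I. if i \<in> K then v i else \<zero>) = (\<Oplus>\<^sub>M i\<in>K. v i \<odot>\<^sub>M p (unit i))"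
  if "finite K" "K <= I" "\<And>i. i \<in> K ==> v i \<in> El R" for K v
  using that
 proof (induction K)
  case empty
  thus ?case using pz by (simp add: restrict_def)
 next
  case (insert k K)
  let ?w = "\<lambda>i\<in>I. if i \<in> K then v i else \<zero>"
  have wL: "?w \<in> El ?L"
   using insert by (auto simp: free_module_simps intro: finite_subset[of _ K])
  have suL: "v k \<odot>\<^sub>?L unit k \<in> El ?L"
   using insert.prems by (auto simp: free_module_simps unit_def intro: finite_subset[of _ "{k}"])
  have "(\<lambda>i\<in>I. if i \<in> insert k K then v i else \<zero>) = (v k \<odot>\<^sub>?L unit k) \<oplus>\<^sub>?L ?w"
   using insert by (auto simp: free_module_simps unit_def intro!: restrict_ext)
  hence "p (\<lambda>i\<in>I. if i \<in> insert k K then v i else \<zero>) = v k \<odot>\<^sub>M p (unit k) \<oplus>\<^sub>M p ?w"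
   using padd[OF suL wL] psm[OF _ uL, of "v k" k] insert.prems by simp
  also have "p ?w = (\<Oplus>\<^sub>M i\<in>K. v i \<odot>\<^sub>M p (unit i))"
   by (rule insert.IH) (use insert.prems in auto)
  also have "v k \<odot>\<^sub>M p (unit k) \<oplus>\<^sub>M ... = (\<Oplus>\<^sub>M i\<in>insert k K. v i \<odot>\<^sub>M p (unit i))"
   using insert pc[OF uL] by (intro M.finsum_insert[symmetric]) auto
  finally show ?case .
 qed
 show ?thesis
 proof (rule dual_basis_of_family[OF I0(1), of "%i. p (unit i)" "%i x. s x i"])
  show "p (unit j) \<in> El M" for j by (rule pc[OF uL])
  show "functional R M (%x. s x j)" if "j \<in> I0" for j using sfun I0(2) that by auto
  fix x assume x: "x \<in> El M"
  have "s x = (\<lambda>i\<in>I. if i \<in> I0 then s x i else \<zero>)"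
   by (rule extensionalityI[of _ I]) (use sc(1)[OF x] supp[OF x] in \<open>auto simp: PiE_def\<close>)
  hence "x = p (\<lambda>i\<in>I. if i \<in> I0 then s x i else \<zero>)" using ps[OF x] by simp
  also have "... = (\<Oplus>\<^sub>M i\<in>I0. s x i \<odot>\<^sub>M p (unit i))"
   using I0 sc(1)[OF x] by (intro pexp) auto
  finally show "x = (\<Oplus>\<^sub>M j\<in>I0. s x j \<odot>\<^sub>M p (unit j))" .
 qed
qed

lemma restricted_imp_dual_module:
 assumes "simple_bold_ring R" "restricted R M" shows "dual_module R M"
proof -
 interpret R: simple_bold_ring R by fact
 interpret M: bold_module R M using assms(2) by (simp add: restricted_def)
 show ?thesis
 proof (intro dual_module.intro dual_module_axioms.intro)
  show "\<exists>A f. dual_basis R M A f"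
   using assms(2) by (intro M.projective_imp_dual_basis) (auto simp: restricted_def)
  show "\<exists>\<psi>. functional R M \<psi> \<and> (\<forall>x\<in>El M. \<psi> (tau M x) = endo R (f x))" if "functional R M f" for f
   using assms(2) that by (intro M.bijective_imp_dual_tau) (auto simp: restricted_def)
 qed (fact assms(1), fact M.bold_module_axioms)
qed

context dual_module
begin

lemma finitely_generated_M: "finitely_generated R M"
proof -
 obtain A f where db: "dual_basis R M A f" using dual_basis_exists by blast
 note dbD = dual_basisD[OF db]
 show ?thesis
  unfolding finitely_generated_def
 proof (intro exI[of _ A] conjI ballI)
  fix x assume x: "x \<in> El M"
  show "\<exists>c\<in>A \<rightarrow> El R. x = (\<Oplus>\<^sub>M a\<in>A. c a \<odot>\<^sub>M a)"
   using dbD(4)[OF x] dbD(5)[OF _ x] by (intro bexI[of _ "%a. f a x"]) auto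
 qed (use dbD in auto)
qed

lemma projective_M: "projective R M"
proof -
 obtain A f where db: "dual_basis R M A f" using dual_basis_exists by blast
 note dbD = dual_basisD[OF db]
 let ?L = "free_module R A"
 let ?s = "\<lambda>x\<in>El M. \<lambda>a\<in>A. f a x"
 let ?p = "\<lambda>v\<in>El ?L. \<Oplus>\<^sub>M a\<in>A. v a \<odot>\<^sub>M a"
 have Lc: "v \<in> El ?L \<longleftrightarrow> v \<in> A \<rightarrow>\<^sub>E El R" for v using dbD(1) by (auto simp: free_module_simps)
 have sL: "(\<lambda>a\<in>A. f a x) \<in> El ?L" if "x \<in> El M" for x
  unfolding Lc using dbD(5)[OF _ that] by auto
 have "?s \<in> linear_maps R M ?L"
  unfolding linear_maps_def
  using sL functionalD(2,3)[OF dbD(3)]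
  by (auto simp: free_module_simps(2,3) intro!: restrict_ext)
 moreover have "?p \<in> linear_maps R ?L M"
  unfolding linear_maps_def
 proof (intro CollectI conjI ballI)
  have vc: "v a \<in> El R" if "v \<in> El ?L" "a \<in> A" for v a using that unfolding Lc by auto
  show "?p \<in> El ?L \<rightarrow>\<^sub>E El M" using vc dbD(2) by (auto intro!: M.finsum_closed)
  fix v assume v: "v \<in> El ?L"
  show "?p (v \<oplus>\<^sub>?L w) = ?p v \<oplus>\<^sub>M ?p w" if w: "w \<in> El ?L" for w
  proof -
   have vw: "v \<oplus>\<^sub>?L w \<in> El ?L" using vc[OF v] vc[OF w] unfolding Lc by (auto simp: free_module_simps(2))
   have "(\<Oplus>\<^sub>M a\<in>A. (v \<oplus>\<^sub>?L w) a \<odot>\<^sub>M a) = (\<Oplus>\<^sub>M a\<in>A. v a \<odot>\<^sub>M a \<oplus>\<^sub>M w a \<odot>\<^sub>M a)"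
    using vc[OF v] vc[OF w] dbD(2) by (intro M.finsum_cong') (auto simp: free_module_simps(2) smult_l_distr)
   also have "... = (\<Oplus>\<^sub>M a\<in>A. v a \<odot>\<^sub>M a) \<oplus>\<^sub>M (\<Oplus>\<^sub>M a\<in>A. w a \<odot>\<^sub>M a)"
    using vc[OF v] vc[OF w] dbD(2) by (intro M.finsum_addf) auto
   finally show ?thesis using v w vw by simp
  qed
  show "?p (r \<odot>\<^sub>?L w) = r \<odot>\<^sub>M ?p w" if r: "r \<in> El R" and w: "w \<in> El ?L" for r w
  proof -
   have vw: "r \<odot>\<^sub>?L w \<in> El ?L" using r vc[OF w] unfolding Lc by (auto simp: free_module_simps(3))
   have "r \<odot>\<^sub>M (\<Oplus>\<^sub>M a\<in>A. w a \<odot>\<^sub>M a) = (\<Oplus>\<^sub>M a\<in>A. r \<odot>\<^sub>M (w a \<odot>\<^sub>M a))"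
    using r vc[OF w] dbD(1,2) by (intro finsum_smult_ldistr) auto
   also have "... = (\<Oplus>\<^sub>M a\<in>A. (r \<odot>\<^sub>?L w) a \<odot>\<^sub>M a)"
    using r vc[OF w] dbD(2) by (intro M.finsum_cong') (auto simp: free_module_simps(3) smult_assoc1)
   finally show ?thesis using w vw by simp
  qed
 qed
 moreover have "?p (?s x) = x" if x: "x \<in> El M" for x
 proof -
  have "(\<Oplus>\<^sub>M a\<in>A. (\<lambda>a\<in>A. f a x) a \<odot>\<^sub>M a) = (\<Oplus>\<^sub>M a\<in>A. f a x \<odot>\<^sub>M a)"
   using dbD(2) dbD(5)[OF _ x] by (intro M.finsum_cong') auto
  thus ?thesis using x sL[OF x] dbD(4)[OF x] by simp
 qed
 ultimately show ?thesis unfolding projective_def by blast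
qed

text \<open>Surjectivity holds because the image of \<open>\<tau>\<close> generates. For injectivity, the dual \<open>\<tau>\<close> recovers the coordinates
of an element of the tensor product from its image.\<close>
lemma tau_lin_bijective: "bij_betw (tau_lin M) (El TW) (El M)"
proof -
 interpret T: tensor R "restrict_scalars (endo R) R" M by (rule twist_tensor)
 obtain A f where db: "dual_basis R M A f" using dual_basis_exists by blast
 note dbD = dual_basisD[OF db]
 show ?thesis
 proof (rule bij_betw_additiveI[OF T.T_abelian_group M.abelian_group_axioms tau_lin_additive])
  define L where "L a = tensor_lift R (%(r, m). r \<otimes> endo R (f a m))" for a
  have La: "additive_map TW R (L a)" if "a \<in> A" for a
   unfolding L_def by (rule T.lift_additive[OF R.is_abelian_group functional_twist[OF dbD(3)[OF that]]])
  have Lp: "L a (T.pure r m) = r \<otimes> endo R (f a m)" if "a \<in> A" "r \<in> El R" "m \<in> El M" for a r m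
   unfolding L_def using T.lift_pure[OF R.is_abelian_group functional_twist[OF dbD(3)[OF that(1)]]] that by simp
  have pm: "additive_map M TW (%m. T.pure r m)" if "r \<in> El R" for r
   using that by (simp add: additive_map_def T.pure_add_r)
  have expand: "U = (\<Oplus>\<^sub>TW a\<in>A. T.pure (L a U) a)" if U: "U \<in> El TW" for U
   using U
  proof (induction rule: T.T_induct)
   case (pure r m)
   hence rm: "r \<in> El R" "m \<in> El M" by auto
   have "T.pure r m = T.pure r (\<Oplus>\<^sub>M a\<in>A. f a m \<odot>\<^sub>M a)" using dbD(4)[OF rm(2)] by simp
   also have "... = (\<Oplus>\<^sub>TW a\<in>A. T.pure r (f a m \<odot>\<^sub>M a))"
    using dbD rm by (intro additive_map_finsum[OF M.abelian_group_axioms T.T_abelian_group pm]) auto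
   also have "... = (\<Oplus>\<^sub>TW a\<in>A. T.pure (L a (T.pure r m)) a)"
   proof (rule T.T.finsum_cong')
    show "(%a. T.pure (L a (T.pure r m)) a) \<in> A \<rightarrow> El TW"
     using dbD rm additive_map_closed[OF La] by auto
    fix a assume a: "a \<in> A"
    show "T.pure r (f a m \<odot>\<^sub>M a) = T.pure (L a (T.pure r m)) a"
     using T.pure_smult[of "f a m" r a] dbD a rm by (simp add: Lp R.m_comm)
   qed simp
   finally show ?case .
  next
   case (add U V)
   have c: "L a U \<in> El R" "L a V \<in> El R" "a \<in> El M" if "a \<in> A" for a
    using additive_map_closed[OF La[OF that]] add(1,2) dbD(2) that by auto
   have "U \<oplus>\<^sub>TW V = (\<Oplus>\<^sub>TW a\<in>A. T.pure (L a U) a) \<oplus>\<^sub>TW (\<Oplus>\<^sub>TW a\<in>A. T.pure (L a V) a)"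
    using add(3,4) by simp
   also have "... = (\<Oplus>\<^sub>TW a\<in>A. T.pure (L a U) a \<oplus>\<^sub>TW T.pure (L a V) a)"
    using c by (intro T.T.finsum_addf[symmetric]) auto
   also have "... = (\<Oplus>\<^sub>TW a\<in>A. T.pure (L a (U \<oplus>\<^sub>TW V)) a)"
   proof (rule T.T.finsum_cong')
    show "(%a. T.pure (L a (U \<oplus>\<^sub>TW V)) a) \<in> A \<rightarrow> El TW"
     using c additive_map_closed[OF La] add(1,2) by auto
    fix a assume a: "a \<in> A"
    show "T.pure (L a U) a \<oplus>\<^sub>TW T.pure (L a V) a = T.pure (L a (U \<oplus>\<^sub>TW V)) a"
     using T.pure_add_l[of "L a U" "L a V" a] c[OF a] additive_map_add[OF La[OF a] add(1,2)] by simp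
   qed simp
   finally show ?case .
  qed
  fix U assume U: "U \<in> El TW" and U0: "tau_lin M U = \<zero>\<^sub>M"
  have L0: "L a U = \<zero>" if a: "a \<in> A" for a
  proof -
   obtain \<psi> where \<psi>: "functional R M \<psi>" "\<forall>x\<in>El M. \<psi> (tau M x) = endo R (f a x)"
    using dual_tau[OF dbD(3)[OF a]] by blast
   have "L a V = \<psi> (tau_lin M V)" if "V \<in> El TW" for V
    using that
   proof (induction rule: T.T_induct)
    case (pure r m)
    thus ?case using a \<psi>(2) functionalD(3)[OF \<psi>(1)] by (simp add: Lp tau_lin_pure)
   next
    case (add V W)
    thus ?case
     using additive_map_closed[OF tau_lin_additive] functionalD(2)[OF \<psi>(1)]
     by (simp add: additive_map_add[OF La[OF a]] additive_map_add[OF tau_lin_additive])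
   qed
   thus ?thesis
    using U U0 additive_map_zero[OF M.abelian_group_axioms R.is_abelian_group functionalD(4)[OF \<psi>(1)]] by simp
  qed
  have "U = (\<Oplus>\<^sub>TW a\<in>A. T.pure (L a U) a)" by (rule expand[OF U])
  also have "... = \<zero>\<^sub>TW"
  proof (rule T.T.add.finprod_one_eqI)
   fix a assume a: "a \<in> A"
   show "T.pure (L a U) a = \<zero>\<^sub>TW" using L0[OF a] T.pure_zero_l[OF dbD(2)[OF a]] by simp
  qed
  finally show "U = \<zero>\<^sub>TW" .
 next
  fix y assume "y \<in> El M"
  hence "y \<in> module_span R M (tau M ` El M)" using tau_generates[OF carrier_tau_submodule] by simp
  thus "\<exists>U\<in>El TW. tau_lin M U = y"
  proof induction
   case zero
   show ?case
    using additive_map_zero[OF T.T_abelian_group M.abelian_group_axioms tau_lin_additive]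
    by (intro bexI[of _ "\<zero>\<^sub>TW"]) auto
  next
   case (base s)
   then obtain m where m: "m \<in> El M" "s = tau M m" by auto
   thus ?case using tau_lin_pure[of \<one> m] by (intro bexI[of _ "T.pure \<one> m"]) auto
  next
   case (add x y)
   thus ?case using additive_map_add[OF tau_lin_additive] by (metis T.T.a_closed)
  next
   case (smult r x)
   then obtain U where U: "U \<in> El TW" "tau_lin M U = x" by blast
   have "\<exists>U'\<in>El TW. tau_lin M U' = r \<odot>\<^sub>M tau_lin M U"
    using U(1)
   proof (induction rule: T.T_induct)
    case (pure s m)
    thus ?case using smult.hyps(1)
     by (intro bexI[of _ "T.pure (r \<otimes> s) m"]) (auto simp: tau_lin_pure smult_assoc1)
   next
    case (add U V)
    then obtain U' V' where "U' \<in> El TW" "tau_lin M U' = r \<odot>\<^sub>M tau_lin M U"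
     "V' \<in> El TW" "tau_lin M V' = r \<odot>\<^sub>M tau_lin M V" by blast
    thus ?case
     using smult.hyps(1) add(1,2) additive_map_closed[OF tau_lin_additive]
     by (intro bexI[of _ "U' \<oplus>\<^sub>TW V'"]) (auto simp: additive_map_add[OF tau_lin_additive] smult_r_distr)
   qed
   thus ?case using U(2) by simp
  qed
 qed
qed

lemma dual_module_restricted: "restricted R M"
 unfolding restricted_def
 using bold_module_axioms finitely_generated_M projective_M tau_lin_bijective by blast

lemma sub_module: assumes "tau_submodule R M N" shows "module R (M\<lparr>carrier := N\<rparr>)"
 using assms submodule.submodule_is_module[OF _ module_axioms] unfolding tau_submodule_def by blast

lemma finsum_sub:
 assumes N: "tau_submodule R M N" and h: "h \<in> J \<rightarrow> N"
 shows "finsum (M\<lparr>carrier := N\<rparr>) h J = finsum M h J"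
proof -
 interpret N: module R "M\<lparr>carrier := N\<rparr>" by (rule sub_module[OF N])
 show ?thesis
  using h
 proof (induction J rule: infinite_finite_induct)
  case (insert j J)
  hence "h j \<in> N" "h \<in> J \<rightarrow> N" by auto
  moreover have "h j \<in> El M" "h \<in> J \<rightarrow> El M"
   using tau_submoduleD(1)[OF N] insert.prems by auto
  ultimately show ?case using insert by (simp add: N.M.finsum_insert M.finsum_insert)
 next
  case (infinite J)
  thus ?case using N.M.finsum_infinite[OF infinite(1), of h] by simp
 next
  case empty
  thus ?case using N.M.finsum_empty by simp
 qed
qed

lemma sub_dual_module: assumes N: "tau_submodule R M N" shows "dual_module R (M\<lparr>carrier := N\<rparr>)"
proof -
 let ?N = "M\<lparr>carrier := N\<rparr>"
 note ND = tau_submoduleD[OF N]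
 interpret N: module R ?N by (rule sub_module[OF N])
 have bm: "bold_module R ?N"
  by (intro bold_module.intro bold_module_axioms.intro bold_ring_axioms N.module_axioms)
    (use ND in \<open>auto simp: tau_add tau_smult\<close>)
 obtain \<pi> where \<pi>: "linear_map R M M \<pi>" "\<forall>x\<in>El M. \<pi> x \<in> N" "\<forall>y\<in>N. \<pi> y = y" using summand[OF N] by blast
 obtain A f where db: "dual_basis R M A f" using dual_basis_exists by blast
 note dbD = dual_basisD[OF db]
 have restr: "functional R ?N g" if "functional R M g" for g
  using functionalD(1-3)[OF that] ND by (auto simp: functional_def additive_map_def)
 show ?thesis
 proof (intro dual_module.intro dual_module_axioms.intro simple_bold_ring_axioms bm)
  show "\<exists>A f. dual_basis R ?N A f"
  proof (rule N.dual_basis_of_family[OF dbD(1), of \<pi> f])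
   show "\<pi> a \<in> El ?N" if "a \<in> A" for a using \<pi>(2) dbD(2)[OF that] by simp
   show "functional R ?N (f a)" if "a \<in> A" for a by (rule restr[OF dbD(3)[OF that]])
   fix x assume "x \<in> El ?N"
   hence x: "x \<in> N" "x \<in> El M" using ND(1) by auto
   have "x = \<pi> (\<Oplus>\<^sub>M a\<in>A. f a x \<odot>\<^sub>M a)" using dbD(4)[OF x(2)] \<pi>(3) x(1) by simp
   also have "... = (\<Oplus>\<^sub>M a\<in>A. \<pi> (f a x \<odot>\<^sub>M a))"
    using dbD x by (intro linear_map_finsum[OF module_axioms \<pi>(1)]) auto
   also have "... = (\<Oplus>\<^sub>M a\<in>A. f a x \<odot>\<^sub>M \<pi> a)"
    using dbD x linear_mapD(1,3)[OF \<pi>(1)] by (intro M.finsum_cong') auto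
   also have "... = (\<Oplus>\<^sub>?N a\<in>A. f a x \<odot>\<^sub>?N \<pi> a)"
    using dbD x \<pi>(2) ND(4) by (subst finsum_sub[OF N]) auto
   finally show "x = (\<Oplus>\<^sub>?N a\<in>A. f a x \<odot>\<^sub>?N \<pi> a)" .
  qed
  fix g assume g: "functional R ?N g"
  have "functional R M (%x. g (\<pi> x))"
   using functionalD(1-3)[OF g] linear_mapD(1-3)[OF \<pi>(1)] \<pi>(2) by (auto simp: functional_def additive_map_def)
  from dual_tau[OF this] obtain \<psi> where \<psi>: "functional R M \<psi>" "\<forall>x\<in>El M. \<psi> (tau M x) = endo R (g (\<pi> x))" by blast
  show "\<exists>\<psi>. functional R ?N \<psi> \<and> (\<forall>x\<in>El ?N. \<psi> (tau ?N x) = endo R (g x))"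
   using restr[OF \<psi>(1)] \<psi>(2) \<pi>(3) ND(1) by (intro exI[of _ \<psi>]) auto
 qed
qed

lemma tau_submodule_sub:
 assumes N: "tau_submodule R M N"
 shows "tau_submodule R (M\<lparr>carrier := N\<rparr>) N' \<longleftrightarrow> tau_submodule R M N' \<and> N' <= N"
proof -
 interpret N: dual_module R "M\<lparr>carrier := N\<rparr>" by (rule sub_dual_module[OF N])
 note ND = tau_submoduleD[OF N]
 show ?thesis
 proof
  assume h: "tau_submodule R (M\<lparr>carrier := N\<rparr>) N'"
  note h' = N.tau_submoduleD[OF h]
  show "tau_submodule R M N' \<and> N' <= N"
   using h' ND(1) by (auto intro!: tau_submoduleI)
 next
  assume h: "tau_submodule R M N' \<and> N' <= N"
  note h' = tau_submoduleD[OF conjunct1[OF h]]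
  show "tau_submodule R (M\<lparr>carrier := N\<rparr>) N'"
   using h' h by (intro N.tau_submoduleI) auto
 qed
qed

lemma subobject_iff: "subobject R N M \<longleftrightarrow> tau_submodule R M N"
 using dual_module.dual_module_restricted[OF sub_dual_module]
 unfolding subobject_def tau_submodule_def by blast

lemma simple_object_iff: "simple_object R M \<longleftrightarrow> simple_sub R M (El M)"
 unfolding simple_object_def simple_sub_def subobject_iff
 using dual_module_restricted carrier_tau_submodule tau_submoduleD(1) by blast

lemma simple_object_sub:
 assumes N: "tau_submodule R M N"
 shows "simple_object R (M\<lparr>carrier := N\<rparr>) \<longleftrightarrow> simple_sub R M N"
proof -
 interpret N: dual_module R "M\<lparr>carrier := N\<rparr>" by (rule sub_dual_module[OF N])
 show ?thesis
  unfolding N.simple_object_iff unfolding simple_sub_def tau_submodule_sub[OF N] using N by auto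
qed

end

section \<open>Semisimplicity\<close>

context dual_module
begin

lemma sum_representation:
 assumes N: "\<And>i. i < n ==> tau_submodule R M (N i)" and x: "x \<in> module_span R M (\<Union>i<n. N i)"
 shows "\<exists>f. (\<forall>i<n. f i \<in> N i) \<and> x = (\<Oplus>\<^sub>M i\<in>{..<n::nat}. f i)"
proof -
 note ND = tau_submoduleD[OF N]
 show ?thesis
  using x
 proof induction
  case zero
  show ?case using ND(2) by (intro exI[of _ "%_. \<zero>\<^sub>M"]) auto
 next
  case (base s)
  then obtain i where i: "i < n" "s \<in> N i" by auto
  have sc: "s \<in> El M" using ND(1) i by blast
  have "(\<Oplus>\<^sub>M j\<in>{..<n}. if j = i then s else \<zero>\<^sub>M) = s"
   using i sc by (subst M.add.finprod_mono_neutral_cong_right[of _ "{i}" _ "%_. s"]) auto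
  thus ?case using i ND(2) by (intro exI[of _ "%j. if j = i then s else \<zero>\<^sub>M"]) auto
 next
  case (add x y)
  then obtain f g where f: "\<forall>i<n. f i \<in> N i" "x = (\<Oplus>\<^sub>M i\<in>{..<n}. f i)"
   and g: "\<forall>i<n. g i \<in> N i" "y = (\<Oplus>\<^sub>M i\<in>{..<n}. g i)" by blast
  have "x \<oplus>\<^sub>M y = (\<Oplus>\<^sub>M i\<in>{..<n}. f i \<oplus>\<^sub>M g i)"
   unfolding f(2) g(2) using f(1) g(1) ND(1) by (intro M.finsum_addf[symmetric]) blast+
  thus ?case using f(1) g(1) ND(3) by (intro exI[of _ "%i. f i \<oplus>\<^sub>M g i"]) auto
 next
  case (smult r x)
  then obtain f where f: "\<forall>i<n. f i \<in> N i" "x = (\<Oplus>\<^sub>M i\<in>{..<n}. f i)" by blast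
  have "r \<odot>\<^sub>M x = (\<Oplus>\<^sub>M i\<in>{..<n}. r \<odot>\<^sub>M f i)"
   unfolding f(2) using f(1) ND(1) smult.hyps(1) by (intro finsum_smult_ldistr) blast+
  thus ?case using f(1) ND(4) smult.hyps(1) by (intro exI[of _ "%i. r \<odot>\<^sub>M f i"]) auto
 qed
qed

text \<open>A simple submodule is either contained in the sum of the others or meets it in zero.\<close>
lemma direct_subfamily:
 assumes "finite \<N>" "\<And>K. K \<in> \<N> ==> simple_sub R M K"
 shows "\<exists>(n::nat) N. (\<forall>i<n. simple_sub R M (N i)) \<and>
  (\<forall>f. (\<forall>i<n. f i \<in> N i) --> (\<Oplus>\<^sub>M i\<in>{..<n}. f i) = \<zero>\<^sub>M --> (\<forall>i<n. f i = \<zero>\<^sub>M)) \<and>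
  \<Union>\<N> <= module_span R M (\<Union>i<n. N i)"
 using assms
proof (induction \<N>)
 case empty
 show ?case by (intro exI[of _ 0]) auto
next
 case (insert K \<N>)
 then obtain n N where N: "\<And>i. i < n ==> simple_sub R M (N i)"
  and dir: "\<And>f. (\<And>i. i < n ==> f i \<in> N i) ==> (\<Oplus>\<^sub>M i\<in>{..<n}. f i) = \<zero>\<^sub>M ==> (\<forall>i<n. f i = \<zero>\<^sub>M)"
  and sp: "\<Union>\<N> <= module_span R M (\<Union>i<n::nat. N i)" by auto
 have Nt: "tau_submodule R M (N i)" if "i < n" for i using N[OF that] by (simp add: simple_sub_def)
 note ND = tau_submoduleD[OF Nt]
 have Ks: "simple_sub R M K" using insert by auto
 hence Kt: "tau_submodule R M K" by (simp add: simple_sub_def)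
 note KD = tau_submoduleD[OF Kt]
 let ?Y = "module_span R M (\<Union>i<n. N i)"
 have Uc: "(\<Union>i<n. N i) <= El M" using ND(1) by blast
 have Yt: "tau_submodule R M ?Y"
  using ND(5) by (intro span_tau_submodule[OF Uc]) (auto intro: module_span.base)
 show ?case
 proof (cases "K <= ?Y")
  case True
  thus ?thesis using N dir sp by (intro exI[of _ n] exI[of _ N]) auto
 next
  case False
  have KY: "K \<inter> ?Y = {\<zero>\<^sub>M}"
   using Ks inter_tau_submodule[OF Kt Yt] False unfolding simple_sub_def by blast
  let ?N = "N(n := K)"
  have d: "\<forall>i<Suc n. f i = \<zero>\<^sub>M"
   if f: "\<forall>i<Suc n. f i \<in> ?N i" "(\<Oplus>\<^sub>M i\<in>{..<Suc n}. f i) = \<zero>\<^sub>M" for f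
  proof -
   have fN: "f i \<in> N i" if "i < n" for i using f(1) that by (auto dest!: spec[of _ i])
   have fn: "f n \<in> K" using f(1) by auto
   have fc: "f i \<in> El M" if "i < n" for i using ND(1)[OF that fN[OF that]] .
   have fnc: "f n \<in> El M" by (rule KD(1)[OF fn])
   let ?s = "\<Oplus>\<^sub>M i\<in>{..<n}. f i"
   have sc: "?s \<in> El M" using fc by (intro M.finsum_closed) auto
   have eq: "f n \<oplus>\<^sub>M ?s = \<zero>\<^sub>M"
    using f(2) M.finsum_insert[of "{..<n}" n f] fc fnc by (simp add: lessThan_Suc)
   have "?s \<in> ?Y"
    using fN Yt unfolding tau_submodule_def by (intro submodule_sum) (auto intro: module_span.base)
   moreover have "f n = \<ominus>\<^sub>M ?s" using M.minus_equality[OF eq sc fnc] by simp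
   ultimately have "f n \<in> ?Y" using tau_submoduleD(6)[OF Yt] by simp
   hence fn0: "f n = \<zero>\<^sub>M" using fn KY by blast
   hence "?s = \<zero>\<^sub>M" using eq sc by simp
   hence "\<forall>i<n. f i = \<zero>\<^sub>M" by (intro dir fN)
   thus ?thesis using fn0 less_Suc_eq by simp
  qed
  have U: "(\<Union>i<Suc n. ?N i) = K \<union> (\<Union>i<n. N i)" by (auto simp: less_Suc_eq)
  have Uc': "K \<union> (\<Union>i<n. N i) <= El M" using KD(1) Uc by blast
  have "?Y <= module_span R M (K \<union> (\<Union>i<n. N i))"
   by (rule module_span_mono[OF _ Uc']) (auto intro: module_span.base)
  hence "\<Union>(insert K \<N>) <= module_span R M (\<Union>i<Suc n. ?N i)"
   unfolding U using sp by (auto intro: module_span.base)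
  moreover have "\<forall>i<Suc n. simple_sub R M (?N i)" using N Ks by (auto simp: less_Suc_eq)
  ultimately show ?thesis using d by (intro exI[of _ "Suc n"] exI[of _ ?N]) blast
 qed
qed

lemma semisimple_of_simples:
 assumes "finite \<N>" "\<And>K. K \<in> \<N> ==> simple_sub R M K" "module_span R M (\<Union>\<N>) = El M"
 shows "semisimple_object R M"
proof -
 obtain n N where N: "\<And>i. i < (n::nat) ==> simple_sub R M (N i)"
  and dir: "\<And>f. (\<And>i. i < n ==> f i \<in> N i) ==> (\<Oplus>\<^sub>M i\<in>{..<n}. f i) = \<zero>\<^sub>M ==> (\<forall>i<n. f i = \<zero>\<^sub>M)"
  and sp: "\<Union>\<N> <= module_span R M (\<Union>i<n. N i)"
  using direct_subfamily[OF assms(1,2)] by auto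
 have Nt: "tau_submodule R M (N i)" if "i < n" for i using N[OF that] by (simp add: simple_sub_def)
 note ND = tau_submoduleD[OF Nt]
 have Uc: "(\<Union>i<n. N i) <= El M" using ND(1) by blast
 have full: "El M <= module_span R M (\<Union>i<n. N i)"
  unfolding assms(3)[symmetric] by (rule module_span_mono[OF sp Uc])
 have uniq: "\<exists>!f. f \<in> (\<Pi>\<^sub>E i\<in>{..<n}. N i) \<and> x = (\<Oplus>\<^sub>M i\<in>{..<n}. f i)" if x: "x \<in> El M" for x
 proof -
  obtain f where f: "\<forall>i<n. f i \<in> N i" "x = (\<Oplus>\<^sub>M i\<in>{..<n}. f i)"
   using sum_representation[of n N x, OF Nt] full x by auto
  have fc: "f i \<in> El M" if "i < n" for i using ND(1)[OF that] f(1) that by blast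
  show ?thesis
  proof (rule ex1I[of _ "\<lambda>i\<in>{..<n}. f i"])
   have "(\<Oplus>\<^sub>M i\<in>{..<n}. (\<lambda>i\<in>{..<n}. f i) i) = (\<Oplus>\<^sub>M i\<in>{..<n}. f i)"
    using fc by (intro M.finsum_cong') auto
   thus "(\<lambda>i\<in>{..<n}. f i) \<in> (\<Pi>\<^sub>E i\<in>{..<n}. N i) \<and> x = (\<Oplus>\<^sub>M i\<in>{..<n}. (\<lambda>i\<in>{..<n}. f i) i)"
    using f by auto
   fix g assume g: "g \<in> (\<Pi>\<^sub>E i\<in>{..<n}. N i) \<and> x = (\<Oplus>\<^sub>M i\<in>{..<n}. g i)"
   have gN: "g i \<in> N i" if "i < n" for i using g that by auto
   have gc: "g i \<in> El M" if "i < n" for i using ND(1)[OF that gN[OF that]] .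
   let ?d = "%i. g i \<oplus>\<^sub>M (\<ominus> \<one>) \<odot>\<^sub>M f i"
   have "(\<Oplus>\<^sub>M i\<in>{..<n}. ?d i) = (\<Oplus>\<^sub>M i\<in>{..<n}. g i) \<oplus>\<^sub>M (\<Oplus>\<^sub>M i\<in>{..<n}. (\<ominus> \<one>) \<odot>\<^sub>M f i)"
    using fc gc by (intro M.finsum_addf) auto
   also have "(\<Oplus>\<^sub>M i\<in>{..<n}. (\<ominus> \<one>) \<odot>\<^sub>M f i) = (\<ominus> \<one>) \<odot>\<^sub>M (\<Oplus>\<^sub>M i\<in>{..<n}. f i)"
    using fc by (intro finsum_smult_ldistr[symmetric]) auto
   also have "(\<Oplus>\<^sub>M i\<in>{..<n}. g i) \<oplus>\<^sub>M ... = \<zero>\<^sub>M"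
    using g f(2) x by (simp add: smult_l_minus M.r_neg)
   finally have "\<forall>i<n. ?d i = \<zero>\<^sub>M"
    by (intro dir) (use gN f(1) ND(3,4) in auto)
   hence "g i = f i" if "i < n" for i
   proof -
    have "g i \<oplus>\<^sub>M (\<ominus>\<^sub>M f i) = \<zero>\<^sub>M" using \<open>\<forall>i<n. ?d i = \<zero>\<^sub>M \<close> that fc by (simp add: smult_l_minus)
    from M.minus_equality[OF this] show ?thesis using fc gc that by simp
   qed
   thus "g = (\<lambda>i\<in>{..<n}. f i)"
    using g by (intro extensionalityI[of _ "{..<n}"]) (auto simp: PiE_def)
  qed
 qed
 show ?thesis
  unfolding semisimple_object_def
 proof (intro conjI exI allI impI ballI)
  show "subobject R (N i) M" "simple_object R (M\<lparr>carrier := N i\<rparr>)" if "i < n" for i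
   using N[OF that] Nt[OF that] by (simp_all add: subobject_iff simple_object_sub)
 qed (use dual_module_restricted uniq in auto)
qed

lemma simple_sub_sub:
 assumes N: "tau_submodule R M N"
 shows "simple_sub R (M\<lparr>carrier := N\<rparr>) K \<longleftrightarrow> simple_sub R M K \<and> K <= N"
 by (simp add: simple_sub_def tau_submodule_sub[OF N]) blast

lemma module_span_sub:
 assumes N: "tau_submodule R M N" and S: "S <= N"
 shows "module_span R (M\<lparr>carrier := N\<rparr>) S = module_span R M S"
proof
 show "module_span R (M\<lparr>carrier := N\<rparr>) S <= module_span R M S"
 proof
  fix x assume "x \<in> module_span R (M\<lparr>carrier := N\<rparr>) S"
  thus "x \<in> module_span R M S" by induction (auto intro: module_span.intros)
 qed
 show "module_span R M S <= module_span R (M\<lparr>carrier := N\<rparr>) S"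
 proof
  fix x assume "x \<in> module_span R M S"
  thus "x \<in> module_span R (M\<lparr>carrier := N\<rparr>) S"
  proof induction
   case zero
   thus ?case using module_span.zero[where M = "M\<lparr>carrier := N\<rparr>"] by simp
  next
   case (base s)
   thus ?case by (rule module_span.base)
  next
   case (add x y)
   thus ?case using module_span.add[where M = "M\<lparr>carrier := N\<rparr>"] by simp
  next
   case (smult r x)
   thus ?case using module_span.smult[where M = "M\<lparr>carrier := N\<rparr>"] by simp
  qed
 qed
qed

end

context base_change
begin

lemma extended_tau_submodule:
 assumes N: "tau_submodule R M N" shows "tau_submodule R' M' (module_span R' M' (\<iota> ` N))"
proof -
 note ND = M.tau_submoduleD[OF N]
 show ?thesis
 proof (rule M'.span_tau_submodule)
  show "\<iota> ` N <= El M'" using ND(1) by auto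
  show "tau M' ` (\<iota> ` N) <= module_span R' M' (\<iota> ` N)"
  proof
   fix y assume "y \<in> tau M' ` (\<iota> ` N)"
   then obtain x where x: "x \<in> N" "y = tau M' (\<iota> x)" by auto
   have "y = \<iota> (tau M x)" using x ND(1) by (simp add: \<iota>_tau)
   thus "y \<in> module_span R' M' (\<iota> ` N)" using x ND(5) by (auto intro: module_span.base)
  qed
 qed
qed

lemma sub_base_change:
 assumes N: "tau_submodule R M N"
 shows "base_change F e F' R R' c \<phi> c' (M\<lparr>carrier := N\<rparr>) (M'\<lparr>carrier := module_span R' M' (\<iota> ` N)\<rparr>) \<iota>"
proof -
 let ?N' = "module_span R' M' (\<iota> ` N)"
 note ND = M.tau_submoduleD[OF N]
 have N': "tau_submodule R' M' ?N'" by (rule extended_tau_submodule[OF N])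
 note N'D = M'.tau_submoduleD[OF N']
 have \<iota>N: "\<iota> ` N <= ?N'" by (auto intro: module_span.base)
 obtain \<pi> where \<pi>: "linear_map R M M \<pi>" "\<forall>x\<in>El M. \<pi> x \<in> N" "\<forall>y\<in>N. \<pi> y = y" using M.summand[OF N] by blast
 show ?thesis
 proof (intro base_change.intro base_change_axioms.intro fraction_descent_axioms M.sub_dual_module[OF N] M'.sub_dual_module[OF N'])
  show "additive_map (M\<lparr>carrier := N\<rparr>) (M'\<lparr>carrier := ?N'\<rparr>) \<iota>"
   using ND \<iota>N \<iota>_add by (auto simp: additive_map_def)
  show "module_span R' (M'\<lparr>carrier := ?N'\<rparr>) (\<iota> ` El (M\<lparr>carrier := N\<rparr>)) = El (M'\<lparr>carrier := ?N'\<rparr>)"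
   using M'.module_span_sub[OF N' \<iota>N] by simp
  fix f assume f: "functional R (M\<lparr>carrier := N\<rparr>) f"
  have "functional R M (%x. f (\<pi> x))"
   using functionalD(1-3)[OF f] linear_mapD(1-3)[OF \<pi>(1)] \<pi>(2) by (auto simp: functional_def additive_map_def)
  from functional_extends[OF this] obtain f' where f': "functional R' M' f'"
   "\<forall>x\<in>El M. f' (\<iota> x) = \<phi> (f (\<pi> x))" by blast
  have "functional R' (M'\<lparr>carrier := ?N'\<rparr>) f'"
   using functionalD(1-3)[OF f'(1)] N'D(1) by (auto simp: functional_def additive_map_def)
  thus "\<exists>f'. functional R' (M'\<lparr>carrier := ?N'\<rparr>) f' \<and> (\<forall>x\<in>El (M\<lparr>carrier := N\<rparr>). f' (\<iota> x) = \<phi> (f x))"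
   using f'(2) \<pi>(3) ND(1) by (intro exI[of _ f']) auto
 qed (use ND(1) \<iota>_smult \<iota>_tau in auto)
qed

theorem base_change_semisimple:
 assumes ss: "semisimple_object R M" and sep: "separable_extension F e F'"
 shows "semisimple_object R' M'"
proof -
 have "\<exists>(n::nat) N. (\<forall>i<n. subobject R (N i) M \<and> simple_object R (M\<lparr>carrier := N i\<rparr>)) \<and>
   (\<forall>x\<in>El M. \<exists>!f. f \<in> (\<Pi>\<^sub>E i\<in>{..<n}. N i) \<and> x = (\<Oplus>\<^sub>M i\<in>{..<n}. f i))"
  using ss unfolding semisimple_object_def by (rule conjunct2)
 then obtain n N where subs: "\<forall>i<(n::nat). subobject R (N i) M \<and> simple_object R (M\<lparr>carrier := N i\<rparr>)"
  and unique_rep: "\<forall>x\<in>El M. \<exists>!f. f \<in> (\<Pi>\<^sub>E i\<in>{..<n}. N i) \<and> x = (\<Oplus>\<^sub>M i\<in>{..<n}. f i)"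
  by (elim exE conjE) (rule that)
 have N: "subobject R (N i) M" "simple_object R (M\<lparr>carrier := N i\<rparr>)" if "i < n" for i using subs that by simp_all
 have rep: "\<exists>f. f \<in> (\<Pi>\<^sub>E i\<in>{..<n}. N i) \<and> x = (\<Oplus>\<^sub>M i\<in>{..<n}. f i)" if "x \<in> El M" for x
  using bspec[OF unique_rep that] by (rule ex1_implies_ex)
 have Nt: "tau_submodule R M (N i)" if "i < n" for i using N(1)[OF that] by (simp add: M.subobject_iff)
 note ND = M.tau_submoduleD[OF Nt]
 let ?N' = "%i. module_span R' M' (\<iota> ` N i)"
 have "\<exists>\<N>. finite \<N> \<and> (\<forall>K\<in>\<N>. simple_sub R' M' K) \<and> module_span R' M' (\<Union>\<N>) = ?N' i" if i: "i < n" for i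
 proof -
  have N't: "tau_submodule R' M' (?N' i)" by (rule extended_tau_submodule[OF Nt[OF i]])
  interpret B: base_change F e F' R R' c \<phi> c' "M\<lparr>carrier := N i\<rparr>" "M'\<lparr>carrier := ?N' i\<rparr>" \<iota>
   by (rule sub_base_change[OF Nt[OF i]])
  have s: "simple_sub R (M\<lparr>carrier := N i\<rparr>) (El (M\<lparr>carrier := N i\<rparr>))"
   by (rule iffD1[OF B.M.simple_object_iff N(2)[OF i]])
  have "\<exists>\<N>. finite \<N> \<and> (\<forall>K\<in>\<N>. simple_sub R' (M'\<lparr>carrier := ?N' i\<rparr>) K) \<and>
    module_span R' (M'\<lparr>carrier := ?N' i\<rparr>) (\<Union>\<N>) = El (M'\<lparr>carrier := ?N' i\<rparr>)"
   by (rule B.M'.sum_of_simples[OF _ B.M'.carrier_tau_submodule]) (rule B.splitting[OF s sep])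
  then obtain \<N> where \<N>: "finite \<N>" "\<forall>K\<in>\<N>. simple_sub R' (M'\<lparr>carrier := ?N' i\<rparr>) K"
   "module_span R' (M'\<lparr>carrier := ?N' i\<rparr>) (\<Union>\<N>) = El (M'\<lparr>carrier := ?N' i\<rparr>)"
   by (elim exE conjE) (rule that)
  have K: "simple_sub R' M' K \<and> K <= ?N' i" if "K \<in> \<N>" for K
   using bspec[OF \<N>(2) that] by (rule iffD1[OF M'.simple_sub_sub[OF N't]])
  have "module_span R' M' (\<Union>\<N>) = ?N' i"
   using \<N>(3) M'.module_span_sub[OF N't, of "\<Union>\<N>"] K by auto
  thus ?thesis using \<N>(1) K by blast
 qed
 hence "\<forall>i\<in>{..<n}. \<exists>\<N>. finite \<N> \<and> (\<forall>K\<in>\<N>. simple_sub R' M' K) \<and> module_span R' M' (\<Union>\<N>) = ?N' i" by simp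
 from bchoice[OF this] obtain \<N> where \<N>: "\<And>i. i < n ==> finite (\<N> i)"
  "\<And>i K. i < n ==> K \<in> \<N> i ==> simple_sub R' M' K" "\<And>i. i < n ==> module_span R' M' (\<Union>(\<N> i)) = ?N' i" by auto
 let ?\<N> = "\<Union>i<n. \<N> i"
 show ?thesis
 proof (rule M'.semisimple_of_simples)
  show "finite ?\<N>" using \<N>(1) by auto
  show s: "simple_sub R' M' K" if "K \<in> ?\<N>" for K using \<N>(2) that by auto
  have c: "\<Union>?\<N> <= El M'"
  proof
   fix x assume "x \<in> \<Union>?\<N>"
   then obtain K where "x \<in> K" "simple_sub R' M' K" using s by blast
   thus "x \<in> El M'" using M'.tau_submoduleD(1)[of K x] by (simp add: simple_sub_def)
  qed
  let ?P = "module_span R' M' (\<Union>?\<N>)"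
  have Ps: "submodule ?P R' M'" by (rule M'.module_span_submodule[OF c])
  have "\<iota> x \<in> ?P" if x: "x \<in> El M" for x
  proof -
   obtain f where f: "f \<in> (\<Pi>\<^sub>E i\<in>{..<n}. N i)" "x = (\<Oplus>\<^sub>M i\<in>{..<n}. f i)" using rep[OF x] by blast
   have fi: "f i \<in> N i" "f i \<in> El M" if "i < n" for i using f(1) that ND(1)[OF that] by auto
   have "\<iota> x = (\<Oplus>\<^sub>M' i\<in>{..<n}. \<iota> (f i))"
    unfolding f(2) using fi
    by (intro additive_map_finsum[OF module.axioms(2)[OF M.module_axioms] M'_ab \<iota>_additive]) auto
   moreover have "\<iota> (f i) \<in> ?P" if i: "i < n" for i
   proof -
    have "\<iota> (f i) \<in> ?N' i" using fi[OF i] by (auto intro: module_span.base)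
    hence "\<iota> (f i) \<in> module_span R' M' (\<Union>(\<N> i))" using \<N>(3)[OF i] by simp
    moreover have "module_span R' M' (\<Union>(\<N> i)) <= ?P"
     using i by (intro M'.module_span_mono[OF _ c]) (auto intro: module_span.base)
    ultimately show ?thesis by blast
   qed
   ultimately show ?thesis using M'.submodule_sum[OF Ps, of "{..<n}" "%i. \<iota> (f i)"] by auto
  qed
  hence "El M' <= ?P"
   unfolding \<iota>_generates[symmetric] by (intro M'.module_span_least[OF Ps]) auto
  thus "?P = El M'" using M'.module_span_carrier[OF c] by blast
 qed
qed

end

section \<open>Scalar extension as a base change\<close>

text \<open>The scalar extension of one module, with its tensor product operations unfolded to pure tensors.\<close>
locale extended_module = fraction_descent F e F' R R' c \<phi> c' + M: dual_module R M
 for F :: "('f, 'x2) ring_scheme" and e :: "'f => 'g" and F' :: "('g, 'x3) ring_scheme"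
  and R :: "('r, 'y1) bold_ring_scheme" and R' :: "('s, 'y2) bold_ring_scheme"
  and c \<phi> c' and M :: "('r, 'm, 'z1) bold_module_scheme"
begin

sublocale Y: tensor R "restrict_scalars \<phi> R'" M
 by (intro tensor.intro restrict_scalars_module R.cring_axioms R'.cring_axioms \<phi>_hom M.module_axioms)

abbreviation "E \<equiv> scalar_extension R \<phi> R' M"
abbreviation "p \<equiv> Y.pure"

lemma E_simps:
 "El E = El Y.T" "(\<oplus>\<^sub>E) = (\<oplus>\<^sub>Y.T)" "\<zero>\<^sub>E = \<zero>\<^sub>Y.T"
 by (simp_all add: scalar_extension_def Let_def)

lemma E_abelian_group: "abelian_group E"
 by (rule abelian_group_cong[OF Y.T_abelian_group]) (simp_all add: E_simps)

lemma p_closed [simp]: "a \<in> El R' ==> m \<in> El M ==> p a m \<in> El E"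
 using Y.pure_closed[of a m] by (simp add: E_simps)

lemma p_add_l: "a \<in> El R' ==> a' \<in> El R' ==> m \<in> El M ==>
  p (a \<oplus>\<^sub>R' a') m = p a m \<oplus>\<^sub>E p a' m"
 using Y.pure_add_l[of a a' m] by (simp add: E_simps)

lemma p_add_r: "a \<in> El R' ==> m \<in> El M ==> m' \<in> El M ==>
  p a (m \<oplus>\<^sub>M m') = p a m \<oplus>\<^sub>E p a m'"
 using Y.pure_add_r[of a m m'] by (simp add: E_simps)

lemma p_smult: "r \<in> El R ==> a \<in> El R' ==> m \<in> El M ==>
  p (\<phi> r \<otimes>\<^sub>R' a) m = p a (r \<odot>\<^sub>M m)"
 using Y.pure_smult[of r a m] by simp

lemma E_induct [consumes 1, case_names pure add]:
 assumes "U \<in> El E"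
  and "\<And>a m. a \<in> El R' ==> m \<in> El M ==> P (p a m)"
  and "\<And>U V. U \<in> El E ==> V \<in> El E ==> P U ==> P V ==> P (U \<oplus>\<^sub>E V)"
 shows "P U"
 using assms Y.T_induct[of U P] by (simp add: E_simps)

abbreviation "bal \<equiv> balanced R (restrict_scalars \<phi> R') M"

lemma balancedI:
 assumes "\<And>a m. a \<in> El R' ==> m \<in> El M ==> f (a, m) \<in> El P"
  and "\<And>a a' m. a \<in> El R' ==> a' \<in> El R' ==> m \<in> El M ==>
   f (a \<oplus>\<^sub>R' a', m) = f (a, m) \<oplus>\<^sub>P f (a', m)"
  and "\<And>a m m'. a \<in> El R' ==> m \<in> El M ==> m' \<in> El M ==>
   f (a, m \<oplus>\<^sub>M m') = f (a, m) \<oplus>\<^sub>P f (a, m')"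
  and "\<And>r a m. r \<in> El R ==> a \<in> El R' ==> m \<in> El M ==>
   f (\<phi> r \<otimes>\<^sub>R' a, m) = f (a, r \<odot>\<^sub>M m)"
 shows "bal P f"
 using assms by (simp add: balanced_def)

lemma lift_E:
 assumes "abelian_group P" "bal P f"
 shows "additive_map E P (tensor_lift P f)"
  and "\<And>a m. a \<in> El R' ==> m \<in> El M ==> tensor_lift P f (p a m) = f (a, m)"
 using Y.lift_additive[OF assms] Y.lift_pure[OF assms] by (simp_all add: additive_map_def E_simps)

lemma lift_into_E:
 assumes "bal E f"
 shows "additive_map E E (tensor_lift Y.T f)"
  and "\<And>a m. a \<in> El R' ==> m \<in> El M ==> tensor_lift Y.T f (p a m) = f (a, m)"
proof -
 have "bal Y.T f" using assms by (simp add: balanced_def E_simps)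
 note L = lift_E[OF Y.T_abelian_group this]
 show "additive_map E E (tensor_lift Y.T f)" using L(1) by (simp add: additive_map_def E_simps)
 show "\<And>a m. a \<in> El R' ==> m \<in> El M ==> tensor_lift Y.T f (p a m) = f (a, m)" by (rule L(2))
qed

lemma smult_balanced:
 assumes r: "r \<in> El R'" shows "bal E (%(a, m). p (r \<otimes>\<^sub>R' a) m)"
proof (rule balancedI)
 fix s a m assume *: "s \<in> El R" "a \<in> El R'" "m \<in> El M"
 have "r \<otimes>\<^sub>R' (\<phi> s \<otimes>\<^sub>R' a) = \<phi> s \<otimes>\<^sub>R' (r \<otimes>\<^sub>R' a)" using * r by (simp add: R'.m_lcomm)
 thus "(case (\<phi> s \<otimes>\<^sub>R' a, m) of (a, m) => p (r \<otimes>\<^sub>R' a) m) =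
   (case (a, s \<odot>\<^sub>M m) of (a, m) => p (r \<otimes>\<^sub>R' a) m)"
  using * r by (simp add: p_smult)
qed (use r in \<open>simp_all add: R'.r_distr p_add_l p_add_r\<close>)

lemma tau_balanced: "bal E (%(a, m). p (endo R' a) (tau M m))"
proof (rule balancedI)
 fix s a m assume *: "s \<in> El R" "a \<in> El R'" "m \<in> El M"
 have "endo R' (\<phi> s \<otimes>\<^sub>R' a) = \<phi> (endo R s) \<otimes>\<^sub>R' endo R' a"
  using * by (simp add: R'.sigma_mult \<phi>_sigma)
 thus "(case (\<phi> s \<otimes>\<^sub>R' a, m) of (a, m) => p (endo R' a) (tau M m)) =
   (case (a, s \<odot>\<^sub>M m) of (a, m) => p (endo R' a) (tau M m))"
  using * by (simp add: p_smult M.tau_smult)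
qed (simp_all add: R'.sigma_add M.tau_add p_add_l p_add_r)

lemma E_smult: "r \<odot>\<^sub>E U = tensor_lift Y.T (%(a, m). p (r \<otimes>\<^sub>R' a) m) U"
 and E_tau: "tau E U = tensor_lift Y.T (%(a, m). p (endo R' a) (tau M m)) U"
 by (simp_all add: scalar_extension_def Let_def)

lemma smult_additive: "r \<in> El R' ==> additive_map E E (%U. r \<odot>\<^sub>E U)"
 unfolding E_smult by (rule lift_into_E(1)[OF smult_balanced])

lemma smult_p [simp]: "r \<in> El R' ==> a \<in> El R' ==> m \<in> El M ==> r \<odot>\<^sub>E p a m = p (r \<otimes>\<^sub>R' a) m"
 unfolding E_smult using lift_into_E(2)[OF smult_balanced] by simp

lemma E_tau_additive: "additive_map E E (tau E)"
 using lift_into_E(1)[OF tau_balanced] by (simp add: additive_map_def E_tau)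

lemma tau_p [simp]: "a \<in> El R' ==> m \<in> El M ==> tau E (p a m) = p (endo R' a) (tau M m)"
 unfolding E_tau using lift_into_E(2)[OF tau_balanced] by simp

lemmas E_smult_closed = additive_map_closed[OF smult_additive]
lemmas E_smult_add = additive_map_add[OF smult_additive]
lemmas E_tau_closed = additive_map_closed[OF E_tau_additive]
lemmas E_tau_add = additive_map_add[OF E_tau_additive]

lemma E_module: "module R' E"
proof -
 interpret E: abelian_group E by (rule E_abelian_group)
 show ?thesis
 proof (rule moduleI)
  show "cring R'" by (rule R'.cring_axioms)
  fix r s U assume rs: "r \<in> El R'" "s \<in> El R'" and U: "U \<in> El E"
  show "(r \<oplus>\<^sub>R' s) \<odot>\<^sub>E U = r \<odot>\<^sub>E U \<oplus>\<^sub>E s \<odot>\<^sub>E U"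
   using U
  proof (induction rule: E_induct)
   case (pure a m)
   thus ?case using rs by (simp add: R'.l_distr p_add_l)
  next
   case (add U V)
   thus ?case using rs by (simp add: E_smult_add E_smult_closed E.a_ac)
  qed
  show "(r \<otimes>\<^sub>R' s) \<odot>\<^sub>E U = r \<odot>\<^sub>E (s \<odot>\<^sub>E U)"
   using U
  proof (induction rule: E_induct)
   case (pure a m)
   thus ?case using rs by (simp add: R'.m_assoc)
  next
   case (add U V)
   thus ?case using rs by (simp add: E_smult_add E_smult_closed)
  qed
 next
  fix U assume "U \<in> El E"
  thus "\<one>\<^sub>R' \<odot>\<^sub>E U = U"
   by (induction rule: E_induct) (simp_all add: E_smult_add)
 qed (simp_all add: E_smult_add E_smult_closed E_abelian_group)
qed

lemma E_bold_module: "bold_module R' E"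
proof (intro bold_module.intro bold_module_axioms.intro E_module R'.bold_ring_axioms)
 interpret E: abelian_group E by (rule E_abelian_group)
 show "tau E (r \<odot>\<^sub>E U) = endo R' r \<odot>\<^sub>E tau E U" if r: "r \<in> El R'" and U: "U \<in> El E" for r U
  using U
 proof (induction rule: E_induct)
  case (pure a m)
  thus ?case using r by (simp add: R'.sigma_mult)
 next
  case (add U V)
  thus ?case using r by (simp add: E_smult_add E_smult_closed E_tau_add E_tau_closed)
 qed
qed (auto simp: E_tau_add E_tau_closed)

definition extend :: "('m => 'r) => ('s, 'm) tensor => 's" where
 "extend f = tensor_lift R' (%(a, m). a \<otimes>\<^sub>R' \<phi> (f m))"

lemma extend_functional:
 assumes f: "functional R M f"
 shows "functional R' E (extend f)"
  and "a \<in> El R' ==> m \<in> El M ==> extend f (p a m) = a \<otimes>\<^sub>R' \<phi> (f m)"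
proof -
 note fD = functionalD[OF f]
 have b: "bal R' (%(a, m). a \<otimes>\<^sub>R' \<phi> (f m))"
  by (rule balancedI)
   (simp_all add: fD ring_hom_add[OF \<phi>_hom] ring_hom_mult[OF \<phi>_hom] R'.l_distr R'.r_distr R'.m_ac)
 have ab: "abelian_group R'" by (rule R'.abelian_group_axioms)
 have ext_p: "extend f (p a m) = a \<otimes>\<^sub>R' \<phi> (f m)" if "a \<in> El R'" "m \<in> El M" for a m
  using lift_E(2)[OF ab b that] by (simp add: extend_def)
 thus "a \<in> El R' ==> m \<in> El M ==> extend f (p a m) = a \<otimes>\<^sub>R' \<phi> (f m)" .
 have add: "additive_map E R' (extend f)" using lift_E(1)[OF ab b] by (simp add: extend_def additive_map_def)
 have "extend f (r \<odot>\<^sub>E U) = r \<otimes>\<^sub>R' extend f U" if r: "r \<in> El R'" and U: "U \<in> El E" for r U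
  using U
 proof (induction rule: E_induct)
  case (pure a m)
  thus ?case using r by (simp add: ext_p fD R'.m_assoc)
 next
  case (add U V)
  note ad = additive_map_add[OF \<open>additive_map E R' (extend f)\<close>]
   and cl = additive_map_closed[OF \<open>additive_map E R' (extend f)\<close>]
  show ?case using add r by (simp add: ad cl E_smult_add E_smult_closed R'.r_distr)
 qed
 thus "functional R' E (extend f)" using add by (simp add: functional_def)
qed

abbreviation "\<iota> m \<equiv> p \<one>\<^sub>R' m"

text \<open>The extensions of the functionals of a dual basis of \<open>M\<close> form, with the same vectors, a dual basis of the extension.\<close>
lemma extend_expand:
 assumes db: "dual_basis R M A f" and U: "U \<in> El E"
 shows "U = (\<Oplus>\<^sub>E a\<in>A. extend (f a) U \<odot>\<^sub>E \<iota> a)"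
proof -
 interpret E: module R' E by (rule E_module)
 note dbD = M.dual_basisD[OF db]
 note ext = extend_functional[OF dbD(3)]
 have closed: "extend (f a) U \<odot>\<^sub>E \<iota> a \<in> El E" if "a \<in> A" "U \<in> El E" for a U
  using that functionalD(1)[OF ext(1)] dbD(2) by (intro E_smult_closed) auto
 show ?thesis
  using U
 proof (induction rule: E_induct)
  case (pure x m)
  have "p x m = p x (\<Oplus>\<^sub>M a\<in>A. f a m \<odot>\<^sub>M a)" using dbD(4)[OF pure(2)] by simp
  also have "... = (\<Oplus>\<^sub>E a\<in>A. p x (f a m \<odot>\<^sub>M a))"
   by (rule additive_map_finsum[OF module.axioms(2)[OF M.module_axioms] E_abelian_group])
    (use pure dbD in \<open>auto simp: additive_map_def p_add_r\<close>)
  also have "... = (\<Oplus>\<^sub>E a\<in>A. extend (f a) (p x m) \<odot>\<^sub>E \<iota> a)"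
  proof (rule E.M.finsum_cong')
   fix a assume a: "a \<in> A"
   show "p x (f a m \<odot>\<^sub>M a) = extend (f a) (p x m) \<odot>\<^sub>E \<iota> a"
    using a pure dbD(2,5) ext(2) p_smult[of "f a m" x a, symmetric] by (simp add: R'.m_comm)
  qed (use pure closed in auto)
  finally show ?case .
 next
  case (add U V)
  have "U \<oplus>\<^sub>E V = (\<Oplus>\<^sub>E a\<in>A. extend (f a) U \<odot>\<^sub>E \<iota> a) \<oplus>\<^sub>E (\<Oplus>\<^sub>E a\<in>A. extend (f a) V \<odot>\<^sub>E \<iota> a)"
   using add.IH by simp
  also have "... = (\<Oplus>\<^sub>E a\<in>A. extend (f a) U \<odot>\<^sub>E \<iota> a \<oplus>\<^sub>E extend (f a) V \<odot>\<^sub>E \<iota> a)"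
   using closed add.hyps by (intro E.M.finsum_addf[symmetric]) auto
  also have "... = (\<Oplus>\<^sub>E a\<in>A. extend (f a) (U \<oplus>\<^sub>E V) \<odot>\<^sub>E \<iota> a)"
  proof (rule E.M.finsum_cong')
   fix a assume a: "a \<in> A"
   note eD = functionalD[OF ext(1)[OF a]]
   show "extend (f a) U \<odot>\<^sub>E \<iota> a \<oplus>\<^sub>E extend (f a) V \<odot>\<^sub>E \<iota> a = extend (f a) (U \<oplus>\<^sub>E V) \<odot>\<^sub>E \<iota> a"
    using add.hyps eD(1) p_closed[of "\<one>\<^sub>R'" a] dbD(2)[OF a]
    by (simp only: eD(2) E.smult_l_distr R'.one_closed)
  qed (use add.hyps closed E.M.a_closed in auto)
  finally show ?case .
 qed
qed

theorem extended_base_change: "base_change F e F' R R' c \<phi> c' M E (%m. \<iota> m)"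
proof (intro base_change.intro base_change_axioms.intro fraction_descent_axioms M.dual_module_axioms)
 interpret E: bold_module R' E by (rule E_bold_module)
 obtain A f where db: "dual_basis R M A f" using M.dual_basis_exists by blast
 note dbD = M.dual_basisD[OF db]
 show "dual_module R' E"
 proof (intro dual_module.intro dual_module_axioms.intro simple_R' E_bold_module)
  show "\<exists>A f. dual_basis R' E A f"
   by (rule E.dual_basis_of_family[OF dbD(1), where y = "%a. \<iota> a" and g = "%a. extend (f a)"])
    (use dbD extend_functional(1) extend_expand[OF db] in auto)
  fix \<phi>' assume \<phi>': "functional R' E \<phi>'"
  note \<phi>'D = functionalD[OF \<phi>']
  have "\<forall>a\<in>A. \<exists>\<psi>. functional R M \<psi> \<and> (\<forall>x\<in>El M. \<psi> (tau M x) = endo R (f a x))"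
   using M.dual_tau[OF dbD(3)] by blast
  from bchoice[OF this] obtain \<psi> where \<psi>: "\<And>a. a \<in> A ==> functional R M (\<psi> a)"
   and \<psi>_tau: "\<And>a x. a \<in> A ==> x \<in> El M ==> \<psi> a (tau M x) = endo R (f a x)" by blast
  have ext_tau: "extend (\<psi> a) (tau E U) = endo R' (extend (f a) U)" if a: "a \<in> A" and U: "U \<in> El E" for a U
   using U
  proof (induction rule: E_induct)
   case (pure x m)
   thus ?case
    using a dbD(5) by (simp add: extend_functional(2)[OF \<psi>] extend_functional(2)[OF dbD(3)] \<psi>_tau R'.sigma_mult \<phi>_sigma)
  next
   case (add U V)
   note eD = functionalD[OF extend_functional(1)[OF \<psi>[OF a]]] functionalD[OF extend_functional(1)[OF dbD(3)[OF a]]]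
   show ?case using add by (simp add: eD E_tau_add E_tau_closed R'.sigma_add)
  qed
  have coef: "endo R' (\<phi>' (\<iota> a)) \<in> El R'" "\<phi>' (\<iota> a) \<in> El R'" if "a \<in> A" for a using that dbD(2) \<phi>'D(1) by auto
  have extc: "extend (f a) U \<in> El R'" if "a \<in> A" "U \<in> El E" for a U
   using functionalD(1)[OF extend_functional(1)[OF dbD(3)[OF that(1)]] that(2)] .
  show "\<exists>\<psi>'. functional R' E \<psi>' \<and> (\<forall>U\<in>El E. \<psi>' (tau E U) = endo R' (\<phi>' U))"
  proof (intro exI conjI ballI)
   show "functional R' E (%U. \<Oplus>\<^sub>R' a\<in>A. endo R' (\<phi>' (\<iota> a)) \<otimes>\<^sub>R' extend (\<psi> a) U)"
    by (intro E.functional_sum dbD(1) extend_functional(1) \<psi> coef)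
   fix U assume U: "U \<in> El E"
   have "endo R' (\<phi>' U) = endo R' (\<phi>' (\<Oplus>\<^sub>E a\<in>A. extend (f a) U \<odot>\<^sub>E \<iota> a))"
    using extend_expand[OF db U] by simp
   also have "\<phi>' (\<Oplus>\<^sub>E a\<in>A. extend (f a) U \<odot>\<^sub>E \<iota> a) = (\<Oplus>\<^sub>R' a\<in>A. \<phi>' (extend (f a) U \<odot>\<^sub>E \<iota> a))"
    by (rule E.functional_finsum[OF \<phi>']) (use extc U dbD(2) E_smult_closed in auto)
   also have "endo R' ... = (\<Oplus>\<^sub>R' a\<in>A. endo R' (\<phi>' (extend (f a) U \<odot>\<^sub>E \<iota> a)))"
    by (rule additive_map_finsum[OF R'.abelian_group_axioms R'.abelian_group_axioms R'.sigma_additive])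
     (use extc U dbD(2) E_smult_closed \<phi>'D(1) in auto)
   also have "... = (\<Oplus>\<^sub>R' a\<in>A. endo R' (\<phi>' (\<iota> a)) \<otimes>\<^sub>R' extend (\<psi> a) (tau E U))"
   proof (rule R'.finsum_cong')
    fix a assume a: "a \<in> A"
    have "\<phi>' (extend (f a) U \<odot>\<^sub>E \<iota> a) = extend (f a) U \<otimes>\<^sub>R' \<phi>' (\<iota> a)"
     using a extc U dbD(2) by (intro \<phi>'D(3)) auto
    thus "endo R' (\<phi>' (extend (f a) U \<odot>\<^sub>E \<iota> a)) = endo R' (\<phi>' (\<iota> a)) \<otimes>\<^sub>R' extend (\<psi> a) (tau E U)"
     using a extc[OF a U] U coef[OF a] by (simp add: ext_tau R'.sigma_mult R'.m_comm)
   qed (use ext_tau extc U coef in auto)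
   finally show "(\<Oplus>\<^sub>R' a\<in>A. endo R' (\<phi>' (\<iota> a)) \<otimes>\<^sub>R' extend (\<psi> a) (tau E U)) = endo R' (\<phi>' U)" by simp
  qed
 qed
 show "additive_map M E (%m. \<iota> m)" by (auto simp: additive_map_def p_add_r)
 show "\<iota> (r \<odot>\<^sub>M x) = \<phi> r \<odot>\<^sub>E \<iota> x" if "r \<in> El R" "x \<in> El M" for r x
  using that p_smult[of r "\<one>\<^sub>R'" x] by simp
 show "\<iota> (tau M x) = tau E (\<iota> x)" if "x \<in> El M" for x using that by simp
 show "module_span R' E ((%m. \<iota> m) ` El M) = El E"
 proof
  have sub: "(%m. \<iota> m) ` El M <= El E" by auto
  show "module_span R' E ((%m. \<iota> m) ` El M) <= El E" by (rule E.module_span_carrier[OF sub])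
  show "El E <= module_span R' E ((%m. \<iota> m) ` El M)"
  proof
   fix U assume "U \<in> El E"
   thus "U \<in> module_span R' E ((%m. \<iota> m) ` El M)"
   proof (induction rule: E_induct)
    case (pure a m)
    have "a \<odot>\<^sub>E \<iota> m \<in> module_span R' E ((%m. \<iota> m) ` El M)"
     using pure by (intro E.submodule_smult[OF E.module_span_submodule[OF sub]] module_span.base) auto
    thus ?case using pure by simp
   next
    case (add U V)
    thus ?case by (intro E.submodule_add[OF E.module_span_submodule[OF sub]])
   qed
  qed
 qed
 show "\<exists>f'. functional R' E f' \<and> (\<forall>x\<in>El M. f' (\<iota> x) = \<phi> (f x))" if f: "functional R M f" for f
  using extend_functional[OF f] functionalD(1)[OF f] by (intro exI[of _ "extend f"]) auto
qed

end

section \<open>Relative full faithfulness\<close>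

lemma bold_homsD:
 assumes "h \<in> bold_homs R M N"
 shows "linear_map R M N h" "x \<in> El M ==> h x \<in> El N"
  "x \<in> El M ==> h (tau M x) = tau N (h x)" "h \<in> extensional (El M)"
 using assms by (auto simp: bold_homs_iff bold_map_def linear_map_def additive_map_def)

lemma bold_homsI:
 assumes "\<And>x. x \<in> El M ==> h x \<in> El N"
  and "\<And>x y. x \<in> El M ==> y \<in> El M ==> h (x \<oplus>\<^sub>M y) = h x \<oplus>\<^sub>N h y"
  and "\<And>r x. r \<in> El R ==> x \<in> El M ==> h (r \<odot>\<^sub>M x) = r \<odot>\<^sub>N h x"
  and "\<And>x. x \<in> El M ==> h (tau M x) = tau N (h x)" "h \<in> extensional (El M)"
 shows "h \<in> bold_homs R M N"
 using assms by (auto simp: bold_homs_iff bold_map_def linear_map_def additive_map_def)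

lemma bold_Hom_simps [simp]:
 "El (bold_Hom c R M N) = bold_homs R M N"
 "\<zero>\<^bsub>bold_Hom c R M N\<^esub> = (\<lambda>x\<in>El M. \<zero>\<^sub>N)"
 "g \<oplus>\<^bsub>bold_Hom c R M N\<^esub> h = (\<lambda>x\<in>El M. g x \<oplus>\<^sub>N h x)"
 "a \<odot>\<^bsub>bold_Hom c R M N\<^esub> h = (\<lambda>x\<in>El M. c a \<odot>\<^sub>N h x)"
 by (simp_all add: bold_Hom_def)

lemma bold_Hom_module:
 assumes "bold_module R M" "bold_module R N" "cring F" and c: "c \<in> ring_hom F R"
  and inv: "\<And>a. a \<in> El F ==> endo R (c a) = c a"
 shows "module F (bold_Hom c R M N)"
proof -
 interpret M: bold_module R M by fact
 interpret N: bold_module R N by fact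
 interpret F: cring F by fact
 note cD [simp] = ring_hom_closed[OF c] ring_hom_add[OF c] ring_hom_mult[OF c] ring_hom_one[OF c]
 have hc [simp]: "h x \<in> El N" if "h \<in> bold_homs R M N" "x \<in> El M" for h x
  using bold_homsD(2)[OF that] .
 have tc [simp]: "tau M x \<in> El M" if "x \<in> El M" for x using M.tau_closed that by auto
 note hD = linear_mapD[OF bold_homsD(1)] and ht = bold_homsD(3)
 have sum: "(\<lambda>x\<in>El M. g x \<oplus>\<^sub>N h x) \<in> bold_homs R M N"
  if "g \<in> bold_homs R M N" "h \<in> bold_homs R M N" for g h
  by (rule bold_homsI)
   (use that in \<open>simp_all add: hD[OF that(1)] hD[OF that(2)] ht[OF that(1)] ht[OF that(2)] N.a_ac N.smult_r_distr N.tau_add\<close>)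
 have smult: "(\<lambda>x\<in>El M. c a \<odot>\<^sub>N h x) \<in> bold_homs R M N"
  if a: "a \<in> El F" and h: "h \<in> bold_homs R M N" for a h
 proof (rule bold_homsI)
  fix r x assume r: "r \<in> El R" and x: "x \<in> El M"
  have "c a \<odot>\<^sub>N (r \<odot>\<^sub>N h x) = (c a \<otimes>\<^sub>R r) \<odot>\<^sub>N h x" using a h r x by (simp add: N.smult_assoc1)
  also have "... = (r \<otimes>\<^sub>R c a) \<odot>\<^sub>N h x" using a r by (simp add: M.R.m_comm)
  also have "... = r \<odot>\<^sub>N (c a \<odot>\<^sub>N h x)" using a h r x by (simp add: N.smult_assoc1)
  finally show "(\<lambda>x\<in>El M. c a \<odot>\<^sub>N h x) (r \<odot>\<^sub>M x) = r \<odot>\<^sub>N (\<lambda>x\<in>El M. c a \<odot>\<^sub>N h x) x"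
   using r x by (simp add: hD(3)[OF h])
 qed (use a h in \<open>simp_all add: hD[OF h] ht[OF h] N.smult_r_distr N.tau_smult inv\<close>)
 have zero: "(\<lambda>x\<in>El M. \<zero>\<^sub>N) \<in> bold_homs R M N"
 proof (rule bold_homsI)
  have "\<zero>\<^sub>N = tau N \<zero>\<^sub>N"
   using N.tau_smult[of "\<zero>\<^sub>R" "\<zero>\<^sub>N"] N.tau_closed by (auto simp: M.sigma_zero Pi_iff)
  thus "(\<lambda>x\<in>El M. \<zero>\<^sub>N) (tau M x) = tau N ((\<lambda>x\<in>El M. \<zero>\<^sub>N) x)" if "x \<in> El M" for x
   using that by simp
 qed auto
 have ext: "g = h" if "g \<in> bold_homs R M N" "h \<in> bold_homs R M N" "\<And>x. x \<in> El M ==> g x = h x" for g h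
  using bold_homsD(4)[OF that(1)] bold_homsD(4)[OF that(2)] that(3) by (rule extensionalityI)
 have rext: "(\<lambda>x\<in>El M. g x) = h" if "h \<in> bold_homs R M N" "\<And>x. x \<in> El M ==> g x = h x" for g h
  by (rule extensionalityI[OF restrict_extensional bold_homsD(4)[OF that(1)]]) (use that(2) in simp)
 show ?thesis
 proof (rule moduleI)
  show "abelian_group (bold_Hom c R M N)"
  proof (rule abelian_groupI)
   fix g assume g: "g \<in> El (bold_Hom c R M N)"
   show "\<exists>h\<in>El (bold_Hom c R M N). h \<oplus>\<^bsub>bold_Hom c R M N\<^esub> g = \<zero>\<^bsub>bold_Hom c R M N\<^esub>"
   proof (rule bexI[of _ "\<lambda>x\<in>El M. c (\<ominus>\<^sub>F \<one>\<^sub>F) \<odot>\<^sub>N g x"])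
    have "c (\<ominus>\<^sub>F \<one>\<^sub>F) \<odot>\<^sub>N g x \<oplus>\<^sub>N g x = \<zero>\<^sub>N" if "x \<in> El M" for x
    proof -
     have "c (\<ominus>\<^sub>F \<one>\<^sub>F) \<odot>\<^sub>N g x \<oplus>\<^sub>N g x = (c (\<ominus>\<^sub>F \<one>\<^sub>F) \<oplus>\<^sub>R \<one>\<^sub>R) \<odot>\<^sub>N g x"
      using g that by (simp add: N.smult_l_distr)
     also have "c (\<ominus>\<^sub>F \<one>\<^sub>F) \<oplus>\<^sub>R \<one>\<^sub>R = c (\<ominus>\<^sub>F \<one>\<^sub>F \<oplus>\<^sub>F \<one>\<^sub>F)" by (simp del: F.l_neg)
     also have "... = \<zero>\<^sub>R"
      using ring_hom_zero[OF c F.ring_axioms M.R.ring_axioms] by (simp add: F.l_neg)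
     finally show ?thesis using g that by simp
    qed
    thus "(\<lambda>x\<in>El M. c (\<ominus>\<^sub>F \<one>\<^sub>F) \<odot>\<^sub>N g x) \<oplus>\<^bsub>bold_Hom c R M N\<^esub> g = \<zero>\<^bsub>bold_Hom c R M N\<^esub>"
     by (auto intro!: restrict_ext)
   qed (use g smult in auto)
  next
   fix g assume "g \<in> El (bold_Hom c R M N)"
   thus "\<zero>\<^bsub>bold_Hom c R M N\<^esub> \<oplus>\<^bsub>bold_Hom c R M N\<^esub> g = g" by (auto intro!: rext)
  qed (auto simp: sum zero N.a_ac intro!: restrict_ext)
 next
  fix g assume "g \<in> El (bold_Hom c R M N)"
  thus "\<one>\<^sub>F \<odot>\<^bsub>bold_Hom c R M N\<^esub> g = g" by (auto intro!: rext)
 qed (auto simp: smult F.cring_axioms N.smult_l_distr N.smult_r_distr N.smult_assoc1 intro!: restrict_ext)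
qed

text \<open>Injectivity is linear disjointness, applied to the values of the homomorphisms; surjectivity is the
decomposition of a homomorphism into independent components.\<close>
theorem full_faithfulness:
 assumes FD: "fraction_descent F e F' R R' c \<phi> c'" and dM: "dual_module R M" and dN: "dual_module R N"
 shows "fully_faithful_on F e F' (bold_Hom c R M N)
  (bold_Hom c' R' (scalar_extension R \<phi> R' M) (scalar_extension R \<phi> R' N)) (scalar_extension_map R \<phi> R' M N)"
proof -
 interpret EM: extended_module F e F' R R' c \<phi> c' M by (rule extended_module.intro[OF FD dM])
 interpret EN: extended_module F e F' R R' c \<phi> c' N by (rule extended_module.intro[OF FD dN])
 interpret B: base_change_pair F e F' R R' c \<phi> c' M EM.E "%m. EM.\<iota> m" N EN.E "%m. EN.\<iota> m"
  by (rule base_change_pair.intro[OF EM.extended_base_change EN.extended_base_change])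
 let ?HC = "bold_Hom c R M N" and ?HD = "bold_Hom c' R' EM.E EN.E"
 let ?V = "scalar_extension_map R \<phi> R' M N"
 have mC: "module F ?HC"
  by (rule bold_Hom_module[OF EM.M.bold_module_axioms EN.M.bold_module_axioms EM.F.cring_axioms EM.c_hom EM.c_invariant])
 have mD: "module F' ?HD"
  by (rule bold_Hom_module[OF EM.E_bold_module EN.E_bold_module EM.F'.cring_axioms EM.c'_hom EM.c'_invariant])
 interpret HC: module F ?HC by (rule mC)
 interpret HD: module F' ?HD by (rule mD)
 have ab: "abelian_group ?HD" by (rule HD.abelian_group_axioms)
 have mN: "module R' EN.E" by (rule EN.E_module)
 have eqI: "g = h" if g: "g \<in> El ?HD" and h: "h \<in> El ?HD"
  and eq: "\<And>x. x \<in> El M ==> g (EM.\<iota> x) = h (EM.\<iota> x)" for g h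
 proof (rule extensionalityI[of _ "El EM.E"])
  have gh: "g \<in> bold_homs R' EM.E EN.E" "h \<in> bold_homs R' EM.E EN.E" using g h by auto
  show "g \<in> extensional (El EM.E)" "h \<in> extensional (El EM.E)" using gh by (auto intro: bold_homsD(4))
  show "g U = h U" if "U \<in> El EM.E" for U
   by (rule B.BM.extension_unique[OF mN bold_homsD(1)[OF gh(1)] bold_homsD(1)[OF gh(2)] eq that])
 qed
 have V: "?V h \<in> El ?HD" "x \<in> El M ==> ?V h (EM.\<iota> x) = EN.\<iota> (h x)" if "h \<in> El ?HC" for h x
 proof -
  have h: "h \<in> bold_homs R M N" using that by simp
  note hc = bold_homsD(2)[OF h] and hD = linear_mapD[OF bold_homsD(1)[OF h]] and ht = bold_homsD(3)[OF h]
  have b: "EM.bal EN.E (%(a, m). EN.p a (h m))"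
   by (rule EM.balancedI) (simp_all add: hc hD EN.p_add_l EN.p_add_r EN.p_smult)
  note L = EM.lift_E[OF EN.E_abelian_group b]
  have Vp: "?V h (EM.p a m) = EN.p a (h m)" if "a \<in> El R'" "m \<in> El M" for a m
   using L(2)[OF that] that by (simp add: scalar_extension_map_def)
  thus "x \<in> El M ==> ?V h (EM.\<iota> x) = EN.\<iota> (h x)" by simp
  have add: "additive_map EM.E EN.E (?V h)"
   using L(1) module.axioms(2)[OF EM.E_module] by (auto simp: additive_map_def scalar_extension_map_def abelian_group_def abelian_monoid.a_closed)
  note Vadd = additive_map_add[OF add] and Vc = additive_map_closed[OF add]
  have "?V h \<in> bold_homs R' EM.E EN.E"
  proof (rule bold_homsI)
   show "?V h \<in> extensional (El EM.E)" by (simp add: scalar_extension_map_def)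
   show "?V h (r \<odot>\<^sub>EM.E U) = r \<odot>\<^sub>EN.E ?V h U" if r: "r \<in> El R'" and U: "U \<in> El EM.E" for r U
    using U
   proof (induction rule: EM.E_induct)
    case (pure a m)
    thus ?case using r by (simp add: Vp hc)
   next
    case (add U V)
    thus ?case using r by (simp add: EM.E_smult_add EM.E_smult_closed EN.E_smult_add Vadd Vc)
   qed
   show "?V h (tau EM.E U) = tau EN.E (?V h U)" if U: "U \<in> El EM.E" for U
    using U
   proof (induction rule: EM.E_induct)
    case (pure a m)
    thus ?case by (simp add: Vp hc ht)
   next
    case (add U V)
    thus ?case by (simp add: EM.E_tau_add EM.E_tau_closed EN.E_tau_add Vadd Vc)
   qed
  qed (use Vadd Vc in auto)
  thus "?V h \<in> El ?HD" by simp
 qed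
 have iota: "EM.\<iota> x \<in> El EM.E" if "x \<in> El M" for x using that by simp
 have hC: "h x \<in> El N" if "h \<in> El ?HC" "x \<in> El M" for h x
  using bold_homsD(2)[of h R M N x] that by simp
 have tens: "tensor F EM.FF' ?HC"
  by (intro tensor.intro EM.F.cring_axioms EM.module_FF' mC)
 interpret T: tensor F EM.FF' ?HC by (rule tens)
 have val: "(b \<odot>\<^sub>?HD ?V h) (EM.\<iota> x) = c' b \<odot>\<^sub>EN.E EN.\<iota> (h x)" if "b \<in> El F'" "h \<in> El ?HC" "x \<in> El M" for b h x
  using that V(2)[OF that(2,3)] iota by simp
 have smc: "b \<odot>\<^sub>?HD ?V h \<in> El ?HD" if "b \<in> El F'" "h \<in> El ?HC" for b h
  using that V(1) HD.smult_closed by blast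
 have ev_add: "(g \<oplus>\<^sub>?HD h) (EM.\<iota> x) = g (EM.\<iota> x) \<oplus>\<^sub>EN.E h (EM.\<iota> x)" if "x \<in> El M" for g h x
  using iota[OF that] by simp
 have bal: "balanced F EM.FF' ?HC ?HD (%(b, h). b \<odot>\<^sub>?HD ?V h)"
  unfolding balanced_def
 proof (intro conjI ballI)
  fix b h assume b: "b \<in> El EM.FF'" and h: "h \<in> El ?HC"
  have b': "b \<in> El F'" using b by simp
  show "(case (b, h) of (b, h) => b \<odot>\<^sub>?HD ?V h) \<in> El ?HD" using smc[OF b' h] by simp
  {
   fix b2 assume "b2 \<in> El EM.FF'"
   thus "(case (b \<oplus>\<^sub>EM.FF' b2, h) of (b, h) => b \<odot>\<^sub>?HD ?V h) =
    (case (b, h) of (b, h) => b \<odot>\<^sub>?HD ?V h) \<oplus>\<^sub>?HD (case (b2, h) of (b, h) => b \<odot>\<^sub>?HD ?V h)"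
    using HD.smult_l_distr[OF b' _ V(1)[OF h]] by (simp del: bold_Hom_simps)
  next
   fix h2 assume h2: "h2 \<in> El ?HC"
   have hh: "h \<oplus>\<^sub>?HC h2 \<in> El ?HC" using h h2 by (rule HC.M.a_closed)
   have "b \<odot>\<^sub>?HD ?V (h \<oplus>\<^sub>?HC h2) = b \<odot>\<^sub>?HD ?V h \<oplus>\<^sub>?HD b \<odot>\<^sub>?HD ?V h2"
   proof (rule eqI)
    fix x assume x: "x \<in> El M"
    have "(h \<oplus>\<^sub>?HC h2) x = h x \<oplus>\<^sub>N h2 x" using x by simp
    thus "(b \<odot>\<^sub>?HD ?V (h \<oplus>\<^sub>?HC h2)) (EM.\<iota> x) = (b \<odot>\<^sub>?HD ?V h \<oplus>\<^sub>?HD b \<odot>\<^sub>?HD ?V h2) (EM.\<iota> x)"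
     unfolding ev_add[OF x] val[OF b' h x] val[OF b' h2 x] val[OF b' hh x]
     using b' hC[OF h x] hC[OF h2 x] by (simp add: EN.p_add_r EN.E_smult_add)
   qed (intro smc b' h h2 hh HD.M.a_closed)+
   thus "(case (b, h \<oplus>\<^sub>?HC h2) of (b, h) => b \<odot>\<^sub>?HD ?V h) =
    (case (b, h) of (b, h) => b \<odot>\<^sub>?HD ?V h) \<oplus>\<^sub>?HD (case (b, h2) of (b, h) => b \<odot>\<^sub>?HD ?V h)"
    by (simp del: bold_Hom_simps)
  }
 next
  fix s b h assume s: "s \<in> El F" and b: "b \<in> El EM.FF'" and h: "h \<in> El ?HC"
  have b': "b \<in> El F'" and sb: "e s \<otimes>\<^sub>F' b \<in> El F'" using b s by simp_all
  have sh: "s \<odot>\<^sub>?HC h \<in> El ?HC" using s h by (rule HC.smult_closed)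
  have "(e s \<otimes>\<^sub>F' b) \<odot>\<^sub>?HD ?V h = b \<odot>\<^sub>?HD ?V (s \<odot>\<^sub>?HC h)"
  proof (rule eqI)
   fix x assume x: "x \<in> El M"
   have 1: "(s \<odot>\<^sub>?HC h) x = c s \<odot>\<^sub>N h x" using x by simp
   have 2: "EN.p \<one>\<^sub>R' (c s \<odot>\<^sub>N h x) = EN.p (c' (e s)) (h x)"
    using EN.p_smult[of "c s" "\<one>\<^sub>R'" "h x"] s hC[OF h x] by (simp add: EM.\<phi>_c)
   show "((e s \<otimes>\<^sub>F' b) \<odot>\<^sub>?HD ?V h) (EM.\<iota> x) = (b \<odot>\<^sub>?HD ?V (s \<odot>\<^sub>?HC h)) (EM.\<iota> x)"
    unfolding val[OF sb h x] val[OF b' sh x] 1 2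
    using s b' hC[OF h x] by (simp add: ring_hom_mult[OF EM.c'_hom] EM.R'.m_comm)
  qed (intro smc b' sb sh h)+
  thus "(case (s \<odot>\<^sub>EM.FF' b, h) of (b, h) => b \<odot>\<^sub>?HD ?V h) = (case (b, s \<odot>\<^sub>?HC h) of (b, h) => b \<odot>\<^sub>?HD ?V h)"
   by (simp del: bold_Hom_simps)
 qed
 let ?g = "tensor_lift ?HD (%(b, h). b \<odot>\<^sub>?HD ?V h)"
 have g_add: "additive_map T.T ?HD ?g" by (rule T.lift_additive[OF ab bal])
 have g_pure: "?g (T.pure b h) = b \<odot>\<^sub>?HD ?V h" if "b \<in> El F'" "h \<in> El ?HC" for b h
  using T.lift_pure[OF ab bal, of b h] that by (simp del: bold_Hom_simps)
 have g_sum: "?g (\<Oplus>\<^sub>T.T b\<in>S. T.pure b (v b)) (EM.\<iota> x) = B.BN.mcomb S (%b. v b x)"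
  if S: "S <= El F'" and v: "v \<in> S \<rightarrow> El ?HC" and x: "x \<in> El M" for S v x
 proof -
  have vb: "v b \<in> El ?HC" if "b \<in> S" for b using v that by auto
  have bS: "b \<in> El F'" if "b \<in> S" for b using S that by auto
  have "?g (\<Oplus>\<^sub>T.T b\<in>S. T.pure b (v b)) = (\<Oplus>\<^sub>?HD b\<in>S. ?g (T.pure b (v b)))"
   by (rule additive_map_finsum[OF T.T_abelian_group ab g_add]) (use vb bS in \<open>simp del: bold_Hom_simps\<close>)
  also have "... = (\<Oplus>\<^sub>?HD b\<in>S. b \<odot>\<^sub>?HD ?V (v b))" (is "_ = ?W")
   by (rule HD.M.finsum_cong') (use vb bS smc in \<open>simp_all add: g_pure del: bold_Hom_simps\<close>)
  finally have "?g (\<Oplus>\<^sub>T.T b\<in>S. T.pure b (v b)) (EM.\<iota> x) = ?W (EM.\<iota> x)" by (rule arg_cong)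
  also have "... = (\<Oplus>\<^sub>EN.E b\<in>S. (b \<odot>\<^sub>?HD ?V (v b)) (EM.\<iota> x))"
  proof (rule additive_map_finsum[OF ab EN.E_abelian_group, where g = "%h. h (EM.\<iota> x)"])
   show "additive_map ?HD EN.E (%h. h (EM.\<iota> x))"
    using iota[OF x] by (auto simp: additive_map_def intro: bold_homsD(2))
  qed (use vb bS smc in \<open>simp del: bold_Hom_simps\<close>)
  also have "... = B.BN.mcomb S (%b. v b x)"
   by (rule abelian_monoid.finsum_cong'[OF abelian_group.axioms(1)[OF EN.E_abelian_group]])
    (use vb bS x hC in \<open>simp_all add: val EN.E_smult_closed del: bold_Hom_simps\<close>)
  finally show ?thesis .
 qed
 show ?thesis
  unfolding fully_faithful_on_def
 proof (rule bij_betw_additiveI[OF T.T_abelian_group ab g_add])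
  fix U assume U: "U \<in> El T.T" and gU: "?g U = \<zero>\<^sub>?HD"
  obtain S v where S: "EM.indep S" and v: "v \<in> S \<rightarrow> El ?HC" and Uv: "U = (\<Oplus>\<^sub>T.T b\<in>S. T.pure b (v b))"
   by (rule EM.tensor_combination[OF mC U])
  have Sc: "S <= El F'" by (rule EM.indepD(2)[OF S])
  have vz: "v b = \<zero>\<^sub>?HC" if b: "b \<in> S" for b
  proof -
   have vb: "v b \<in> El ?HC" using v b by auto
   have "v b x = \<zero>\<^sub>N" if x: "x \<in> El M" for x
   proof (rule B.BN.mcomb_zero[OF S _ _ b, where v = "%b. v b x"])
    show "(%b. v b x) \<in> S \<rightarrow> El N" using v x hC by auto
    show "B.BN.mcomb S (%b. v b x) = \<zero>\<^sub>EN.E"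
     using g_sum[OF Sc v x] gU iota[OF x] by (simp add: Uv)
   qed
   thus ?thesis
    using bold_homsD(4)[of "v b" R M N] vb by (auto intro!: extensionalityI[of _ "El M"])
  qed
  have "T.pure b (v b) = \<zero>\<^sub>T.T" if b: "b \<in> S" for b
  proof -
   have "additive_map ?HC T.T (%h. T.pure b h)"
    using T.pure_closed T.pure_add_r b Sc by (auto simp: additive_map_def simp del: bold_Hom_simps)
   from additive_map_zero[OF HC.abelian_group_axioms T.T_abelian_group this] show ?thesis unfolding vz[OF b] .
  qed
  hence "U = (\<Oplus>\<^sub>T.T b\<in>S. \<zero>\<^sub>T.T)"
   unfolding Uv by (intro T.T.finsum_cong') auto
  thus "U = \<zero>\<^sub>T.T" by simp
 next
  fix h' assume "h' \<in> El ?HD"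
  hence h': "h' \<in> bold_homs R' EM.E EN.E" by simp
  obtain S h where S: "EM.indep S"
   and h: "\<forall>b\<in>S. linear_map R M N (h b) \<and> (\<forall>x\<in>El M. h b (tau M x) = tau N (h b x))"
   and dec: "\<forall>x\<in>El M. h' (EM.\<iota> x) = B.BN.mcomb S (%b. h b x)"
   by (rule exE[OF B.hom_decomposition[OF bold_homsD(1)[OF h']]], erule bold_homsD(3)[OF h'])
    (elim exE conjE, rule that)
  have Sc: "S <= El F'" by (rule EM.indepD(2)[OF S])
  define v where "v b = (\<lambda>x\<in>El M. h b x)" for b
  have v: "v \<in> S \<rightarrow> El ?HC"
  proof
   fix b assume b: "b \<in> S"
   note hb = linear_mapD[OF conjunct1[OF bspec[OF h b]]] conjunct2[OF bspec[OF h b]]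
   have "v b \<in> bold_homs R M N"
    by (rule bold_homsI) (use hb EM.M.tau_in in \<open>auto simp: v_def\<close>)
   thus "v b \<in> El ?HC" by simp
  qed
  let ?U = "\<Oplus>\<^sub>T.T b\<in>S. T.pure b (v b)"
  have Uc: "?U \<in> El T.T" using v Sc by (intro T.T.finsum_closed) (auto simp: Pi_iff subset_iff simp del: bold_Hom_simps)
  have "?g ?U = h'"
  proof (rule eqI)
   show "?g ?U \<in> El ?HD" by (rule additive_map_closed[OF g_add Uc])
   show "h' \<in> El ?HD" by fact
   fix x assume x: "x \<in> El M"
   have "B.BN.mcomb S (%b. v b x) = B.BN.mcomb S (%b. h b x)" using x by (simp add: v_def)
   thus "?g ?U (EM.\<iota> x) = h' (EM.\<iota> x)" using g_sum[OF Sc v x] dec x by simp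
  qed
  thus "\<exists>U\<in>El T.T. ?g U = h'" using Uc by blast
 qed
qed

section \<open>The Frobenius of a finite field\<close>

lemma (in ring) eval_map_rev:
 assumes "a \<in> {..<n} \<rightarrow> El R" "x \<in> El R"
 shows "eval (map a (rev [0..<n])) x = (\<Oplus>i\<in>{..<n}. a i \<otimes> x [^] i)"
 using assms(1)
proof (induction n)
 case (Suc n)
 have "a i \<in> El R" if "i \<le> n" for i using Suc.prems that by auto
 thus ?case using Suc.IH assms(2) by (simp add: lessThan_Suc finsum_insert Pi_iff)
qed simp

lemma (in ring) normalize_Nil: "normalize p = [] ==> set p <= {\<zero>}"
 by (induction p) (auto split: if_splits)

text \<open>A polynomial has no more roots than its degree, stated for coefficient functions.\<close>
lemma (in field) vanishing_coefficients:
 assumes a: "a \<in> {..<n} \<rightarrow> El R" and S: "finite S" "S <= El R" "n \<le> card S"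
  and zero: "\<And>x. x \<in> S ==> (\<Oplus>i\<in>{..<n}. a i \<otimes> x [^] i) = \<zero>" and i: "i < n"
 shows "a i = \<zero>"
proof -
 let ?p = "map a (rev [0..<n])"
 have sp: "set ?p <= El R" using a by auto
 have q: "normalize ?p \<in> El (poly_ring R)"
  using normalize_gives_polynomial[OF sp] by (simp add: univ_poly_carrier)
 have "normalize ?p = []"
 proof (rule ccontr)
  assume ne: "normalize ?p ~= []"
  have "S <= set_mset (roots (normalize ?p))"
  proof
   fix x assume x: "x \<in> S"
   hence xc: "x \<in> El R" using S(2) by blast
   have "eval (normalize ?p) x = \<zero>"
    using eval_normalize[OF sp xc] eval_map_rev[OF a xc] zero[OF x] by simp
   thus "x \<in> set_mset (roots (normalize ?p))"
    using xc ne by (simp add: roots_mem_iff_is_root[OF q] is_root_def)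
  qed
  hence "card S \<le> card (set_mset (roots (normalize ?p)))" by (intro card_mono) auto
  also have "... = size (mset_set (set_mset (roots (normalize ?p))))" by simp
  also have "... \<le> size (roots (normalize ?p))" by (intro size_mset_mono mset_set_set_mset_msubset)
  also have "... \<le> length (normalize ?p) - 1" using size_roots_le_degree[OF q] by simp
  also have "... < length (normalize ?p)" using ne by simp
  also have "... \<le> n" using normalize_length_le[of ?p] by simp
  finally show False using S(3) by simp
 qed
 hence "set ?p <= {\<zero>}" by (rule normalize_Nil)
 moreover have "a i \<in> set ?p" using i by auto
 ultimately show ?thesis by blast
qed

context cring
begin

lemma binomial_expansion:
 assumes x: "x \<in> El R" and y: "y \<in> El R"
 shows "(x \<oplus> y) [^] n = (\<Oplus>k\<in>{..n}. add_pow R (n choose k) (x [^] k \<otimes> y [^] (n - k)))"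
proof (induction n)
 case 0
 show ?case by simp
next
 case (Suc n)
 let ?t = "%k. add_pow R (n choose k) (x [^] k \<otimes> y [^] (n - k))"
 let ?u = "%k. add_pow R (n choose k) (x [^] k \<otimes> y [^] (Suc n - k))"
 have tc: "?t \<in> S \<rightarrow> El R" "?u \<in> S \<rightarrow> El R" for S using x y by auto
 have tx: "?t k \<otimes> x = add_pow R (n choose k) (x [^] Suc k \<otimes> y [^] (n - k))" for k
 proof -
  have "(x [^] k \<otimes> y [^] (n - k)) \<otimes> x = x [^] Suc k \<otimes> y [^] (n - k)" using x y by (simp add: m_ac)
  thus ?thesis using x y by (simp add: add_pow_ldistr)
 qed
 have ty: "?t k \<otimes> y = ?u k" if "k \<le> n" for k
 proof -
  have "(x [^] k \<otimes> y [^] (n - k)) \<otimes> y = x [^] k \<otimes> y [^] (Suc n - k)"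
   using x y that by (simp add: m_assoc Suc_diff_le)
  thus ?thesis using x y by (simp add: add_pow_ldistr)
 qed
 have "(x \<oplus> y) [^] Suc n = (\<Oplus>k\<in>{..n}. ?t k) \<otimes> x \<oplus> (\<Oplus>k\<in>{..n}. ?t k) \<otimes> y"
  using x y tc(1) by (simp add: Suc.IH r_distr)
 also have "(\<Oplus>k\<in>{..n}. ?t k) \<otimes> y = (\<Oplus>k\<in>{..n}. ?u k)"
  using x y by (subst finsum_ldistr) (auto simp: ty intro!: finsum_cong')
 also have "... = (\<Oplus>k\<in>{..Suc n}. ?u k)"
  using finsum_Suc[OF tc(2)] x y finsum_closed[OF tc(2)] by (simp add: binomial_eq_0)
 also have "... = (\<Oplus>k\<in>{..n}. ?u (Suc k)) \<oplus> ?u 0" by (rule finsum_Suc2[OF tc(2)])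
 also have "(\<Oplus>k\<in>{..n}. ?t k) \<otimes> x = (\<Oplus>k\<in>{..n}. add_pow R (n choose k) (x [^] Suc k \<otimes> y [^] (n - k)))"
  using x y by (subst finsum_ldistr) (auto simp: tx intro!: finsum_cong')
 also have "... \<oplus> ((\<Oplus>k\<in>{..n}. ?u (Suc k)) \<oplus> ?u 0) =
   (\<Oplus>k\<in>{..n}. add_pow R (n choose k) (x [^] Suc k \<otimes> y [^] (n - k)) \<oplus> ?u (Suc k)) \<oplus> ?u 0"
 proof -
  have "(\<Oplus>k\<in>{..n}. add_pow R (n choose k) (x [^] Suc k \<otimes> y [^] (n - k)) \<oplus> ?u (Suc k)) =
    (\<Oplus>k\<in>{..n}. add_pow R (n choose k) (x [^] Suc k \<otimes> y [^] (n - k))) \<oplus> (\<Oplus>k\<in>{..n}. ?u (Suc k))"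
   using x y by (intro finsum_addf) auto
  thus ?thesis using x y by (simp add: a_assoc Pi_iff)
 qed
 also have "(\<Oplus>k\<in>{..n}. add_pow R (n choose k) (x [^] Suc k \<otimes> y [^] (n - k)) \<oplus> ?u (Suc k)) =
   (\<Oplus>k\<in>{..n}. add_pow R (Suc n choose Suc k) (x [^] Suc k \<otimes> y [^] (Suc n - Suc k)))"
  using x y by (intro finsum_cong') (auto simp: add.nat_pow_mult simp del: nat_pow_Suc)
 also have "... \<oplus> ?u 0 = (\<Oplus>k\<in>{..Suc n}. add_pow R (Suc n choose k) (x [^] k \<otimes> y [^] (Suc n - k)))"
  using x y by (subst finsum_Suc2) auto
 finally show ?case .
qed

lemma binomial_ends:
 assumes x: "x \<in> El R" and y: "y \<in> El R" and n: "n = Suc (Suc m)"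
 shows "(x \<oplus> y) [^] n = (\<Oplus>k\<in>{..m}. add_pow R (n choose Suc k) (x [^] Suc k \<otimes> y [^] (n - Suc k))) \<oplus> (x [^] n \<oplus> y [^] n)"
proof -
 let ?t = "%k. add_pow R (n choose k) (x [^] k \<otimes> y [^] (n - k))"
 have tc: "?t \<in> S \<rightarrow> El R" "(%k. ?t (Suc k)) \<in> S \<rightarrow> El R" for S using x y by auto
 have "(x \<oplus> y) [^] n = (\<Oplus>k\<in>{..Suc (Suc m)}. ?t k)" using binomial_expansion[OF x y, of n] n by simp
 also have "... = (\<Oplus>k\<in>{..Suc m}. ?t (Suc k)) \<oplus> ?t 0" by (rule finsum_Suc2[OF tc(1)])
 also have "(\<Oplus>k\<in>{..Suc m}. ?t (Suc k)) = ?t (Suc (Suc m)) \<oplus> (\<Oplus>k\<in>{..m}. ?t (Suc k))"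
  by (rule finsum_Suc[OF tc(2)])
 also have "?t (Suc (Suc m)) = x [^] n" using x n by (simp del: nat_pow_Suc)
 also have "?t 0 = y [^] n" using y by simp
 also have "x [^] n \<oplus> (\<Oplus>k\<in>{..m}. ?t (Suc k)) \<oplus> y [^] n = (\<Oplus>k\<in>{..m}. ?t (Suc k)) \<oplus> (x [^] n \<oplus> y [^] n)"
  using x y finsum_closed[OF tc(2)] by (simp add: a_ac)
 finally show ?thesis .
qed

end

locale finite_field = field Q for Q :: "('q, 'x1) ring_scheme" (structure) +
 assumes finite_Q: "finite (El Q)"
begin

abbreviation "q \<equiv> card (El Q)"

lemma q_ge_2: "\<exists>m. q = Suc (Suc m)"
proof -
 have "card {\<zero>, \<one>} \<le> q" by (rule card_mono[OF finite_Q]) auto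
 hence "2 \<le> q" by simp
 thus ?thesis by (metis Suc_le_D numeral_2_eq_2 Suc_le_mono)
qed

lemma power_q: assumes x: "x \<in> El Q" shows "x [^] q = x"
proof (cases "x = \<zero>")
 case True
 obtain m where "q = Suc (Suc m)" using q_ge_2 by blast
 thus ?thesis using True by simp
next
 case False
 interpret U: group "Multiplicative_Group.mult_of Q" by (rule field_mult_group)
 have "x [^]\<^bsub>Multiplicative_Group.mult_of Q\<^esub> order (Multiplicative_Group.mult_of Q) = \<one>"
  using U.pow_order_eq_1[of x] x False by simp
 hence "x [^] (q - 1) = \<one>" unfolding order_mult_of[OF finite_Q] Multiplicative_Group.nat_pow_mult_of by (simp add: order_def)
 moreover obtain m where "q = Suc m" using q_ge_2 by blast
 ultimately show ?thesis using x by simp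
qed

text \<open>This avoids the characteristic: since \<open>(x + 1)\<^sup>q = x + 1\<close> and \<open>x\<^sup>q = x\<close> on \<open>Q\<close>, the inner part of the binomial
expansion, divided by \<open>x\<close>, is a polynomial of degree below \<open>q - 1\<close> that vanishes at the \<open>q - 1\<close> nonzero elements.\<close>
lemma binomial_coefficient_zero:
 assumes q: "q = Suc (Suc m)" and k: "k \<le> m" shows "add_pow Q (q choose Suc k) \<one> = \<zero>"
proof (rule vanishing_coefficients[where n = "Suc m" and S = "El Q - {\<zero>}" and a = "%k. add_pow Q (q choose Suc k) \<one>" and i = k])
 show "Suc m \<le> card (El Q - {\<zero>})" using q finite_Q by simp
 fix x assume x: "x \<in> El Q - {\<zero>}"
 let ?s = "\<Oplus>k\<in>{..m}. add_pow Q (q choose Suc k) (x [^] Suc k \<otimes> \<one> [^] (q - Suc k))"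
 have sc: "?s \<in> El Q" using x by (intro finsum_closed) auto
 have "?s \<oplus> (x \<oplus> \<one>) = \<zero> \<oplus> (x \<oplus> \<one>)"
  using binomial_ends[OF _ one_closed q, of x] power_q[of x] power_q[of "x \<oplus> \<one>"] x by simp
 hence "?s = \<zero>" using sc x by (simp del: l_zero r_zero)
 moreover have "?s = (\<Oplus>k\<in>{..m}. add_pow Q (q choose Suc k) \<one> \<otimes> x [^] k) \<otimes> x"
  using x by (subst finsum_ldistr) (auto simp: add_pow_ldistr m_assoc intro!: finsum_cong')
 ultimately show "(\<Oplus>k\<in>{..<Suc m}. add_pow Q (q choose Suc k) \<one> \<otimes> x [^] k) = \<zero>"
  using x integral[of "\<Oplus>k\<in>{..m}. add_pow Q (q choose Suc k) \<one> \<otimes> x [^] k" x]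
  by (auto simp: lessThan_Suc_atMost)
qed (use finite_Q k in auto)

lemma frobenius_hom:
 assumes R: "cring R" and h: "h \<in> ring_hom Q R"
 shows "(%x. x [^]\<^sub>R q) \<in> ring_hom R R"
proof -
 interpret R: cring R by fact
 obtain m where q: "q = Suc (Suc m)" using q_ge_2 by blast
 have mult: "h (add_pow Q (n) \<one>) = add_pow R (n) \<one>\<^sub>R" for n :: nat
 proof (induction n)
  case 0
  show ?case using ring_hom_zero[OF h ring_axioms R.ring_axioms] by simp
 qed (simp add: ring_hom_add[OF h] ring_hom_one[OF h])
 have add: "(x \<oplus>\<^sub>R y) [^]\<^sub>R q = x [^]\<^sub>R q \<oplus>\<^sub>R y [^]\<^sub>R q" if x: "x \<in> El R" and y: "y \<in> El R" for x y
 proof -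
  have "add_pow R (q choose Suc k) (x [^]\<^sub>R Suc k \<otimes>\<^sub>R y [^]\<^sub>R (q - Suc k)) = \<zero>\<^sub>R" if k: "k \<le> m" for k
  proof -
   let ?z = "x [^]\<^sub>R Suc k \<otimes>\<^sub>R y [^]\<^sub>R (q - Suc k)"
   have z: "?z \<in> El R" using x y by blast
   have "add_pow R (q choose Suc k) ?z = (add_pow R (q choose Suc k) \<one>\<^sub>R) \<otimes>\<^sub>R ?z"
    using R.add_pow_ldistr[OF R.one_closed z, of "q choose Suc k"] z by simp
   also have "add_pow R (q choose Suc k) \<one>\<^sub>R = \<zero>\<^sub>R"
    using mult[of "q choose Suc k"] binomial_coefficient_zero[OF q k] ring_hom_zero[OF h ring_axioms R.ring_axioms] by simp
   finally show ?thesis using z by simp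
  qed
  hence "(\<Oplus>\<^sub>R k\<in>{..m}. add_pow R (q choose Suc k) (x [^]\<^sub>R Suc k \<otimes>\<^sub>R y [^]\<^sub>R (q - Suc k))) = (\<Oplus>\<^sub>R k\<in>{..m}. \<zero>\<^sub>R)"
   by (intro R.finsum_cong') (auto simp del: R.nat_pow_Suc)
  thus ?thesis using R.binomial_ends[OF x y q] x y by simp
 qed
 show ?thesis by (rule ring_hom_memI) (simp_all add: R.nat_pow_distrib add)
qed

lemma frobenius_fixed:
 assumes K: "field K" and j: "j \<in> ring_hom Q K" and x: "x \<in> El K" "x [^]\<^sub>K q = x"
 shows "\<exists>a\<in>El Q. x = j a"
proof (rule ccontr)
 assume nx: "\<not> (\<exists>a\<in>El Q. x = j a)"
 interpret K: field K by fact
 interpret J: field_hom Q j K by (intro field_hom.intro field_hom_axioms.intro field_axioms K j)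
 obtain m where q: "q = Suc (Suc m)" using q_ge_2 by blast
 have inj: "inj_on j (El Q)"
 proof (rule inj_onI)
  fix a b assume ab: "a \<in> El Q" "b \<in> El Q" "j a = j b"
  have "j (a \<ominus> b) = \<zero>\<^sub>K"
   using ab additive_map_neg[OF abelian_group_axioms K.abelian_group_axioms J.e_additive, of b]
   by (simp add: minus_eq ring_hom_add[OF j] K.r_neg)
  hence "a \<ominus> b = \<zero>" using ab J.e_inj by auto
  thus "a = b" using ab by simp
 qed
 have power: "(j a) [^]\<^sub>K n = j (a [^] n)" if "a \<in> El Q" for a and n :: nat
  using that by (induction n) (simp_all add: ring_hom_one[OF j] ring_hom_mult[OF j])
 let ?S = "insert x (j ` El Q)"
 have fixed: "y \<in> El K \<and> y [^]\<^sub>K q = y" if "y \<in> ?S" for y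
  using that x by (auto simp: power power_q)
 let ?a = "%k. if k = q then \<one>\<^sub>K else if k = 1 then \<ominus>\<^sub>K \<one>\<^sub>K else \<zero>\<^sub>K"
 have "?a q = \<zero>\<^sub>K"
 proof (rule K.vanishing_coefficients[where n = "Suc q" and S = ?S and a = ?a and i = q])
  show "?a \<in> {..<Suc q} \<rightarrow> El K" by auto
  show "finite ?S" using finite_Q by simp
  show "?S <= El K" using fixed by blast
  have "card ?S = Suc q" using nx finite_Q card_image[OF inj] by (subst card_insert_disjoint) auto
  thus "Suc q \<le> card ?S" by simp
  fix y assume "y \<in> ?S"
  hence y: "y \<in> El K" "y [^]\<^sub>K q = y" using fixed by auto
  have "(\<Oplus>\<^sub>K k\<in>{..<q}. ?a k \<otimes>\<^sub>K y [^]\<^sub>K k) = (\<Oplus>\<^sub>K k\<in>{..<q}. if 1 = k then \<ominus>\<^sub>K y else \<zero>\<^sub>K)"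
   using y by (intro K.finsum_cong') (auto simp: K.l_minus)
  also have "... = \<ominus>\<^sub>K y"
   using y q by (intro K.finsum_singleton[of 1 "{..<q}" "%_. \<ominus>\<^sub>K y"]) auto
  finally have s: "(\<Oplus>\<^sub>K k\<in>{..<q}. ?a k \<otimes>\<^sub>K y [^]\<^sub>K k) = \<ominus>\<^sub>K y" .
  have "(\<Oplus>\<^sub>K k\<in>{..<Suc q}. ?a k \<otimes>\<^sub>K y [^]\<^sub>K k) =
    ?a q \<otimes>\<^sub>K y [^]\<^sub>K q \<oplus>\<^sub>K (\<Oplus>\<^sub>K k\<in>{..<q}. ?a k \<otimes>\<^sub>K y [^]\<^sub>K k)"
   unfolding lessThan_Suc by (rule K.finsum_insert) (use y in auto)
  also have "... = \<zero>\<^sub>K" unfolding s using y by (simp add: K.r_neg)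
  finally show "(\<Oplus>\<^sub>K k\<in>{..<Suc q}. ?a k \<otimes>\<^sub>K y [^]\<^sub>K k) = \<zero>\<^sub>K" .
 qed simp
 thus False by simp
qed

end

context field_hom
begin

text \<open>By Zorn's lemma choose a subspace \<open>W\<close> maximal among those that do not contain \<open>1\<close>. Then \<open>F'\<close> is the direct sum of \<open>W\<close>
and the line of \<open>1\<close>; the retraction is the coordinate on that line.\<close>
lemma linear_retraction:
 "\<exists>l. additive_map F' F l \<and> (\<forall>a\<in>El F. \<forall>b\<in>El F'. l (e a \<otimes>\<^sub>F' b) = a \<otimes>\<^sub>F l b) \<and> l \<one>\<^sub>F' = \<one>\<^sub>F"
proof -
 interpret V: module F FF' by (rule module_FF')
 let ?W = "{W. submodule W F FF' \<and> \<one>\<^sub>F' \<notin> W}"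
 have zero_sub: "{\<zero>\<^sub>F'} \<in> ?W"
 proof -
  have "submodule {\<zero>\<^sub>F'} F FF'"
   by (rule V.submoduleI) (use V.M.r_neg[of "\<zero>\<^sub>F'"] V.M.a_inv_closed[of "\<zero>\<^sub>F'"] in auto)
  thus ?thesis by simp
 qed
 have "\<exists>W\<in>?W. \<forall>W'\<in>?W. W <= W' --> W' = W"
 proof (rule subset_Zorn_nonempty)
  show "?W ~= {}" using zero_sub by blast
  fix C assume C: "C ~= {}" "subset.chain ?W C"
  have sub: "submodule W F FF'" "\<one>\<^sub>F' \<notin> W" if "W \<in> C" for W using C(2) that by (auto simp: subset.chain_def)
  have two: "\<exists>W\<in>C. x \<in> W \<and> y \<in> W" if xy: "x \<in> \<Union>C" "y \<in> \<Union>C" for x y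
  proof -
   obtain W1 W2 where "W1 \<in> C" "x \<in> W1" "W2 \<in> C" "y \<in> W2" using xy by blast
   moreover have "W1 <= W2 \<or> W2 <= W1" using C(2) \<open>W1 \<in> C\<close> \<open>W2 \<in> C\<close> by (auto simp: subset.chain_def)
   ultimately show ?thesis by blast
  qed
  have "submodule (\<Union>C) F FF'"
  proof (rule V.submoduleI)
   show "\<Union>C <= El FF'" using sub(1) V.submodule_carrier by blast
   show "\<zero>\<^sub>FF' \<in> \<Union>C" using C(1) sub(1) V.submodule_zero by blast
   show "\<ominus>\<^sub>FF' a \<in> \<Union>C" if "a \<in> \<Union>C" for a using that sub(1) V.submodule_neg by blast
   show "a \<oplus>\<^sub>FF' b \<in> \<Union>C" if "a \<in> \<Union>C" "b \<in> \<Union>C" for a b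
    using two[OF that] sub(1) V.submodule_add by blast
   show "a \<odot>\<^sub>FF' x \<in> \<Union>C" if "a \<in> El F" "x \<in> \<Union>C" for a x
    using that sub(1) V.submodule_smult by blast
  qed
  thus "\<Union>C \<in> ?W" using sub(2) by blast
 qed
 then obtain W where W: "submodule W F FF'" "\<one>\<^sub>F' \<notin> W"
  and max: "\<And>W'. submodule W' F FF' ==> \<one>\<^sub>F' \<notin> W' ==> W <= W' ==> W' = W" by blast
 have Wc: "x \<in> El F'" if "x \<in> W" for x using V.submodule_carrier[OF W(1) that] by simp
 have Wadd: "x \<oplus>\<^sub>F' y \<in> W" if "x \<in> W" "y \<in> W" for x y using V.submodule_add[OF W(1) that] by simp
 have Wsm: "e a \<otimes>\<^sub>F' x \<in> W" if "a \<in> El F" "x \<in> W" for a x using V.submodule_smult[OF W(1) that] by simp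
 have W0: "\<zero>\<^sub>F' \<in> W" using V.submodule_zero[OF W(1)] by simp
 have eD: "e (a \<oplus>\<^sub>F b) = e a \<oplus>\<^sub>F' e b" "e (a \<otimes>\<^sub>F b) = e a \<otimes>\<^sub>F' e b"
  if "a \<in> El F" "b \<in> El F" for a b using ring_hom_add[OF e_hom that] ring_hom_mult[OF e_hom that] .
 have e1: "e \<one>\<^sub>F = \<one>\<^sub>F'" by (rule ring_hom_one[OF e_hom])
 have eneg: "e (\<ominus>\<^sub>F a) = \<ominus>\<^sub>F' e a" if "a \<in> El F" for a
  by (rule additive_map_neg[OF F.abelian_group_axioms F'.abelian_group_axioms e_additive that])
 have Wneg: "\<ominus>\<^sub>F' x \<in> W" if "x \<in> W" for x
  using Wsm[of "\<ominus>\<^sub>F \<one>\<^sub>F" x] that Wc[OF that] by (simp add: eneg e1 F'.l_minus)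
 have inv_a: "e (inv\<^bsub>F\<^esub> a) \<otimes>\<^sub>F' e a = \<one>\<^sub>F'" "inv\<^bsub>F\<^esub> a \<in> El F"
  if "a \<in> El F" "a ~= \<zero>\<^sub>F" for a
 proof -
  have u: "a \<in> Units F" using that by (simp add: F.field_Units)
  thus i: "inv\<^bsub>F\<^esub> a \<in> El F" by (rule F.Units_inv_closed)
  show "e (inv\<^bsub>F\<^esub> a) \<otimes>\<^sub>F' e a = \<one>\<^sub>F'"
   using eD(2)[OF i that(1)] F.Units_l_inv[OF u] e1 by simp
 qed
 have uniq0: "a = \<zero>\<^sub>F" if a: "a \<in> El F" "e a \<in> W" for a
  using Wsm[of "inv\<^bsub>F\<^esub> a" "e a"] inv_a[of a] a W(2) by (cases "a = \<zero>\<^sub>F") auto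
  \<comment> \<open>by maximality, \<open>W\<close> is a complement of the line spanned by \<open>\<one>\<close>\<close>
 have decomp: "\<exists>a\<in>El F. x \<oplus>\<^sub>F' e a \<in> W" if x: "x \<in> El F'" for x
 proof (cases "x \<in> W")
  case True
  thus ?thesis
   using x additive_map_zero[OF F.abelian_group_axioms F'.abelian_group_axioms e_additive]
   by (intro bexI[of _ "\<zero>\<^sub>F"]) auto
 next
  case False
  let ?W' = "{w \<oplus>\<^sub>F' e a \<otimes>\<^sub>F' x | w a. w \<in> W \<and> a \<in> El F}"
  have "submodule ?W' F FF'"
  proof (rule V.submoduleI)
   show "?W' <= El FF'" using Wc x by auto
   show "\<zero>\<^sub>FF' \<in> ?W'"
    using W0 x additive_map_zero[OF F.abelian_group_axioms F'.abelian_group_axioms e_additive]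
    by (auto intro!: exI[of _ "\<zero>\<^sub>F'"] exI[of _ "\<zero>\<^sub>F"])
   show add: "y \<oplus>\<^sub>FF' z \<in> ?W'" if yz: "y \<in> ?W'" "z \<in> ?W'" for y z
   proof -
    obtain w a w2 a2 where *: "y = w \<oplus>\<^sub>F' e a \<otimes>\<^sub>F' x" "w \<in> W" "a \<in> El F"
     "z = w2 \<oplus>\<^sub>F' e a2 \<otimes>\<^sub>F' x" "w2 \<in> W" "a2 \<in> El F" using yz by blast
    have "y \<oplus>\<^sub>F' z = (w \<oplus>\<^sub>F' w2) \<oplus>\<^sub>F' e (a \<oplus>\<^sub>F a2) \<otimes>\<^sub>F' x"
     using * Wc x by (simp add: eD F'.l_distr F'.a_ac)
    thus ?thesis using * Wadd by auto
   qed
   show sm: "b \<odot>\<^sub>FF' y \<in> ?W'" if b: "b \<in> El F" and y: "y \<in> ?W'" for b y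
   proof -
    obtain w a where *: "y = w \<oplus>\<^sub>F' e a \<otimes>\<^sub>F' x" "w \<in> W" "a \<in> El F" using y by blast
    have "e b \<otimes>\<^sub>F' y = (e b \<otimes>\<^sub>F' w) \<oplus>\<^sub>F' e (b \<otimes>\<^sub>F a) \<otimes>\<^sub>F' x"
     using * Wc x b by (simp add: eD F'.r_distr F'.m_assoc)
    thus ?thesis using * Wsm b by auto
   qed
   show "\<ominus>\<^sub>FF' y \<in> ?W'" if y: "y \<in> ?W'" for y
   proof -
    have yc: "y \<in> El FF'" using y Wc x by auto
    hence "\<ominus>\<^sub>FF' y = (\<ominus>\<^sub>F \<one>\<^sub>F) \<odot>\<^sub>FF' y"
     using V.smult_l_minus[of "\<one>\<^sub>F" y] V.smult_one[of y] by (simp del: restrict_scalars_simps)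
    thus ?thesis using sm[of "\<ominus>\<^sub>F \<one>\<^sub>F" y] y by simp
   qed
  qed
  moreover have "W <= ?W'"
  proof
   fix w assume w: "w \<in> W"
   have "w = w \<oplus>\<^sub>F' e \<zero>\<^sub>F \<otimes>\<^sub>F' x"
    using Wc[OF w] x additive_map_zero[OF F.abelian_group_axioms F'.abelian_group_axioms e_additive] by simp
   thus "w \<in> ?W'" using w by blast
  qed
  moreover have "x \<in> ?W'"
  proof -
   have "x = \<zero>\<^sub>F' \<oplus>\<^sub>F' e \<one>\<^sub>F \<otimes>\<^sub>F' x" using x e1 by simp
   thus ?thesis using W0 by blast
  qed
  ultimately have "\<one>\<^sub>F' \<in> ?W'" using max[of ?W'] False by blast
  then obtain w a where wa: "\<one>\<^sub>F' = w \<oplus>\<^sub>F' e a \<otimes>\<^sub>F' x" "w \<in> W" "a \<in> El F" by blast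
  have a0: "a ~= \<zero>\<^sub>F"
  proof
   assume "a = \<zero>\<^sub>F"
   hence "\<one>\<^sub>F' = w"
    using wa x Wc[OF wa(2)] additive_map_zero[OF F.abelian_group_axioms F'.abelian_group_axioms e_additive] by simp
   thus False using wa(2) W(2) by simp
  qed
  let ?b = "inv\<^bsub>F\<^esub> a"
  note b = inv_a[OF wa(3) a0]
  have wc: "w \<in> El F'" by (rule Wc[OF wa(2)])
  have "e ?b = e ?b \<otimes>\<^sub>F' w \<oplus>\<^sub>F' (e ?b \<otimes>\<^sub>F' e a) \<otimes>\<^sub>F' x"
   using arg_cong[OF wa(1), of "%y. e ?b \<otimes>\<^sub>F' y"] b(2) wa(3) wc x by (simp add: F'.r_distr F'.m_assoc)
  hence eb: "e ?b = e ?b \<otimes>\<^sub>F' w \<oplus>\<^sub>F' x" using b x by simp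
  have "x \<oplus>\<^sub>F' e (\<ominus>\<^sub>F ?b) = \<ominus>\<^sub>F' (e ?b \<otimes>\<^sub>F' w)"
  proof -
   have "x \<oplus>\<^sub>F' e (\<ominus>\<^sub>F ?b) = x \<oplus>\<^sub>F' \<ominus>\<^sub>F' (e ?b \<otimes>\<^sub>F' w \<oplus>\<^sub>F' x)"
    unfolding eneg[OF b(2)] by (subst eb) (rule refl)
   also have "... = \<ominus>\<^sub>F' (e ?b \<otimes>\<^sub>F' w)"
    using b(2) wc x by (simp add: F'.minus_add F'.r_neg2 F'.a_ac)
   finally show ?thesis .
  qed
  moreover have "\<ominus>\<^sub>F' (e ?b \<otimes>\<^sub>F' w) \<in> W" by (rule Wneg[OF Wsm[OF b(2) wa(2)]])
  ultimately show ?thesis using b(2) F.a_inv_closed[OF b(2)] by (intro bexI[of _ "\<ominus>\<^sub>F ?b"]) simp_all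
 qed
 have "\<exists>a\<in>El F. x \<oplus>\<^sub>F' \<ominus>\<^sub>F' e a \<in> W" if x: "x \<in> El F'" for x
 proof -
  obtain a where a: "a \<in> El F" "x \<oplus>\<^sub>F' e a \<in> W" using decomp[OF x] by blast
  thus ?thesis using eneg[of "\<ominus>\<^sub>F a"] eneg[of a] by (intro bexI[of _ "\<ominus>\<^sub>F a"]) auto
 qed
 hence "\<forall>x\<in>El F'. \<exists>a. a \<in> El F \<and> x \<oplus>\<^sub>F' \<ominus>\<^sub>F' e a \<in> W" by blast
 from bchoice[OF this] obtain l where l: "\<And>x. x \<in> El F' ==> l x \<in> El F"
  and lW: "\<And>x. x \<in> El F' ==> x \<oplus>\<^sub>F' \<ominus>\<^sub>F' e (l x) \<in> W" by blast
 have uniq: "l x = a" if x: "x \<in> El F'" and a: "a \<in> El F" "x \<oplus>\<^sub>F' \<ominus>\<^sub>F' e a \<in> W" for x a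
 proof -
  have "(x \<oplus>\<^sub>F' \<ominus>\<^sub>F' e a) \<oplus>\<^sub>F' \<ominus>\<^sub>F' (x \<oplus>\<^sub>F' \<ominus>\<^sub>F' e (l x)) = e (l x \<oplus>\<^sub>F \<ominus>\<^sub>F a)"
  proof -
   have "e (l x \<oplus>\<^sub>F \<ominus>\<^sub>F a) = e (l x) \<oplus>\<^sub>F' \<ominus>\<^sub>F' e a" using l[OF x] a by (simp add: eD eneg)
   moreover have "(x \<oplus>\<^sub>F' \<ominus>\<^sub>F' e a) \<oplus>\<^sub>F' \<ominus>\<^sub>F' (x \<oplus>\<^sub>F' \<ominus>\<^sub>F' e (l x)) = e (l x) \<oplus>\<^sub>F' \<ominus>\<^sub>F' e a"
    using x a l[OF x] by (simp add: F'.minus_add F'.r_neg F'.r_neg1 F'.r_neg2 F'.a_ac)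
   ultimately show ?thesis by simp
  qed
  hence "e (l x \<oplus>\<^sub>F \<ominus>\<^sub>F a) \<in> W" using Wadd[OF a(2) Wneg[OF lW[OF x]]] by simp
  hence "l x \<oplus>\<^sub>F \<ominus>\<^sub>F a = \<zero>\<^sub>F" using l[OF x] a by (intro uniq0) auto
  thus ?thesis using l[OF x] a F.minus_equality[of "l x" "\<ominus>\<^sub>F a"] by simp
 qed
 show ?thesis
 proof (intro exI conjI ballI)
  show "additive_map F' F l"
   unfolding additive_map_def
  proof (intro conjI ballI)
   show "l x \<in> El F" if "x \<in> El F'" for x by (rule l[OF that])
   show "l (x \<oplus>\<^sub>F' y) = l x \<oplus>\<^sub>F l y" if x: "x \<in> El F'" and y: "y \<in> El F'" for x y
   proof (rule uniq)
    have "(x \<oplus>\<^sub>F' y) \<oplus>\<^sub>F' \<ominus>\<^sub>F' e (l x \<oplus>\<^sub>F l y) =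
      (x \<oplus>\<^sub>F' \<ominus>\<^sub>F' e (l x)) \<oplus>\<^sub>F' (y \<oplus>\<^sub>F' \<ominus>\<^sub>F' e (l y))"
     using x y l[OF x] l[OF y] by (simp add: eD F'.minus_add F'.a_ac)
    thus "(x \<oplus>\<^sub>F' y) \<oplus>\<^sub>F' \<ominus>\<^sub>F' e (l x \<oplus>\<^sub>F l y) \<in> W"
     using Wadd[OF lW[OF x] lW[OF y]] by simp
   qed (use x y l in auto)
  qed
  fix a b assume a: "a \<in> El F" and b: "b \<in> El F'"
  show "l (e a \<otimes>\<^sub>F' b) = a \<otimes>\<^sub>F l b"
  proof (rule uniq)
   have "e a \<otimes>\<^sub>F' b \<oplus>\<^sub>F' \<ominus>\<^sub>F' e (a \<otimes>\<^sub>F l b) = e a \<otimes>\<^sub>F' (b \<oplus>\<^sub>F' \<ominus>\<^sub>F' e (l b))"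
    using a b l[OF b] by (simp add: eD F'.r_distr F'.r_minus)
   thus "e a \<otimes>\<^sub>F' b \<oplus>\<^sub>F' \<ominus>\<^sub>F' e (a \<otimes>\<^sub>F l b) \<in> W" using Wsm[OF a lW[OF b]] by simp
  qed (use a b l in auto)
 next
  show "l \<one>\<^sub>F' = \<one>\<^sub>F" by (rule uniq) (simp_all add: e1 F'.r_neg W0)
 qed
qed

end

lemma tensor_algebra_nontrivial:
 assumes "field Q" "field F" "field K" "i \<in> ring_hom Q F" "j \<in> ring_hom Q K"
 shows "\<one>\<^bsub>tensor_algebra Q i F j K\<^esub> ~= \<zero>\<^bsub>tensor_algebra Q i F j K\<^esub>"
proof -
 interpret Q: field Q by fact
 interpret F: field F by fact
 interpret K: field K by fact
 interpret J: field_hom Q j K by (intro field_hom.intro field_hom_axioms.intro assms)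
 interpret T: tensor_of_algebras Q i F j K
  by (intro tensor_of_algebras.intro tensor_of_algebras_axioms.intro Q.cring_axioms F.cring_axioms K.cring_axioms assms)
 obtain l where l: "additive_map K Q l" "\<And>a b. a \<in> El Q ==> b \<in> El K ==> l (j a \<otimes>\<^sub>K b) = a \<otimes>\<^sub>Q l b"
  "l \<one>\<^sub>K = \<one>\<^sub>Q" using J.linear_retraction by blast
 note lD = additive_map_closed[OF l(1)] additive_map_add[OF l(1)]
 note iD = ring_hom_closed[OF assms(4)] ring_hom_add[OF assms(4)] ring_hom_mult[OF assms(4)]
 let ?f = "%(a, b). a \<otimes>\<^sub>F i (l b)"
 have b: "T.bal F ?f"
  by (rule T.balancedI) (simp_all add: lD iD l(2) F.l_distr F.r_distr F.m_ac)
 note L = T.lift_TA[OF F.abelian_group_axioms b]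
 have "tensor_lift F ?f \<one>\<^sub>T.TA = \<one>\<^sub>F"
  unfolding T.TA_simps(4) using L(2)[of "\<one>\<^sub>F" "\<one>\<^sub>K"] by (simp add: l(3) ring_hom_one[OF assms(4)])
 thus ?thesis using additive_map_zero[OF T.TA_abelian_group F.abelian_group_axioms L(1)] F.one_not_zero by auto
qed

section \<open>The bold ring of a field extension\<close>

lemma cring_cong:
 assumes "cring R" "El T = El R" "(\<oplus>\<^sub>T) = (\<oplus>\<^sub>R)" "(\<otimes>\<^sub>T) = (\<otimes>\<^sub>R)"
  and "\<zero>\<^sub>T = \<zero>\<^sub>R" "\<one>\<^sub>T = \<one>\<^sub>R"
 shows "cring T"
proof -
 interpret R: cring R by fact
 show ?thesis
 proof (rule cringI)
  show "abelian_group T" by (rule abelian_group_cong[OF R.abelian_group_axioms assms(2,3,5)])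
  show "comm_monoid T" by (rule comm_monoidI) (simp_all add: assms R.m_ac)
 qed (simp add: assms R.l_distr)
qed

text \<open>Bold rings are extended records; this one forgets any further fields of \<open>R\<close>.\<close>
definition with_endo :: "('a, 'x) ring_scheme => ('a => 'a) => 'a bold_ring" where
 "with_endo R s =
   \<lparr>carrier = El R, monoid.mult = (\<otimes>\<^sub>R), one = \<one>\<^sub>R,
   ring.zero = \<zero>\<^sub>R, ring.add = (\<oplus>\<^sub>R), endo = s\<rparr>"

lemma with_endo_simps [simp]:
 "El (with_endo R s) = El R" "(\<otimes>\<^bsub>with_endo R s\<^esub>) = (\<otimes>\<^sub>R)" "\<one>\<^bsub>with_endo R s\<^esub> = \<one>\<^sub>R"
 "\<zero>\<^bsub>with_endo R s\<^esub> = \<zero>\<^sub>R" "(\<oplus>\<^bsub>with_endo R s\<^esub>) = (\<oplus>\<^sub>R)" "endo (with_endo R s) = s"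
 by (simp_all add: with_endo_def)

lemma with_endo_nat_pow [simp]: "x [^]\<^bsub>with_endo R s\<^esub> (n::nat) = x [^]\<^sub>R n"
 by (simp add: nat_pow_def)

lemma with_endo_cring: "cring R ==> cring (with_endo R s)"
 by (rule cring_cong) simp_all

lemma ring_hom_with_endo:
 "h \<in> ring_hom R (with_endo S s) \<longleftrightarrow> h \<in> ring_hom R S" "h \<in> ring_hom (with_endo R r) S \<longleftrightarrow> h \<in> ring_hom R S"
 by (simp_all add: ring_hom_def)

lemma with_endo_bold_ring: "cring R ==> s \<in> ring_hom R R ==> bold_ring (with_endo R s)"
 by (intro bold_ring.intro bold_ring_axioms.intro with_endo_cring) (simp_all add: ring_hom_with_endo)

lemma field_simple_bold_ring:
 assumes "field K" "s \<in> ring_hom K K" shows "simple_bold_ring (with_endo K s)"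
proof -
 interpret K: field K by fact
 show ?thesis
 proof (intro simple_bold_ring.intro simple_bold_ring_axioms.intro with_endo_bold_ring K.cring_axioms assms(2))
  fix I assume I: "ideal I (with_endo K s)"
  show "I = {\<zero>\<^bsub>with_endo K s\<^esub>} \<or> I = El (with_endo K s)"
  proof (rule disjCI)
   assume ne: "I ~= El (with_endo K s)"
   have "x = \<zero>\<^sub>K" if x: "x \<in> I" for x
   proof (rule ccontr)
    assume "x ~= \<zero>\<^sub>K"
    moreover have xc: "x \<in> El K" using ideal.Icarr[OF I x] by simp
    ultimately have u: "x \<in> Units K" by (simp add: K.field_Units)
    have "inv\<^bsub>K\<^esub> x \<otimes>\<^sub>K x \<in> I" using ideal.I_l_closed[OF I x, of "inv\<^bsub>K\<^esub> x"] u by simp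
    hence "\<one>\<^bsub>with_endo K s\<^esub> \<in> I" using u by simp
    thus False using ideal.one_imp_carrier[OF I] ne by simp
   qed
   moreover have "\<zero>\<^sub>K \<in> I"
    using additive_subgroup.zero_closed[OF ideal.axioms(1)[OF I]] by simp
   ultimately have "I = {\<zero>\<^sub>K}" by blast
   thus "I = {\<zero>\<^bsub>with_endo K s\<^esub>}" by simp
  qed
 qed simp
qed

lemma fraction_descentI:
 assumes A: "cring A" and D: "descent F e F' R (with_endo (total_fractions A) s) c \<phi> c'"
  and sp: "\<And>a. a \<in> El A ==> fraction A a \<one>\<^sub>A \<in> descent.span F' R (with_endo (total_fractions A) s) \<phi> c'"
 shows "fraction_descent F e F' R (with_endo (total_fractions A) s) c \<phi> c'"
proof -
 interpret A: cring A by fact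
 interpret D: descent F e F' R "with_endo (total_fractions A) s" c \<phi> c' by fact
 show ?thesis
 proof (intro fraction_descent.intro fraction_descent_axioms.intro D)
  fix x assume "x \<in> El (with_endo (total_fractions A) s)"
  then obtain a t where a: "a \<in> El A" and t: "t \<in> A.NZ" and x: "x = A.fr a t" using A.Fr_elem by auto
  have tc: "t \<in> El A" by (rule A.NZ_carrier[OF t])
  have cl: "A.fr t \<one>\<^sub>A \<in> El A.Fr" "A.fr \<one>\<^sub>A t \<in> El A.Fr" using tc t A.NZ_one by auto
  have inv: "A.fr t \<one>\<^sub>A \<otimes>\<^sub>A.Fr A.fr \<one>\<^sub>A t = \<one>\<^sub>A.Fr" by (rule A.frac_denominator(2)[OF a t])
  hence inv': "A.fr \<one>\<^sub>A t \<otimes>\<^sub>A.Fr A.fr t \<one>\<^sub>A = \<one>\<^sub>A.Fr"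
   using comm_monoid.m_comm[OF cring.axioms(2)[OF A.Fr_cring] cl] by simp
  show "\<exists>d\<in>D.span. d \<in> Units (with_endo A.Fr s) \<and> d \<otimes>\<^bsub>with_endo A.Fr s\<^esub> x \<in> D.span"
  proof (rule bexI[of _ "A.fr t \<one>\<^sub>A"])
   show "A.fr t \<one>\<^sub>A \<in> D.span" by (rule sp[OF tc])
   show "A.fr t \<one>\<^sub>A \<in> Units (with_endo A.Fr s) \<and> A.fr t \<one>\<^sub>A \<otimes>\<^bsub>with_endo A.Fr s\<^esub> x \<in> D.span"
    using cl inv inv' sp[OF a] A.frac_denominator(1)[OF a t] unfolding Units_def x by auto
  qed
 qed
qed

locale constant_extension = tensor_of_algebras Q i F j K
 for Q :: "('q, 'x1) ring_scheme" and i :: "'q => 'f" and F :: "('f, 'x2) ring_scheme"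
  and j :: "'q => 'k" and K :: "('k, 'x3) ring_scheme" +
 assumes Q_finite_field: "finite_field Q" and F_field: "field F" and K_field: "field K"
begin

sublocale Q: finite_field Q by (rule Q_finite_field)
sublocale F: field F by (rule F_field)
sublocale K: field K by (rule K_field)

abbreviation "q \<equiv> card (El Q)"
abbreviation "frob \<equiv> %x. x [^]\<^sub>K q"
abbreviation "sig \<equiv> tensor_lift TA (%(a, c). ap a (c [^]\<^sub>K q))"
abbreviation "tau_F \<equiv> tensor_lift TA (%(a, c). ap (a [^]\<^sub>F q) c)"
abbreviation "KB \<equiv> with_endo K frob"
abbreviation "AB \<equiv> with_endo TA sig"
abbreviation "left a \<equiv> ap a \<one>\<^sub>K"
abbreviation "right x \<equiv> ap \<one>\<^sub>F x"

lemma hom_power: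
 assumes "field L" "h \<in> ring_hom Q L" "a \<in> El Q"
 shows "(h a) [^]\<^sub>L q = h a"
proof -
 interpret L: field L by fact
 have "(h a) [^]\<^sub>L n = h (a [^]\<^sub>Q n)" for n :: nat
  by (induction n) (simp_all add: ring_hom_one[OF assms(2)] ring_hom_mult[OF assms(2)] assms(3))
 thus ?thesis using Q.power_q[OF assms(3)] by simp
qed

lemma frob_hom: "frob \<in> ring_hom K K" by (rule Q.frobenius_hom[OF B.cring_axioms j_hom])

lemma sig_hom: "sig \<in> ring_hom TA TA"
 and sig_ap: "a \<in> El F ==> c \<in> El K ==> sig (ap a c) = ap a (c [^]\<^sub>K q)"
proof -
 have \<beta>: "(%c. right (c [^]\<^sub>K q)) \<in> ring_hom K TA"
  using ring_hom_trans[OF frob_hom ap_right_hom] by (simp add: comp_def)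
 have \<alpha>\<beta>: "left (i s) = right (j s [^]\<^sub>K q)" if "s \<in> El Q" for s
  using that by (simp add: hom_power[OF K_field j_hom] ap_scalar)
 have f: "(case (a, c) of (a, c) => ap a (c [^]\<^sub>K q)) = left a \<otimes>\<^sub>TA right (c [^]\<^sub>K q)"
  if "a \<in> El F" "c \<in> El K" for a c using that by simp
 note L = lift_ring_hom[OF TA_cring ap_left_hom \<beta> \<alpha>\<beta> f]
 show "sig \<in> ring_hom TA TA" by (rule L(2))
 show "a \<in> El F ==> c \<in> El K ==> sig (ap a c) = ap a (c [^]\<^sub>K q)" using L(3)[of a c] by simp
qed

lemma tau_F_hom: "tau_F \<in> ring_hom TA TA"
 and tau_F_ap: "a \<in> El F ==> c \<in> El K ==> tau_F (ap a c) = ap (a [^]\<^sub>F q) c"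
proof -
 have \<alpha>: "(%a. left (a [^]\<^sub>F q)) \<in> ring_hom F TA"
  using ring_hom_trans[OF Q.frobenius_hom[OF A.cring_axioms i_hom] ap_left_hom] by (simp add: comp_def)
 have \<alpha>\<beta>: "left (i s [^]\<^sub>F q) = right (j s)" if "s \<in> El Q" for s
  using that by (simp add: hom_power[OF F_field i_hom] ap_scalar)
 have f: "(case (a, c) of (a, c) => ap (a [^]\<^sub>F q) c) = left (a [^]\<^sub>F q) \<otimes>\<^sub>TA right c"
  if "a \<in> El F" "c \<in> El K" for a c using that by simp
 note L = lift_ring_hom[OF TA_cring \<alpha> ap_right_hom \<alpha>\<beta> f]
 show "tau_F \<in> ring_hom TA TA" by (rule L(2))
 show "a \<in> El F ==> c \<in> El K ==> tau_F (ap a c) = ap (a [^]\<^sub>F q) c" using L(3)[of a c] by simp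
qed

lemma scalar_hom: "(%s. left (i s)) \<in> ring_hom Q TA"
 using ring_hom_trans[OF i_hom ap_left_hom] by (simp add: comp_def)

lemma ap_power: "a \<in> El F ==> c \<in> El K ==> ap a c [^]\<^sub>TA (n::nat) = ap (a [^]\<^sub>F n) (c [^]\<^sub>K n)"
 by (induction n) (simp_all add: TA_simps(4))

text \<open>The \<open>q\<close>-Frobenius of \<open>F \<otimes> K\<close> is the product of the Frobenius maps of the two factors. As \<open>F \<otimes> K\<close> is reduced, this
controls the kernel of \<open>\<sigma>\<close> and the image of non-zero-divisors.\<close>
lemma frobenius_factorisation:
 assumes "x \<in> El TA" shows "sig (tau_F x) = x [^]\<^sub>TA q" "tau_F (sig x) = x [^]\<^sub>TA q"
proof -
 note fr = Q.frobenius_hom[OF TA_cring scalar_hom]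
 show "sig (tau_F x) = x [^]\<^sub>TA q"
  using assms
 proof (induction rule: TA_induct)
  case (pure a c)
  thus ?case by (simp add: tau_F_ap sig_ap ap_power)
 next
  case (add U V)
  thus ?case using ring_hom_add[OF fr add.hyps]
   by (simp add: ring_hom_add[OF tau_F_hom] ring_hom_add[OF sig_hom] ring_hom_closed[OF tau_F_hom])
 qed
 show "tau_F (sig x) = x [^]\<^sub>TA q"
  using assms
 proof (induction rule: TA_induct)
  case (pure a c)
  thus ?case by (simp add: tau_F_ap sig_ap ap_power)
 next
  case (add U V)
  thus ?case using ring_hom_add[OF fr add.hyps]
   by (simp add: ring_hom_add[OF tau_F_hom] ring_hom_add[OF sig_hom] ring_hom_closed[OF sig_hom])
 qed
qed

lemma KB_simple: "simple_bold_ring KB" by (rule field_simple_bold_ring[OF K_field frob_hom])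

lemma AB_bold_ring: "bold_ring AB" by (rule with_endo_bold_ring[OF TA_cring sig_hom])

lemma Q_field_hom: "field_hom Q i F"
 by (intro field_hom.intro field_hom_axioms.intro Q.field_axioms F_field i_hom)

lemma nontrivial: "\<one>\<^sub>TA ~= \<zero>\<^sub>TA"
 by (rule tensor_algebra_nontrivial[OF Q.field_axioms F_field K_field i_hom j_hom])

lemma KB_invariants: "r \<in> El KB ==> endo KB r = r ==> \<exists>a\<in>El Q. r = j a"
 using Q.frobenius_fixed[OF K_field j_hom] by simp

text \<open>Here the span is all of \<open>F \<otimes> K\<close>, so \<open>1\<close> is a common denominator.\<close>
lemma tensor_descent: "fraction_descent Q i F KB AB j (%x. right x) (%a. left a)"
proof -
 have D: "descent Q i F KB AB j (%x. right x) (%a. left a)"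
 proof (intro descent.intro descent_axioms.intro Q_field_hom KB_simple AB_bold_ring)
  show "j \<in> ring_hom Q KB" "(%x. right x) \<in> ring_hom KB AB" "(%a. left a) \<in> ring_hom F AB"
   using j_hom ap_right_hom ap_left_hom by (simp_all add: ring_hom_with_endo)
  show "\<exists>a\<in>El Q. r = j a" if "r \<in> El KB" "endo KB r = r" for r by (rule KB_invariants[OF that])
 qed (simp_all add: sig_ap ap_scalar hom_power[OF K_field j_hom] nontrivial)
 interpret D: descent Q i F KB AB j "%x. right x" "%a. left a" by (rule D)
 have "x \<in> D.span" if "x \<in> El TA" for x
  using that
 proof (induction rule: TA_induct)
  case (pure a c)
  thus ?case using D.span_pure[of a c] pure by simp
 next
  case (add U V)
  thus ?case using D.span_add by simp
 qed
 thus ?thesis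
  by (intro fraction_descent.intro fraction_descent_axioms.intro D bexI[of _ "\<one>\<^sub>TA"])
   (auto simp: Units_def)
qed

lemma AB_simple: "simple_bold_ring AB" by (rule fraction_descent.simple_R'[OF tensor_descent])

lemma AB_invariants: "x \<in> El AB ==> endo AB x = x ==> \<exists>a\<in>El F. x = left a" by (rule fraction_descent.invariants_R'[OF tensor_descent])

lemma TA_reduced: "x \<in> El TA ==> x [^]\<^sub>TA (n::nat) = \<zero>\<^sub>TA ==> x = \<zero>\<^sub>TA"
 using simple_bold_ring.reduced_R[OF AB_simple] by (auto simp: reduced_def)

text \<open>If \<open>\<sigma>(s) a = 0\<close>, applying the Frobenius of \<open>F\<close> gives \<open>s\<^sup>q\<close> times an element, which must vanish; applying \<open>\<sigma>\<close> to that
element gives \<open>a\<^sup>q = 0\<close>.\<close>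
lemma sig_NZ: assumes s: "s \<in> TA.NZ" shows "sig s \<in> TA.NZ"
proof (rule TA.NZ_I)
 have sc: "s \<in> El TA" by (rule TA.NZ_carrier[OF s])
 show "sig s \<in> El TA" by (rule ring_hom_closed[OF sig_hom sc])
 have pow: "s [^]\<^sub>TA n \<in> TA.NZ" for n :: nat
  by (induction n) (simp_all add: TA.NZ_one TA.NZ_mult s)
 fix a assume a: "a \<in> El TA" "sig s \<otimes>\<^sub>TA a = \<zero>\<^sub>TA"
 have z: "tau_F \<zero>\<^sub>TA = \<zero>\<^sub>TA" "sig \<zero>\<^sub>TA = \<zero>\<^sub>TA"
  using ring_hom_zero[OF _ TA.ring_axioms TA.ring_axioms] tau_F_hom sig_hom by blast+
 have tc: "tau_F a \<in> El TA" by (rule ring_hom_closed[OF tau_F_hom a(1)])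
 have "s [^]\<^sub>TA q \<otimes>\<^sub>TA tau_F a = tau_F (sig s \<otimes>\<^sub>TA a)"
  using frobenius_factorisation(2)[OF sc] ring_hom_mult[OF tau_F_hom ring_hom_closed[OF sig_hom sc] a(1)] by simp
 hence "tau_F a = \<zero>\<^sub>TA" using TA.NZ_cancel[OF pow tc] a(2) z by simp
 hence "a [^]\<^sub>TA q = \<zero>\<^sub>TA" using frobenius_factorisation(1)[OF a(1)] z by simp
 thus "a = \<zero>\<^sub>TA" by (rule TA_reduced[OF a(1)])
qed

abbreviation "FK \<equiv> bold_frac Q i F j K"
abbreviation "const \<equiv> bold_frac_const Q i F j K"

lemma FK_eq: "FK = with_endo TA.Fr (frac_map TA sig)"
 by (simp add: bold_frac_def with_endo_def Let_def)

lemma const_eq: "const a = TA.fr (left a) \<one>\<^sub>TA"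
 by (simp add: bold_frac_const_def Let_def)

lemma FK_bold_ring: "bold_ring FK"
 unfolding FK_eq by (intro with_endo_bold_ring TA.Fr_cring frac_map_hom[OF TA_cring TA_cring sig_hom sig_NZ])

lemma FK_endo: "a \<in> El TA ==> endo FK (TA.fr a \<one>\<^sub>TA) = TA.fr (sig a) \<one>\<^sub>TA"
 unfolding FK_eq using frac_map_frac[OF TA_cring TA_cring sig_hom sig_NZ, of a "\<one>\<^sub>TA"]
 by (simp add: TA.NZ_one ring_hom_one[OF sig_hom])

lemma FK_nontrivial: "\<one>\<^sub>FK ~= \<zero>\<^sub>FK"
 unfolding FK_eq using nontrivial TA.frac_one_inj by (simp add: TA.Fr_simps)

lemma const_hom: "const \<in> ring_hom F FK"
 unfolding FK_eq ring_hom_with_endo using ring_hom_trans[OF ap_left_hom TA.frac_one_hom] by (simp add: comp_def const_eq[abs_def])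

lemma const_invariant: "a \<in> El F ==> endo FK (const a) = const a"
 unfolding const_eq by (simp add: FK_endo sig_ap)

lemma FK_descent: "fraction_descent Q i F KB FK j (%x. TA.fr (right x) \<one>\<^sub>TA) const"
proof -
 have D: "descent Q i F KB FK j (%x. TA.fr (right x) \<one>\<^sub>TA) const"
 proof (intro descent.intro descent_axioms.intro Q_field_hom KB_simple FK_bold_ring const_hom const_invariant FK_nontrivial)
  show "j \<in> ring_hom Q KB" using j_hom by (simp add: ring_hom_with_endo)
  show "(%x. TA.fr (right x) \<one>\<^sub>TA) \<in> ring_hom KB FK"
   unfolding FK_eq ring_hom_with_endo using ring_hom_trans[OF ap_right_hom TA.frac_one_hom] by (simp add: comp_def)
  show "\<exists>a\<in>El Q. r = j a" if "r \<in> El KB" "endo KB r = r" for r by (rule KB_invariants[OF that])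
 qed (simp_all add: sig_ap ap_scalar hom_power[OF K_field j_hom] FK_endo const_eq)
 interpret D: descent Q i F KB FK j "%x. TA.fr (right x) \<one>\<^sub>TA" const by (rule D)
 have span_add: "x \<oplus>\<^sub>TA.Fr y \<in> D.span" if "x \<in> D.span" "y \<in> D.span" for x y
  using D.span_add[OF that] by (simp add: FK_eq)
 have "TA.fr a \<one>\<^sub>TA \<in> D.span" if "a \<in> El TA" for a
  using that
 proof (induction rule: TA_induct)
  case (pure a c)
  have "TA.fr (ap a c) \<one>\<^sub>TA = const a \<otimes>\<^sub>FK TA.fr (right c) \<one>\<^sub>TA"
   using pure ring_hom_mult[OF TA.frac_one_hom, of "left a" "right c"]
   by (simp add: const_eq FK_eq)
  thus ?case using D.span_pure[of a c] pure by simp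
 next
  case (add U V)
  thus ?case using span_add ring_hom_add[OF TA.frac_one_hom add.hyps] by simp
 qed
 thus ?thesis using fraction_descentI[OF TA_cring D[unfolded FK_eq]] unfolding FK_eq by simp
qed

lemma FK_simple: "simple_bold_ring FK"
 by (rule fraction_descent.simple_R'[OF FK_descent])

lemma FK_invariants: "x \<in> El FK ==> endo FK x = x ==> \<exists>a\<in>El F. x = const a"
 by (rule fraction_descent.invariants_R'[OF FK_descent])

end

locale constant_extension_pair =
 A1: constant_extension Q i F j K + A2: constant_extension Q i' F' j K
 for Q :: "('q, 'x1) ring_scheme" and i :: "'q => 'f" and F :: "('f, 'x2) ring_scheme"
  and j :: "'q => 'k" and K :: "('k, 'x3) ring_scheme" and e :: "'f => 'g" and i' :: "'q => 'g" and F' :: "('g, 'x4) ring_scheme" +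
 assumes e_hom: "e \<in> ring_hom F F'" and i'_eq: "e \<circ> i = i'"
begin

abbreviation "\<phi>A \<equiv> tensor_lift A2.TA (%(a, c). A2.ap (e a) c)"

lemma \<phi>A_hom: "\<phi>A \<in> ring_hom A1.TA A2.TA"
 and \<phi>A_ap: "a \<in> El F ==> c \<in> El K ==> \<phi>A (A1.ap a c) = A2.ap (e a) c"
proof -
 have \<alpha>: "(%a. A2.left (e a)) \<in> ring_hom F A2.TA"
  using ring_hom_trans[OF e_hom A2.ap_left_hom] by (simp add: comp_def)
 have \<alpha>\<beta>: "A2.left (e (i s)) = A2.right (j s)" if "s \<in> El Q" for s
  using A2.ap_scalar[OF that] by (simp flip: i'_eq)
 have f: "(case (a, c) of (a, c) => A2.ap (e a) c) = A2.left (e a) \<otimes>\<^sub>A2.TA A2.right c"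
  if "a \<in> El F" "c \<in> El K" for a c
  using that ring_hom_closed[OF e_hom] by simp
 note L = A1.lift_ring_hom[OF A2.TA_cring \<alpha> A2.ap_right_hom \<alpha>\<beta> f]
 show "\<phi>A \<in> ring_hom A1.TA A2.TA" by (rule L(2))
 show "a \<in> El F ==> c \<in> El K ==> \<phi>A (A1.ap a c) = A2.ap (e a) c" using L(3)[of a c] by simp
qed

lemma e_closed: "a \<in> El F ==> e a \<in> El F'" by (rule ring_hom_closed[OF e_hom])

lemma \<phi>A_sig: assumes "x \<in> El A1.TA" shows "\<phi>A (A1.sig x) = A2.sig (\<phi>A x)"
 using assms
proof (induction rule: A1.TA_induct)
 case (pure a c)
 thus ?case by (simp add: \<phi>A_ap A1.sig_ap A2.sig_ap e_closed)
next
 case (add U V)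
 thus ?case
  by (simp add: ring_hom_add[OF \<phi>A_hom] ring_hom_add[OF A1.sig_hom] ring_hom_add[OF A2.sig_hom]
    ring_hom_closed[OF \<phi>A_hom] ring_hom_closed[OF A1.sig_hom])
qed

lemma FF'_field_hom: "field_hom F e F'"
 by (intro field_hom.intro field_hom_axioms.intro A1.F_field A2.F_field e_hom)

lemma tensor_pair_descent: "descent F e F' A1.AB A2.AB (%a. A1.left a) \<phi>A (%b. A2.left b)"
proof (intro descent.intro descent_axioms.intro FF'_field_hom A1.AB_simple A2.AB_bold_ring)
 show "(%a. A1.left a) \<in> ring_hom F A1.AB" "\<phi>A \<in> ring_hom A1.AB A2.AB" "(%b. A2.left b) \<in> ring_hom F' A2.AB"
  using A1.ap_left_hom \<phi>A_hom A2.ap_left_hom by (simp_all add: ring_hom_with_endo)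
 show "\<exists>a\<in>El F. r = A1.left a" if "r \<in> El A1.AB" "endo A1.AB r = r" for r
  by (rule A1.AB_invariants[OF that])
qed (simp_all add: \<phi>A_sig \<phi>A_ap A1.sig_ap A2.sig_ap A2.nontrivial)

text \<open>Multiplication by the image of \<open>s\<close> acts on the coefficients of a combination of independent elements of \<open>F'\<close>.\<close>
lemma \<phi>A_NZ: assumes s: "s \<in> A1.TA.NZ" shows "\<phi>A s \<in> A2.TA.NZ"
proof (rule A2.TA.NZ_I)
 interpret D: descent F e F' A1.AB A2.AB "%a. A1.left a" \<phi>A "%b. A2.left b" by (rule tensor_pair_descent)
 have sc: "s \<in> El A1.TA" by (rule A1.TA.NZ_carrier[OF s])
 show "\<phi>A s \<in> El A2.TA" by (rule ring_hom_closed[OF \<phi>A_hom sc])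
 fix y assume y: "y \<in> El A2.TA" and z: "\<phi>A s \<otimes>\<^sub>A2.TA y = \<zero>\<^sub>A2.TA"
 have "y \<in> D.span"
  using y
 proof (induction rule: A2.TA_induct)
  case (pure b c)
  have "A2.ap b c = A2.left b \<otimes>\<^sub>A2.TA \<phi>A (A1.right c)"
   using pure by (simp add: \<phi>A_ap ring_hom_one[OF e_hom])
  thus ?case using D.span_pure[of b "A1.right c"] pure by simp
 next
  case (add U V)
  thus ?case using D.span_add by simp
 qed
 then obtain S r where S: "D.indep S" and r: "r \<in> S \<rightarrow> El A1.AB" and yr: "y = D.comb S r" by (rule D.span_indep)
 have rc: "r b \<in> El A1.TA" if "b \<in> S" for b using r that by auto
 have "D.comb S (%b. s \<otimes>\<^sub>A1.AB r b) = \<zero>\<^sub>A2.AB"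
  using D.comb_mult[OF D.indepD(2)[OF S] D.indepD(1)[OF S] r, of s] sc z yr by simp
 hence "s \<otimes>\<^sub>A1.TA r b = \<zero>\<^sub>A1.TA" if "b \<in> S" for b
  using D.linearly_disjoint[OF S, of "%b. s \<otimes>\<^sub>A1.AB r b" b] that rc sc by simp
 hence r0: "r b = \<zero>\<^sub>A1.AB" if "b \<in> S" for b using A1.TA.NZ_cancel[OF s rc] that by simp
 have \<phi>0: "\<phi>A \<zero>\<^sub>A1.TA = \<zero>\<^sub>A2.TA"
  by (rule ring_hom_zero[OF \<phi>A_hom A1.TA.ring_axioms A2.TA.ring_axioms])
 have "D.comb S r = (\<Oplus>\<^sub>A2.AB b\<in>S. \<zero>\<^sub>A2.AB)"
  using r0 \<phi>0 D.indepD(2)[OF S] by (intro D.R'.finsum_cong') (auto simp: subset_iff)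
 also have "... = \<zero>\<^sub>A2.AB" by (rule D.R'.finsum_zero)
 finally show "y = \<zero>\<^sub>A2.TA" using yr by simp
qed

abbreviation "\<phi> \<equiv> bold_frac_map Q i e F' j K"

lemma \<phi>_eq: "\<phi> = frac_map A2.TA \<phi>A"
 by (simp add: bold_frac_map_def Let_def i'_eq)

lemma \<phi>_fr: "a \<in> El A1.TA ==> s \<in> A1.TA.NZ ==> \<phi> (A1.TA.fr a s) = A2.TA.fr (\<phi>A a) (\<phi>A s)"
 unfolding \<phi>_eq by (rule frac_map_frac[OF A1.TA_cring A2.TA_cring \<phi>A_hom \<phi>A_NZ])

theorem FK_pair_descent: "fraction_descent F e F' A1.FK A2.FK A1.const \<phi> A2.const"
proof -
 have D: "descent F e F' A1.FK A2.FK A1.const \<phi> A2.const"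
 proof (intro descent.intro descent_axioms.intro FF'_field_hom A1.FK_simple A2.FK_bold_ring A1.const_hom A2.const_hom
   A1.const_invariant A2.const_invariant A1.FK_invariants A2.FK_nontrivial)
  show "\<phi> \<in> ring_hom A1.FK A2.FK"
   unfolding A1.FK_eq A2.FK_eq ring_hom_with_endo \<phi>_eq
   by (rule frac_map_hom[OF A1.TA_cring A2.TA_cring \<phi>A_hom \<phi>A_NZ])
  show "\<phi> (endo A1.FK r) = endo A2.FK (\<phi> r)" if "r \<in> El A1.FK" for r
  proof -
   obtain a s where a: "a \<in> El A1.TA" and s: "s \<in> A1.TA.NZ" and r: "r = A1.TA.fr a s"
    using \<open>r \<in> El A1.FK\<close> A1.TA.Fr_elem unfolding A1.FK_eq by auto
   have sc: "s \<in> El A1.TA" by (rule A1.TA.NZ_carrier[OF s])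
   have "endo A1.FK r = A1.TA.fr (A1.sig a) (A1.sig s)"
    unfolding r A1.FK_eq using frac_map_frac[OF A1.TA_cring A1.TA_cring A1.sig_hom A1.sig_NZ a s] by simp
   moreover have "endo A2.FK (\<phi> r) = A2.TA.fr (A2.sig (\<phi>A a)) (A2.sig (\<phi>A s))"
    unfolding r \<phi>_fr[OF a s] A2.FK_eq
    using frac_map_frac[OF A2.TA_cring A2.TA_cring A2.sig_hom A2.sig_NZ ring_hom_closed[OF \<phi>A_hom a] \<phi>A_NZ[OF s]] by simp
   ultimately show ?thesis
    using \<phi>_fr[OF ring_hom_closed[OF A1.sig_hom a] A1.sig_NZ[OF s]] \<phi>A_sig[OF a] \<phi>A_sig[OF sc] by simp
  qed
  show "\<phi> (A1.const a) = A2.const (e a)" if "a \<in> El F" for a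
   using that \<phi>_fr[of "A1.left a" "\<one>\<^sub>A1.TA"]
   by (simp add: A1.const_eq A2.const_eq A1.TA.NZ_one \<phi>A_ap ring_hom_one[OF \<phi>A_hom])
 qed
 interpret D: descent F e F' A1.FK A2.FK A1.const \<phi> A2.const by (rule D)
 have span_add: "x \<oplus>\<^sub>A2.TA.Fr y \<in> D.span" if "x \<in> D.span" "y \<in> D.span" for x y
  using D.span_add[OF that] by (simp add: A2.FK_eq)
 have "A2.TA.fr a \<one>\<^sub>A2.TA \<in> D.span" if "a \<in> El A2.TA" for a
  using that
 proof (induction rule: A2.TA_induct)
  case (pure b c)
  have "\<phi> (A1.TA.fr (A1.right c) \<one>\<^sub>A1.TA) = A2.TA.fr (A2.right c) \<one>\<^sub>A2.TA"
   using pure \<phi>_fr[of "A1.right c" "\<one>\<^sub>A1.TA"]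
   by (simp add: A1.TA.NZ_one \<phi>A_ap ring_hom_one[OF e_hom] ring_hom_one[OF \<phi>A_hom])
  hence "A2.TA.fr (A2.ap b c) \<one>\<^sub>A2.TA = A2.const b \<otimes>\<^sub>A2.FK \<phi> (A1.TA.fr (A1.right c) \<one>\<^sub>A1.TA)"
   using pure ring_hom_mult[OF A2.TA.frac_one_hom, of "A2.left b" "A2.right c"]
   by (simp add: A2.const_eq A2.FK_eq)
  moreover have "A1.TA.fr (A1.right c) \<one>\<^sub>A1.TA \<in> El A1.FK"
   unfolding A1.FK_eq using pure A1.TA.NZ_one by simp
  ultimately show ?case using D.span_pure[of b "A1.TA.fr (A1.right c) \<one>\<^sub>A1.TA"] pure by simp
 next
  case (add U V)
  thus ?case using span_add ring_hom_add[OF A2.TA.frac_one_hom add.hyps] by simp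
 qed
 thus ?thesis using fraction_descentI[OF A2.TA_cring D[unfolded A2.FK_eq]] unfolding A2.FK_eq by simp
qed

end

section \<open>Scalar extension of restricted modules\<close>

theorem theorem3p11:
  fixes Q :: "('q, 'x1) ring_scheme" and F :: "('f, 'x2) ring_scheme"
    and F' :: "('g, 'x3) ring_scheme" and K :: "('k, 'x4) ring_scheme"
    and i :: "'q \<Rightarrow> 'f" and e :: "'f \<Rightarrow> 'g" and j :: "'q \<Rightarrow> 'k"
  assumes "field Q" and "finite (carrier Q)" and "field F" and "field F'" and "field K"
    and "i \<in> ring_hom Q F" and "e \<in> ring_hom F F'" and "j \<in> ring_hom Q K"
    and "finite (roots_of_unity K)"
    and FK: "FK = bold_frac Q i F j K" and F'K: "F'K = bold_frac Q (e \<circ> i) F' j K"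
    and c: "c = bold_frac_const Q i F j K" and c': "c' = bold_frac_const Q (e \<circ> i) F' j K"
    and \<phi>: "\<phi> = bold_frac_map Q i e F' j K"
  shows "(\<forall>(M :: (_, 'm) bold_module) (N :: (_, 'n) bold_module).
            restricted FK M \<and> restricted FK N \<longrightarrow>
            fully_faithful_on F e F' (bold_Hom c FK M N)
              (bold_Hom c' F'K (scalar_extension FK \<phi> F'K M) (scalar_extension FK \<phi> F'K N))
              (scalar_extension_map FK \<phi> F'K M N)) \<and>
         (separable_extension F e F' \<longrightarrow>
           (\<forall>P :: (_, 'p) bold_module.
              semisimple_object FK P \<longrightarrow>
              semisimple_object F'K (scalar_extension FK \<phi> F'K P)))"
proof -
 interpret Q: field Q by fact
 have "finite_field Q" by (intro finite_field.intro finite_field_axioms.intro assms)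
 moreover have "e \<circ> i \<in> ring_hom Q F'" by (rule ring_hom_trans[OF \<open>i \<in> ring_hom Q F\<close> \<open>e \<in> ring_hom F F'\<close>])
 ultimately interpret P: constant_extension_pair Q i F j K e "e \<circ> i" F'
  by (intro constant_extension_pair.intro constant_extension_pair_axioms.intro constant_extension.intro
    constant_extension_axioms.intro tensor_of_algebras.intro tensor_of_algebras_axioms.intro
    domain.axioms(1)[OF field.axioms(1)] assms refl)
 have FD: "fraction_descent F e F' FK F'K c \<phi> c'"
  unfolding FK F'K c c' \<phi> by (rule P.FK_pair_descent)
 have simple: "simple_bold_ring FK" unfolding FK by (rule P.A1.FK_simple)
 show ?thesis
 proof (intro conjI allI impI)
  fix M :: "(_, 'm) bold_module" and N :: "(_, 'n) bold_module"
  assume MN: "restricted FK M \<and> restricted FK N"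
  show "fully_faithful_on F e F' (bold_Hom c FK M N)
    (bold_Hom c' F'K (scalar_extension FK \<phi> F'K M) (scalar_extension FK \<phi> F'K N))
    (scalar_extension_map FK \<phi> F'K M N)"
   using MN by (intro full_faithfulness[OF FD] restricted_imp_dual_module[OF simple]) simp_all
 next
  fix P :: "(_, 'p) bold_module"
  assume sep: "separable_extension F e F'" and ss: "semisimple_object FK P"
  have "restricted FK P" using ss unfolding semisimple_object_def by (rule conjunct1)
  hence "dual_module FK P" by (rule restricted_imp_dual_module[OF simple])
  then interpret E: extended_module F e F' FK F'K c \<phi> c' P by (rule extended_module.intro[OF FD])
  show "semisimple_object F'K (scalar_extension FK \<phi> F'K P)"
   by (rule base_change.base_change_semisimple[OF E.extended_base_change ss sep])
 qed
qed

end
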